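(* Let $d\ge1$ be an integer and let $\{X, X_{k,i}^{(m)}: k,i\ge1,\ 1\le m\le d\}$ be an array of i.i.d. real random variables with $\mathbb EX=0$, $\mathbb EX^2=1$ and $\mathbb EX^4<\infty$. Let $X'$ be an independent copy of $X$, let $\alpha,c_1,c_2>0$, and assume $$\sup_x x^{1+2\alpha}\,\mathbb P\big(|XX'|\ge\sqrt{x\log x}\big)<\infty.$$ For each $n$ let $p=p_n$ be an integer with $c_1n^\alpha\le p\le c_2n^\alpha$. Put $Y^{(m)}_{k,i,j}=X^{(m)}_{k,i}X^{(m)}_{k,j}$, $X_{k,i,j}=(Y^{(1)}_{k,i,j},\dots,Y^{(d)}_{k,i,j})\in\mathbb R^d$, $A_{n,i}=\sum_{m=1}^d\sum_{k=1}^n(X^{(m)}_{k,i})^2$, $Q_{n,i,j}=A_{n,i}A_{n,j}$, and $$\mathcal L_{p,n}^2=\max_{1\le i<j\le p}\frac{\|\sum_{k=1}^nX_{k,i,j}\|^2}{Q_{n,i,j}},$$ with $\|\cdot\|$ the Euclidean norm. Let $\alpha_p=4\log p-(2-d)\log_2p$. Then for any $0<\varepsilon\le10^{-4}$ there exists a finite constant $C$ (independent of $n$ and $p$) such that for all $n$ $$\sup_{y\in\mathbb R}\Big|\mathbb P\big(d^2n\mathcal L_{p,n}^2-\alpha_p\le y\big)-\exp\Big(-\frac{p^2-p}{2}\mathbb P(\chi^2(d)\ge\alpha_p+y)\Big)\Big|$$ $$\le Cp^{-1+20\sqrt\varepsilon}+C\frac{(\log n)^{5/2}}{n^{1/2}}+Cn^{1+2\alpha}\,\mathbb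 P\big(|XX'|\ge d^{-1/2}\varepsilon\sqrt{n\log p}\big)+\tau_n,$$ where $\tau_n=Cnp^{20\sqrt\varepsilon}\,\mathbb P\big(|X|\ge n^{1/4}/(\log p)^{1/4}\big)$ and $\chi^2(d)$ is a chi-square random variable with $d$ degrees of freedom.
   Context: Throughout, $\log x$ denotes $\ln\max(x,e)$ and $\log_2x=\log(\log x)$. *)

theory Defs
  imports "HOL-Probability.Probability"
begin

(* log x := ln (max x e), as fixed in the paper *)
definition logc :: "real \<Rightarrow> real" where
  "logc x = ln (max x (exp 1))"

definition loglog :: "real \<Rightarrow> real" where
  "loglog x = logc (logc x)"

definition std_normal_measure :: "real measure" where
  "std_normal_measure = density lborel (\<lambda>x. ennreal (std_normal_density x))"

definition chi_square :: "nat \<Rightarrow> real measure" where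
  "chi_square d = distr (PiM {1..d} (\<lambda>_. std_normal_measure)) borel
                        (\<lambda>z. \<Sum>m\<in>{1..d}. (z m)^2)"

definition chi_square_tail :: "nat \<Rightarrow> real \<Rightarrow> real" where
  "chi_square_tail d t = measure (chi_square d) {t..}"

(* A_{n,i} = sum_{m=1}^d sum_{k=1}^n (X^{(m)}_{k,i})^2 ; Xa m k i is X^{(m)}_{k,i} *)
definition A_ni :: "nat \<Rightarrow> (nat \<Rightarrow> nat \<Rightarrow> nat \<Rightarrow> 'a \<Rightarrow> real) \<Rightarrow> nat \<Rightarrow> nat \<Rightarrow> 'a \<Rightarrow> real" where
  "A_ni d Xa n i \<omega> = (\<Sum>m=1..d. \<Sum>k=1..n. (Xa m k i \<omega>)^2)"

(* || sum_{k=1}^n X_{k,i,j} ||^2 (Euclidean norm in R^d), written out componentwise *)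
definition S_sq :: "nat \<Rightarrow> (nat \<Rightarrow> nat \<Rightarrow> nat \<Rightarrow> 'a \<Rightarrow> real) \<Rightarrow> nat \<Rightarrow> nat \<Rightarrow> nat \<Rightarrow> 'a \<Rightarrow> real" where
  "S_sq d Xa n i j \<omega> = (\<Sum>m=1..d. (\<Sum>k=1..n. Xa m k i \<omega> * Xa m k j \<omega>)^2)"

definition L_sq :: "nat \<Rightarrow> (nat \<Rightarrow> nat \<Rightarrow> nat \<Rightarrow> 'a \<Rightarrow> real) \<Rightarrow> nat \<Rightarrow> nat \<Rightarrow> 'a \<Rightarrow> real" where
  "L_sq d Xa p n \<omega> = Max {S_sq d Xa n i j \<omega> / (A_ni d Xa n i \<omega> * A_ni d Xa n j \<omega>) | i j. 1 \<le> i \<and> i < j \<and> j \<le> p}"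

definition alpha_p :: "nat \<Rightarrow> nat \<Rightarrow> real" where
  "alpha_p d p = 4 * logc (real p) - (2 - real d) * loglog (real p)"

end

theory Submission
  imports Defs
begin

text \<open>Truncate the entries at \<open>b = (n / log p) powr (1/4)\<close>, so that the products of two truncated
  entries are bounded by \<open>sqrt (n / log p)\<close>. A Cramer-type moderate deviation expansion, obtained
  from exponential tilting and a Berry-Esseen bound for convolution operators, shows that for a
  pair of columns the squared norm of the sum of truncated products, divided by \<open>n\<close>, exceeds
  \<open>t = O(log p)\<close> with probability \<open>(1 + O((log p)^2 / sqrt n))\<close> times the chi-square tail.
  Since exceedances for disjoint pairs are independent and exceedances for two pairs sharing a
  column have squared order of probability, a Poisson approximation yields the double exponential
  limit for levels \<open>t\<close> between \<open>(4 - 4 \<epsilon>) log p\<close> and \<open>8 log p\<close>, and monotonicity in \<open>t\<close> covers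
  all other levels. The truncation is removed with Chernoff bounds over a finite net of directions:
  a large entry is penalised by its own probability (last error term), products beyond
  \<open>\<epsilon> sqrt (n log p / d)\<close> by the third error term, and the column norms \<open>A\<^sub>n\<^sub>,\<^sub>i\<close> concentrate around \<open>d n\<close>.\<close>

definition bdd_borel :: "(real => real) => bool" where
 "bdd_borel f \<longleftrightarrow> f : borel_measurable borel & (\<exists>C. \<forall>x. \<bar>f x\<bar> <= C)"

definition conv_op :: "real measure => (real => real) => real => real" where
 "conv_op mu f x = (LINT y|mu. f (x + y))"

lemma bdd_borelI: "f : borel_measurable borel ==> (!!x. \<bar>f x\<bar> <= C) ==> bdd_borel f"
 unfolding bdd_borel_def by blast

lemma bdd_borel_measurable: "bdd_borel f ==> f : borel_measurable borel"
 by (simp add: bdd_borel_def)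

lemma bdd_borel_cmult: "bdd_borel f ==> bdd_borel (%x. c * f x)"
proof -
 assume f: "bdd_borel f"
 obtain C where C: "!!x. \<bar>f x\<bar> <= C" using f by (auto simp: bdd_borel_def)
 show ?thesis
 proof (rule bdd_borelI)
  show "(%x. c * f x) : borel_measurable borel" using f by (auto simp: bdd_borel_def)
  show "\<bar>c * f x\<bar> <= \<bar>c\<bar> * C" for x using C[of x] by (simp add: abs_mult mult_left_mono)
 qed
qed

lemma bdd_borel_indicator: "A : sets borel ==> bdd_borel (indicator A)"
 by (rule bdd_borelI[where C=1]) (auto simp: indicator_def)

lemma abs_integral_le:
 fixes f g :: "'a => real"
 assumes "integrable M f" "integrable M g" "!!x. \<bar>f x\<bar> <= g x"
 shows "\<bar>\<integral>x. f x \<partial>M\<bar> <= (LINT x|M. g x)"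
proof -
 have "\<bar>\<integral>x. f x \<partial>M\<bar> <= (LINT x|M. \<bar>f x\<bar>)" by (rule integral_abs_bound)
 also have "... <= (LINT x|M. g x)" by (rule integral_mono) (use assms in auto)
 finally show ?thesis .
qed

context real_distribution
begin

lemma prob_UNIV [simp]: "prob UNIV = 1"
 using prob_space by simp

lemma bdd_borel_integrable:
 assumes "bdd_borel f" shows "integrable M (%y. f (x + y))"
proof -
 obtain C where C: "!!x. \<bar>f x\<bar> <= C" using assms by (auto simp: bdd_borel_def)
 have [measurable]: "f : borel_measurable borel" using assms by (simp add: bdd_borel_def)
 show ?thesis by (rule integrable_const_bound[where B=C]) (use C in auto)
qed

lemma conv_op_bound:
 assumes "bdd_borel f" "!!x. \<bar>f x\<bar> <= C" shows "\<bar>conv_op M f x\<bar> <= C"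
proof -
 have "\<bar>conv_op M f x\<bar> <= (LINT y|M. \<bar>f (x + y)\<bar>)"
  unfolding conv_op_def by (rule integral_abs_bound)
 also have "... <= (LINT y|M. C)"
  by (rule integral_mono) (use assms bdd_borel_integrable[OF assms(1), of x] in auto)
 finally show ?thesis by (simp add: prob_space)
qed

lemma bdd_borel_conv_op:
 assumes "bdd_borel f" shows "bdd_borel (conv_op M f)"
proof -
 obtain C where C: "!!x. \<bar>f x\<bar> <= C" using assms by (auto simp: bdd_borel_def)
 have [measurable]: "f : borel_measurable borel" using assms by (simp add: bdd_borel_def)
 show ?thesis
  by (rule bdd_borelI[OF _ conv_op_bound[OF assms C]]) (auto simp: conv_op_def[abs_def])
qed

lemma conv_op_diff:
 assumes "bdd_borel f" "bdd_borel g"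
 shows "conv_op M (%x. f x - g x) x = conv_op M f x - conv_op M g x"
 unfolding conv_op_def by (rule Bochner_Integration.integral_diff) (simp_all add: bdd_borel_integrable assms)

lemma conv_op_mono:
 assumes "bdd_borel f" "bdd_borel g" "AE y in M. f (x + y) <= g (x + y)"
 shows "conv_op M f x <= conv_op M g x"
 unfolding conv_op_def by (rule integral_mono_AE) (use assms bdd_borel_integrable in auto)

lemma conv_op_pow_bdd: "bdd_borel f ==> bdd_borel ((conv_op M ^^ k) f)"
 by (induction k) (auto intro: bdd_borel_conv_op)

end

lemma conv_op_cmult: "conv_op mu (%x. c * f x) x = c * conv_op mu f x"
 unfolding conv_op_def by simp

lemma conv_op_commute:
 assumes "real_distribution mu" "real_distribution nu" "bdd_borel f"
 shows "conv_op mu (conv_op nu f) = conv_op nu (conv_op mu f)"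
proof
 fix x
 interpret mu: real_distribution mu by fact
 interpret nu: real_distribution nu by fact
 interpret P: pair_prob_space mu nu ..
 obtain C where C: "!!x. \<bar>f x\<bar> <= C" using assms by (auto simp: bdd_borel_def)
 have [measurable]: "f : borel_measurable borel" using assms by (simp add: bdd_borel_def)
 have "integrable (mu \<Otimes>\<^sub>M nu) (%(y, y'). f (x + y + y'))"
  by (rule P.P.integrable_const_bound[where B=C]) (use C in auto)
 from P.Fubini_integral[OF this]
 show "conv_op mu (conv_op nu f) x = conv_op nu (conv_op mu f) x"
  unfolding conv_op_def by (simp add: add_ac)
qed

lemma conv_op_convolution:
 assumes "real_distribution mu" "real_distribution nu" "bdd_borel f"
 shows "conv_op (mu \<star> nu) f = conv_op mu (conv_op nu f)" and "real_distribution (mu \<star> nu)"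
proof -
 interpret mu: real_distribution mu by fact
 interpret nu: real_distribution nu by fact
 interpret P: pair_prob_space mu nu ..
 obtain C where C: "!!x. \<bar>f x\<bar> <= C" using assms by (auto simp: bdd_borel_def)
 have [measurable]: "f : borel_measurable borel" using assms by (simp add: bdd_borel_def)
 show "conv_op (mu \<star> nu) f = conv_op mu (conv_op nu f)"
 proof
  fix x
  have "integrable (mu \<Otimes>\<^sub>M nu) (%(y, y'). f (x + y + y'))"
   by (rule P.P.integrable_const_bound[where B=C]) (use C in auto)
  from P.integral_fst'[OF this]
  show "conv_op (mu \<star> nu) f x = conv_op mu (conv_op nu f) x"
   unfolding conv_op_def convolution_def by (simp add: integral_distr split_beta' add_ac)
 qed
 show "real_distribution (mu \<star> nu)"
  unfolding convolution_def by (rule P.P.real_distribution_distr) auto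
qed

lemma conv_op_return: "bdd_borel f ==> conv_op (return borel 0) f = f"
 unfolding conv_op_def bdd_borel_def by (subst integral_return) auto

lemma conv_op_pow_measure:
 assumes "real_distribution mu"
 obtains rh where "real_distribution rh" "!!f. bdd_borel f ==> (conv_op mu ^^ k) f = conv_op rh f"
proof -
 interpret real_distribution mu by fact
 have "\<exists>rh. real_distribution rh & (\<forall>f. bdd_borel f --> (conv_op mu ^^ k) f = conv_op rh f)"
 proof (induction k)
  case 0
  have "real_distribution (return borel 0)"
   unfolding real_distribution_def real_distribution_axioms_def by (auto intro: prob_space_return)
  then show ?case by (auto intro!: exI[of _ "return borel 0"] simp: conv_op_return)
 next
  case (Suc k)
  then obtain rh where rh: "real_distribution rh" "!!f. bdd_borel f ==> (conv_op mu ^^ k) f = conv_op rh f" by blast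
  have "bdd_borel (indicator {0::real})" by (rule bdd_borel_indicator) auto
  with rh(1) have "real_distribution (mu \<star> rh)" by (rule conv_op_convolution(2)[OF assms])
  then show ?case using rh by (auto intro!: exI[of _ "mu \<star> rh"] simp: conv_op_convolution(1)[OF assms])
 qed
 then show ?thesis using that by blast
qed

lemma conv_op_pow_commute:
 assumes "real_distribution mu" "real_distribution nu" "bdd_borel f"
 shows "(conv_op mu ^^ k) (conv_op nu f) = conv_op nu ((conv_op mu ^^ k) f)"
 by (rule conv_op_pow_measure[OF assms(1), of k])
  (simp add: real_distribution.bdd_borel_conv_op assms conv_op_commute)

lemma conv_op_shift: "conv_op mu (%y. f (y + c)) x = conv_op mu f (x + c)"
 by (simp add: conv_op_def add_ac)

lemma conv_op_pow_shift: "(conv_op mu ^^ k) (%y. f (y + c)) x = (conv_op mu ^^ k) f (x + c)"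
proof (induction k arbitrary: x)
 case (Suc k)
 then have "(conv_op mu ^^ k) (%y. f (y + c)) = (%x. (conv_op mu ^^ k) f (x + c))" by auto
 then show ?case using conv_op_shift[of mu "(conv_op mu ^^ k) f" c x] by simp
qed simp

text \<open>Bounded second derivatives make the difference quotients converge uniformly, so that
 derivatives pass through the convolution.\<close>

lemma conv_op_DERIV:
 assumes "real_distribution mu" "bdd_borel f" "bdd_borel f'"
  and d1: "!!x. (f has_real_derivative f' x) (at x)"
  and d2: "!!x. (f' has_real_derivative f'' x) (at x)"
  and C: "!!x. \<bar>f'' x\<bar> <= C"
 shows "(conv_op mu f has_real_derivative conv_op mu f' x) (at x)"
proof -
 interpret real_distribution mu by fact
 have C0: "0 <= C" using C[of 0] by linarith
 have tay: "\<bar>f (y + h) - f y - h * f' y\<bar> <= C * h\<^sup>2" for y h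
 proof -
  have lip: "\<bar>f' u - f' y\<bar> <= C * \<bar>u - y\<bar>" for u
   using field_differentiable_bound[of UNIV f' f'' C u y] d2 C by (auto simp: has_field_derivative_at_within)
  have "\<bar>(%u. f u - u * f' y) (y+h) - (%u. f u - u * f' y) y\<bar> <= (C * \<bar>h\<bar>) * \<bar>(y+h) - y\<bar>"
  proof (rule field_differentiable_bound[where S="closed_segment y (y+h)" and f'="%u. f' u - f' y", simplified])
   fix u assume "u : closed_segment y (y+h)"
   then have "\<bar>u - y\<bar> <= \<bar>h\<bar>" by (auto simp: closed_segment_eq_real_ivl split: if_splits)
   then show "\<bar>f' u - f' y\<bar> <= C * \<bar>h\<bar>" using lip[of u] C0 by (smt (verit) mult_left_mono)
   show "((%u. f u - u * f' y) has_field_derivative f' u - f' y) (at u within closed_segment y (y + h))"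
    by (rule DERIV_subset[of _ _ _ UNIV]) (auto intro!: derivative_eq_intros d1)
  qed auto
  then show ?thesis by (simp add: power2_eq_square algebra_simps abs_mult_self_eq) 
 qed
 have key: "\<bar>(conv_op mu f (x+h) - conv_op mu f x) / h - conv_op mu f' x\<bar> <= C * \<bar>h\<bar>" if "h ~= 0" for h
 proof -
  have "conv_op mu f (x+h) - conv_op mu f x - h * conv_op mu f' x
   = (LINT y|mu. f (x + y + h) - f (x+y) - h * f' (x+y))"
   using bdd_borel_integrable[OF assms(2), of "x+h"] bdd_borel_integrable[OF assms(2), of x] bdd_borel_integrable[OF assms(3), of x]
   unfolding conv_op_def by (simp add: add_ac)
  also have "\<bar>\<dots>\<bar> <= (LINT y|mu. C * h\<^sup>2)"
  proof (rule abs_integral_le)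
   show "integrable mu (%y. f (x + y + h) - f (x+y) - h * f' (x+y))"
    using bdd_borel_integrable[OF assms(2), of "x+h"] bdd_borel_integrable[OF assms(2), of x] bdd_borel_integrable[OF assms(3), of x]
    by (auto simp: add_ac)
  qed (use tay in auto)
  finally have "\<bar>conv_op mu f (x+h) - conv_op mu f x - h * conv_op mu f' x\<bar> <= C * h\<^sup>2"
   by (simp add: prob_space)
  then have "\<bar>conv_op mu f (x+h) - conv_op mu f x - h * conv_op mu f' x\<bar> / \<bar>h\<bar> <= C * \<bar>h\<bar>"
   using that by (simp add: divide_le_eq power2_eq_square abs_mult_self_eq mult.assoc)
  then show ?thesis using that by (simp add: abs_divide[symmetric] diff_divide_distrib)
 qed
 show ?thesis
 proof (subst DERIV_def, rule tendsto_sandwich[where f="%h. conv_op mu f' x - C * \<bar>h\<bar>" and h="%h. conv_op mu f' x + C * \<bar>h\<bar>"])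
  show "\<forall>\<^sub>F h in at 0. conv_op mu f' x - C * \<bar>h\<bar> <= (conv_op mu f (x+h) - conv_op mu f x) / h"
   using key by (auto simp: eventually_at abs_le_iff intro!: exI[of _ 1]) (smt (verit))
  show "\<forall>\<^sub>F h in at 0. (conv_op mu f (x+h) - conv_op mu f x) / h <= conv_op mu f' x + C * \<bar>h\<bar>"
   using key by (auto simp: eventually_at abs_le_iff intro!: exI[of _ 1]) (smt (verit))
  show "((%h. conv_op mu f' x - C * \<bar>h\<bar>) \<longlongrightarrow> conv_op mu f' x) (at 0)"
   by (auto intro!: tendsto_eq_intros)
  show "((%h. conv_op mu f' x + C * \<bar>h\<bar>) \<longlongrightarrow> conv_op mu f' x) (at 0)"
   by (auto intro!: tendsto_eq_intros)
 qed
qed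

text \<open>Functions of bounded variation vanishing at infinity are averages of half-line indicators,
 so they inherit the Kolmogorov distance.\<close>

lemma conv_op_total_variation:
 assumes "real_distribution mu" "real_distribution nu" and k: "integrable lborel k"
  and \<psi>: "!!y. \<psi> y = (LINT z|lborel. k z * indicator {..z} y)"
  and dl: "!!z. \<bar>conv_op mu (indicator {..z}) x - conv_op nu (indicator {..z}) x\<bar> <= dl"
 shows "\<bar>conv_op mu \<psi> x - conv_op nu \<psi> x\<bar> <= dl * (LINT z|lborel. \<bar>k z\<bar>)"
proof -
 have [measurable]: "k : borel_measurable borel" using k by auto
 have ind: "indicator {..z} y = (if y <= z then 1 else 0 :: real)" for y z :: real
  by (auto simp: indicator_def)
 have *: "conv_op rh \<psi> x = (LINT z|lborel. k z * conv_op rh (indicator {..z}) x)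
   & integrable lborel (%z. k z * conv_op rh (indicator {..z}) x)"
  if "real_distribution rh" for rh
 proof -
  interpret real_distribution rh by fact
  interpret P: pair_sigma_finite lborel rh ..
  have int: "integrable (lborel \<Otimes>\<^sub>M rh) (%(z, y). k z * indicator {..z} (x + y))"
  proof (rule P.Fubini_integrable)
   show "(%(z, y). k z * indicator {..z} (x + y)) : borel_measurable (lborel \<Otimes>\<^sub>M rh)"
    unfolding ind by measurable
   show "AE z in lborel. integrable rh (%y. case (z, y) of (z, y) => k z * indicator {..z} (x + y))"
   proof (rule AE_I2)
    fix z show "integrable rh (%y. case (z, y) of (z, y) => k z * indicator {..z} (x + y))"
     unfolding ind by (auto intro!: integrable_const_bound[where B="1"])
   qed
   have "integrable lborel (%z. \<bar>k z\<bar> * (LINT y|rh. indicator {..z} (x + y)))"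
   proof (rule Bochner_Integration.integrable_bound[OF k])
    show "(%z. \<bar>k z\<bar> * (LINT y|rh. indicator {..z} (x + y))) : borel_measurable lborel"
     unfolding ind by measurable
    show "AE z in lborel. norm (\<bar>k z\<bar> * (LINT y|rh. indicator {..z} (x + y))) <= norm (k z)"
    proof (rule AE_I2)
     fix z
     have "\<bar>conv_op rh (indicator {..z}) x\<bar> <= 1"
      by (rule conv_op_bound) (auto intro: bdd_borel_indicator simp: indicator_def)
     then show "norm (\<bar>k z\<bar> * (LINT y|rh. indicator {..z} (x + y))) <= norm (k z)"
      by (simp add: conv_op_def abs_mult mult_left_le)
    qed
   qed
   then show "integrable lborel (%z. \<integral>y. norm (case (z, y) of (z, y) => k z * indicator {..z} (x + y)) \<partial>rh)"
    by (simp add: abs_mult)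
  qed
  have "conv_op rh \<psi> x = (\<integral>y. \<integral>z. k z * indicator {..z} (x + y) \<partial>lborel \<partial>rh)"
   unfolding conv_op_def \<psi> ..
  also have "... = (\<integral>z. \<integral>y. k z * indicator {..z} (x + y) \<partial>rh \<partial>lborel)"
   by (rule P.Fubini_integral[OF int])
  finally show ?thesis using P.integrable_fst'[OF int] by (simp add: conv_op_def)
 qed
 have "\<bar>conv_op mu \<psi> x - conv_op nu \<psi> x\<bar> =
  \<bar>\<integral>z. k z * (conv_op mu (indicator {..z}) x - conv_op nu (indicator {..z}) x) \<partial>lborel\<bar>"
  using *[OF assms(1)] *[OF assms(2)] by (simp add: right_diff_distrib)
 also have "... <= (LINT z|lborel. dl * \<bar>k z\<bar>)"
 proof (rule abs_integral_le)
  show "integrable lborel (%z. k z * (conv_op mu (indicator {..z}) x - conv_op nu (indicator {..z}) x))"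
   using *[OF assms(1)] *[OF assms(2)] by (simp add: right_diff_distrib)
  show "integrable lborel (%z. dl * \<bar>k z\<bar>)" using k by auto
  fix z show "\<bar>k z * (conv_op mu (indicator {..z}) x - conv_op nu (indicator {..z}) x)\<bar> <= dl * \<bar>k z\<bar>"
   using dl[of z] by (simp add: abs_mult mult.commute[of dl] mult_left_mono)
 qed
 finally show ?thesis by simp
qed

lemma integral_FTC_atMost:
 fixes F f :: "real => real"
 assumes d: "!!x. (F has_real_derivative f x) (at x)" and c: "!!x. isCont f x"
  and i: "integrable lborel f" and l: "(F \<longlongrightarrow> 0) at_bot"
 shows "F a = (LINT t|lborel. f t * indicator {..a} t)"
proof -
 have [measurable]: "f : borel_measurable borel" using i by auto
 have "(%n. \<integral>t. f t * indicator {-real n..a} t \<partial>lborel) \<longlonglongrightarrow> (LINT t|lborel. f t * indicator {..a} t)"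
 proof (rule integral_dominated_convergence[where w="%t. \<bar>f t\<bar>"])
  show "AE t in lborel. (%n. f t * indicator {-real n..a} t) \<longlonglongrightarrow> f t * indicator {..a} t"
  proof (rule AE_I2)
   fix t
   have "\<forall>\<^sub>F n in sequentially. -real n <= t" by real_asymp
   then have "\<forall>\<^sub>F n in sequentially. f t * indicator {-real n..a} t = f t * indicator {..a} t"
    by eventually_elim (auto simp: indicator_def)
   then show "(%n. f t * indicator {-real n..a} t) \<longlonglongrightarrow> f t * indicator {..a} t"
    by (rule tendsto_eventually)
  qed
 qed (use i in \<open>auto simp: indicator_def abs_mult\<close>)
 moreover have ev: "\<forall>\<^sub>F n in sequentially. (LINT t|lborel. f t * indicator {-real n..a} t) = F a - F (-real n)"
 proof -
  have "\<forall>\<^sub>F n in sequentially. -real n <= a" by real_asymp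
  then show ?thesis by eventually_elim (intro integral_FTC_Icc_real d c)
 qed
 moreover have "(%n. F a - F (-real n)) \<longlonglongrightarrow> F a - 0"
 proof (intro tendsto_intros)
  have "filterlim (%n. -real n) at_bot sequentially" by real_asymp
  then show "(%n. F (-real n)) \<longlonglongrightarrow> 0" by (rule filterlim_compose[OF l])
 qed
 ultimately have "F a - 0 = (LINT t|lborel. f t * indicator {..a} t)"
  using tendsto_cong[OF ev] by (intro LIMSEQ_unique) auto
 then show ?thesis by simp
qed

definition Phi :: "real => real" where
 "Phi a = (LINT t|lborel. std_normal_density t * indicator {..a} t)"

lemma integrable_std_normal_density_indicator:
 assumes [measurable]: "A : sets borel" shows "integrable lborel (%t. std_normal_density t * indicator A t)"
 using integrable_real_mult_indicator[of A lborel "std_normal_density"] by simp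

lemma isCont_std_normal_density: "isCont std_normal_density x"
 unfolding std_normal_density_def[abs_def] by (intro continuous_intros) auto

lemma DERIV_std_normal_density:
 "(std_normal_density has_real_derivative - x * std_normal_density x) (at x)"
proof -
 have "((%x. (1 / sqrt (2 * pi)) * exp (- x\<^sup>2 / 2)) has_real_derivative (1 / sqrt (2 * pi)) * (exp (- x\<^sup>2 / 2) * (- x))) (at x)"
  by (intro DERIV_cmult DERIV_fun_exp) (auto intro!: derivative_eq_intros)
 then show ?thesis unfolding std_normal_density_def[abs_def] by (simp add: mult_ac)
qed

lemma Phi_diff:
 assumes "a <= b" shows "Phi b - Phi a = (LINT t|lborel. std_normal_density t * indicator {a..b} t)"
proof -
 have "Phi b - Phi a = (LINT t|lborel. std_normal_density t * indicator {..b} t - std_normal_density t * indicator {..a} t)"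
  unfolding Phi_def by (intro Bochner_Integration.integral_diff[symmetric] integrable_std_normal_density_indicator) auto
 also have "... = (LINT t|lborel. std_normal_density t * indicator {a..b} t)"
 proof (rule integral_cong_AE)
  have "AE t in lborel. t ~= a" by (rule AE_lborel_singleton)
  then show "AE t in lborel. std_normal_density t * indicator {..b} t - std_normal_density t * indicator {..a} t = std_normal_density t * indicator {a..b} t"
   by eventually_elim (use assms in \<open>auto simp: indicator_def\<close>)
 qed auto
 finally show ?thesis .
qed

lemma DERIV_Phi: "(Phi has_real_derivative std_normal_density x) (at x)"
proof -
 have eq: "Phi y = Phi (x - 1) + integral {x-1..y} std_normal_density" if "y : {x-1..x+1}" for y
 proof -
  have "(LINT t|lborel. std_normal_density t * indicator {x-1..y} t) = (LINT t:{x-1..y}|lborel. std_normal_density t)"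
   by (simp add: set_lebesgue_integral_def mult.commute)
  also have "... = integral {x-1..y} std_normal_density"
   by (rule set_borel_integral_eq_integral)
    (use integrable_std_normal_density_indicator[of "{x-1..y}"] in \<open>simp add: set_integrable_def mult.commute\<close>)
  finally show ?thesis using Phi_diff[of "x-1" y] that by simp
 qed
 have "((%y. integral {x-1..y} std_normal_density) has_real_derivative std_normal_density x) (at x within {x-1..x+1})"
  by (rule integral_has_real_derivative) (auto intro!: continuous_at_imp_continuous_on isCont_std_normal_density)
 then have "((%y. Phi (x - 1) + integral {x-1..y} std_normal_density) has_real_derivative std_normal_density x) (at x within {x-1..x+1})"
  by (auto intro!: derivative_eq_intros)
 then have "(Phi has_real_derivative std_normal_density x) (at x within {x-1..x+1})"
 proof (rule has_field_derivative_transform_within[where d=1])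
  fix y assume "y : {x-1..x+1}"
  then show "Phi (x - 1) + integral {x-1..y} std_normal_density = Phi y" by (rule eq[symmetric])
 qed auto
 moreover have "at x within {x-1..x+1} = at x" by (rule at_within_Icc_at) auto
 ultimately show ?thesis by metis
qed

definition nd2 :: "real => real" where "nd2 x = - x * std_normal_density x"
definition nd3 :: "real => real" where "nd3 x = (x\<^sup>2 - 1) * std_normal_density x"
definition nd4 :: "real => real" where "nd4 x = (3 * x - x ^ 3) * std_normal_density x"

lemma DERIV_nd2: "(nd2 has_real_derivative nd3 x) (at x)"
proof -
 have "((%x. - x * std_normal_density x) has_real_derivative (- 1) * std_normal_density x + (- x * std_normal_density x) * (- x)) (at x)"
  by (rule DERIV_mult[OF _ DERIV_std_normal_density]) (auto intro!: derivative_eq_intros)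
 then show ?thesis unfolding nd2_def[abs_def] nd3_def by (simp add: algebra_simps power2_eq_square)
qed

lemma DERIV_nd3: "(nd3 has_real_derivative nd4 x) (at x)"
proof -
 have "((%x. (x\<^sup>2 - 1) * std_normal_density x) has_real_derivative (2 * x) * std_normal_density x + (- x * std_normal_density x) * (x\<^sup>2 - 1)) (at x)"
  by (rule DERIV_mult[OF _ DERIV_std_normal_density]) (auto intro!: derivative_eq_intros)
 then show ?thesis unfolding nd3_def[abs_def] nd4_def by (simp add: algebra_simps power2_eq_square power3_eq_cube)
qed

lemma std_normal_density_le_exp: "std_normal_density x <= exp (- x\<^sup>2 / 2)"
proof -
 have "1 <= sqrt (2 * pi)" using pi_gt3 by simp
 then have "exp (- x\<^sup>2 / 2) * 1 <= exp (- x\<^sup>2 / 2) * sqrt (2 * pi)" by (intro mult_left_mono) auto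
 then show ?thesis unfolding std_normal_density_def by (simp add: divide_le_eq)
qed

lemma std_normal_density_le_1: "std_normal_density x <= 1"
 by (rule order_trans[OF std_normal_density_le_exp]) simp

lemma std_normal_density_power4_le: "x ^ 4 * std_normal_density x <= 8"
proof -
 have "(x\<^sup>2 / 2)\<^sup>2 / 2 <= exp (x\<^sup>2 / 2)"
  using exp_lower_Taylor_quadratic[of "x\<^sup>2/2"] zero_le_power2[of x] by linarith
 then have "x ^ 4 <= 8 * exp (x\<^sup>2/2)" by (simp add: power_divide power_mult[symmetric])
 then have "x ^ 4 * exp (- x\<^sup>2 / 2) <= 8" by (simp add: exp_minus field_simps)
 then show ?thesis using mult_left_mono[OF std_normal_density_le_exp[of x], of "x^4"] by simp
qed

lemma nd_bounds: "\<bar>std_normal_density x\<bar> <= 30" "\<bar>nd2 x\<bar> <= 30" "\<bar>nd3 x\<bar> <= 30" "\<bar>nd4 x\<bar> <= 30"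
proof -
 let ?s = "std_normal_density x"
 have s: "0 <= ?s" "?s <= 1" by (simp_all add: std_normal_density_le_1)
 have 4: "x ^ 4 * ?s <= 8" by (rule std_normal_density_power4_le)
 have a: "q * ?s <= 30" if "q <= 5 + 2 * x ^ 4" for q
 proof -
  have "q * ?s <= (5 + 2 * x ^ 4) * ?s" using that s by (intro mult_right_mono) auto
  also have "... <= 5 + 2 * 8" using 4 s by (simp add: algebra_simps)
  finally show ?thesis by simp
 qed
 have x2: "x\<^sup>2 <= 1 + x^4"
  using zero_le_power2[of "x\<^sup>2 - 1/2"] by (simp add: power2_eq_square power4_eq_xxxx algebra_simps)
 have x1: "\<bar>x\<bar> <= 1 + x\<^sup>2" using zero_le_power2[of "\<bar>x\<bar> - 1/2"] by (simp add: power2_eq_square algebra_simps)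
 have x3: "\<bar>x\<bar>^3 <= x\<^sup>2 + x^4"
 proof -
  have "\<bar>x\<bar>^3 = \<bar>x\<bar>\<^sup>2 * \<bar>x\<bar>" by (simp add: power2_eq_square power3_eq_cube del: abs_mult_self_eq)
  then have "\<bar>x\<bar>^3 = x\<^sup>2 * \<bar>x\<bar>" by simp
  also have "... <= x\<^sup>2 * (1 + x\<^sup>2)" using x1 by (intro mult_left_mono) auto
  finally show ?thesis by (simp add: power2_eq_square power4_eq_xxxx algebra_simps)
 qed
 have x4: "0 <= x^4" by simp
 show "\<bar>?s\<bar> <= 30" using s by simp
 have "\<bar>nd2 x\<bar> = \<bar>x\<bar> * ?s" using s by (simp add: nd2_def abs_mult)
 also have "... <= 30" using x1 x2 x4 by (intro a) linarith
 finally show "\<bar>nd2 x\<bar> <= 30" .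
 have "\<bar>nd3 x\<bar> = \<bar>x\<^sup>2 - 1\<bar> * ?s" using s by (simp add: nd3_def abs_mult)
 also have "... <= 30" using x1 x2 x4 zero_le_power2[of x] by (intro a) linarith
 finally show "\<bar>nd3 x\<bar> <= 30" .
 have "\<bar>3 * x - x^3\<bar> <= 3 * \<bar>x\<bar> + \<bar>x\<bar>^3" 
  using abs_triangle_ineq4[of "3*x" "x^3"] by (simp add: abs_mult power_abs)
 moreover have "x\<^sup>2 <= 1/2 + x^4/2"
  using zero_le_power2[of "x\<^sup>2 - 1"] by (simp add: power2_eq_square power4_eq_xxxx algebra_simps)
 moreover have "\<bar>x\<bar> <= 3/4 + x\<^sup>2/3" using zero_le_power2[of "\<bar>x\<bar> - 3/2"] by (simp add: power2_eq_square algebra_simps)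
 ultimately have "\<bar>3 * x - x^3\<bar> <= 5 + 2 * x^4" using x3 x4 by linarith
 then have "\<bar>3 * x - x^3\<bar> * ?s <= 30" by (rule a)
 then show "\<bar>nd4 x\<bar> <= 30" using s by (simp add: nd4_def abs_mult)
qed

lemma integrable_nd4: "integrable lborel nd4"
proof -
 have "integrable lborel (%x. 3 * (std_normal_density x * x^1) - std_normal_density x * x^3)"
  using integrable_std_normal_moment[of 1] integrable_std_normal_moment[of 3]
  by (intro Bochner_Integration.integrable_diff integrable_mult_right) auto
 also have "(%x. 3 * (std_normal_density x * x^1) - std_normal_density x * x^3) = nd4"
  by (auto simp: nd4_def algebra_simps)
 finally show ?thesis .
qed

lemma nd3_eq_integral: "nd3 a = (LINT t|lborel. nd4 t * indicator {..a} t)"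
proof (rule integral_FTC_atMost[OF DERIV_nd3 _ integrable_nd4])
 show "isCont nd4 x" for x unfolding nd4_def[abs_def] by (intro continuous_intros isCont_std_normal_density)
 show "(nd3 \<longlongrightarrow> 0) at_bot"
 proof -
  have "((%x::real. (x\<^sup>2 - 1) * exp (- x\<^sup>2 / 2)) \<longlongrightarrow> 0) at_bot" by real_asymp
  then have "((%x. (1 / sqrt (2 * pi)) * ((x\<^sup>2 - 1) * exp (- x\<^sup>2 / 2))) \<longlongrightarrow> 0) at_bot"
   by (rule tendsto_mult_right_zero)
  then show ?thesis unfolding nd3_def[abs_def] std_normal_density_def by (simp add: mult_ac)
 qed
qed

definition gau :: "real => real measure" where
 "gau w = density lborel (normal_density 0 (sqrt w))"

lemma real_distribution_gau: "0 < w ==> real_distribution (gau w)"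
 unfolding gau_def real_distribution_def real_distribution_axioms_def
 by (auto intro: prob_space_normal_density)

lemma gau_convolution:
 assumes "0 < w" "0 < v" shows "gau w \<star> gau v = gau (w + v)"
proof -
 have "density lborel (%x. ennreal (normal_density 0 (sqrt w) x)) \<star> density lborel (%x. ennreal (normal_density 0 (sqrt v) x)) =
  density lborel (%x. \<integral>\<^sup>+y. ennreal (normal_density 0 (sqrt w) (x - y)) * ennreal (normal_density 0 (sqrt v) y) \<partial>lborel)"
  using assms by (intro convolution_density)
  (auto intro!: prob_space.finite_measure prob_space_normal_density)
 also have "(%x. \<integral>\<^sup>+y. ennreal (normal_density 0 (sqrt w) (x - y)) * ennreal (normal_density 0 (sqrt v) y) \<partial>lborel)
  = (%x. \<integral>\<^sup>+y. ennreal (normal_density 0 (sqrt w) (x - y) * normal_density 0 (sqrt v) y) \<partial>lborel)"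
  by (simp add: ennreal_mult')
 also have "... = normal_density 0 (sqrt (w + v))"
  using assms by (subst conv_normal_density_zero_mean) auto
 finally show ?thesis unfolding gau_def .
qed

lemma conv_op_gau_gau:
 assumes "0 < w" "0 < v" "bdd_borel f"
 shows "conv_op (gau w) (conv_op (gau v) f) = conv_op (gau (w + v)) f"
 using conv_op_convolution(1)[OF real_distribution_gau[OF assms(1)] real_distribution_gau[OF assms(2)] assms(3)]
 unfolding gau_convolution[OF assms(1,2)] by (rule sym)

lemma conv_op_gau_pow:
 assumes "0 < w" "bdd_borel f"
 shows "(conv_op (gau 1) ^^ j) (conv_op (gau w) f) = conv_op (gau (real j + w)) f"
proof (induction j)
 case (Suc j)
 then show ?case using conv_op_gau_gau[of 1 "real j + w" f] assms by (simp add: add_ac)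
qed simp

lemma conv_op_gau_pow1:
 assumes "1 <= j" "bdd_borel f" shows "(conv_op (gau 1) ^^ j) f = conv_op (gau (real j)) f"
proof -
 obtain i where "j = Suc i" using assms(1) by (cases j) auto
 then show ?thesis using conv_op_gau_pow[of 1 f i] assms by (simp add: funpow_swap1 add_ac)
qed

lemma integral_gau:
 fixes f :: "real => real"
 assumes "0 < w" and [measurable]: "f : borel_measurable borel"
 shows "(\<integral>y. f y \<partial>gau w) = (LINT t|lborel. std_normal_density t * f (sqrt w * t))"
proof -
 have "(\<integral>y. f y \<partial>gau w) = (LINT y|lborel. normal_density 0 (sqrt w) y * f y)"
  unfolding gau_def by (subst integral_density) auto
 also have "... = sqrt w * (LINT t|lborel. normal_density 0 (sqrt w) (sqrt w * t) * f (sqrt w * t))"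
  using assms by (subst lborel_integral_real_affine[where c="sqrt w" and t=0]) auto
 also have "... = (LINT t|lborel. sqrt w * (normal_density 0 (sqrt w) (sqrt w * t) * f (sqrt w * t)))" by simp
 also have "... = (LINT t|lborel. std_normal_density t * f (sqrt w * t))"
  using assms by (intro Bochner_Integration.integral_cong)
   (auto simp: normal_density_def power_mult_distrib real_sqrt_mult field_simps)
 finally show ?thesis .
qed

lemma conv_op_gau_indicator:
 assumes "0 < w" shows "conv_op (gau w) (indicator {..z}) x = Phi ((z - x) / sqrt w)"
proof -
 have "conv_op (gau w) (indicator {..z}) x = (LINT t|lborel. std_normal_density t * indicator {..z} (x + sqrt w * t))"
  unfolding conv_op_def using assms by (subst integral_gau) (auto simp: )
 also have "... = Phi ((z - x) / sqrt w)"
  unfolding Phi_def using assms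
  by (intro Bochner_Integration.integral_cong) (auto simp: indicator_def field_simps)
 finally show ?thesis .
qed

lemma Phi_bounds: "0 <= Phi a" "Phi a <= 1"
proof -
 show "0 <= Phi a" unfolding Phi_def by (rule Bochner_Integration.integral_nonneg) auto
 have "Phi a <= (LINT t|lborel. std_normal_density t)"
  unfolding Phi_def by (rule integral_mono) (auto intro!: integrable_std_normal_density_indicator mult_right_le_one_le)
 then show "Phi a <= 1" by simp
qed

lemma Phi_lipschitz: "\<bar>Phi a - Phi b\<bar> <= \<bar>a - b\<bar>"
proof -
 have "norm (Phi a - Phi b) <= 1 * norm (a - b)"
  by (rule field_differentiable_bound[of UNIV Phi std_normal_density])
   (simp_all add: DERIV_Phi std_normal_density_le_1)
 then show ?thesis by simp
qed

lemma gau_tail: 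
 assumes "0 < w" shows "measure (gau w) {y. \<bar>y\<bar> > 2 * sqrt w} <= 1/4"
proof -
 interpret real_distribution "gau w" by (rule real_distribution_gau) fact
 have i: "integrable lborel (%t. std_normal_density t * t^2)" by (rule integrable_std_normal_moment)
 have "measure (gau w) {y. \<bar>y\<bar> > 2 * sqrt w} = (\<integral>y. indicator {y. \<bar>y\<bar> > 2 * sqrt w} y \<partial>gau w)" by simp
 also have "... = (LINT t|lborel. std_normal_density t * indicator {y. \<bar>y\<bar> > 2 * sqrt w} (sqrt w * t))"
  by (rule integral_gau[OF assms]) measurable
 also have "... <= (LINT t|lborel. (std_normal_density t * t^2) / 4)"
 proof (rule integral_mono')
  show "integrable lborel (%t. std_normal_density t * t^2 / 4)" using i by auto
  fix t 
  show "std_normal_density t * indicator {y. \<bar>y\<bar> > 2 * sqrt w} (sqrt w * t) <= std_normal_density t * t^2 / 4"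
  proof (cases "\<bar>sqrt w * t\<bar> > 2 * sqrt w")
   case True
   then have "2 < \<bar>t\<bar>" using assms by (auto simp: abs_mult)
   then have "4 <= t\<^sup>2" using power_mono[of 2 "\<bar>t\<bar>" 2] by simp
   then have "std_normal_density t * 4 <= std_normal_density t * t\<^sup>2" by (intro mult_left_mono) auto
   with True show ?thesis by (auto simp: indicator_def)
  qed (auto simp: indicator_def)
 qed auto
 also have "... = 1/4" using integral_std_normal_moment_even[of 1] by simp
 finally show ?thesis .
qed

lemma smoothing_inequality:
 fixes F G :: "real => real"
 assumes "real_distribution gmv" and tail: "measure gmv {y. \<bar>y\<bar> > a} <= 1/4" and a: "0 <= a"
  and F: "mono F" and [measurable]: "F : borel_measurable borel" "G : borel_measurable borel"
  and b: "!!z. \<bar>F z - G z\<bar> <= 1" and lip: "!!x y. \<bar>G x - G y\<bar> <= c * \<bar>x - y\<bar>"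
  and sm: "!!z. \<bar>\<integral>y. F (z - y) - G (z - y) \<partial>gmv\<bar> <= \<Delta>"
 shows "\<bar>F z - G z\<bar> <= 2 * \<Delta> + 3 * c * a"
proof -
 interpret real_distribution gmv by fact
 define D where "D z = F z - G z" for z
 define dl where "dl = (SUP z. \<bar>D z\<bar>)"
 have bdd: "bdd_above (range (%z. \<bar>D z\<bar>))" using b by (auto simp: D_def bdd_above_def)
 have Ddl: "\<bar>D z\<bar> <= dl" for z unfolding dl_def by (rule cSUP_upper[OF _ bdd]) simp
 have dl0: "0 <= dl" using Ddl[of 0] by linarith
 have \<Delta>0: "0 <= \<Delta>" using sm[of 0] by linarith
 have c0: "0 <= c" using lip[of 1 0] by simp
 have [measurable]: "D : borel_measurable borel" unfolding D_def[abs_def] by measurable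
 define T where "T = {y::real. \<bar>y\<bar> > a}"
 have T: "T : sets borel" unfolding T_def by measurable
 have iD: "integrable gmv (%y. D (z - y))" for z
  by (rule integrable_const_bound[where B=dl]) (use Ddl in auto)
 have key: "E <= 4/3 * \<Delta> + dl / 3"
  if E: "!!y. \<bar>y\<bar> <= a ==> E <= s * D (z - y)" and s: "s = 1 \<or> s = -1" for E s z
 proof (cases "E <= 0")
  case True then show ?thesis using \<Delta>0 dl0 by linarith
 next
  case False
  let ?I = "indicator T :: real => real"
  have iI: "integrable gmv ?I" using T by (intro integrable_real_indicator) (auto simp: emeasure_eq_measure)
  have c1: "E - (E + dl) / 4 <= E - (E + dl) * measure gmv T"
  proof -
   have "(E + dl) * measure gmv T <= (E + dl) * (1/4)"
    using False dl0 tail unfolding T_def by (intro mult_left_mono) linarith+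
   then show ?thesis by linarith
  qed
  have c2: "E - (E + dl) * measure gmv T = (LINT y|gmv. E - (E + dl) * ?I y)" using iI T by simp
  have c3: "(LINT y|gmv. E - (E + dl) * ?I y) <= (LINT y|gmv. s * D (z - y))"
  proof (rule integral_mono)
   show "integrable gmv (%y. E - (E + dl) * ?I y)"
    using iI by (intro Bochner_Integration.integrable_diff integrable_mult_right integrable_const)
   show "integrable gmv (%y. s * D (z - y))" using iD by auto
   fix y show "E - (E + dl) * ?I y <= s * D (z - y)"
    using E[of y] Ddl[of "z - y"] s by (auto simp: indicator_def T_def)
  qed
  have c4: "(LINT y|gmv. s * D (z - y)) = s * (LINT y|gmv. D (z - y))" by simp
  have c5: "s * (LINT y|gmv. D (z - y)) <= \<Delta>" using sm[of z] s by (auto simp: D_def)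
  have "E - (E + dl) / 4 <= \<Delta>" using c1 c3 c5 unfolding c2 c4 by (rule order_trans[OF order_trans])
  then show ?thesis by argo
 qed
 have 1: "D z0 - 2 * c * a <= 4/3 * \<Delta> + dl / 3" for z0
 proof (rule key[OF _ disjI1[OF refl]])
  fix y :: real assume y: "\<bar>y\<bar> <= a"
  have "F z0 <= F (z0 + a - y)" using y by (intro monoD[OF F]) linarith
  moreover have "\<bar>G (z0 + a - y) - G z0\<bar> <= c * (2 * a)"
  proof -
   have "\<bar>z0 + a - y - z0\<bar> <= 2 * a" using y by linarith
   then have "c * \<bar>z0 + a - y - z0\<bar> <= c * (2 * a)" by (rule mult_left_mono[OF _ c0])
   with lip[of "z0 + a - y" z0] show ?thesis by (rule order_trans)
  qed
  ultimately show "D z0 - 2 * c * a <= 1 * D (z0 + a - y)" by (simp add: D_def)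
 qed
 have 2: "- D z0 - 2 * c * a <= 4/3 * \<Delta> + dl / 3" for z0
 proof (rule key[OF _ disjI2[OF refl]])
  fix y :: real assume y: "\<bar>y\<bar> <= a"
  have "F (z0 - a - y) <= F z0" using y by (intro monoD[OF F]) linarith
  moreover have "\<bar>G (z0 - a - y) - G z0\<bar> <= c * (2 * a)"
  proof -
   have "\<bar>z0 - a - y - z0\<bar> <= 2 * a" using y by linarith
   then have "c * \<bar>z0 - a - y - z0\<bar> <= c * (2 * a)" by (rule mult_left_mono[OF _ c0])
   with lip[of "z0 - a - y" z0] show ?thesis by (rule order_trans)
  qed
  ultimately show "- D z0 - 2 * c * a <= -1 * D (z0 - a - y)" by (simp add: D_def)
 qed
 have "dl <= 4/3 * \<Delta> + dl / 3 + 2 * c * a"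
  unfolding dl_def
 proof (rule cSUP_least)
  fix z show "\<bar>D z\<bar> <= 4/3 * \<Delta> + (SUP z. \<bar>D z\<bar>) / 3 + 2 * c * a"
   using 1[of z] 2[of z] unfolding dl_def by linarith
 qed simp
 then have "dl <= 2 * \<Delta> + 3 * c * a" by linarith
 then show ?thesis using Ddl[of z] by (simp add: D_def)
qed

lemma integrable_le_cube:
 assumes "real_distribution mu" "integrable mu (%y. \<bar>y\<bar> ^ 3)"
 shows "integrable mu (%y. y)" "integrable mu (%y. y\<^sup>2)"
proof -
 interpret real_distribution mu by fact
 have i: "integrable mu (%y. 1 + \<bar>y\<bar> ^ 3)" using assms(2) by simp
 have le: "t <= 1 + t ^ 3 & t\<^sup>2 <= 1 + t ^ 3" if "0 <= t" for t :: real
 proof (cases "t <= 1")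
  case True
  then have "t\<^sup>2 <= 1" "0 <= t^3" using that by (auto simp: power_le_one)
  then show ?thesis using True by linarith
 next
  case False
  then have "t^1 <= t^3" "t^2 <= t^3" by (intro power_increasing; simp)+
  then show ?thesis by simp
 qed
 show "integrable mu (%y. y)" using le[of "\<bar>y\<bar>" for y]
  by (intro Bochner_Integration.integrable_bound[OF i]) auto
 have "y\<^sup>2 <= 1 + \<bar>y\<bar>^3" for y :: real using le[of "\<bar>y\<bar>"] by simp
 then show "integrable mu (%y. y\<^sup>2)"
  by (intro Bochner_Integration.integrable_bound[OF i]) auto
qed

lemma taylor3_bound:
 fixes G :: "real => real"
 assumes d1: "!!x. (G has_real_derivative G1 x) (at x)"
  and d2: "!!x. (G1 has_real_derivative G2 x) (at x)"
  and d3: "!!x. (G2 has_real_derivative G3 x) (at x)"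
  and g: "!!x. \<bar>G3 x\<bar> <= g"
 shows "\<bar>G (x + y) - G x - G1 x * y - G2 x / 2 * y\<^sup>2\<bar> <= g / 6 * \<bar>y\<bar> ^ 3"
proof -
 define diff where "diff m h = (if m = 0 then G (x + h) else if m = 1 then G1 (x + h) else if m = 2 then G2 (x + h) else G3 (x + h))" for m :: nat and h
 have sh: "((%h. F (x + h)) has_real_derivative F' (x + t)) (at t)"
  if "!!u. (F has_real_derivative F' u) (at u)" for F F' t
 proof -
  have "((%h. x + h) has_real_derivative 1) (at t)" by (auto intro!: derivative_eq_intros)
  from DERIV_chain2[OF that this] show ?thesis by simp
 qed
 have "\<exists>t. \<bar>t\<bar> <= \<bar>y\<bar> & (%h. G (x + h)) y = (\<Sum>m<3. diff m 0 / fact m * y ^ m) + diff 3 t / fact 3 * y ^ 3"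
 proof (rule Maclaurin_bi_le)
  show "diff 0 = (%h. G (x + h))" by (auto simp: diff_def)
  show "\<forall>m t. m < 3 & \<bar>t\<bar> <= \<bar>y\<bar> --> (diff m has_real_derivative diff (Suc m) t) (at t)"
  proof (intro allI impI)
   fix m :: nat and t assume "m < 3 & \<bar>t\<bar> <= \<bar>y\<bar>"
   then consider "m = 0" | "m = 1" | "m = 2" by linarith
   then show "(diff m has_real_derivative diff (Suc m) t) (at t)"
    by cases (auto simp: diff_def[abs_def] intro!: sh d1 d2 d3)
  qed
 qed
 then obtain t where "G (x + y) = G x + G1 x * y + G2 x / 2 * y\<^sup>2 + G3 (x + t) / 6 * y ^ 3"
  by (auto simp: diff_def numeral_3_eq_3 numeral_2_eq_2)
 then have "G (x + y) - G x - G1 x * y - G2 x / 2 * y\<^sup>2 = G3 (x + t) / 6 * y ^ 3" by simp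
 then have "\<bar>G (x + y) - G x - G1 x * y - G2 x / 2 * y\<^sup>2\<bar> = \<bar>G3 (x + t) / 6 * y ^ 3\<bar>" by (simp only:)
 then have "\<bar>G (x + y) - G x - G1 x * y - G2 x / 2 * y\<^sup>2\<bar> = \<bar>G3 (x + t)\<bar> / 6 * \<bar>y\<bar> ^ 3"
  unfolding abs_mult power_abs abs_divide by simp
 also have "... <= g / 6 * \<bar>y\<bar> ^ 3" using g by (intro mult_right_mono divide_right_mono) auto
 finally show ?thesis .
qed

lemma conv_op_taylor3:
 assumes "real_distribution mu" "integrable mu (%y. \<bar>y\<bar> ^ 3)" "bdd_borel G"
  and d1: "!!x. (G has_real_derivative G1 x) (at x)"
  and d2: "!!x. (G1 has_real_derivative G2 x) (at x)"
  and d3: "!!x. (G2 has_real_derivative G3 x) (at x)"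
  and g: "!!x. \<bar>G3 x\<bar> <= g"
 shows "\<bar>conv_op mu G x - G x - G1 x * (LINT y|mu. y) - G2 x / 2 * (LINT y|mu. y\<^sup>2)\<bar>
  <= g / 6 * (LINT y|mu. \<bar>y\<bar> ^ 3)"
proof -
 interpret real_distribution mu by fact
 note i = bdd_borel_integrable[OF assms(3), of x] integrable_le_cube[OF assms(1,2)]
 have j: "integrable mu (%y. G (x + y))" "integrable mu (%y. G x)" "integrable mu (%y. G1 x * y)" "integrable mu (%y. G2 x / 2 * y\<^sup>2)"
  by (rule i(1), simp, rule integrable_mult_right[OF i(2)], rule integrable_mult_right[OF i(3)])
 have "conv_op mu G x - G x - G1 x * (LINT y|mu. y) - G2 x / 2 * (LINT y|mu. y\<^sup>2)
  = (LINT y|mu. G (x + y) - G x - G1 x * y - G2 x / 2 * y\<^sup>2)"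
  unfolding conv_op_def using j
  by (simp only: Bochner_Integration.integral_diff Bochner_Integration.integrable_diff integral_mult_right_zero lebesgue_integral_const)
   simp
 also have "\<bar>\<dots>\<bar> <= (LINT y|mu. g / 6 * \<bar>y\<bar> ^ 3)"
 proof (rule abs_integral_le)
  show "integrable mu (%y. G (x + y) - G x - G1 x * y - G2 x / 2 * y\<^sup>2)"
   by (intro Bochner_Integration.integrable_diff j)
  show "integrable mu (%y. g / 6 * \<bar>y\<bar> ^ 3)" by (rule integrable_mult_right[OF assms(2)])
  show "\<bar>G (x + y) - G x - G1 x * y - G2 x / 2 * y\<^sup>2\<bar> <= g / 6 * \<bar>y\<bar> ^ 3" for y
   by (rule taylor3_bound[OF d1 d2 d3 g])
 qed
 finally show ?thesis by simp
qed

lemma gau1_moments: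
 "integrable (gau 1) (%y. \<bar>y\<bar> ^ 3)" "(\<integral>y. y \<partial>gau 1) = 0" "(\<integral>y. y\<^sup>2 \<partial>gau 1) = 1" "(\<integral>y. \<bar>y\<bar> ^ 3 \<partial>gau 1) <= 2"
proof -
 have "integrable (gau 1) (%y. \<bar>y ^ 3\<bar>)"
  using integrable_std_normal_distribution_moment[of 3] by (simp add: gau_def)
 then show "integrable (gau 1) (%y. \<bar>y\<bar> ^ 3)" by (simp add: power_abs)
 show "(\<integral>y. y \<partial>gau 1) = 0"
  using integral_std_normal_moment_odd[of 0] by (subst integral_gau) auto
 show "(\<integral>y. y\<^sup>2 \<partial>gau 1) = 1"
  using integral_std_normal_moment_even[of 1] by (subst integral_gau) auto
 have "(\<integral>y. \<bar>y\<bar> ^ 3 \<partial>gau 1) = sqrt (2 / pi) * 2"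
  using integral_std_normal_moment_abs_odd[of 1] by (subst integral_gau) (auto simp: numeral_3_eq_3)
 also have "sqrt (2 / pi) <= sqrt 1" using pi_gt3 by (intro real_sqrt_le_mono) (simp add: divide_le_eq)
 finally show "(\<integral>y. \<bar>y\<bar> ^ 3 \<partial>gau 1) <= 2" by simp
qed

definition gphi :: "real => real => real => real" where "gphi w z x = Phi ((z - x) / sqrt w)"
definition gphi1 :: "real => real => real => real" where "gphi1 w z x = - (1 / sqrt w) * std_normal_density ((z - x) / sqrt w)"
definition gphi2 :: "real => real => real => real" where "gphi2 w z x = (1 / sqrt w) ^ 2 * nd2 ((z - x) / sqrt w)"
definition gphi3 :: "real => real => real => real" where "gphi3 w z x = - ((1 / sqrt w) ^ 3) * nd3 ((z - x) / sqrt w)"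
definition gphi4 :: "real => real => real => real" where "gphi4 w z x = (1 / sqrt w) ^ 4 * nd4 ((z - x) / sqrt w)"

lemma DERIV_scaled:
 assumes "!!u. (F has_real_derivative F' u) (at u)"
 shows "((%x. c * F ((z - x) / s)) has_real_derivative - (c * (1 / s)) * F' ((z - x) / s)) (at (x::real))"
proof -
 have "((%x. (z - x) / s) has_real_derivative - (1 / s)) (at x)"
  by (cases "s = 0") (auto intro!: derivative_eq_intros)
 from DERIV_cmult[OF DERIV_chain2[OF assms this], of c]
 show ?thesis by (simp add: mult_ac)
qed

lemma gphi_DERIV:
 "(gphi w z has_real_derivative gphi1 w z x) (at x)"
 "(gphi1 w z has_real_derivative gphi2 w z x) (at x)"
 "(gphi2 w z has_real_derivative gphi3 w z x) (at x)"
 "(gphi3 w z has_real_derivative gphi4 w z x) (at x)"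
proof -
 show "(gphi w z has_real_derivative gphi1 w z x) (at x)"
  using DERIV_scaled[OF DERIV_Phi, of 1 z "sqrt w" x] by (simp add: gphi_def[abs_def] gphi1_def)
 have 2: "(std_normal_density has_real_derivative nd2 u) (at u)" for u
  using DERIV_std_normal_density[of u] by (simp add: nd2_def)
 show "(gphi1 w z has_real_derivative gphi2 w z x) (at x)"
  using DERIV_scaled[OF 2, of "- (1 / sqrt w)" z "sqrt w" x] unfolding gphi1_def[abs_def] gphi2_def
  by (simp add: power2_eq_square)
 show "(gphi2 w z has_real_derivative gphi3 w z x) (at x)"
  using DERIV_scaled[OF DERIV_nd2, of "(1 / sqrt w)^2" z "sqrt w" x] unfolding gphi2_def[abs_def] gphi3_def
  by (simp add: power2_eq_square power3_eq_cube)
 show "(gphi3 w z has_real_derivative gphi4 w z x) (at x)"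
  using DERIV_scaled[OF DERIV_nd3, of "- ((1 / sqrt w)^3)" z "sqrt w" x] unfolding gphi3_def[abs_def] gphi4_def
  by (simp add: power4_eq_xxxx power3_eq_cube)
qed

lemma gphi_bounds:
 assumes "0 < w"
 shows "\<bar>gphi w z x\<bar> <= 1" "\<bar>gphi1 w z x\<bar> <= 30 * (1 / sqrt w)" "\<bar>gphi2 w z x\<bar> <= 30 * (1 / sqrt w) ^ 2"
  "\<bar>gphi3 w z x\<bar> <= 30 * (1 / sqrt w) ^ 3" "\<bar>gphi4 w z x\<bar> <= 30 * (1 / sqrt w) ^ 4"
proof -
 have a: "\<bar>c * u\<bar> <= 30 * d" if "\<bar>u\<bar> <= 30" "\<bar>c\<bar> = d" for c d u :: real
 proof -
  have "\<bar>u\<bar> * \<bar>c\<bar> <= 30 * \<bar>c\<bar>" by (rule mult_right_mono[OF that(1)]) simp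
  then show ?thesis unfolding that(2)[symmetric] abs_mult by (simp only: mult.commute)
 qed
 show "\<bar>gphi w z x\<bar> <= 1" using Phi_bounds by (simp add: gphi_def)
 show "\<bar>gphi1 w z x\<bar> <= 30 * (1 / sqrt w)" unfolding gphi1_def using assms by (intro a nd_bounds) auto
 show "\<bar>gphi2 w z x\<bar> <= 30 * (1 / sqrt w) ^ 2" unfolding gphi2_def using assms by (intro a nd_bounds) auto
 show "\<bar>gphi3 w z x\<bar> <= 30 * (1 / sqrt w) ^ 3" unfolding gphi3_def using assms by (intro a nd_bounds) auto
 show "\<bar>gphi4 w z x\<bar> <= 30 * (1 / sqrt w) ^ 4" unfolding gphi4_def using assms by (intro a nd_bounds) auto
qed

lemma DERIV_bdd_borel:
 assumes "!!x. (f has_real_derivative f' x) (at x)" "!!x. \<bar>f x\<bar> <= C"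
 shows "bdd_borel f"
proof -
 have "continuous_on UNIV f" using assms(1) by (meson DERIV_isCont continuous_at_imp_continuous_on)
 then show ?thesis by (intro bdd_borelI[where C=C] borel_measurable_continuous_onI assms(2))
qed

lemma gphi_bdd_borel:
 assumes "0 < w" shows "bdd_borel (gphi w z)" "bdd_borel (gphi1 w z)" "bdd_borel (gphi2 w z)" "bdd_borel (gphi3 w z)"
 by (rule DERIV_bdd_borel[OF gphi_DERIV(1) gphi_bounds(1)[OF assms]]
  DERIV_bdd_borel[OF gphi_DERIV(2) gphi_bounds(2)[OF assms]]
  DERIV_bdd_borel[OF gphi_DERIV(3) gphi_bounds(3)[OF assms]]
  DERIV_bdd_borel[OF gphi_DERIV(4) gphi_bounds(4)[OF assms]])+

lemma conv_op_gphi_DERIV: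
 assumes "real_distribution rh" "0 < w"
 shows "(conv_op rh (gphi w z) has_real_derivative conv_op rh (gphi1 w z) x) (at x)"
  "(conv_op rh (gphi1 w z) has_real_derivative conv_op rh (gphi2 w z) x) (at x)"
  "(conv_op rh (gphi2 w z) has_real_derivative conv_op rh (gphi3 w z) x) (at x)"
 by (rule conv_op_DERIV[OF assms(1) gphi_bdd_borel(1)[OF assms(2)] gphi_bdd_borel(2)[OF assms(2)] gphi_DERIV(1) gphi_DERIV(2) gphi_bounds(3)[OF assms(2)]]
  conv_op_DERIV[OF assms(1) gphi_bdd_borel(2)[OF assms(2)] gphi_bdd_borel(3)[OF assms(2)] gphi_DERIV(2) gphi_DERIV(3) gphi_bounds(4)[OF assms(2)]]
  conv_op_DERIV[OF assms(1) gphi_bdd_borel(3)[OF assms(2)] gphi_bdd_borel(4)[OF assms(2)] gphi_DERIV(3) gphi_DERIV(4) gphi_bounds(5)[OF assms(2)]])+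

lemma gphi_eq_conv_op: "0 < w ==> gphi w z = conv_op (gau w) (indicator {..z})"
 by (rule ext) (simp add: gphi_def conv_op_gau_indicator)

lemma conv_op_gau_pow_gphi:
 assumes "0 < w" shows "(conv_op (gau 1) ^^ i) (gphi w z) = gphi (real i + w) z"
  "(conv_op (gau 1) ^^ i) (gphi3 w z) = gphi3 (real i + w) z"
proof -
 have bi: "bdd_borel (indicator {..z})" by (rule bdd_borel_indicator) auto
 show 0: "(conv_op (gau 1) ^^ i) (gphi w z) = gphi (real i + w) z"
  using conv_op_gau_pow[OF assms bi, of i] assms by (simp add: gphi_eq_conv_op)
 obtain rh where rh: "real_distribution rh" "!!f. bdd_borel f ==> (conv_op (gau 1) ^^ i) f = conv_op rh f"
  using conv_op_pow_measure[OF real_distribution_gau[of 1], of i] by auto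
 note D = conv_op_gphi_DERIV[OF rh(1) assms, of z]
 have e0: "conv_op rh (gphi w z) = gphi (real i + w) z" using 0 rh(2)[OF gphi_bdd_borel(1)[OF assms]] by simp
 have e1: "conv_op rh (gphi1 w z) = gphi1 (real i + w) z"
  using DERIV_unique[OF D(1)[unfolded e0] gphi_DERIV(1)] by auto
 have e2: "conv_op rh (gphi2 w z) = gphi2 (real i + w) z"
  using DERIV_unique[OF D(2)[unfolded e1] gphi_DERIV(2)] by auto
 have e3: "conv_op rh (gphi3 w z) = gphi3 (real i + w) z"
  using DERIV_unique[OF D(3)[unfolded e2] gphi_DERIV(3)] by auto
 show "(conv_op (gau 1) ^^ i) (gphi3 w z) = gphi3 (real i + w) z"
  using e3 rh(2)[OF gphi_bdd_borel(4)[OF assms]] by simp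
qed

definition nd4_L1 :: real where "nd4_L1 = (LINT t|lborel. \<bar>nd4 t\<bar>)"

lemma nd4_L1_nonneg: "0 <= nd4_L1" unfolding nd4_L1_def by simp

lemma gphi3_variation:
 assumes "0 < w" "real_distribution mu" "real_distribution nu"
  and dl: "!!u. \<bar>conv_op mu (indicator {..u}) x - conv_op nu (indicator {..u}) x\<bar> <= dl"
 shows "\<bar>conv_op mu (gphi3 w z) x - conv_op nu (gphi3 w z) x\<bar> <= dl * ((1 / sqrt w) ^ 3 * nd4_L1)"
proof -
 define s where "s = sqrt w"
 have s: "0 < s" using assms by (simp add: s_def)
 define k where "k v = - ((1/s)^3) * ((1/s) * nd4 ((z - v) / s))" for v
 have i1: "integrable lborel (%v. nd4 ((z - v) / s))"
  using lborel_integrable_real_affine[OF integrable_nd4, of "-1/s" "z/s"] s by (simp add: diff_divide_distrib)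
 have ik: "integrable lborel k" unfolding k_def[abs_def] using i1 by (intro integrable_mult_right) auto
 have rep: "gphi3 w z y = (LINT v|lborel. k v * indicator {..v} y)" for y
 proof -
  have "nd3 ((z - y) / s) = (1/s) * (LINT v|lborel. nd4 (z/s + (-1/s) * v) * indicator {..(z - y)/s} (z/s + (-1/s) * v))"
   unfolding nd3_eq_integral using s by (subst lborel_integral_real_affine[where c="-1/s" and t="z/s"]) auto
  also have "(%v. nd4 (z/s + (-1/s) * v) * indicator {..(z - y)/s} (z/s + (-1/s) * v)) = (%v. nd4 ((z - v) / s) * indicator {..v} y)"
  proof
   fix v
   have "z/s + (-1/s) * v = (z - v) / s" by (simp add: diff_divide_distrib)
   moreover have "(z - v) / s <= (z - y) / s \<longleftrightarrow> y <= v" using s by (simp add: divide_le_cancel)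
   ultimately show "nd4 (z/s + (-1/s) * v) * indicator {..(z - y)/s} (z/s + (-1/s) * v) = nd4 ((z - v) / s) * indicator {..v} y"
    by (simp add: indicator_def)
  qed
  finally have "gphi3 w z y = - ((1/s)^3) * ((1/s) * (LINT v|lborel. nd4 ((z - v) / s) * indicator {..v} y))"
   by (simp add: gphi3_def s_def)
  also have "... = (\<integral>v. - ((1/s)^3) * ((1/s) * (nd4 ((z - v) / s) * indicator {..v} y)) \<partial>lborel)"
   by (simp only: integral_mult_right_zero)
  finally show ?thesis by (simp add: k_def mult_ac)
 qed
 have "(LINT v|lborel. \<bar>k v\<bar>) = (1/s)^3 * ((1/s) * (LINT v|lborel. \<bar>nd4 ((z - v) / s)\<bar>))"
  unfolding k_def abs_mult using s by simp
 also have "(1/s) * (LINT v|lborel. \<bar>nd4 ((z - v) / s)\<bar>) = nd4_L1"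
  unfolding nd4_L1_def using s by (subst lborel_integral_real_affine[where c="-1/s" and t="z/s" and f="%t. \<bar>nd4 t\<bar>"])
   (auto simp: diff_divide_distrib)
 finally have "(LINT v|lborel. \<bar>k v\<bar>) = (1/s)^3 * nd4_L1" .
 with conv_op_total_variation[OF assms(2,3) ik rep dl] show ?thesis by (simp add: s_def)
qed

lemma sum_inverse_sqrt_le:
 assumes "1 <= K" shows "(\<Sum>j<k. 1 / sqrt (real j + K)) <= 2 * sqrt (real k)"
proof (induction k)
 case (Suc k)
 have "1 / sqrt (real k + K) <= 1 / sqrt (real k + 1)" using assms by (intro divide_left_mono) auto
 moreover have "1 / sqrt (real k + 1) <= 2 * (sqrt (real k + 1) - sqrt (real k))"
 proof -
  define u D where "u = sqrt (real k + 1)" and "D = sqrt (real k + 1) - sqrt (real k)"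
  have D0: "0 <= D" and u0: "0 < u" by (simp_all add: D_def u_def)
  have "u^2 - (u - D)^2 = 1" by (simp add: u_def D_def)
  then have "D * (2 * u) = 1 + D^2" by (simp add: power2_eq_square algebra_simps)
  then have "1 <= 2 * D * u" using zero_le_power2[of D] by (simp add: mult_ac)
  then have "1 / u <= 2 * D" using u0 by (simp add: pos_divide_le_eq)
  then show ?thesis by (simp only: u_def D_def)
 qed
 ultimately show ?case using Suc by (simp add: add_ac)
qed simp

lemma sum_inverse_le:
 assumes "1 <= K" "1 <= k" shows "(\<Sum>j<k. 1 / (real j + K)) <= 1 + ln (real k)"
 using assms(2)
proof (induction k rule: dec_induct)
 case base then show ?case using assms(1) by (simp add: divide_le_eq)
next
 case (step k)
 have k: "0 < real k" using step by simp
 have "1 / (real k + K) <= 1 / (real k + 1)" using assms by (intro divide_left_mono) auto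
 also have "... <= ln (real k + 1) - ln (real k)"
 proof -
  have "ln (real k / (real k + 1)) <= real k / (real k + 1) - 1" using k by (intro ln_le_minus_one) auto
  also have "... = - (1 / (real k + 1))" using k by (simp add: field_simps)
  finally show ?thesis using k by (simp add: ln_div)
 qed
 finally show ?case using step by (simp add: add_ac)
qed

lemma sum_inverse_sqrt_cube_le:
 assumes "1 <= K" shows "(\<Sum>j<k. (1 / sqrt (real j + K)) ^ 3) <= 4 / sqrt K"
proof -
 have st: "(1 / sqrt w) ^ 3 <= 4 * (1 / sqrt w - 1 / sqrt (w + 1))" if "1 <= w" for w
 proof -
  define a b where "a = sqrt w" and "b = sqrt (w + 1)"
  have a: "1 <= a" and ab: "a <= b" using that by (auto simp: a_def b_def)
  have sq: "b^2 - a^2 = 1" using that by (simp add: a_def b_def)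
  have b2: "b <= 3/2 * a"
  proof (rule power2_le_imp_le)
   have "1 <= a^2" using a by simp
   then show "b\<^sup>2 <= (3/2 * a)\<^sup>2" using sq by (simp add: power_mult_distrib power_divide)
  qed (use a in auto)
  have bp: "0 < b" using a ab by simp
  have "b * (b + a) <= (3/2 * a) * (3/2 * a + a)" using b2 a bp by (intro mult_mono) auto
  also have "... <= 4 * a^2" using a by (simp add: power2_eq_square)
  finally have "b * (b + a) <= 4 * a^2" .
  moreover have "(b - a) * (b + a) = 1" using sq by (simp add: power2_eq_square algebra_simps)
  ultimately have "b * ((b - a) * (b + a)) * 1 <= (b - a) * (4 * a^2) "
   using mult_left_mono[of "b * (b + a)" "4 * a^2" "b - a"] ab by (simp add: mult_ac)
  then have "b <= (b - a) * (4 * a^2)" using \<open>(b - a) * (b + a) = 1\<close> by simp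
  then have "b <= 4 * (b - a) * a^2" by (simp add: algebra_simps)
  then have "b / (a^3 * b) <= 4 * (b - a) * a^2 / (a^3 * b)" using a bp by (intro divide_right_mono) auto
  moreover have "b / (a^3 * b) = (1/a)^3" using bp by (simp add: power_divide)
  moreover have "4 * (b - a) * a^2 / (a^3 * b) = 4 * (1/a - 1/b)"
   using a bp by (simp add: field_simps power2_eq_square power3_eq_cube)
  ultimately show ?thesis by (simp add: a_def b_def)
 qed
 have "(\<Sum>j<k. (1 / sqrt (real j + K)) ^ 3) <= 4 / sqrt K - 4 / sqrt (real k + K)"
 proof (induction k)
  case (Suc k) then show ?case using st[of "real k + K"] assms by (simp add: add_ac)
 qed simp
 also have "... <= 4 / sqrt K" using assms by simp
 finally show ?thesis .
qed

lemma lindeberg_step: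
 assumes nu: "real_distribution nu" "integrable nu (%y. \<bar>y\<bar> ^ 3)"
  and e1: "\<bar>\<integral>y. y \<partial>nu\<bar> <= e1" and e2: "\<bar>(LINT y|nu. y\<^sup>2) - 1\<bar> <= e2" and r: "(LINT y|nu. \<bar>y\<bar> ^ 3) <= r"
  and rh: "real_distribution rh" and w: "0 < w" and g: "!!x. \<bar>conv_op rh (gphi3 w z) x\<bar> <= g"
 shows "\<bar>conv_op nu (conv_op rh (gphi w z)) x - conv_op (gau 1) (conv_op rh (gphi w z)) x\<bar>
  <= e1 * (30 * (1 / sqrt w)) + e2 * (15 * (1 / sqrt w)\<^sup>2) + (r + 2) / 6 * g"
proof -
 let ?G = "conv_op rh (gphi w z)" and ?G1 = "conv_op rh (gphi1 w z) x" and ?G2 = "conv_op rh (gphi2 w z) x"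
 have bG: "bdd_borel ?G" by (rule real_distribution.bdd_borel_conv_op[OF rh gphi_bdd_borel(1)[OF w]])
 note D = conv_op_gphi_DERIV[OF rh w]
 have g0: "0 <= g" using g[of 0] by linarith
 have G1: "\<bar>?G1\<bar> <= 30 * (1 / sqrt w)"
  by (rule real_distribution.conv_op_bound[OF rh gphi_bdd_borel(2)[OF w] gphi_bounds(2)[OF w]])
 have G2: "\<bar>?G2\<bar> <= 30 * (1 / sqrt w)\<^sup>2"
  by (rule real_distribution.conv_op_bound[OF rh gphi_bdd_borel(3)[OF w] gphi_bounds(3)[OF w]])
 let ?m1 = "\<integral>y. y \<partial>nu" and ?m2 = "\<integral>y. y\<^sup>2 \<partial>nu"
 have 1: "\<bar>conv_op nu ?G x - ?G x - ?G1 * ?m1 - ?G2 / 2 * ?m2\<bar> <= g / 6 * r"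
  using conv_op_taylor3[OF nu bG D(1) D(2) D(3) g, of x] mult_left_mono[OF r, of "g / 6"] g0 by linarith
 have "\<bar>conv_op (gau 1) ?G x - ?G x - ?G1 * 0 - ?G2 / 2 * 1\<bar> <= g / 6 * (\<integral>y. \<bar>y\<bar> ^ 3 \<partial>gau 1)"
  using conv_op_taylor3[OF real_distribution_gau gau1_moments(1) bG D(1) D(2) D(3) g, of x]
  unfolding gau1_moments(2,3) by simp
 moreover have "g / 6 * (\<integral>y. \<bar>y\<bar> ^ 3 \<partial>gau 1) <= g / 6 * 2"
  using g0 by (intro mult_left_mono gau1_moments(4)) auto
 ultimately have 2: "\<bar>conv_op (gau 1) ?G x - ?G x - ?G2 / 2\<bar> <= g / 6 * 2" by linarith
 have 3: "\<bar>?G1 * ?m1\<bar> <= e1 * (30 * (1 / sqrt w))"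
  unfolding abs_mult using mult_mono[OF G1 e1] w by (simp add: mult.commute)
 have "\<bar>?G2 / 2 * ?m2 - ?G2 / 2\<bar> = \<bar>?G2\<bar> * \<bar>?m2 - 1\<bar> / 2"
 proof -
  have "?G2 / 2 * ?m2 - ?G2 / 2 = ?G2 * (?m2 - 1) / 2" by (simp add: algebra_simps diff_divide_distrib)
  then show ?thesis by (simp only: abs_mult abs_divide abs_numeral)
 qed
 also have "... <= (30 * (1 / sqrt w)\<^sup>2) * e2 / 2"
  by (intro divide_right_mono mult_mono G2 e2) auto
 finally have 4: "\<bar>?G2 / 2 * ?m2 - ?G2 / 2\<bar> <= e2 * (15 * (1 / sqrt w)\<^sup>2)" by (simp add: mult_ac)
 have "(r + 2) / 6 * g = g / 6 * r + g / 6 * 2" by (simp add: algebra_simps add_divide_distrib)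
 with 1 2 3 4 show ?thesis by linarith
qed

lemma conv_op_telescope:
 assumes mu: "real_distribution mu" and nu: "real_distribution nu" and f: "bdd_borel f"
 shows "(conv_op mu ^^ k) f x - (conv_op nu ^^ k) f x =
  (\<Sum>j<k. conv_op mu ((conv_op mu ^^ (k - 1 - j)) ((conv_op nu ^^ j) f)) x
    - conv_op nu ((conv_op mu ^^ (k - 1 - j)) ((conv_op nu ^^ j) f)) x)"
proof -
 define a where "a j = (conv_op mu ^^ (k - j)) ((conv_op nu ^^ j) f) x" for j
 have "(\<Sum>j<k. a j - a (Suc j)) = a 0 - a k" by (rule sum_lessThan_telescope')
 moreover have "a j - a (Suc j) = conv_op mu ((conv_op mu ^^ (k - 1 - j)) ((conv_op nu ^^ j) f)) x
    - conv_op nu ((conv_op mu ^^ (k - 1 - j)) ((conv_op nu ^^ j) f)) x" if "j < k" for j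
 proof -
  have e: "k - j = Suc (k - 1 - j)" "k - Suc j = k - 1 - j" using that by auto
  have b: "bdd_borel ((conv_op nu ^^ j) f)" by (rule real_distribution.conv_op_pow_bdd[OF nu f])
  show ?thesis unfolding a_def e by (simp add: conv_op_pow_commute[OF mu nu b])
 qed
 ultimately show ?thesis by (simp add: a_def)
qed

lemma bdd_borel_halfline: "bdd_borel (indicator {..z})"
 by (rule bdd_borel_indicator) simp

lemma conv_op_pow_halfline_shift:
 "(conv_op mu ^^ i) (indicator {..u}) x = (conv_op mu ^^ i) (indicator {..u - x}) (0::real)"
proof -
 have "(%y. indicator {..u} (y + x)) = (indicator {..u - x} :: real => real)"
  by (auto simp: indicator_def fun_eq_iff)
 then show ?thesis using conv_op_pow_shift[of i mu "indicator {..u}" x 0] by simp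
qed

lemma bergstrom_step:
 assumes nu: "real_distribution nu" "integrable nu (%y. \<bar>y\<bar> ^ 3)"
  and e1: "\<bar>\<integral>y. y \<partial>nu\<bar> <= e1" and e2: "\<bar>(LINT y|nu. y\<^sup>2) - 1\<bar> <= e2" and r: "(LINT y|nu. \<bar>y\<bar> ^ 3) <= r"
  and K: "1 <= K" and k: "1 <= k" and D0: "0 <= D"
  and IH: "!!i z. i < k ==> \<bar>(conv_op nu ^^ i) (indicator {..z}) 0 - (conv_op (gau 1) ^^ i) (indicator {..z}) 0\<bar> <= D / sqrt (real i + 1)"
 shows "\<bar>(conv_op nu ^^ k) (gphi K z) x - (conv_op (gau 1) ^^ k) (gphi K z) x\<bar>
  <= 60 * e1 * sqrt k + 15 * e2 * (1 + ln k) + (r + 2) * (15 + nd4_L1 * D / sqrt K) / sqrt k"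
proof -
 have g1: "real_distribution (gau 1)" by (rule real_distribution_gau) simp
 have e10: "0 <= e1" "0 <= e2" using e1 e2 by linarith+
 have r0: "0 <= r" using r by (rule order_trans[rotated]) simp
 have k0: "0 < real k" using k by simp
 define h where "h = 30 * (1 / sqrt (real k / 2)) ^ 3"
 define h' where "h' = D * sqrt 2 / sqrt k * nd4_L1"
 have h'0: "0 <= h'" unfolding h'_def using D0 nd4_L1_nonneg by simp
 have trm: "\<bar>conv_op nu ((conv_op nu ^^ (k - 1 - j)) ((conv_op (gau 1) ^^ j) (gphi K z))) x
    - conv_op (gau 1) ((conv_op nu ^^ (k - 1 - j)) ((conv_op (gau 1) ^^ j) (gphi K z))) x\<bar>
  <= e1 * (30 * (1 / sqrt (real j + K))) + e2 * (15 * (1 / (real j + K))) + (r + 2) / 6 * (h + h' * (1 / sqrt (real j + K)) ^ 3)"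
  if j: "j < k" for j
 proof -
  define w where "w = real j + K"
  define i where "i = k - 1 - j"
  have w: "0 < w" "1 <= w" using K by (auto simp: w_def)
  have i: "i < k" "real i + 1 = real k - real j" using j by (auto simp: i_def of_nat_diff)
  obtain rh where rh: "real_distribution rh" "!!f. bdd_borel f ==> (conv_op nu ^^ i) f = conv_op rh f"
   using conv_op_pow_measure[OF nu(1), of i] by blast
  obtain rh' where rh': "real_distribution rh'" "!!f. bdd_borel f ==> (conv_op (gau 1) ^^ i) f = conv_op rh' f"
   using conv_op_pow_measure[OF g1, of i] by blast
  have g: "\<bar>conv_op rh (gphi3 w z) y\<bar> <= h + h' * (1 / sqrt w) ^ 3" for y
  proof (cases "real k / 2 <= w")
   case True
   have "\<bar>conv_op rh (gphi3 w z) y\<bar> <= 30 * (1 / sqrt w) ^ 3"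
    by (rule real_distribution.conv_op_bound[OF rh(1) gphi_bdd_borel(4)[OF w(1)] gphi_bounds(4)[OF w(1)]])
   also have "... <= h" unfolding h_def using True k0 w
    by (intro mult_left_mono power_mono divide_left_mono) auto
   finally show ?thesis using h'0 w by (simp add: add_increasing2)
  next
   case False
   then have i2: "real k / 2 <= real i + 1" using i K by (simp add: w_def)
   have dl: "\<bar>conv_op rh (indicator {..u}) y - conv_op rh' (indicator {..u}) y\<bar> <= D / sqrt (real i + 1)" for u
    using IH[OF i(1), of "u - y"] conv_op_pow_halfline_shift[of i nu u y] conv_op_pow_halfline_shift[of i "gau 1" u y]
    by (simp add: rh(2)[OF bdd_borel_halfline] rh'(2)[OF bdd_borel_halfline])
   have "\<bar>conv_op rh (gphi3 w z) y - conv_op rh' (gphi3 w z) y\<bar> <= D / sqrt (real i + 1) * ((1 / sqrt w) ^ 3 * nd4_L1)"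
    by (rule gphi3_variation[OF w(1) rh(1) rh'(1) dl])
   also have "... <= D * sqrt 2 / sqrt k * ((1 / sqrt w) ^ 3 * nd4_L1)"
   proof (rule mult_right_mono)
    have "D / sqrt (real i + 1) <= D / sqrt (real k / 2)"
     using i2 k0 D0 by (intro divide_left_mono real_sqrt_le_mono mult_pos_pos) auto
    also have "... = D * sqrt 2 / sqrt k" by (simp add: real_sqrt_divide)
    finally show "D / sqrt (real i + 1) <= D * sqrt 2 / sqrt k" .
    show "0 <= (1 / sqrt w) ^ 3 * nd4_L1" using w nd4_L1_nonneg by simp
   qed
   finally have 1: "\<bar>conv_op rh (gphi3 w z) y - conv_op rh' (gphi3 w z) y\<bar> <= h' * (1 / sqrt w) ^ 3"
    by (simp only: h'_def mult_ac)
   have "conv_op rh' (gphi3 w z) = gphi3 (real i + w) z"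
    using conv_op_gau_pow_gphi(2)[OF w(1), of i z] rh'(2)[OF gphi_bdd_borel(4)[OF w(1)]] by simp
   then have "\<bar>conv_op rh' (gphi3 w z) y\<bar> <= 30 * (1 / sqrt (real i + w)) ^ 3"
    using gphi_bounds(4)[of "real i + w" z y] w by simp
   also have "... <= h" unfolding h_def using i2 k0 w
    by (intro mult_left_mono power_mono divide_left_mono real_sqrt_le_mono mult_pos_pos) auto
   finally show ?thesis using 1 by linarith
  qed
  have B: "(conv_op (gau 1) ^^ j) (gphi K z) = gphi w z"
   unfolding w_def using K by (intro conv_op_gau_pow_gphi(1)) simp
  have "\<bar>conv_op nu (conv_op rh (gphi w z)) x - conv_op (gau 1) (conv_op rh (gphi w z)) x\<bar>
   <= e1 * (30 * (1 / sqrt w)) + e2 * (15 * (1 / sqrt w)\<^sup>2) + (r + 2) / 6 * (h + h' * (1 / sqrt w) ^ 3)"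
   by (rule lindeberg_step[OF nu e1 e2 r rh(1) w(1) g])
  moreover have "(1 / sqrt w)\<^sup>2 = 1 / w" using w by (simp add: power_divide)
  ultimately show ?thesis
   unfolding B i_def[symmetric] rh(2)[OF gphi_bdd_borel(1)[OF w(1)]] by (simp only: w_def)
 qed
 have hk: "real k * h + h' * (4 / sqrt K) <= 6 * ((15 + nd4_L1 * D / sqrt K) / sqrt k)"
 proof -
  define q where "q = sqrt k"
  have q: "0 < q" "real k = q * q" using k0 by (auto simp: q_def)
  have "sqrt 2 <= sqrt ((3/2)\<^sup>2)" by (rule real_sqrt_le_mono) (simp add: power2_eq_square)
  then have s2: "sqrt 2 * sqrt 2 = (2::real)" "sqrt 2 <= 3/2" unfolding real_sqrt_abs by simp_all
  have "1 / sqrt (real k / 2) = sqrt 2 / q" by (simp add: q_def real_sqrt_divide)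
  then have "real k * h = 30 * (sqrt 2 * (sqrt 2 * sqrt 2)) / q"
   unfolding h_def q(2) using q(1) by (simp add: power3_eq_cube field_simps)
  also have "... <= 90 / q" unfolding s2(1) using s2(2) q(1) by (intro divide_right_mono) auto
  finally have 1: "real k * h <= 90 / q" .
  have "h' * (4 / sqrt K) = (D * nd4_L1 / sqrt K) * (4 * sqrt 2) / q" by (simp add: h'_def q_def mult_ac)
  also have "... <= (D * nd4_L1 / sqrt K) * 6 / q"
   using s2(2) q(1) D0 nd4_L1_nonneg K by (intro divide_right_mono mult_left_mono) auto
  finally have "real k * h + h' * (4 / sqrt K) <= 90 / q + (D * nd4_L1 / sqrt K) * 6 / q" using 1 by linarith
  also have "... = 6 * ((15 + nd4_L1 * D / sqrt K) / q)" by (simp add: add_divide_distrib mult_ac)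
  finally show ?thesis by (simp add: q_def)
 qed
 have bK: "bdd_borel (gphi K z)" using K by (intro gphi_bdd_borel(1)) simp
 have "\<bar>(conv_op nu ^^ k) (gphi K z) x - (conv_op (gau 1) ^^ k) (gphi K z) x\<bar>
  <= (\<Sum>j<k. e1 * (30 * (1 / sqrt (real j + K))) + e2 * (15 * (1 / (real j + K))) + (r + 2) / 6 * (h + h' * (1 / sqrt (real j + K)) ^ 3))"
  unfolding conv_op_telescope[OF nu(1) g1 bK]
  by (rule order_trans[OF sum_abs sum_mono]) (use trm in auto)
 also have "... = e1 * (30 * (\<Sum>j<k. 1 / sqrt (real j + K))) + e2 * (15 * (\<Sum>j<k. 1 / (real j + K)))
   + (r + 2) / 6 * (real k * h + h' * (\<Sum>j<k. (1 / sqrt (real j + K)) ^ 3))"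
  by (simp only: sum.distrib sum_distrib_left[symmetric] sum_constant card_lessThan)
 also have "... <= e1 * (30 * (2 * sqrt k)) + e2 * (15 * (1 + ln k)) + (r + 2) / 6 * (real k * h + h' * (4 / sqrt K))"
  by (intro add_mono mult_left_mono sum_inverse_sqrt_le sum_inverse_le sum_inverse_sqrt_cube_le K k h'0 order_refl)
   (use e10 r0 in auto)
 also have "... <= e1 * (30 * (2 * sqrt k)) + e2 * (15 * (1 + ln k)) + (r + 2) / 6 * (6 * ((15 + nd4_L1 * D / sqrt K) / sqrt k))"
  using r0 by (intro add_left_mono mult_left_mono hk) auto
 also have "... = 60 * e1 * sqrt k + 15 * e2 * (1 + ln k) + (r + 2) * (15 + nd4_L1 * D / sqrt K) / sqrt k"
 proof -
  have "a * (30 * (2 * b)) + c * (15 * u) + R / 6 * (6 * (Y / q)) = 60 * a * b + 15 * c * u + R * Y / q" for a b c u R Y q :: real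
   by simp
  then show ?thesis .
 qed
 finally show ?thesis .
qed

theorem berry_esseen_near_normal:
 fixes r :: real
 assumes "0 <= r"
 obtains C where "0 < C"
  "!!nu n e1 e2 k z. real_distribution nu ==> integrable nu (%y. \<bar>y\<bar> ^ 3) ==> \<bar>\<integral>y. y \<partial>nu\<bar> <= e1 ==>
   \<bar>(LINT y|nu. y\<^sup>2) - 1\<bar> <= e2 ==> (LINT y|nu. \<bar>y\<bar> ^ 3) <= r ==> 1 <= n ==> k <= n ==>
   \<bar>(conv_op nu ^^ k) (indicator {..z}) 0 - (conv_op (gau 1) ^^ k) (indicator {..z}) 0\<bar>
    <= C * (1 + e1 * real n + e2 * (sqrt n * (1 + ln n))) / sqrt (real k + 1)"
proof -
 define R where "R = r + 2"
 define s where "s = 6 * R * (nd4_L1 + 1)"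
 define K where "K = s * s"
 have R: "2 <= R" using assms by (simp add: R_def)
 have V: "0 <= nd4_L1" by (rule nd4_L1_nonneg)
 have s1: "1 <= s"
 proof -
  have "1 * 1 <= (6 * R) * (nd4_L1 + 1)" using R V by (intro mult_mono) auto
  then show ?thesis by (simp add: s_def)
 qed
 have K1: "1 <= K" using mult_mono[OF s1 s1] s1 by (simp add: K_def)
 have sK: "sqrt K = s" using s1 by (simp add: K_def)
 define C where "C = 3 * (120 + 30 * R + 6 * s)"
 have C0: "0 < C" using R s1 by (simp add: C_def)
 show ?thesis
 proof (rule that[OF C0])
  fix nu and n :: nat and e1 e2 z :: real and k :: nat
  assume nu: "real_distribution nu" "integrable nu (%y. \<bar>y\<bar> ^ 3)"
   and e1: "\<bar>\<integral>y. y \<partial>nu\<bar> <= e1" and e2: "\<bar>(LINT y|nu. y\<^sup>2) - 1\<bar> <= e2" and r: "(LINT y|nu. \<bar>y\<bar> ^ 3) <= r"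
   and n: "1 <= n" and kn: "k <= n"
  have g1: "real_distribution (gau 1)" by (rule real_distribution_gau) simp
  have e0: "0 <= e1" "0 <= e2" using e1 e2 by linarith+
  define E where "E = e2 * (sqrt n * (1 + ln n))"
  have E0: "0 <= E" using e0 n by (simp add: E_def)
  define D where "D = 3 * (120 * (e1 * n) + 30 * E + 30 * R + 6 * s)"
  have D0: "0 <= D" using e0 E0 R s1 by (simp add: D_def)
  have DC: "D <= C * (1 + e1 * n + E)"
  proof -
   have "0 <= e1 * n" using e0 by simp
   then have "0 <= (30 * R + 6 * s) * (e1 * n)" "0 <= (90 + 30 * R + 6 * s) * E" using R s1 E0 by simp_all
   then show ?thesis unfolding D_def C_def by (simp add: algebra_simps)
  qed
  have "\<forall>z. \<bar>(conv_op nu ^^ k) (indicator {..z}) 0 - (conv_op (gau 1) ^^ k) (indicator {..z}) 0\<bar> <= D / sqrt (real k + 1)"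
   using kn
  proof (induction k rule: less_induct)
   case (less k)
   show ?case
   proof (cases "k = 0")
    case True then show ?thesis using D0 by simp
   next
    case False
    then have k: "1 <= k" by simp
    define q where "q = sqrt k"
    have q: "0 < q" "real k = q * q" "q <= sqrt n" using k less.prems by (auto simp: q_def)
    define \<Delta> where "\<Delta> = 60 * e1 * sqrt k + 15 * e2 * (1 + ln k) + (r + 2) * (15 + nd4_L1 * D / sqrt K) / sqrt k"
    have IH: "\<bar>(conv_op nu ^^ i) (indicator {..z}) 0 - (conv_op (gau 1) ^^ i) (indicator {..z}) 0\<bar> <= D / sqrt (real i + 1)"
     if "i < k" for i z using less.IH[OF that] less.prems that by auto
    have st: "\<bar>(conv_op nu ^^ k) (gphi K z) x - (conv_op (gau 1) ^^ k) (gphi K z) x\<bar> <= \<Delta>" for z x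
     unfolding \<Delta>_def by (rule bergstrom_step[OF nu e1 e2 r K1 k D0 IH])
    obtain rh where rh: "real_distribution rh" "!!f. bdd_borel f ==> (conv_op nu ^^ k) f = conv_op rh f"
     using conv_op_pow_measure[OF nu(1), of k] by blast
    interpret rh: real_distribution rh by (rule rh(1))
    define F where "F z = (conv_op nu ^^ k) (indicator {..z}) 0" for z
    define G where "G z = Phi (z / sqrt k)" for z
    have F: "F z = measure rh {..z}" for z
     unfolding F_def rh(2)[OF bdd_borel_halfline] by (simp add: conv_op_def)
    have G: "(conv_op (gau 1) ^^ k) (indicator {..z}) x = G (z - x)" for z x
     using k by (simp add: conv_op_gau_pow1[OF k bdd_borel_halfline] conv_op_gau_indicator G_def)
    have Fs: "(conv_op nu ^^ k) (indicator {..z}) x = F (z - x)" for z x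
     unfolding F_def by (rule conv_op_pow_halfline_shift)
    have mF: "mono F" unfolding F mono_def by (auto intro: rh.finite_measure_mono)
    have F01: "0 <= F z" "F z <= 1" for z unfolding F by simp_all
    have G01: "0 <= G z" "G z <= 1" for z unfolding G_def by (rule Phi_bounds)+
    have lip: "\<bar>G x - G y\<bar> <= 1 / q * \<bar>x - y\<bar>" for x y
     unfolding G_def q_def using Phi_lipschitz[of "x / sqrt k" "y / sqrt k"] by (simp flip: diff_divide_distrib)
    have cG: "continuous_on UNIV G"
    proof -
     have "continuous_on UNIV Phi" using DERIV_Phi by (meson DERIV_isCont continuous_at_imp_continuous_on)
     then show ?thesis unfolding G_def by (rule continuous_on_compose2) (use k in \<open>auto intro!: continuous_intros\<close>)
    qed
    have sm: "\<bar>\<integral>y. F (z - y) - G (z - y) \<partial>gau K\<bar> <= \<Delta>" for z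
    proof -
     have gK: "real_distribution (gau K)" using K1 by (intro real_distribution_gau) simp
     have "(\<integral>y. F (z - y) - G (z - y) \<partial>gau K) =
      conv_op (gau K) (%y. (conv_op nu ^^ k) (indicator {..z}) y - (conv_op (gau 1) ^^ k) (indicator {..z}) y) 0"
      by (simp add: conv_op_def Fs G)
     also have "... = conv_op (gau K) ((conv_op nu ^^ k) (indicator {..z})) 0 - conv_op (gau K) ((conv_op (gau 1) ^^ k) (indicator {..z})) 0"
      by (intro real_distribution.conv_op_diff[OF gK] real_distribution.conv_op_pow_bdd[OF nu(1)]
       real_distribution.conv_op_pow_bdd[OF g1] bdd_borel_halfline)
     also have "... = (conv_op nu ^^ k) (gphi K z) 0 - (conv_op (gau 1) ^^ k) (gphi K z) 0"
      using K1 by (simp add: gphi_eq_conv_op conv_op_pow_commute[OF nu(1) gK bdd_borel_halfline] conv_op_pow_commute[OF g1 gK bdd_borel_halfline])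
     finally show ?thesis using st by simp
    qed
    have fin: "\<bar>F z - G z\<bar> <= 2 * \<Delta> + 3 * (1 / q) * (2 * sqrt K)" for z
    proof (rule smoothing_inequality[OF _ gau_tail _ mF _ _ _ lip sm])
     show "real_distribution (gau K)" using K1 by (intro real_distribution_gau) simp
     show "F : borel_measurable borel" by (rule borel_measurable_mono[OF mF])
     show "G : borel_measurable borel" by (rule borel_measurable_continuous_onI[OF cG])
     show "\<bar>F z - G z\<bar> <= 1" for z using F01[of z] G01[of z] by linarith
    qed (use K1 in auto)
    have q\<Delta>: "q * \<Delta> <= 60 * (e1 * n) + 15 * E + 15 * R + D / 6"
    proof -
     have "q * (60 * e1 * sqrt k) = 60 * (e1 * real k)" by (simp add: q_def)
     also have "... <= 60 * (e1 * n)" using less.prems e0 by (intro mult_left_mono) auto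
     finally have 1: "q * (60 * e1 * sqrt k) <= 60 * (e1 * n)" .
     have "q * (15 * e2 * (1 + ln k)) = 15 * (e2 * (q * (1 + ln k)))" by simp
     also have "... <= 15 * (e2 * (sqrt n * (1 + ln n)))"
      using less.prems k e0 q by (intro mult_left_mono mult_mono) auto
     finally have 2: "q * (15 * e2 * (1 + ln k)) <= 15 * E" by (simp add: E_def)
     have "q * ((r + 2) * (15 + nd4_L1 * D / sqrt K) / sqrt k) = R * (15 + nd4_L1 * D / s)"
      using q(1) by (simp add: q_def R_def sK)
     also have "... = 15 * R + (R * nd4_L1 / s) * D" by (simp add: algebra_simps)
     also have "R * nd4_L1 / s <= 1 / 6"
     proof -
      have "R * nd4_L1 * 6 <= s" using R V by (simp add: s_def algebra_simps)
      then show ?thesis using s1 by (simp add: divide_le_eq)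
     qed
     finally have 3: "q * ((r + 2) * (15 + nd4_L1 * D / sqrt K) / sqrt k) <= 15 * R + D / 6"
      using D0 by (simp add: mult_right_mono)
     show ?thesis unfolding \<Delta>_def distrib_left[of q] using 1 2 3 by linarith
    qed
    have "\<bar>F z - G z\<bar> <= D / sqrt (real k + 1)" for z
    proof -
     have "q * \<bar>F z - G z\<bar> <= q * (2 * \<Delta> + 3 * (1 / q) * (2 * sqrt K))"
      using fin q by (intro mult_left_mono) auto
     also have "... = 2 * (q * \<Delta>) + 6 * s" using q(1) by (simp add: sK algebra_simps)
     also have "... <= 2 * (60 * (e1 * n) + 15 * E + 15 * R + D / 6) + 6 * s" using q\<Delta> by simp
     also have "... = D / 3 + D / 3" unfolding D_def by simp
     finally have 1: "q * \<bar>F z - G z\<bar> <= 2 * D / 3" by simp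
     have "sqrt (real k + 1) <= 3/2 * q"
     proof (rule real_le_lsqrt)
      show "real k + 1 <= (3/2 * q)\<^sup>2" using k q(2) by (simp add: power2_eq_square)
     qed (use q in auto)
     then have "sqrt (real k + 1) * \<bar>F z - G z\<bar> <= 3/2 * q * \<bar>F z - G z\<bar>" by (intro mult_right_mono) auto
     also have "... <= 3/2 * (2 * D / 3)" using 1 by simp
     finally have "sqrt (real k + 1) * \<bar>F z - G z\<bar> <= D" by simp
     moreover have "0 < sqrt (real k + 1)" by (simp add: add_nonneg_pos)
     ultimately show ?thesis by (simp add: pos_le_divide_eq mult.commute)
    qed
    then show ?thesis using Fs[of _ 0] G[of _ 0] by simp
   qed
  qed
  then have "\<bar>(conv_op nu ^^ k) (indicator {..z}) 0 - (conv_op (gau 1) ^^ k) (indicator {..z}) 0\<bar> <= D / sqrt (real k + 1)"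
   by blast
  also have "... <= C * (1 + e1 * real n + E) / sqrt (real k + 1)"
   by (intro divide_right_mono DC) simp
  finally show "\<bar>(conv_op nu ^^ k) (indicator {..z}) 0 - (conv_op (gau 1) ^^ k) (indicator {..z}) 0\<bar>
    <= C * (1 + e1 * real n + e2 * (sqrt n * (1 + ln n))) / sqrt (real k + 1)" by (simp add: E_def)
 qed
qed

definition Phibar :: "real => real" where "Phibar u = 1 - Phi u"

lemma Phibar_bounds: "0 <= Phibar u" "Phibar u <= 1"
 using Phi_bounds[of u] by (auto simp: Phibar_def)

lemma Phibar_lower:
 assumes "0 <= u" shows "std_normal_density u * exp (-3/2) / (1 + u) <= Phibar u"
proof -
 define s where "s = 1 / (1 + u)"
 have s: "0 < s" "s <= 1" using assms by (auto simp: s_def)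
 have us: "u * s <= 1" using assms by (simp add: s_def divide_le_eq)
 have low: "std_normal_density u * exp (-3/2) <= std_normal_density t" if "t : {u..u+s}" for t
 proof -
  have "t\<^sup>2 <= (u + s)\<^sup>2" using that assms by (intro power_mono) auto
  also have "... = u\<^sup>2 + 2 * (u * s) + s * s" by (simp add: power2_eq_square algebra_simps)
  also have "... <= u\<^sup>2 + 3" using us mult_mono[of s 1 s 1] s by simp
  finally have "exp (- u\<^sup>2 / 2 + - (3/2)) <= exp (- t\<^sup>2 / 2)" by simp
  then have "exp (- u\<^sup>2 / 2) * exp (- (3/2)) <= exp (- t\<^sup>2 / 2)" unfolding exp_add .
  then show ?thesis unfolding std_normal_density_def by (simp add: divide_right_mono)
 qed
 have "\<exists>z>u. z < u + s & Phi (u + s) - Phi u = (u + s - u) * std_normal_density z"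
  using s by (intro MVT2 DERIV_Phi) auto
 then obtain z where z: "u < z" "z < u + s" "Phi (u + s) - Phi u = s * std_normal_density z" by auto
 have "s * (std_normal_density u * exp (-3/2)) <= s * std_normal_density z"
  using low[of z] z s by (intro mult_left_mono) auto
 also have "... <= Phibar u" using z Phi_bounds(2)[of "u + s"] by (simp add: Phibar_def)
 finally show ?thesis by (simp add: s_def)
qed

lemma Phibar_pos: "0 <= u ==> 0 < Phibar u"
proof -
 assume u: "0 <= u"
 have "0 < std_normal_density u * exp (-3/2) / (1 + u)"
  using u by (intro divide_pos_pos mult_pos_pos normal_density_pos) auto
 then show ?thesis using Phibar_lower[OF u] by linarith
qed

lemma Phibar_shift:
 assumes "0 <= u" "0 <= s"
 shows "Phibar (u + s) <= Phibar u" "Phibar u * (1 - exp (3/2) * (1 + u) * s) <= Phibar (u + s)"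
proof -
 have "\<exists>z. u <= z & z <= u + s & Phi (u + s) - Phi u = s * std_normal_density z"
 proof (cases "s = 0")
  case True then show ?thesis by (intro exI[of _ u]) auto
 next
  case False
  then have "\<exists>z>u. z < u + s & Phi (u + s) - Phi u = (u + s - u) * std_normal_density z"
   using assms by (intro MVT2 DERIV_Phi) auto
  then obtain z where "u < z" "z < u + s" "Phi (u + s) - Phi u = (u + s - u) * std_normal_density z" by blast
  then show ?thesis by (intro exI[of _ z]) auto
 qed
 then obtain z where z: "u <= z" "Phi (u + s) - Phi u = s * std_normal_density z" by blast
 have "0 <= s * std_normal_density z" using assms by simp
 then show "Phibar (u + s) <= Phibar u" using z by (simp add: Phibar_def)
 have "u\<^sup>2 <= z\<^sup>2" using z assms by (intro power_mono) auto
 then have "std_normal_density z <= std_normal_density u"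
  unfolding std_normal_density_def by (simp add: divide_right_mono)
 also have "std_normal_density u <= exp (3/2) * (1 + u) * Phibar u"
 proof -
  have "std_normal_density u * exp (-3/2) <= Phibar u * (1 + u)"
   using Phibar_lower[OF assms(1)] assms by (simp add: divide_le_eq)
  then have 1: "(std_normal_density u * exp (-3/2)) * exp (3/2) <= (Phibar u * (1 + u)) * exp (3/2)"
   by (rule mult_right_mono) simp
  have "exp (-3/2) * exp (3/2) = (1::real)" by (simp add: exp_add[symmetric])
  then have "(std_normal_density u * exp (-3/2)) * exp (3/2) = std_normal_density u" by (simp only: mult.assoc mult_1_right)
  with 1 show ?thesis by (simp only: mult_ac)
 qed
 finally have "s * std_normal_density z <= s * (exp (3/2) * (1 + u) * Phibar u)"
  using assms by (intro mult_left_mono) auto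
 then show "Phibar u * (1 - exp (3/2) * (1 + u) * s) <= Phibar (u + s)"
  using z unfolding Phibar_def by (simp add: algebra_simps)
qed

lemma conv_op_pow_tilt:
 assumes nu: "real_distribution nu" and g: "bdd_borel g"
  and tilt: "!!g x. bdd_borel g ==> conv_op kp (%x. exp (h * x) * g x) x = m * exp (h * x) * conv_op nu g (x + h)"
 shows "(conv_op kp ^^ k) (%x. exp (h * x) * g x) x = m ^ k * exp (h * x) * (conv_op nu ^^ k) g (x + real k * h)"
proof (induction k arbitrary: x)
 case (Suc k)
 define G where "G = (%x. (conv_op nu ^^ k) g (x + real k * h))"
 have b: "bdd_borel ((conv_op nu ^^ k) g)" by (rule real_distribution.conv_op_pow_bdd[OF nu g])
 obtain C where C: "!!x. \<bar>(conv_op nu ^^ k) g x\<bar> <= C" using b by (auto simp: bdd_borel_def)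
 have [measurable]: "(conv_op nu ^^ k) g : borel_measurable borel" using b by (rule bdd_borel_measurable)
 have bG: "bdd_borel G" unfolding G_def by (rule bdd_borelI[where C=C]) (use C in auto)
 have "(conv_op kp ^^ Suc k) (%x. exp (h * x) * g x) x = conv_op kp (%x. m ^ k * (exp (h * x) * G x)) x"
 proof -
  have "(conv_op kp ^^ k) (%x. exp (h * x) * g x) = (%x. m ^ k * (exp (h * x) * G x))"
   by (rule ext) (simp add: Suc.IH G_def)
  then show ?thesis by simp
 qed
 also have "... = m ^ k * (m * exp (h * x) * conv_op nu G (x + h))" by (simp only: conv_op_cmult tilt[OF bG])
 also have "conv_op nu G (x + h) = conv_op nu ((conv_op nu ^^ k) g) (x + h + real k * h)"
  unfolding G_def by (rule conv_op_shift)
 finally show ?case by (simp add: algebra_simps)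
qed simp

lemma gau1_tilt:
 assumes [measurable]: "g : borel_measurable borel"
 shows "conv_op (gau 1) (%x. exp (h * x) * g x) x = exp (h\<^sup>2 / 2) * exp (h * x) * conv_op (gau 1) g (x + h)"
proof -
 have "conv_op (gau 1) (%x. exp (h * x) * g x) x = (LINT y|lborel. std_normal_density y * (exp (h * (x + y)) * g (x + y)))"
  unfolding conv_op_def by (subst integral_gau) auto
 also have "... = (LINT y|lborel. std_normal_density (h + y) * (exp (h * (x + (h + y))) * g (x + (h + y))))"
  by (subst lborel_integral_real_affine[where c=1 and t=h]) auto
 also have "... = (LINT y|lborel. exp (h\<^sup>2 / 2) * exp (h * x) * (std_normal_density y * g (x + h + y)))"
 proof (rule Bochner_Integration.integral_cong)
  fix y
  have "exp (- (h + y)\<^sup>2 / 2) * exp (h * (x + (h + y))) = exp (h\<^sup>2 / 2) * exp (h * x) * exp (- y\<^sup>2 / 2)"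
   unfolding exp_add[symmetric] by (rule arg_cong[where f=exp]) (simp add: power2_eq_square field_simps)
  then have "std_normal_density (h + y) * exp (h * (x + (h + y))) = exp (h\<^sup>2 / 2) * exp (h * x) * std_normal_density y"
   unfolding std_normal_density_def by (simp add: field_simps)
  then show "std_normal_density (h + y) * (exp (h * (x + (h + y))) * g (x + (h + y))) =
   exp (h\<^sup>2 / 2) * exp (h * x) * (std_normal_density y * g (x + h + y))"
   by (simp add: add_ac mult.assoc[symmetric])
 qed simp
 also have "... = exp (h\<^sup>2 / 2) * exp (h * x) * (LINT y|lborel. std_normal_density y * g (x + h + y))"
  by (simp only: integral_mult_right_zero)
 also have "(LINT y|lborel. std_normal_density y * g (x + h + y)) = conv_op (gau 1) g (x + h)"
  unfolding conv_op_def by (subst integral_gau) auto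
 finally show ?thesis .
qed

definition tilted :: "real measure => real => real measure" where
 "tilted kp h = distr (density kp (%y. exp (h * y) / (LINT y|kp. exp (h * y)))) borel (%y. y - h)"

lemma tilted_props:
 assumes kp: "real_distribution kp" and i: "integrable kp (%y. exp (h * y))"
 defines "m \<equiv> (LINT y|kp. exp (h * y))"
 shows "0 < m" "real_distribution (tilted kp h)"
  and "!!f. f : borel_measurable borel ==> (\<integral>y. f y \<partial>tilted kp h) = (LINT y|kp. exp (h * y) * f (y - h)) / m"
  and "!!f. f : borel_measurable borel ==> integrable kp (%y. exp (h * y) * f (y - h)) ==> integrable (tilted kp h) f"
proof -
 interpret real_distribution kp by fact
 show m: "0 < m"
 proof -
  have "m ~= 0"
  proof
   assume "m = 0"
   then have "AE y in kp. exp (h * y) = 0" using integral_nonneg_eq_0_iff_AE[OF i] by (simp add: m_def)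
   then have "AE y in kp. False" by eventually_elim simp
   then show False by simp
  qed
  moreover have "0 <= m" unfolding m_def by simp
  ultimately show ?thesis by simp
 qed
 have "(\<integral>\<^sup>+y. ennreal (exp (h * y) / m) \<partial>kp) = ennreal (LINT y|kp. exp (h * y) / m)"
  using i m by (intro nn_integral_eq_integral) auto
 also have "(LINT y|kp. exp (h * y) / m) = 1" using m by (simp add: m_def)
 finally have 1: "(\<integral>\<^sup>+y. ennreal (exp (h * y) / m) \<partial>kp) = 1" by simp
 have "prob_space (density kp (%y. ennreal (exp (h * y) / m)))"
 proof (rule prob_spaceI)
  have "emeasure (density kp (%y. ennreal (exp (h * y) / m))) (space kp) = (\<integral>\<^sup>+y. ennreal (exp (h * y) / m) * indicator (space kp) y \<partial>kp)"
   by (rule emeasure_density) auto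
  also have "... = (\<integral>\<^sup>+y. ennreal (exp (h * y) / m) \<partial>kp)" by (rule nn_integral_cong) simp
  finally show "emeasure (density kp (%y. ennreal (exp (h * y) / m))) (space (density kp (%y. ennreal (exp (h * y) / m)))) = 1"
   unfolding 1 space_density .
 qed
 then show "real_distribution (tilted kp h)"
  unfolding tilted_def m_def[symmetric] by (rule prob_space.real_distribution_distr) auto
 fix f :: "real => real" assume [measurable]: "f : borel_measurable borel"
 show "(\<integral>y. f y \<partial>tilted kp h) = (LINT y|kp. exp (h * y) * f (y - h)) / m"
  unfolding tilted_def m_def[symmetric] using m by (simp add: integral_distr integral_density)
 assume "integrable kp (%y. exp (h * y) * f (y - h))"
 then show "integrable (tilted kp h) f"
  unfolding tilted_def m_def[symmetric] using m by (simp add: integrable_distr_eq integrable_density)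
qed

lemma exp_taylor_bounds:
 fixes t :: real assumes "\<bar>t\<bar> <= U"
 shows "exp t <= exp U" "\<bar>exp t - 1\<bar> <= exp U * \<bar>t\<bar>" "\<bar>exp t - 1 - t\<bar> <= exp U * t\<^sup>2" "\<bar>exp t - 1 - t - t\<^sup>2 / 2\<bar> <= exp U * \<bar>t\<bar> ^ 3"
proof -
 show "exp t <= exp U" using assms by simp
 have e: "exp s <= exp U" if "\<bar>s\<bar> <= \<bar>t\<bar>" for s using that assms by simp
 obtain a where a: "\<bar>a\<bar> <= \<bar>t\<bar>" "exp t = (\<Sum>m<1. t ^ m / fact m) + exp a / fact 1 * t ^ 1" using Maclaurin_exp_le by blast
 then have "exp t - 1 = exp a * t" by simp
 then show "\<bar>exp t - 1\<bar> <= exp U * \<bar>t\<bar>" using e[OF a(1)] by (simp add: abs_mult mult_right_mono)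
 obtain b where b: "\<bar>b\<bar> <= \<bar>t\<bar>" "exp t = (\<Sum>m<2. t ^ m / fact m) + exp b / fact 2 * t ^ 2" using Maclaurin_exp_le by blast
 then have "exp t - 1 - t = exp b / 2 * t\<^sup>2" by (simp add: numeral_2_eq_2)
 moreover have "exp b / 2 * t\<^sup>2 <= exp U * t\<^sup>2"
 proof (rule mult_right_mono)
  show "exp b / 2 <= exp U" using e[OF b(1)] exp_gt_zero[of b] by linarith
 qed simp
 moreover have "0 <= exp b / 2 * t\<^sup>2" by simp
 ultimately show "\<bar>exp t - 1 - t\<bar> <= exp U * t\<^sup>2" by linarith
 obtain c where c: "\<bar>c\<bar> <= \<bar>t\<bar>" "exp t = (\<Sum>m<3. t ^ m / fact m) + exp c / fact 3 * t ^ 3" using Maclaurin_exp_le by blast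
 then have "exp t - 1 - t - t\<^sup>2 / 2 = exp c / 6 * t ^ 3" by (simp add: numeral_3_eq_3 numeral_2_eq_2 power2_eq_square)
 then have "\<bar>exp t - 1 - t - t\<^sup>2 / 2\<bar> = exp c / 6 * \<bar>t\<bar> ^ 3" unfolding \<open>exp t - 1 - t - t\<^sup>2 / 2 = _\<close> by (simp add: abs_mult power_abs)
 also have "... <= exp U * \<bar>t\<bar> ^ 3" 
 proof (rule mult_right_mono)
  show "exp c / 6 <= exp U" using e[OF c(1)] exp_gt_zero[of c] by linarith
 qed simp
 finally show "\<bar>exp t - 1 - t - t\<^sup>2 / 2\<bar> <= exp U * \<bar>t\<bar> ^ 3" .
qed

lemma (in finite_measure) abs_integral_le_AE:
 fixes f g :: "'a => real"
 assumes f: "f : borel_measurable M" and g: "integrable M g" and le: "AE x in M. \<bar>f x\<bar> <= g x"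
 shows "integrable M f" "\<bar>\<integral>x. f x \<partial>M\<bar> <= (LINT x|M. g x)"
proof -
 show i: "integrable M f"
 proof (rule Bochner_Integration.integrable_bound[OF g f])
  show "AE x in M. norm (f x) <= norm (g x)" using le by eventually_elim simp
 qed
 have "\<bar>\<integral>x. f x \<partial>M\<bar> <= (LINT x|M. \<bar>f x\<bar>)" by (rule integral_abs_bound)
 also have "... <= (LINT x|M. g x)" by (rule integral_mono_AE) (use i g le in auto)
 finally show "\<bar>\<integral>x. f x \<partial>M\<bar> <= (LINT x|M. g x)" .
qed

definition near_std :: "real => real => real measure => bool" where
 "near_std M zt kp \<longleftrightarrow> real_distribution kp & (AE y in kp. \<bar>y\<bar> <= 1 / zt) & \<bar>\<integral>y. y \<partial>kp\<bar> <= M * zt\<^sup>2 \<and>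
  \<bar>(LINT y|kp. y\<^sup>2) - 1\<bar> <= M * zt & (LINT y|kp. \<bar>y\<bar> ^ 3) <= M"

lemma exp_moments:
 assumes kp: "near_std M zt kp" and zt: "0 < zt" and h: "0 <= h" "h <= U * zt"
 defines "E \<equiv> exp U"
 shows "integrable kp (%y. exp (h * y))" "integrable kp (%y. y * exp (h * y))"
  "integrable kp (%y. y\<^sup>2 * exp (h * y))" "integrable kp (%y. \<bar>y\<bar> ^ 3 * exp (h * y))"
  "\<bar>(LINT y|kp. exp (h * y)) - 1 - h\<^sup>2 / 2\<bar> <= h * (M * zt\<^sup>2) + h\<^sup>2 / 2 * (M * zt) + h ^ 3 * E * M"
  "\<bar>(LINT y|kp. y * exp (h * y)) - h\<bar> <= M * zt\<^sup>2 + h * (M * zt) + h\<^sup>2 * E * M"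
  "\<bar>(LINT y|kp. y\<^sup>2 * exp (h * y)) - 1\<bar> <= M * zt + h * E * M"
  "(LINT y|kp. \<bar>y\<bar> ^ 3 * exp (h * y)) <= E * M"
proof -
 interpret real_distribution kp using kp by (simp add: near_std_def)
 have ae: "AE y in kp. \<bar>y\<bar> <= 1 / zt" and m1: "\<bar>\<integral>y. y \<partial>kp\<bar> <= M * zt\<^sup>2"
  and m2: "\<bar>(LINT y|kp. y\<^sup>2) - 1\<bar> <= M * zt" and m3: "(LINT y|kp. \<bar>y\<bar> ^ 3) <= M"
  using kp by (auto simp: near_std_def)
 have aeU: "AE y in kp. \<bar>h * y\<bar> <= U"
  using ae
 proof eventually_elim
  case (elim y)
  have "h * \<bar>y\<bar> <= (U * zt) * (1 / zt)" using elim h by (intro mult_mono) auto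
  then show ?case using zt h by (simp add: abs_mult)
 qed
 have E0: "0 < E" by (simp add: E_def)
 have pw: "integrable kp (%y. \<bar>y\<bar> ^ j * c)" for j c
 proof (rule integrable_const_bound[where B="(1/zt) ^ j * \<bar>c\<bar>"])
  show "AE y in kp. norm (\<bar>y\<bar> ^ j * c) <= (1/zt) ^ j * \<bar>c\<bar>"
   using ae
  proof eventually_elim
   case (elim y)
   have "\<bar>y\<bar> ^ j * \<bar>c\<bar> <= (1/zt) ^ j * \<bar>c\<bar>" using elim by (intro mult_right_mono power_mono) auto
   then show ?case by (simp add: abs_mult)
  qed
 qed auto
 have i3: "integrable kp (%y. \<bar>y\<bar> ^ 3)" using pw[of 3 1] by simp
 note i12 = integrable_le_cube[OF real_distribution_axioms i3]
 have ex: "integrable kp (%y. f y * exp (h * y))" if [measurable]: "f : borel_measurable borel" and f: "!!y. \<bar>f y\<bar> <= \<bar>y\<bar> ^ j" for f j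
 proof (rule abs_integral_le_AE(1)[OF _ pw[of j E]])
  show "AE y in kp. \<bar>f y * exp (h * y)\<bar> <= \<bar>y\<bar> ^ j * E"
   using aeU
  proof eventually_elim
   case (elim y)
   then have "exp (h * y) <= E" by (simp add: E_def)
   then have "\<bar>f y\<bar> * exp (h * y) <= \<bar>y\<bar> ^ j * E" by (intro mult_mono f) auto
   then show ?case by (simp add: abs_mult)
  qed
 qed measurable
 show I0: "integrable kp (%y. exp (h * y))" using ex[of "%y. 1" 0] by simp
 show I1: "integrable kp (%y. y * exp (h * y))" using ex[of "%y. y" 1] by simp
 show I2: "integrable kp (%y. y\<^sup>2 * exp (h * y))" using ex[of "%y. y\<^sup>2" 2] by simp
 show I3: "integrable kp (%y. \<bar>y\<bar> ^ 3 * exp (h * y))" using ex[of "%y. \<bar>y\<bar> ^ 3" 3] by simp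
 have i3E: "integrable kp (%y. c * \<bar>y\<bar> ^ 3)" for c using i3 by simp
 have cm: "(LINT y|kp. c * \<bar>y\<bar> ^ 3) <= c * M" if "0 <= c" for c using mult_left_mono[OF m3 that] by simp
 have bd: "\<bar>\<integral>y. f y \<partial>kp\<bar> <= c * M"
  if "f : borel_measurable borel" "0 <= c" and le: "!!y. \<bar>h * y\<bar> <= U ==> \<bar>f y\<bar> <= c * \<bar>y\<bar> ^ 3" for f c
 proof -
  have "\<bar>\<integral>y. f y \<partial>kp\<bar> <= (LINT y|kp. c * \<bar>y\<bar> ^ 3)"
  proof (rule abs_integral_le_AE(2)[OF _ i3E])
   show "AE y in kp. \<bar>f y\<bar> <= c * \<bar>y\<bar> ^ 3" using aeU by eventually_elim (rule le)
  qed (use that in auto)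
  then show ?thesis using cm[OF that(2)] by linarith
 qed
 have "\<bar>\<integral>y. exp (h * y) - 1 - h * y - h\<^sup>2 / 2 * y\<^sup>2 \<partial>kp\<bar> <= (h ^ 3 * E) * M"
 proof (rule bd)
  fix y assume "\<bar>h * y\<bar> <= U"
  from exp_taylor_bounds(4)[OF this]
  have "\<bar>exp (h * y) - 1 - h * y - (h * y)\<^sup>2 / 2\<bar> <= E * \<bar>h * y\<bar> ^ 3" by (simp only: E_def)
  then show "\<bar>exp (h * y) - 1 - h * y - h\<^sup>2 / 2 * y\<^sup>2\<bar> <= h ^ 3 * E * \<bar>y\<bar> ^ 3"
   using h by (simp add: power_mult_distrib abs_mult mult_ac)
 qed (use h E0 in auto)
 moreover have "(LINT y|kp. exp (h * y) - 1 - h * y - h\<^sup>2 / 2 * y\<^sup>2) = (LINT y|kp. exp (h * y)) - 1 - h * (LINT y|kp. y) - h\<^sup>2 / 2 * (LINT y|kp. y\<^sup>2)"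
  using I0 i12 integrable_mult_right[OF i12(1), of h] integrable_mult_right[OF i12(2), of "h\<^sup>2/2"]
  by (simp only: Bochner_Integration.integral_diff Bochner_Integration.integrable_diff integral_mult_right_zero lebesgue_integral_const integrable_const) simp
 moreover have "\<bar>h * (LINT y|kp. y)\<bar> <= h * (M * zt\<^sup>2)" using mult_left_mono[OF m1 h(1)] h by (simp add: abs_mult)
 moreover have "\<bar>h\<^sup>2 / 2 * (LINT y|kp. y\<^sup>2) - h\<^sup>2 / 2\<bar> <= h\<^sup>2 / 2 * (M * zt)"
 proof -
  have "h\<^sup>2 / 2 * (LINT y|kp. y\<^sup>2) - h\<^sup>2 / 2 = h\<^sup>2 / 2 * ((LINT y|kp. y\<^sup>2) - 1)" by (simp add: right_diff_distrib)
  then show ?thesis using mult_left_mono[OF m2, of "h\<^sup>2/2"] by (simp only: abs_mult) simp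
 qed
 ultimately show "\<bar>(LINT y|kp. exp (h * y)) - 1 - h\<^sup>2 / 2\<bar> <= h * (M * zt\<^sup>2) + h\<^sup>2 / 2 * (M * zt) + h ^ 3 * E * M" by linarith
 have "\<bar>\<integral>y. y * exp (h * y) - y - h * y\<^sup>2 \<partial>kp\<bar> <= (h\<^sup>2 * E) * M"
 proof (rule bd)
  fix y assume "\<bar>h * y\<bar> <= U"
  from exp_taylor_bounds(3)[OF this] have "\<bar>exp (h * y) - 1 - h * y\<bar> <= E * (h * y)\<^sup>2" by (simp only: E_def)
  then have "\<bar>y\<bar> * \<bar>exp (h * y) - 1 - h * y\<bar> <= \<bar>y\<bar> * (E * (h * y)\<^sup>2)" by (rule mult_left_mono) simp
  also have "\<bar>y\<bar> * (E * (h * y)\<^sup>2) = h\<^sup>2 * E * \<bar>y\<bar> ^ 3"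
  proof -
   have "\<bar>y\<bar> ^ 3 = \<bar>y\<bar> * y\<^sup>2" by (simp add: power3_eq_cube power2_eq_square abs_mult_self_eq mult.assoc)
   then show ?thesis by (simp add: power_mult_distrib mult_ac)
  qed
  finally show "\<bar>y * exp (h * y) - y - h * y\<^sup>2\<bar> <= h\<^sup>2 * E * \<bar>y\<bar> ^ 3"
   unfolding abs_mult[symmetric] by (simp add: algebra_simps power2_eq_square)
 qed (use h E0 in auto)
 moreover have "(LINT y|kp. y * exp (h * y) - y - h * y\<^sup>2) = (LINT y|kp. y * exp (h * y)) - (LINT y|kp. y) - h * (LINT y|kp. y\<^sup>2)"
  using I1 i12 integrable_mult_right[OF i12(2), of h]
  by (simp only: Bochner_Integration.integral_diff Bochner_Integration.integrable_diff integral_mult_right_zero)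
 moreover have "\<bar>h * (LINT y|kp. y\<^sup>2) - h\<bar> <= h * (M * zt)"
 proof -
  have "h * (LINT y|kp. y\<^sup>2) - h = h * ((LINT y|kp. y\<^sup>2) - 1)" by (simp add: right_diff_distrib)
  then show ?thesis using mult_left_mono[OF m2, of h] h by (simp only: abs_mult) simp
 qed
 ultimately show "\<bar>(LINT y|kp. y * exp (h * y)) - h\<bar> <= M * zt\<^sup>2 + h * (M * zt) + h\<^sup>2 * E * M" using m1 by linarith
 have "\<bar>\<integral>y. y\<^sup>2 * exp (h * y) - y\<^sup>2 \<partial>kp\<bar> <= (h * E) * M"
 proof (rule bd)
  fix y assume "\<bar>h * y\<bar> <= U"
  from exp_taylor_bounds(2)[OF this] have "\<bar>exp (h * y) - 1\<bar> <= E * \<bar>h * y\<bar>" by (simp only: E_def)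
  then have "y\<^sup>2 * \<bar>exp (h * y) - 1\<bar> <= y\<^sup>2 * (E * \<bar>h * y\<bar>)" by (rule mult_left_mono) simp
  also have "y\<^sup>2 * (E * \<bar>h * y\<bar>) = h * E * \<bar>y\<bar> ^ 3"
  proof -
   have "\<bar>y\<bar> ^ 3 = \<bar>y\<bar> * y\<^sup>2" by (simp add: power3_eq_cube power2_eq_square abs_mult_self_eq mult.assoc)
   then show ?thesis using h by (simp add: abs_mult mult_ac)
  qed
  also have "y\<^sup>2 * \<bar>exp (h * y) - 1\<bar> = \<bar>y\<^sup>2 * exp (h * y) - y\<^sup>2\<bar>"
  proof -
   have "y\<^sup>2 * exp (h * y) - y\<^sup>2 = y\<^sup>2 * (exp (h * y) - 1)" by (simp add: right_diff_distrib)
   then show ?thesis by (simp only: abs_mult abs_power2)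
  qed
  finally show "\<bar>y\<^sup>2 * exp (h * y) - y\<^sup>2\<bar> <= h * E * \<bar>y\<bar> ^ 3" .
 qed (use h E0 in auto)
 moreover have "(LINT y|kp. y\<^sup>2 * exp (h * y) - y\<^sup>2) = (LINT y|kp. y\<^sup>2 * exp (h * y)) - (LINT y|kp. y\<^sup>2)"
  using I2 i12 by (simp only: Bochner_Integration.integral_diff)
 ultimately show "\<bar>(LINT y|kp. y\<^sup>2 * exp (h * y)) - 1\<bar> <= M * zt + h * E * M" using m2 by linarith
 have "\<bar>\<integral>y. \<bar>y\<bar> ^ 3 * exp (h * y) \<partial>kp\<bar> <= E * M"
 proof (rule bd)
  fix y assume "\<bar>h * y\<bar> <= U"
  then have "exp (h * y) <= E" by (simp add: E_def)
  then have "\<bar>y\<bar> ^ 3 * exp (h * y) <= \<bar>y\<bar> ^ 3 * E" by (intro mult_left_mono) auto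
  then show "\<bar>\<bar>y\<bar> ^ 3 * exp (h * y)\<bar> <= E * \<bar>y\<bar> ^ 3" by (simp add: abs_mult mult.commute)
 qed (use E0 in auto)
 then show "(LINT y|kp. \<bar>y\<bar> ^ 3 * exp (h * y)) <= E * M" by linarith
qed

lemma tilted_moments:
 fixes M U :: real
 assumes M: "0 <= M" and U: "0 <= U"
 obtains c where "1 <= c" "!!kp zt h. near_std M zt kp ==> 0 < zt ==> c * zt <= 1 ==> 0 <= h ==> h <= U * zt ==>
  integrable kp (%y. exp (h * y)) & \<bar>(LINT y|kp. exp (h * y)) - 1 - h\<^sup>2 / 2\<bar> <= c * zt ^ 3 \<and>
  integrable (tilted kp h) (%y. \<bar>y\<bar> ^ 3) & \<bar>\<integral>y. y \<partial>tilted kp h\<bar> <= c * zt\<^sup>2 \<and>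
  \<bar>(\<integral>y. y\<^sup>2 \<partial>tilted kp h) - 1\<bar> <= c * zt & (\<integral>y. \<bar>y\<bar> ^ 3 \<partial>tilted kp h) <= c"
proof -
 define E where "E = exp U"
 have E: "0 < E" by (simp add: E_def)
 define c1 where "c1 = U * M + U\<^sup>2 * M + U ^ 3 * E * M"
 define c2 where "c2 = M + U * M + U\<^sup>2 * E * M"
 define c3 where "c3 = M + U * E * M"
 define c5 where "c5 = U\<^sup>2 + c1"
 define c where "c = 1 + c1 + 2 * c5 + 2 * (c2 + U * c5) + 2 * (c3 + 2 * U * (U + c2) + 2 * U\<^sup>2 + c5) + (8 * E * M + 16 * U ^ 3)"
 have nn: "0 <= c1" "0 <= c2" "0 <= c3" "0 <= c5" using M U E by (auto simp: c1_def c2_def c3_def c5_def intro!: add_nonneg_nonneg mult_nonneg_nonneg)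
 have nn2: "0 <= U * c5" "0 <= U * (U + c2)" "0 <= U\<^sup>2" "0 <= E * M" "0 <= U ^ 3" using nn M U E by auto
 define p2 p3 p4 where "p2 = 2 * (c2 + U * c5)" and "p3 = 2 * (c3 + 2 * U * (U + c2) + 2 * U\<^sup>2 + c5)" and "p4 = 8 * E * M + 16 * U ^ 3"
 have pn: "0 <= p2" "0 <= p3" "0 <= p4"
  using nn nn2 M U E unfolding p2_def p3_def p4_def by (auto intro!: add_nonneg_nonneg mult_nonneg_nonneg)
 have cb: "1 <= c" "c1 <= c" "2 * c5 <= c" "2 * (c2 + U * c5) <= c" "2 * (c3 + 2 * U * (U + c2) + 2 * U\<^sup>2 + c5) <= c" "8 * E * M + 16 * U ^ 3 <= c"
  using nn pn unfolding c_def p2_def[symmetric] p3_def[symmetric] p4_def[symmetric] by linarith+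
 show ?thesis
 proof (rule that[OF cb(1)])
  fix kp zt h assume kp: "near_std M zt kp" and zt: "0 < zt" "c * zt <= 1" and h: "0 <= h" "h <= U * zt"
  have rd: "real_distribution kp" using kp by (simp add: near_std_def)
  interpret real_distribution kp by (rule rd)
  have "1 * zt <= c * zt" using cb zt by (intro mult_right_mono) auto
  then have zt1: "zt <= 1" using zt by linarith
  have z32: "zt ^ 3 <= zt\<^sup>2" "zt\<^sup>2 <= zt" using zt zt1 power_decreasing[of 2 3 zt] power_decreasing[of 1 2 zt] by auto
  note em = exp_moments[OF kp zt(1) h, folded E_def]
  define m where "m = (LINT y|kp. exp (h * y))"
  define n1 where "n1 = (LINT y|kp. y * exp (h * y))"
  define n2 where "n2 = (LINT y|kp. y\<^sup>2 * exp (h * y))"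
  have h2: "h\<^sup>2 <= U\<^sup>2 * zt\<^sup>2" using power_mono[OF h(2) h(1), of 2] by (simp add: power_mult_distrib)
  have h3: "h ^ 3 <= U ^ 3 * zt ^ 3" using power_mono[OF h(2) h(1), of 3] by (simp add: power_mult_distrib)
  have b1: "\<bar>m - 1 - h\<^sup>2 / 2\<bar> <= c1 * zt ^ 3"
  proof -
   have "h * (M * zt\<^sup>2) <= (U * zt) * (M * zt\<^sup>2)" using h M by (intro mult_right_mono) auto
   moreover have "h\<^sup>2 / 2 * (M * zt) <= (U\<^sup>2 * zt\<^sup>2) * (M * zt)" 
   proof (rule mult_right_mono)
    show "h\<^sup>2 / 2 <= U\<^sup>2 * zt\<^sup>2" using h2 zero_le_power2[of h] by linarith
   qed (use M zt in auto)
   moreover have "h ^ 3 * E * M <= (U ^ 3 * zt ^ 3) * E * M" using h3 M E by (intro mult_right_mono) auto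
   ultimately have "h * (M * zt\<^sup>2) + h\<^sup>2 / 2 * (M * zt) + h ^ 3 * E * M <= (U * zt) * (M * zt\<^sup>2) + (U\<^sup>2 * zt\<^sup>2) * (M * zt) + (U ^ 3 * zt ^ 3) * E * M" by linarith
   also have "... = c1 * zt ^ 3" by (simp add: c1_def power2_eq_square power3_eq_cube algebra_simps)
   finally show ?thesis using em(5) unfolding m_def by linarith
  qed
  have b2: "\<bar>n1 - h\<bar> <= c2 * zt\<^sup>2"
  proof -
   have "h * (M * zt) <= (U * zt) * (M * zt)" using h M zt by (intro mult_right_mono) auto
   moreover have "h\<^sup>2 * E * M <= (U\<^sup>2 * zt\<^sup>2) * E * M" using h2 M E by (intro mult_right_mono) auto
   ultimately have "M * zt\<^sup>2 + h * (M * zt) + h\<^sup>2 * E * M <= M * zt\<^sup>2 + (U * zt) * (M * zt) + (U\<^sup>2 * zt\<^sup>2) * E * M" by linarith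
   also have "... = c2 * zt\<^sup>2" by (simp add: c2_def power2_eq_square algebra_simps)
   finally show ?thesis using em(6) unfolding n1_def by linarith
  qed
  have b3: "\<bar>n2 - 1\<bar> <= c3 * zt"
  proof -
   have "h * E * M <= (U * zt) * E * M" using h M E by (intro mult_right_mono) auto
   then have "M * zt + h * E * M <= M * zt + (U * zt) * E * M" by linarith
   also have "... = c3 * zt" by (simp add: c3_def algebra_simps)
   finally show ?thesis using em(7) unfolding n2_def by linarith
  qed
  have b5: "\<bar>m - 1\<bar> <= c5 * zt\<^sup>2"
  proof -
   have "c1 * zt ^ 3 <= c1 * zt\<^sup>2" using z32 nn by (intro mult_left_mono) auto
   moreover have "c5 * zt\<^sup>2 = U\<^sup>2 * zt\<^sup>2 + c1 * zt\<^sup>2" by (simp add: c5_def algebra_simps)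
   ultimately show ?thesis using b1 h2 zero_le_power2[of h] by linarith
  qed
  have "c5 * zt\<^sup>2 <= 1/2"
  proof -
   have "2 * (c5 * zt\<^sup>2) <= 2 * (c5 * zt)" using z32 nn by (intro mult_left_mono) auto
   also have "... = (2 * c5) * zt" by simp
   also have "... <= c * zt" using cb(3) zt by (intro mult_right_mono) auto
   finally show ?thesis using zt by linarith
  qed
  then have mh: "1/2 <= m" "m <= 2" using b5 by linarith+
  note tp = tilted_props[OF rd em(1), folded m_def]
  have dv: "\<bar>x / m\<bar> <= 2 * y" if "\<bar>x\<bar> <= y" for x y
  proof -
   have "\<bar>x\<bar> / m <= y / (1/2)" using that mh by (intro frac_le) auto
   then show ?thesis using mh by (simp add: abs_divide)
  qed
  have t1: "\<bar>\<integral>y. y \<partial>tilted kp h\<bar> <= c * zt\<^sup>2"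
  proof -
   have "(\<integral>y. y \<partial>tilted kp h) = (LINT y|kp. exp (h * y) * (y - h)) / m" by (rule tp(3)) simp
   also have "(LINT y|kp. exp (h * y) * (y - h)) = (LINT y|kp. y * exp (h * y) - h * exp (h * y))"
    by (rule Bochner_Integration.integral_cong) (auto simp: algebra_simps)
   also have "... = n1 - h * m" unfolding n1_def m_def using em(1,2) by simp
   finally have "(\<integral>y. y \<partial>tilted kp h) = (n1 - h * m) / m" .
   moreover have "\<bar>n1 - h * m\<bar> <= (c2 + U * c5) * zt\<^sup>2"
   proof -
    have "\<bar>h * (m - 1)\<bar> <= U * (c5 * zt\<^sup>2)" unfolding abs_mult
    proof (rule mult_mono[OF _ b5 U])
     show "\<bar>h\<bar> <= U" using h zt1 U mult_left_mono[OF zt1 U] by simp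
    qed simp
    moreover have "n1 - h * m = (n1 - h) - h * (m - 1)" by (simp add: algebra_simps)
    ultimately show ?thesis using b2 unfolding distrib_right by linarith
   qed
   ultimately have "\<bar>\<integral>y. y \<partial>tilted kp h\<bar> <= 2 * ((c2 + U * c5) * zt\<^sup>2)" using dv by simp
   also have "... = (2 * (c2 + U * c5)) * zt\<^sup>2" by simp
   also have "... <= c * zt\<^sup>2" using cb(4) by (intro mult_right_mono) auto
   finally show ?thesis .
  qed
  have t2: "\<bar>(\<integral>y. y\<^sup>2 \<partial>tilted kp h) - 1\<bar> <= c * zt"
  proof -
   have "(\<integral>y. y\<^sup>2 \<partial>tilted kp h) = (LINT y|kp. exp (h * y) * (y - h)\<^sup>2) / m" by (rule tp(3)) simp
   also have "(LINT y|kp. exp (h * y) * (y - h)\<^sup>2) = (LINT y|kp. y\<^sup>2 * exp (h * y) - (2 * h) * (y * exp (h * y)) + h\<^sup>2 * exp (h * y))"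
    by (rule Bochner_Integration.integral_cong) (auto simp: algebra_simps power2_eq_square)
   also have "... = n2 - (2 * h) * n1 + h\<^sup>2 * m" unfolding n1_def n2_def m_def using em(1,2,3) by simp
   finally have eq: "(\<integral>y. y\<^sup>2 \<partial>tilted kp h) - 1 = (n2 - (2 * h) * n1 + h\<^sup>2 * m - m) / m" using mh by (simp add: diff_divide_distrib)
   have "\<bar>n2 - (2 * h) * n1 + h\<^sup>2 * m - m\<bar> <= (c3 + 2 * U * (U + c2) + 2 * U\<^sup>2 + c5) * zt"
   proof -
    have n1b: "\<bar>n1\<bar> <= U + c2"
    proof -
     have "c2 * zt\<^sup>2 <= c2 * 1" using z32 zt1 nn by (intro mult_left_mono) auto
     moreover have "h <= U" using h zt1 U mult_left_mono[OF zt1 U] by simp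
     ultimately show ?thesis using b2 h by linarith
    qed
    have "\<bar>(2 * h) * n1\<bar> <= (2 * (U * zt)) * (U + c2)" unfolding abs_mult
     using h n1b U zt by (intro mult_mono) auto
    moreover have "h\<^sup>2 * m <= (U\<^sup>2 * zt) * 2"
    proof (rule mult_mono[OF _ mh(2)])
     show "h\<^sup>2 <= U\<^sup>2 * zt" using h2 mult_left_mono[OF z32(2), of "U\<^sup>2"] by simp
    qed (use mh zt in auto)
    moreover have "0 <= h\<^sup>2 * m" using mh by simp
    moreover have "\<bar>m - 1\<bar> <= c5 * zt" using b5 mult_left_mono[OF z32(2), of c5] nn by linarith
    moreover have "(c3 + 2 * U * (U + c2) + 2 * U\<^sup>2 + c5) * zt = c3 * zt + (2 * (U * zt)) * (U + c2) + (U\<^sup>2 * zt) * 2 + c5 * zt" by (simp add: algebra_simps)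
    ultimately show ?thesis using b3 by linarith
   qed
   from dv[OF this] have "\<bar>(\<integral>y. y\<^sup>2 \<partial>tilted kp h) - 1\<bar> <= (2 * (c3 + 2 * U * (U + c2) + 2 * U\<^sup>2 + c5)) * zt" unfolding eq by (simp only: mult.assoc)
   also have "... <= c * zt" using cb(5) zt by (intro mult_right_mono) auto
   finally show ?thesis .
  qed
  have cube: "\<bar>y - h\<bar> ^ 3 <= 4 * (\<bar>y\<bar> ^ 3 + h ^ 3)" for y
  proof -
   define a where "a = \<bar>y\<bar>"
   have a: "0 <= a" by (simp add: a_def)
   have "\<bar>y - h\<bar> ^ 3 <= (a + h) ^ 3" using h unfolding a_def by (intro power_mono) auto
   also have "... <= 4 * (a ^ 3 + h ^ 3)"
   proof -
    have "4 * (a ^ 3 + h ^ 3) - (a + h) ^ 3 = 3 * ((a + h) * (a - h)\<^sup>2)" by (simp add: power3_eq_cube power2_eq_square algebra_simps)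
    moreover have "0 <= (a + h) * (a - h)\<^sup>2" using a h by simp
    ultimately show ?thesis by linarith
   qed
   finally show ?thesis by (simp add: a_def)
  qed
  have ig: "integrable kp (%y. 4 * (\<bar>y\<bar> ^ 3 * exp (h * y)) + 4 * h ^ 3 * exp (h * y))" using em(1,4) by simp
  have le: "AE y in kp. \<bar>exp (h * y) * \<bar>y - h\<bar> ^ 3\<bar> <= 4 * (\<bar>y\<bar> ^ 3 * exp (h * y)) + 4 * h ^ 3 * exp (h * y)"
  proof (rule AE_I2)
   fix y
   have "exp (h * y) * \<bar>y - h\<bar> ^ 3 <= exp (h * y) * (4 * (\<bar>y\<bar> ^ 3 + h ^ 3))" by (intro mult_left_mono cube) simp
   then show "\<bar>exp (h * y) * \<bar>y - h\<bar> ^ 3\<bar> <= 4 * (\<bar>y\<bar> ^ 3 * exp (h * y)) + 4 * h ^ 3 * exp (h * y)" by (simp add: abs_mult algebra_simps)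
  qed
  have ms: "(%y. exp (h * y) * \<bar>y - h\<bar> ^ 3) : borel_measurable kp" by measurable
  have i3: "integrable (tilted kp h) (%y. \<bar>y\<bar> ^ 3)" by (rule tp(4)[OF _ abs_integral_le_AE(1)[OF ms ig le]]) simp
  have t3: "(\<integral>y. \<bar>y\<bar> ^ 3 \<partial>tilted kp h) <= c"
  proof -
   have eq: "(\<integral>y. \<bar>y\<bar> ^ 3 \<partial>tilted kp h) = (LINT y|kp. exp (h * y) * \<bar>y - h\<bar> ^ 3) / m" by (rule tp(3)) simp
   have "\<bar>\<integral>y. exp (h * y) * \<bar>y - h\<bar> ^ 3 \<partial>kp\<bar> <= 4 * (E * M) + 8 * U ^ 3"
   proof -
    have "(LINT y|kp. 4 * (\<bar>y\<bar> ^ 3 * exp (h * y)) + 4 * h ^ 3 * exp (h * y)) = 4 * (LINT y|kp. \<bar>y\<bar> ^ 3 * exp (h * y)) + 4 * h ^ 3 * m"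
     unfolding m_def using em(1,4) by simp
    moreover have "h ^ 3 * m <= U ^ 3 * 2"
    proof (rule mult_mono[OF _ mh(2)])
     have "zt ^ 3 <= 1" using z32 zt1 by linarith
     then show "h ^ 3 <= U ^ 3" using h3 mult_left_mono[of "zt ^ 3" 1 "U ^ 3"] U by simp
    qed (use mh U in auto)
    ultimately show ?thesis using abs_integral_le_AE(2)[OF ms ig le] em(8) by linarith
   qed
   from dv[OF this] have "(\<integral>y. \<bar>y\<bar> ^ 3 \<partial>tilted kp h) <= 2 * (4 * (E * M) + 8 * U ^ 3)" unfolding eq by linarith
   also have "... = 8 * E * M + 16 * U ^ 3" by simp
   finally show ?thesis using cb(6) by linarith
  qed
  have "\<bar>m - 1 - h\<^sup>2 / 2\<bar> <= c * zt ^ 3" 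
  proof -
   have "c1 * zt ^ 3 <= c * zt ^ 3" using zt by (intro mult_right_mono cb(2)) simp
   with b1 show ?thesis by (rule order_trans)
  qed
  then show "integrable kp (%y. exp (h * y)) & \<bar>(LINT y|kp. exp (h * y)) - 1 - h\<^sup>2 / 2\<bar> <= c * zt ^ 3 \<and>
   integrable (tilted kp h) (%y. \<bar>y\<bar> ^ 3) & \<bar>\<integral>y. y \<partial>tilted kp h\<bar> <= c * zt\<^sup>2 \<and>
   \<bar>(\<integral>y. y\<^sup>2 \<partial>tilted kp h) - 1\<bar> <= c * zt & (\<integral>y. \<bar>y\<bar> ^ 3 \<partial>tilted kp h) <= c"
   using em(1) i3 t1 t2 t3 by (simp add: m_def)
 qed
qed

lemma conv_op_pow_cmult: "(conv_op mu ^^ k) (%x. c * f x) x = c * (conv_op mu ^^ k) f x"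
proof (induction k arbitrary: x)
 case (Suc k)
 then have "(conv_op mu ^^ k) (%x. c * f x) = (%x. c * (conv_op mu ^^ k) f x)" by (intro ext)
 then show ?case by (simp add: conv_op_cmult)
qed simp

lemma integral_std_normal_upper: "(LINT t|lborel. std_normal_density t * indicator {a..} t) = Phibar a"
proof -
 have "(LINT t|lborel. std_normal_density t * indicator {a..} t) + Phi a
  = (LINT t|lborel. std_normal_density t * indicator {a..} t + std_normal_density t * indicator {..a} t)"
  unfolding Phi_def by (intro Bochner_Integration.integral_add[symmetric] integrable_std_normal_density_indicator) auto
 also have "... = (LINT t|lborel. std_normal_density t)"
 proof (rule integral_cong_AE)
  have "AE t in lborel. t ~= a" by (rule AE_lborel_singleton)
  then show "AE t in lborel. std_normal_density t * indicator {a..} t + std_normal_density t * indicator {..a} t = std_normal_density t"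
   by eventually_elim (auto simp: indicator_def)
 qed auto
 finally show ?thesis by (simp add: Phibar_def)
qed

lemma conv_op_gau_upper:
 assumes "0 < w" shows "conv_op (gau w) (indicator {z..}) x = Phibar ((z - x) / sqrt w)"
proof -
 have "conv_op (gau w) (indicator {z..}) x = (LINT t|lborel. std_normal_density t * indicator {z..} (x + sqrt w * t))"
  unfolding conv_op_def using assms by (subst integral_gau) auto
 also have "... = (LINT t|lborel. std_normal_density t * indicator {(z - x) / sqrt w..} t)"
  using assms by (intro Bochner_Integration.integral_cong) (auto simp: indicator_def field_simps)
 finally show ?thesis by (simp only: integral_std_normal_upper)
qed

lemma exp_tail_integral:
 assumes h: "0 < (h::real)"
 shows "has_bochner_integral lborel (%v. h * exp (- h * v) * indicator {a..} v) (exp (- h * a))"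
proof (rule has_bochner_integral_nn_integral)
 have "(\<integral>\<^sup>+v. ennreal (h * exp (- h * v)) * indicator {a..} v \<partial>lborel) = 0 - (- exp (- h * a))"
 proof (rule nn_integral_FTC_atLeast)
  show "((%v. - exp (- h * v)) has_real_derivative h * exp (- h * v)) (at v)" for v
   by (auto intro!: derivative_eq_intros)
  show "((%v. - exp (- h * v)) \<longlongrightarrow> 0) at_top" using h by real_asymp
 qed (use h in auto)
 also have "(\<integral>\<^sup>+v. ennreal (h * exp (- h * v)) * indicator {a..} v \<partial>lborel) = (\<integral>\<^sup>+v. ennreal (h * exp (- h * v) * indicator {a..} v) \<partial>lborel)"
  by (rule nn_integral_cong) (auto simp: indicator_def)
 finally show "(\<integral>\<^sup>+v. ennreal (h * exp (- h * v) * indicator {a..} v) \<partial>lborel) = ennreal (exp (- h * a))" by simp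
qed (use h in auto)

lemma kolmogorov_exp_halfline:
 assumes mu: "real_distribution mu" and nu: "real_distribution nu" and h: "0 < (h::real)"
  and dl: "!!z. \<bar>conv_op mu (indicator {..z}) 0 - conv_op nu (indicator {..z}) 0\<bar> <= dl"
 shows "\<bar>conv_op mu (%y. exp (- h * y) * indicator {0..} y) 0 - conv_op nu (%y. exp (- h * y) * indicator {0..} y) 0\<bar> <= 2 * dl"
proof -
 interpret mu: real_distribution mu by fact
 interpret nu: real_distribution nu by fact
 define k where "k v = h * exp (- h * v) * indicator {0..} v" for v
 define \<psi> where "\<psi> y = exp (- h * max y 0)" for y
 have ik: "integrable lborel k" and k1: "(LINT v|lborel. k v) = 1"
  using exp_tail_integral[OF h, of 0] unfolding k_def[abs_def] by (auto simp: has_bochner_integral_iff)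
 have "(LINT v|lborel. \<bar>k v\<bar>) = (LINT v|lborel. k v)"
  using h by (intro Bochner_Integration.integral_cong) (auto simp: k_def indicator_def)
 then have ka: "(LINT v|lborel. \<bar>k v\<bar>) = 1" using k1 by simp
 have rep: "\<psi> y = (LINT v|lborel. k v * indicator {..v} y)" for y
 proof -
  have "(%v. k v * indicator {..v} y) = (%v. h * exp (- h * v) * indicator {max y 0..} v)"
   by (auto simp: k_def indicator_def fun_eq_iff)
  then show ?thesis using exp_tail_integral[OF h, of "max y 0"] by (simp add: has_bochner_integral_iff \<psi>_def)
 qed
 have 1: "\<bar>conv_op mu \<psi> 0 - conv_op nu \<psi> 0\<bar> <= dl"
  using conv_op_total_variation[OF mu nu ik rep dl] unfolding ka by simp
 have cd: "conv_op mu (indicator {..z}) 0 = cdf mu z" "conv_op nu (indicator {..z}) 0 = cdf nu z" for z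
  by (simp_all add: conv_op_def cdf_def)
 have "((%z. \<bar>cdf mu z - cdf nu z\<bar>) \<longlongrightarrow> \<bar>measure mu {..<0} - measure nu {..<0}\<bar>) (at_left 0)"
  by (intro tendsto_intros mu.cdf_at_left nu.cdf_at_left)
 then have "\<bar>measure mu {..<0} - measure nu {..<0}\<bar> <= dl"
  by (rule tendsto_upperbound) (use dl cd in \<open>auto intro!: always_eventually\<close>)
 then have 2: "\<bar>conv_op mu (indicator {..<0}) 0 - conv_op nu (indicator {..<0}) 0\<bar> <= dl"
  by (simp add: conv_op_def)
 have eq: "(%y. exp (- h * y) * indicator {0..} y) = (%y. \<psi> y - indicator {..<0} y)"
  by (auto simp: \<psi>_def indicator_def fun_eq_iff max_def)
 have b\<psi>: "bdd_borel \<psi>" unfolding \<psi>_def[abs_def] by (rule bdd_borelI[where C=1]) (use h in auto)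
 have bi: "bdd_borel (indicator {..<0})" by (rule bdd_borel_indicator) simp
 show ?thesis unfolding eq mu.conv_op_diff[OF b\<psi> bi] nu.conv_op_diff[OF b\<psi> bi] using 1 2 by linarith
qed

lemma abs_power_diff_one_le:
 fixes a :: real shows "\<bar>a ^ n - 1\<bar> <= (1 + \<bar>a - 1\<bar>) ^ n - 1"
proof (induction n)
 case (Suc n)
 define b where "b = 1 + \<bar>a - 1\<bar>"
 have b: "\<bar>a\<bar> <= b" "0 <= b" unfolding b_def by linarith+
 have "\<bar>a ^ Suc n - 1\<bar> = \<bar>a * (a ^ n - 1) + (a - 1)\<bar>" by (simp add: algebra_simps)
 also have "... <= \<bar>a\<bar> * \<bar>a ^ n - 1\<bar> + \<bar>a - 1\<bar>" unfolding abs_mult[symmetric] by (rule abs_triangle_ineq)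
 also have "... <= b * (b ^ n - 1) + \<bar>a - 1\<bar>" using b Suc by (intro add_mono mult_mono) (auto simp: b_def)
 also have "... = b ^ Suc n - 1" by (simp add: b_def algebra_simps)
 finally show ?case by (simp add: b_def)
qed simp

lemma abs_power_diff_one_le':
 fixes a :: real assumes "\<bar>a - 1\<bar> <= c * e" "real n * e <= 1" "0 <= c" "0 <= e"
 shows "\<bar>a ^ n - 1\<bar> <= c * exp c * (real n * e)"
proof -
 define t where "t = c * (real n * e)"
 have t: "0 <= t" "t <= c" using assms mult_left_mono[OF assms(2,3)] by (auto simp: t_def)
 have "(1 + \<bar>a - 1\<bar>) ^ n <= exp (c * e) ^ n"
 proof (rule power_mono)
  show "1 + \<bar>a - 1\<bar> <= exp (c * e)" using assms(1) exp_ge_add_one_self[of "c * e"] by linarith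
 qed simp
 also have "... = exp t" by (simp add: t_def exp_of_nat_mult[symmetric] mult_ac)
 finally have 1: "\<bar>a ^ n - 1\<bar> <= exp t - 1" using abs_power_diff_one_le[of a n] by linarith
 have "1 - t <= exp (- t)" using exp_ge_add_one_self[of "-t"] by simp
 then have "exp t * (1 - t) <= exp t * exp (- t)" by (intro mult_left_mono) auto
 then have "exp t - 1 <= exp t * t" by (simp add: algebra_simps exp_minus)
 also have "... <= exp c * t" using t by (intro mult_right_mono) auto
 finally show ?thesis using 1 by (simp add: t_def mult_ac)
qed

theorem cramer_upper_tail:
 fixes M U :: real
 assumes M: "0 <= M" and U: "0 <= U"
 obtains C c where "0 < C" "1 <= c" "!!kp zt h n. near_std M zt kp ==> 0 < zt ==> c * zt <= 1 ==> 1 <= n ==> real n * zt ^ 3 <= 1 ==>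
  0 < h ==> h <= U * zt ==>
  \<bar>(conv_op kp ^^ n) (indicator {h * real n..}) 0 - Phibar (h * sqrt n)\<bar>
   <= C * (real n * zt ^ 3 + (1 + h * sqrt n) * ((1 + real n * zt\<^sup>2 + zt * (sqrt n * (1 + ln n))) / sqrt n)) * Phibar (h * sqrt n)"
proof -
 obtain c where c: "1 <= c" and tm: "!!kp zt h. near_std M zt kp ==> 0 < zt ==> c * zt <= 1 ==> 0 <= h ==> h <= U * zt ==>
  integrable kp (%y. exp (h * y)) & \<bar>(LINT y|kp. exp (h * y)) - 1 - h\<^sup>2 / 2\<bar> <= c * zt ^ 3 \<and>
  integrable (tilted kp h) (%y. \<bar>y\<bar> ^ 3) & \<bar>\<integral>y. y \<partial>tilted kp h\<bar> <= c * zt\<^sup>2 \<and>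
  \<bar>(\<integral>y. y\<^sup>2 \<partial>tilted kp h) - 1\<bar> <= c * zt & (\<integral>y. \<bar>y\<bar> ^ 3 \<partial>tilted kp h) <= c"
  using tilted_moments[OF M U] by blast
 have c0: "0 <= c" using c by simp
 obtain B where B: "0 < B" and be: "!!nu n e1 e2 k z. real_distribution nu ==> integrable nu (%y. \<bar>y\<bar> ^ 3) ==> \<bar>\<integral>y. y \<partial>nu\<bar> <= e1 ==>
   \<bar>(LINT y|nu. y\<^sup>2) - 1\<bar> <= e2 ==> (LINT y|nu. \<bar>y\<bar> ^ 3) <= c ==> 1 <= n ==> k <= n ==>
   \<bar>(conv_op nu ^^ k) (indicator {..z}) 0 - (conv_op (gau 1) ^^ k) (indicator {..z}) 0\<bar>
    <= B * (1 + e1 * real n + e2 * (sqrt n * (1 + ln n))) / sqrt (real k + 1)"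
  using berry_esseen_near_normal[OF c0] by blast
 define c6 where "c6 = c + exp (U\<^sup>2) * U ^ 4"
 have c6: "0 <= c6" using c U by (simp add: c6_def)
 define A where "A = c6 * exp c6"
 have A0: "0 <= A" using c6 by (simp add: A_def)
 define c7 where "c7 = sqrt (2 * pi) * exp (3/2)"
 have c7: "0 < c7" by (simp add: c7_def)
 define C where "C = A + (1 + A) * (2 * B * c * c7) + 1"
 have BC: "0 <= (1 + A) * (2 * B * c * c7)" using A0 B c c7 by simp
 have C0: "0 < C" using A0 BC unfolding C_def by linarith
 show ?thesis
 proof (rule that[OF C0 c])
  fix kp zt h and n :: nat
  assume kp: "near_std M zt kp" and zt: "0 < zt" "c * zt <= 1" and n: "1 <= n" and nz: "real n * zt ^ 3 <= 1" and h: "0 < h" "h <= U * zt"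
  define m where "m = (LINT y|kp. exp (h * y))"
  define nu where "nu = tilted kp h"
  have rd: "real_distribution kp" using kp by (simp add: near_std_def)
  interpret kp: real_distribution kp by (rule rd)
  have tms: "integrable kp (%y. exp (h * y))" "\<bar>m - 1 - h\<^sup>2 / 2\<bar> <= c * zt ^ 3"
   "integrable nu (%y. \<bar>y\<bar> ^ 3)" "\<bar>\<integral>y. y \<partial>nu\<bar> <= c * zt\<^sup>2" "\<bar>(LINT y|nu. y\<^sup>2) - 1\<bar> <= c * zt" "(LINT y|nu. \<bar>y\<bar> ^ 3) <= c"
   using tm[OF kp zt less_imp_le[OF h(1)] h(2), folded m_def nu_def] by blast+
  note tp = tilted_props[OF rd tms(1), folded m_def nu_def]
  have g1: "real_distribution (gau 1)" by (rule real_distribution_gau) simp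
  define q where "q = sqrt n"
  have q: "0 < q" "real n = q * q" using n by (auto simp: q_def)
  define g where "g y = exp (- h * y) * indicator {h * real n..} y" for y
  define g0 where "g0 = (%y. exp (- h * y) * indicator {0..} y :: real)"
  have bg: "bdd_borel g" unfolding g_def[abs_def]
  proof (rule bdd_borelI[where C=1])
   fix y
   have "0 <= y" if "h * real n <= y" 
   proof -
    have "0 <= h * real n" using h by simp
    with that show ?thesis by linarith
   qed
   then show "\<bar>exp (- h * y) * indicator {h * real n..} y\<bar> <= 1" using h by (auto simp: indicator_def)
  qed measurable
  have bg0: "bdd_borel g0" unfolding g0_def
   by (rule bdd_borelI[where C=1]) (use h in \<open>auto simp: indicator_def\<close>)
  have ind: "indicator {h * real n..} = (%x. exp (h * x) * g x)"
  proof
   fix x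
   have "exp (h * x) * exp (- h * x) = 1" unfolding exp_add[symmetric] by simp
   then show "indicator {h * real n..} x = exp (h * x) * g x" unfolding g_def mult.assoc[symmetric] by simp
  qed
  have gsh: "(%y. g (y + real n * h)) = (%y. exp (- real n * h\<^sup>2) * g0 y)"
  proof
   fix y
   have 1: "exp (- h * (y + real n * h)) = exp (- real n * h\<^sup>2) * exp (- h * y)"
    unfolding exp_add[symmetric] by (rule arg_cong[where f=exp]) (simp add: power2_eq_square algebra_simps)
   have 2: "indicator {h * real n..} (y + real n * h) = (indicator {0..} y :: real)"
    by (simp add: indicator_def mult.commute)
   show "g (y + real n * h) = exp (- real n * h\<^sup>2) * g0 y" unfolding g_def g0_def 1 2 by simp
  qed
  have main: "(conv_op kp' ^^ n) (indicator {h * real n..}) 0 = m' ^ n * exp (- real n * h\<^sup>2) * (conv_op nu' ^^ n) g0 0"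
   if nu': "real_distribution nu'" and tl: "!!g x. bdd_borel g ==> conv_op kp' (%x. exp (h * x) * g x) x = m' * exp (h * x) * conv_op nu' g (x + h)" for kp' m' nu'
  proof -
   have "(conv_op kp' ^^ n) (indicator {h * real n..}) 0 = m' ^ n * (conv_op nu' ^^ n) g (0 + real n * h)"
   proof -
    have "(conv_op kp' ^^ n) (%x. exp (h * x) * g x) 0 = m' ^ n * exp (h * 0) * (conv_op nu' ^^ n) g (0 + real n * h)"
     by (rule conv_op_pow_tilt[OF nu' bg]) (rule tl)
    then show ?thesis unfolding ind by simp
   qed
   also have "(conv_op nu' ^^ n) g (0 + real n * h) = exp (- real n * h\<^sup>2) * (conv_op nu' ^^ n) g0 0"
    unfolding conv_op_pow_shift[symmetric] gsh by (rule conv_op_pow_cmult)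
   finally show ?thesis by simp
  qed
  define X where "X = (conv_op nu ^^ n) g0 0"
  define XB where "XB = (conv_op (gau 1) ^^ n) g0 0"
  have PX: "(conv_op kp ^^ n) (indicator {h * real n..}) 0 = m ^ n * exp (- real n * h\<^sup>2) * X"
   unfolding X_def
  proof (rule main[OF tp(2)])
   fix g :: "real => real" and x assume "bdd_borel g"
   then have [measurable]: "g : borel_measurable borel" by (rule bdd_borel_measurable)
   have "conv_op nu g (x + h) = (LINT y|kp. exp (h * y) * g (x + h + (y - h))) / m"
    unfolding conv_op_def by (rule tp(3)) measurable
   then have "m * exp (h * x) * conv_op nu g (x + h) = exp (h * x) * (LINT y|kp. exp (h * y) * g (x + y))" using tp(1) by simp
   also have "... = (LINT y|kp. exp (h * x) * (exp (h * y) * g (x + y)))" by simp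
   also have "... = conv_op kp (%x. exp (h * x) * g x) x"
    unfolding conv_op_def by (intro Bochner_Integration.integral_cong) (auto simp: distrib_left exp_add)
   finally show "conv_op kp (%x. exp (h * x) * g x) x = m * exp (h * x) * conv_op nu g (x + h)" by simp
  qed
  define u where "u = h * sqrt n"
  have u0: "0 <= u" using h by (simp add: u_def)
  have u2: "u\<^sup>2 = real n * h\<^sup>2" by (simp add: u_def power_mult_distrib)
  have PG: "Phibar u = exp (h\<^sup>2 / 2) ^ n * exp (- real n * h\<^sup>2) * XB"
  proof -
   have "(conv_op (gau 1) ^^ n) (indicator {h * real n..}) 0 = exp (h\<^sup>2 / 2) ^ n * exp (- real n * h\<^sup>2) * XB"
    unfolding XB_def
   proof (rule main[OF g1])
    fix g :: "real => real" and x assume "bdd_borel g"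
    then have "g : borel_measurable borel" by (rule bdd_borel_measurable)
    then show "conv_op (gau 1) (%x. exp (h * x) * g x) x = exp (h\<^sup>2 / 2) * exp (h * x) * conv_op (gau 1) g (x + h)"
     by (rule gau1_tilt)
   qed
   moreover have "(conv_op (gau 1) ^^ n) (indicator {h * real n..}) 0 = Phibar u"
   proof -
    have "bdd_borel (indicator {h * real n..})" by (rule bdd_borel_indicator) simp
    then have "(conv_op (gau 1) ^^ n) (indicator {h * real n..}) 0 = Phibar (h * real n / sqrt n)"
     using n by (simp add: conv_op_gau_pow1 conv_op_gau_upper)
    also have "h * real n / sqrt n = u" unfolding u_def times_divide_eq_right[symmetric] by (simp add: real_div_sqrt)
    finally show ?thesis .
   qed
   ultimately show ?thesis by simp
  qed
  have mb: "Phibar u = exp (- (real n * h\<^sup>2 / 2)) * XB"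
  proof -
   have "exp (h\<^sup>2 / 2) ^ n * exp (- real n * h\<^sup>2) = exp (real n * (h\<^sup>2 / 2) + - real n * h\<^sup>2)"
    unfolding exp_add exp_of_nat_mult ..
   also have "real n * (h\<^sup>2 / 2) + - real n * h\<^sup>2 = - (real n * h\<^sup>2 / 2)" by simp
   finally show ?thesis unfolding PG by simp
  qed
  have XB0: "1 / (c7 * (1 + u)) <= XB"
  proof -
   have "XB = exp (u\<^sup>2 / 2) * Phibar u" unfolding mb u2 by (simp add: exp_minus)
   moreover have "exp (u\<^sup>2 / 2) * (std_normal_density u * exp (-3/2) / (1 + u)) <= exp (u\<^sup>2 / 2) * Phibar u"
    by (intro mult_left_mono Phibar_lower u0) simp
   moreover have "exp (u\<^sup>2 / 2) * (std_normal_density u * exp (-3/2) / (1 + u)) = 1 / (c7 * (1 + u))"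
   proof -
    have 1: "exp (u\<^sup>2 / 2) * exp (- u\<^sup>2 / 2) = 1" unfolding exp_add[symmetric] by simp
    have 2: "exp (-3/2) = 1 / exp (3/2 :: real)" using exp_minus[of "3/2 :: real"] by (simp add: inverse_eq_divide)
    have "exp (u\<^sup>2 / 2) * (std_normal_density u * exp (-3/2) / (1 + u)) =
     (exp (u\<^sup>2 / 2) * exp (- u\<^sup>2 / 2)) * (1 / sqrt (2 * pi) * exp (-3/2) / (1 + u))"
     unfolding std_normal_density_def times_divide_eq_right by (simp only: mult_ac)
    then show ?thesis unfolding 1 2 c7_def by simp
   qed
   ultimately show ?thesis by simp
  qed
  have u1: "0 < c7 * (1 + u)" using c7 u0 by simp
  have "0 < 1 / (c7 * (1 + u))" using u1 by simp
  with XB0 have XBp: "0 < XB" by linarith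
  have X1: "1 <= c7 * (1 + u) * XB" using XB0 u1 by (simp add: divide_le_eq mult.commute)
  define dl where "dl = B * (1 + (c * zt\<^sup>2) * real n + (c * zt) * (sqrt n * (1 + ln n))) / sqrt (real n + 1)"
  have XX: "\<bar>X - XB\<bar> <= 2 * dl"
  proof -
   obtain rh where rh: "real_distribution rh" "!!f. bdd_borel f ==> (conv_op nu ^^ n) f = conv_op rh f"
    using conv_op_pow_measure[OF tp(2), of n] by blast
   obtain rh' where rh': "real_distribution rh'" "!!f. bdd_borel f ==> (conv_op (gau 1) ^^ n) f = conv_op rh' f"
    using conv_op_pow_measure[OF g1, of n] by blast
   have "\<bar>conv_op rh (indicator {..z}) 0 - conv_op rh' (indicator {..z}) 0\<bar> <= dl" for z
    using be[OF tp(2) tms(3,4,5,6) n order_refl, of z]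
    by (simp only: dl_def rh(2)[OF bdd_borel_halfline] rh'(2)[OF bdd_borel_halfline])
   from kolmogorov_exp_halfline[OF rh(1) rh'(1) h(1) this]
   show ?thesis unfolding X_def XB_def rh(2)[OF bg0] rh'(2)[OF bg0] by (simp only: g0_def)
  qed
  define a where "a = m * exp (- (h\<^sup>2 / 2))"
  have zt1: "zt <= 1" using zt mult_right_mono[OF c, of zt] by linarith
  have a1: "\<bar>a - 1\<bar> <= c6 * zt ^ 3"
  proof -
   have hU: "h <= U" using h(2) mult_left_mono[OF zt1 U] by linarith
   have "h\<^sup>2 <= U\<^sup>2" using hU h by (intro power_mono) auto
   then have "\<bar>h\<^sup>2 / 2\<bar> <= U\<^sup>2" using zero_le_power2[of h] by linarith
   from exp_taylor_bounds(3)[OF this] have 1: "\<bar>exp (h\<^sup>2 / 2) - 1 - h\<^sup>2 / 2\<bar> <= exp (U\<^sup>2) * (h\<^sup>2 / 2)\<^sup>2" .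
   have "(h\<^sup>2 / 2)\<^sup>2 <= (h\<^sup>2)\<^sup>2" by (intro power_mono) auto
   also have "... = h ^ 4" by simp
   also have "... <= (U * zt) ^ 4" using h by (intro power_mono) auto
   also have "... = U ^ 4 * zt ^ 4" by (simp add: power_mult_distrib)
   also have "... <= U ^ 4 * zt ^ 3" using zt zt1 by (intro mult_left_mono power_decreasing) auto
   finally have "exp (U\<^sup>2) * (h\<^sup>2 / 2)\<^sup>2 <= exp (U\<^sup>2) * (U ^ 4 * zt ^ 3)" by (intro mult_left_mono) auto
   then have 2: "\<bar>m - exp (h\<^sup>2 / 2)\<bar> <= c6 * zt ^ 3" using 1 tms(2) unfolding c6_def distrib_right mult.assoc by linarith
   have "a - 1 = (m - exp (h\<^sup>2 / 2)) * exp (- (h\<^sup>2 / 2))" by (simp add: a_def left_diff_distrib exp_minus)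
   then have "\<bar>a - 1\<bar> = \<bar>m - exp (h\<^sup>2 / 2)\<bar> * exp (- (h\<^sup>2 / 2))" by (simp add: abs_mult)
   also have "... <= \<bar>m - exp (h\<^sup>2 / 2)\<bar> * 1" by (intro mult_left_mono) auto
   finally have "\<bar>a - 1\<bar> <= \<bar>m - exp (h\<^sup>2 / 2)\<bar>" by simp
   then show ?thesis using 2 by (rule order_trans)
  qed
  define e where "e = real n * zt ^ 3"
  have e: "0 <= e" "e <= 1" using zt nz by (auto simp: e_def)
  have an: "\<bar>a ^ n - 1\<bar> <= A * e"
   unfolding A_def e_def by (rule abs_power_diff_one_le'[OF a1 nz c6]) (use zt in simp)
  have ma: "m ^ n * exp (- real n * h\<^sup>2) * X = exp (- (real n * h\<^sup>2 / 2)) * (a ^ n * X)"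
  proof -
   have "exp (- (h\<^sup>2 / 2)) ^ n = exp (real n * - (h\<^sup>2 / 2))" by (rule exp_of_nat_mult[symmetric])
   then have "a ^ n = m ^ n * exp (- (real n * h\<^sup>2 / 2))" by (simp add: a_def power_mult_distrib)
   moreover have "exp (- real n * h\<^sup>2) = exp (- (real n * h\<^sup>2 / 2)) * exp (- (real n * h\<^sup>2 / 2))"
    unfolding exp_add[symmetric] by simp
   ultimately show "m ^ n * exp (- real n * h\<^sup>2) * X = exp (- (real n * h\<^sup>2 / 2)) * (a ^ n * X)" by simp
  qed
  define W where "W = (1 + real n * zt\<^sup>2 + zt * (sqrt n * (1 + ln n))) / sqrt n"
  have W0: "0 <= W" using zt n by (simp add: W_def)
  have dlW: "dl <= B * c * W"
  proof -
   define Y where "Y = 1 + real n * zt\<^sup>2 + zt * (sqrt n * (1 + ln n))"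
   have y: "0 <= real n * zt\<^sup>2" "0 <= zt * (sqrt n * (1 + ln n))" using zt n by auto
   have "1 + (c * zt\<^sup>2) * real n + (c * zt) * (sqrt n * (1 + ln n)) = 1 + c * (real n * zt\<^sup>2) + c * (zt * (sqrt n * (1 + ln n)))" by (simp add: mult_ac)
   also have "... <= c * 1 + c * (real n * zt\<^sup>2) + c * (zt * (sqrt n * (1 + ln n)))" using c by simp
   also have "... = c * Y" by (simp only: Y_def distrib_left)
   finally have "B * (1 + (c * zt\<^sup>2) * real n + (c * zt) * (sqrt n * (1 + ln n))) <= B * (c * Y)" using B by (intro mult_left_mono) auto
   then have "dl <= B * (c * Y) / sqrt (real n + 1)" unfolding dl_def by (rule divide_right_mono) simp
   also have "... <= B * (c * Y) / sqrt n"
   proof (rule divide_left_mono)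
    show "0 <= B * (c * Y)" using B c0 y by (simp add: Y_def)
   qed (use n in auto)
   finally show ?thesis by (simp add: W_def Y_def)
  qed
  have "\<bar>a ^ n * X - XB\<bar> <= C * (e + (1 + u) * W) * XB"
  proof -
   have "a ^ n * X - XB = (a ^ n - 1) * XB + a ^ n * (X - XB)" by (simp add: algebra_simps)
   then have "\<bar>a ^ n * X - XB\<bar> <= \<bar>a ^ n - 1\<bar> * XB + \<bar>a ^ n\<bar> * \<bar>X - XB\<bar>"
    using abs_triangle_ineq[of "(a ^ n - 1) * XB" "a ^ n * (X - XB)"] XBp by (simp only: abs_mult abs_of_pos)
   moreover have "\<bar>a ^ n - 1\<bar> * XB <= A * e * XB" using an XBp by (intro mult_right_mono) auto
   moreover have "\<bar>a ^ n\<bar> * \<bar>X - XB\<bar> <= (1 + A) * (2 * (B * c * W))"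
   proof (rule mult_mono)
    have "A * e <= A * 1" using e A0 by (intro mult_left_mono) auto
    then show "\<bar>a ^ n\<bar> <= 1 + A" using an by linarith
    show "\<bar>X - XB\<bar> <= 2 * (B * c * W)" using XX dlW by linarith
   qed (use A0 in auto)
   moreover have "(1 + A) * (2 * (B * c * W)) * 1 <= (1 + A) * (2 * (B * c * W)) * (c7 * (1 + u) * XB)"
    using A0 B c0 W0 by (intro mult_left_mono X1) auto
   moreover have "(1 + A) * (2 * (B * c * W)) * (c7 * (1 + u) * XB) = (1 + A) * (2 * B * c * c7) * ((1 + u) * W) * XB" by (simp add: mult_ac)
   moreover have "A * e * XB + (1 + A) * (2 * B * c * c7) * ((1 + u) * W) * XB <= C * (e + (1 + u) * W) * XB"
   proof -
    define D where "D = (1 + A) * (2 * B * c * c7)"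
    define V where "V = (1 + u) * W"
    have V: "0 <= V" using u0 W0 by (simp add: V_def)
    have "C = A + D + 1" by (simp only: C_def D_def)
    then have "C * (e + V) = A * e + D * V + (A * V + D * e + e + V)" by (simp add: algebra_simps)
    moreover have "0 <= A * V + D * e + e + V" using A0 V BC e by (simp add: D_def)
    ultimately have "A * e + D * V <= C * (e + V)" by linarith
    then have "(A * e + D * V) * XB <= C * (e + V) * XB" using XBp by (intro mult_right_mono) auto
    then show ?thesis by (simp only: V_def D_def distrib_right)
   qed
   ultimately show ?thesis by linarith
  qed
  then have "exp (- (real n * h\<^sup>2 / 2)) * \<bar>a ^ n * X - XB\<bar> <= exp (- (real n * h\<^sup>2 / 2)) * (C * (e + (1 + u) * W) * XB)" by (intro mult_left_mono) auto
  moreover have "(conv_op kp ^^ n) (indicator {h * real n..}) 0 - Phibar u = exp (- (real n * h\<^sup>2 / 2)) * (a ^ n * X - XB)"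
   unfolding PX ma mb by (simp add: right_diff_distrib)
  ultimately have "\<bar>(conv_op kp ^^ n) (indicator {h * real n..}) 0 - Phibar u\<bar> <= C * (e + (1 + u) * W) * Phibar u"
   unfolding mb by (simp add: abs_mult mult_ac)
  then show "\<bar>(conv_op kp ^^ n) (indicator {h * real n..}) 0 - Phibar (h * sqrt n)\<bar>
   <= C * (real n * zt ^ 3 + (1 + h * sqrt n) * ((1 + real n * zt\<^sup>2 + zt * (sqrt n * (1 + ln n))) / sqrt n)) * Phibar (h * sqrt n)"
   by (simp only: e_def W_def u_def)
 qed
qed

lemma (in prob_space) expectation_sum_conv_op:
 assumes "finite I" "indep_vars (%_. borel) Y I" "!!i. i : I ==> distr M borel (Y i) = mu"
  and mu: "real_distribution mu" and "bdd_borel f"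
 shows "(LINT om|M. f (x + (\<Sum>i\<in>I. Y i om))) = (conv_op mu ^^ card I) f x"
 using assms(1,2,3,5)
proof (induction I arbitrary: f)
 case empty
 then show ?case by (simp add: prob_space)
next
 case (insert i I)
 interpret mu: real_distribution mu by (rule mu)
 have f[measurable]: "f : borel_measurable borel" using insert.prems by (simp add: bdd_borel_def)
 obtain C where C: "!!x. \<bar>f x\<bar> <= C" using insert.prems by (auto simp: bdd_borel_def)
 define S where "S om = (\<Sum>i\<in>I. Y i om)" for om
 have ind: "indep_var borel (Y i) borel S"
  unfolding S_def[abs_def] by (rule indep_vars_sum[OF insert.hyps insert.prems(1)])
 have rv[measurable]: "random_variable borel (Y i)" "random_variable borel S" and
  jd: "distr M borel (Y i) \<Otimes>\<^sub>M distr M borel S = distr M (borel \<Otimes>\<^sub>M borel) (%om. (Y i om, S om))"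
  using ind unfolding indep_var_distribution_eq by auto
 interpret \<sigma>: real_distribution "distr M borel S" by (rule real_distribution_distr) simp
 interpret P: pair_prob_space mu "distr M borel S" ..
 have Yi: "distr M borel (Y i) = mu" using insert.prems by simp
 have "(LINT om|M. f (x + (\<Sum>i\<in>insert i I. Y i om))) = (LINT om|M. (%(y, s). f (x + s + y)) (Y i om, S om))"
  using insert.hyps by (simp add: S_def add_ac)
 also have "... = (\<integral>z. (%(y, s). f (x + s + y)) z \<partial>distr M (borel \<Otimes>\<^sub>M borel) (%om. (Y i om, S om)))"
  by (rule integral_distr[symmetric]) measurable
 also have "... = (\<integral>z. (%(y, s). f (x + s + y)) z \<partial>(mu \<Otimes>\<^sub>M distr M borel S))"
  unfolding jd[symmetric] Yi ..
 also have "... = (\<integral>s. (LINT y|mu. f (x + s + y)) \<partial>distr M borel S)"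
 proof (rule P.integral_snd[symmetric])
  show "integrable (mu \<Otimes>\<^sub>M distr M borel S) (%(y, s). f (x + s + y))"
   by (rule P.P.integrable_const_bound[where B=C]) (use C in auto)
 qed
 also have "... = (\<integral>s. conv_op mu f (x + s) \<partial>distr M borel S)" by (simp add: conv_op_def)
 also have "... = (LINT om|M. conv_op mu f (x + S om))"
 proof (rule integral_distr)
  have [measurable]: "conv_op mu f : borel_measurable borel"
   by (rule bdd_borel_measurable[OF mu.bdd_borel_conv_op[OF insert.prems(3)]])
  show "(%s. conv_op mu f (x + s)) : borel_measurable borel" by measurable
 qed simp
 also have "... = (conv_op mu ^^ card I) (conv_op mu f) x"
  unfolding S_def using insert.prems
  by (intro insert.IH indep_vars_subset[OF insert.prems(1)] mu.bdd_borel_conv_op) auto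
 also have "... = (conv_op mu ^^ card (insert i I)) f x" using insert.hyps by (simp add: funpow_swap1)
 finally show ?case .
qed

definition gau_sq :: "real measure" where "gau_sq = distr (gau 1) borel (%z. z\<^sup>2)"

lemma real_distribution_gau_sq: "real_distribution gau_sq"
proof -
 interpret real_distribution "gau 1" by (rule real_distribution_gau) simp
 show ?thesis unfolding gau_sq_def by (rule real_distribution_distr) simp
qed

lemma gau_sq_nonneg: "AE y in gau_sq. 0 <= y"
 unfolding gau_sq_def by (subst AE_distr_iff) (auto simp: gau_def)

lemma conv_op_upper: 
 assumes "real_distribution mu" shows "conv_op mu (indicator {t..}) x = measure mu {t - x..}"
proof -
 interpret real_distribution mu by fact
 have "(%y. indicator {t..} (x + y)) = (indicator {t - x..} :: real => real)" by (auto simp: indicator_def fun_eq_iff)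
 then show ?thesis by (simp add: conv_op_def)
qed

lemma two_sided_sets:
 assumes "0 < v" shows "{y::real. v <= y\<^sup>2} = {sqrt v..} \<union> {..- sqrt v}" "{sqrt v..} Int {..- sqrt v} = {}"
proof -
 have s: "0 < sqrt v" using assms by simp
 show "{y::real. v <= y\<^sup>2} = {sqrt v..} \<union> {..- sqrt v}"
 proof (intro set_eqI)
  fix y :: real
  have "v <= y\<^sup>2 \<longleftrightarrow> sqrt v <= \<bar>y\<bar>" using real_sqrt_le_iff[of v "y\<^sup>2"] by simp
  then show "y : {y. v <= y\<^sup>2} \<longleftrightarrow> y : {sqrt v..} \<union> {..- sqrt v}" using s by auto
 qed
 have False if "sqrt v <= x" "x <= - sqrt v" for x using s that by linarith
 then show "{sqrt v..} Int {..- sqrt v} = {}" by auto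
qed

lemma gau_sq_tail:
 assumes "0 < r" shows "measure gau_sq {r..} = 2 * Phibar (sqrt r)"
proof -
 interpret real_distribution "gau 1" by (rule real_distribution_gau) simp
 have "measure gau_sq {r..} = measure (gau 1) ((%z. z\<^sup>2) -` {r..} Int space (gau 1))"
  unfolding gau_sq_def by (rule measure_distr) auto
 also have "(%z. z\<^sup>2) -` {r..} Int space (gau 1) = {sqrt r..} \<union> {..- sqrt r}"
  using two_sided_sets(1)[OF assms] by auto
 also have "measure (gau 1) \<dots> = measure (gau 1) {sqrt r..} + measure (gau 1) {..- sqrt r}"
  by (rule finite_measure_Union) (use two_sided_sets(2)[OF assms] in auto)
 also have "measure (gau 1) {sqrt r..} = Phibar (sqrt r)"
  using conv_op_gau_upper[of 1 "sqrt r" 0] conv_op_upper[OF real_distribution_axioms, of "sqrt r" 0] by simp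
 also have "measure (gau 1) {..- sqrt r} = Phi (- sqrt r)"
  using conv_op_gau_indicator[of 1 "- sqrt r" 0] by (simp add: conv_op_def)
 also have "Phi (- sqrt r) = Phibar (sqrt r)"
 proof -
  have "Phi (- sqrt r) = (LINT t|lborel. std_normal_density (0 + (-1) * t) * indicator {..- sqrt r} (0 + (-1) * t))"
   unfolding Phi_def by (subst lborel_integral_real_affine[where c="-1" and t=0]) auto
  also have "... = (LINT t|lborel. std_normal_density t * indicator {sqrt r..} t)"
   by (intro Bochner_Integration.integral_cong) (auto simp: indicator_def std_normal_density_def)
  finally show ?thesis by (simp only: integral_std_normal_upper)
 qed
 finally show ?thesis by simp
qed

lemma prob_space_std_normal_measure: "prob_space std_normal_measure"
 unfolding std_normal_measure_def by (rule prob_space_normal_density) simp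

lemma chi_square_tail_conv_op: "chi_square_tail d t = (conv_op gau_sq ^^ d) (indicator {t..}) 0"
proof -
 let ?P = "PiM {1..d} (%_. std_normal_measure)"
 have sg: "std_normal_measure = gau 1" unfolding std_normal_measure_def gau_def by simp
 have sets_sn[measurable_cong]: "sets std_normal_measure = sets borel" by (simp add: std_normal_measure_def)
 interpret P: prob_space ?P by (rule prob_space_PiM) (rule prob_space_std_normal_measure)
 have comp: "distr ?P std_normal_measure (%om. om m) = std_normal_measure" if "m : {1..d}" for m
  by (rule distr_PiM_component) (use that prob_space_std_normal_measure in auto)
 have ind: "P.indep_vars (%_. std_normal_measure) (%m om. om m) {1..d}"
 proof (cases "{1..d} = {}")
  case True
  then show ?thesis unfolding P.indep_vars_def P.indep_sets_def by auto
 next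
  case False
  show ?thesis
  proof (subst P.indep_vars_iff_distr_eq_PiM'[OF False])
   have "distr ?P ?P (%x. \<lambda>i\<in>{1..d}. x i) = distr ?P ?P (%x. x)"
    by (rule distr_cong) (auto simp: space_PiM PiE_def extensional_restrict)
   also have "... = ?P" by (rule distr_id2) simp
   also have "... = PiM {1..d} (%i. distr ?P std_normal_measure (%om. om i))"
    by (rule PiM_cong) (use comp in auto)
   finally show "distr ?P ?P (%x. \<lambda>i\<in>{1..d}. x i) = PiM {1..d} (%i. distr ?P std_normal_measure (%om. om i))" .
  qed measurable
 qed
 have ind2: "P.indep_vars (%_. borel) (%m om. (om m)\<^sup>2) {1..d}"
  by (rule P.indep_vars_compose2[OF ind, where Y="%_ x. x\<^sup>2"]) measurable
 have law: "distr ?P borel (%om. (om m)\<^sup>2) = gau_sq" if m: "m : {1..d}" for m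
 proof -
  have "distr ?P borel (%om. (om m)\<^sup>2) = distr (distr ?P std_normal_measure (%om. om m)) borel (%x. x\<^sup>2)"
   using m by (subst distr_distr) (auto simp: comp_def)
  also have "... = gau_sq" unfolding comp[OF m] unfolding gau_sq_def sg ..
  finally show ?thesis .
 qed
 have [measurable]: "(%z. \<Sum>m\<in>{1..d}. (z m)\<^sup>2) : borel_measurable ?P"
  by (intro borel_measurable_sum borel_measurable_power) measurable
 have "chi_square_tail d t = measure ?P ((%z. \<Sum>m\<in>{1..d}. (z m)\<^sup>2) -` {t..} Int space ?P)"
  unfolding chi_square_tail_def chi_square_def by (rule measure_distr) auto
 also have "... = (\<integral>z. indicator ((%z. \<Sum>m\<in>{1..d}. (z m)\<^sup>2) -` {t..} Int space ?P) z \<partial>?P)"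
  by simp
 also have "... = (\<integral>z. indicator {t..} (0 + (\<Sum>m\<in>{1..d}. (z m)\<^sup>2)) \<partial>?P)"
  by (rule Bochner_Integration.integral_cong) (auto simp: indicator_def)
 also have "... = (conv_op gau_sq ^^ card {1..d}) (indicator {t..}) 0"
  by (rule P.expectation_sum_conv_op[OF _ ind2 law real_distribution_gau_sq]) (auto intro: bdd_borel_indicator)
 finally show ?thesis by simp
qed

lemma conv_op_pow_mono_nonneg:
 assumes mu: "real_distribution mu" "AE y in mu. 0 <= y" and f: "bdd_borel f" and g: "bdd_borel g"
  and le: "!!x. 0 <= x ==> f x <= g x"
 shows "0 <= x ==> (conv_op mu ^^ j) f x <= (conv_op mu ^^ j) g x"
proof (induction j arbitrary: x)
 case (Suc j)
 interpret real_distribution mu by fact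
 have "conv_op mu ((conv_op mu ^^ j) f) x <= conv_op mu ((conv_op mu ^^ j) g) x"
 proof (rule conv_op_mono[OF conv_op_pow_bdd[OF f] conv_op_pow_bdd[OF g]])
  show "AE y in mu. (conv_op mu ^^ j) f (x + y) <= (conv_op mu ^^ j) g (x + y)"
   using mu(2) by eventually_elim (use Suc in auto)
 qed
 then show ?case by simp
qed (use le in auto)

text \<open>Two nonnegative laws with comparable tails have comparable tails after convolution: the
 summands are exchanged one at a time, each time as the innermost operator.\<close>

lemma conv_op_pow_tail_compare:
 assumes nu: "real_distribution nu" "AE y in nu. 0 <= y" and gmv: "real_distribution gmv" "AE y in gmv. 0 <= y"
  and a: "0 <= a" "1 <= a"
  and le: "!!r. 0 < r ==> r <= t ==> measure nu {r..} <= a * measure gmv {r..}"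
 shows "(conv_op nu ^^ d) (indicator {t..}) 0 <= a ^ d * (conv_op gmv ^^ d) (indicator {t..}) 0"
proof -
 interpret nu: real_distribution nu by fact
 interpret gmv: real_distribution gmv by fact
 let ?f = "indicator {t..} :: real => real"
 have bf: "bdd_borel ?f" by (rule bdd_borel_indicator) simp
 have all1: "measure rh {r..} = 1" if "real_distribution rh" "AE y in rh. 0 <= y" "r <= 0" for rh r
 proof -
  interpret real_distribution rh by fact
  have "AE y in rh. y : {r..}" using that(2) by eventually_elim (use that(3) in auto)
  then show ?thesis by (intro prob_eq_1[THEN iffD2]) auto
 qed
 have one: "conv_op nu ?f x <= a * conv_op gmv ?f x" if x: "0 <= x" for x
 proof (cases "t - x <= 0")
  case True
  then show ?thesis using a all1[OF nu True] all1[OF gmv True] by (simp add: conv_op_upper nu gmv)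
 next
  case False
  then show ?thesis using le[of "t - x"] x by (simp add: conv_op_upper nu gmv)
 qed
 have "0 <= x ==> (conv_op nu ^^ d) ?f x <= a ^ d * (conv_op gmv ^^ d) ?f x" for x
 proof (induction d arbitrary: x)
  case (Suc d)
  have b1: "bdd_borel (%x. a ^ d * (conv_op gmv ^^ d) ?f x)" by (intro bdd_borel_cmult gmv.conv_op_pow_bdd bf)
  have "(conv_op nu ^^ Suc d) ?f x = conv_op nu ((conv_op nu ^^ d) ?f) x" by simp
  also have "... <= conv_op nu (%x. a ^ d * (conv_op gmv ^^ d) ?f x) x"
  proof (rule nu.conv_op_mono[OF nu.conv_op_pow_bdd[OF bf] b1])
   show "AE y in nu. (conv_op nu ^^ d) ?f (x + y) <= a ^ d * (conv_op gmv ^^ d) ?f (x + y)"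
    using nu(2)
   proof eventually_elim
    case (elim y) then show ?case using Suc.prems by (intro Suc.IH) simp
   qed
  qed
  also have "... = a ^ d * (conv_op gmv ^^ d) (conv_op nu ?f) x"
   unfolding conv_op_cmult conv_op_pow_commute[OF gmv(1) nu(1) bf] ..
  also have "... <= a ^ d * (conv_op gmv ^^ d) (%x. a * conv_op gmv ?f x) x"
   using a by (intro mult_left_mono conv_op_pow_mono_nonneg[OF gmv nu.bdd_borel_conv_op[OF bf] bdd_borel_cmult[OF gmv.bdd_borel_conv_op[OF bf]] one Suc.prems]) auto
  also have "... = a ^ Suc d * (conv_op gmv ^^ Suc d) ?f x"
   by (simp add: conv_op_pow_cmult funpow_swap1)
  finally show ?case .
 qed simp
 then show ?thesis by simp
qed

lemma conv_op_pow_ge_single: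
 assumes mu: "real_distribution mu" "AE y in mu. 0 <= y" and d: "1 <= d"
 shows "measure mu {t..} <= (conv_op mu ^^ d) (indicator {t..}) 0"
proof -
 interpret real_distribution mu by fact
 let ?f = "indicator {t..} :: real => real"
 have bf: "bdd_borel ?f" by (rule bdd_borel_indicator) simp
 have "mono ((conv_op mu ^^ d) ?f) & (\<forall>x. conv_op mu ?f x <= (conv_op mu ^^ d) ?f x)"
  using d
 proof (induction d rule: dec_induct)
  case base
  have "mono (conv_op mu ?f)" unfolding mono_def conv_op_upper[OF mu(1)] by (auto intro!: finite_measure_mono)
  then show ?case by simp
 next
  case (step d)
  let ?g = "(conv_op mu ^^ d) ?f"
  have bg: "bdd_borel ?g" by (rule conv_op_pow_bdd[OF bf])
  have m: "mono ?g" using step by simp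
  have mg: "mono (conv_op mu g)" if "mono g" "bdd_borel g" for g
  proof (rule monoI)
   fix x y :: real assume "x <= y"
   then show "conv_op mu g x <= conv_op mu g y"
    unfolding conv_op_def using that by (intro integral_mono bdd_borel_integrable monoD[OF that(1)]) auto
  qed
  have "mono (conv_op mu ?g)" by (rule mg[OF m bg])
  moreover have "conv_op mu ?f x <= conv_op mu ?g x" for x
  proof -
   have "conv_op mu ?f x <= ?g x" using step by simp
   also have "?g x = (LINT y|mu. ?g x)" by simp
   also have "... <= (LINT y|mu. ?g (x + y))"
   proof (rule integral_mono_AE)
    show "AE y in mu. ?g x <= ?g (x + y)" using mu(2) by eventually_elim (auto intro: monoD[OF m])
   qed (auto intro: bdd_borel_integrable[OF bg])
   finally show ?thesis by (simp add: conv_op_def)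
  qed
  ultimately show ?case by simp
 qed
 then show ?thesis using conv_op_upper[OF mu(1), of t 0] by (metis diff_zero)
qed

lemma chi_square_tail_lower:
 assumes "1 <= d" "0 < t" shows "2 * Phibar (sqrt t) <= chi_square_tail d t"
 using conv_op_pow_ge_single[OF real_distribution_gau_sq gau_sq_nonneg assms(1), of t]
 by (simp add: chi_square_tail_conv_op gau_sq_tail assms(2))

lemma chi_square_tail_antimono: "s <= t ==> chi_square_tail d t <= chi_square_tail d s"
proof -
 assume st: "s <= t"
 have "(conv_op gau_sq ^^ d) (indicator {t..}) 0 <= (conv_op gau_sq ^^ d) (indicator {s..}) 0"
  by (rule conv_op_pow_mono_nonneg[OF real_distribution_gau_sq gau_sq_nonneg])
   (use st in \<open>auto intro: bdd_borel_indicator simp: indicator_def\<close>)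
 then show ?thesis by (simp only: chi_square_tail_conv_op)
qed

lemma one_minus_power_le: "1 - v ^ U <= real U" if "0 <= v" for v :: real and U :: nat
proof (cases U)
 case (Suc k)
 have "0 <= v ^ U" using that by simp
 then show ?thesis using Suc by simp
qed simp

text \<open>The generating function of the number of events almost satisfies the differential equation
 of the Poisson generating function.\<close>

lemma (in prob_space) poisson_zero_approx:
 fixes E :: "'i => 'a set" and N :: "'i => 'i set"
 assumes I: "finite I" and ev: "!!a. a : I ==> E a : events" and N: "!!a. a : I ==> N a \<subseteq> I - {a}"
  and indep: "!!a v. a : I ==> 0 <= v ==> v <= 1 ==>
   (LINT om|M. indicator (E a) om * v ^ (\<Sum>b\<in>I - insert a (N a). if om : E b then 1 else 0))
   = prob (E a) * (LINT om|M. v ^ (\<Sum>b\<in>I - insert a (N a). if om : E b then 1 else 0))"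
 defines "\<Lambda> \<equiv> (\<Sum>a\<in>I. prob (E a))"
 shows "\<bar>prob {om : space M. \<forall>a\<in>I. om \<notin> E a} - exp (- \<Lambda>)\<bar>
  <= (\<Sum>a\<in>I. (\<Sum>b\<in>N a. prob (E a Int E b)) + prob (E a) * (\<Sum>b\<in>insert a (N a). prob (E b)))"
proof -
 define cnt where "cnt A om = (\<Sum>b\<in>A. if om : E b then 1 else 0 :: nat)" for A om
 have cntr: "real (cnt A om) = (\<Sum>b\<in>A. indicator (E b) om)" for A om
  unfolding cnt_def by (auto simp: indicator_def intro!: sum.cong)
 have fin: "finite A" if "A \<subseteq> I" for A using that I by (rule finite_subset)
 have mc[measurable]: "cnt A : measurable M (count_space UNIV)" if "A \<subseteq> I" for A
 proof -
  have "(%om. if om : E b then 1 else 0 :: nat) : measurable M (count_space UNIV)" if "b : A" for b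
  proof -
   have [measurable]: "E b : events" using ev that \<open>A \<subseteq> I\<close> by auto
   show ?thesis by measurable
  qed
  then show ?thesis unfolding cnt_def[abs_def] by (rule measurable_sum_nat)
 qed
 define n where "n = card I"
 have cn: "cnt A om <= n" if "A \<subseteq> I" for A om
 proof -
  have "cnt A om <= (\<Sum>b\<in>A. 1)" unfolding cnt_def by (rule sum_mono) auto
  also have "... <= n" using card_mono[OF I that] by (simp add: n_def)
  finally show ?thesis .
 qed
 have powm: "integrable M (%om. v ^ cnt A om)" if "A \<subseteq> I" "0 <= v" "v <= 1" for A and v :: real
 proof (rule integrable_const_bound[where B=1])
  show "(%om. v ^ cnt A om) : borel_measurable M"
   using measurable_compose[OF mc[OF that(1)], of "%k. v ^ k" borel] by simp
 qed (use that in \<open>auto simp: power_le_one\<close>)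
 have pind: "integrable M (%om. indicator (E a) om * v ^ cnt A om)" if "A \<subseteq> I" "0 <= v" "v <= 1" "a : I" for A a and v :: real
  using integrable_real_mult_indicator[OF ev[OF that(4)] powm[OF that(1-3)]] by (simp add: mult.commute)
 define P where "P w = prob {om : space M. cnt I om = w}" for w
 have evw: "{om : space M. cnt I om = w} : events" for w
  using measurable_sets[OF mc[OF order_refl], of "{w}"] by (simp add: vimage_def Int_def conj_commute)
 have ex: "(LINT om|M. h (cnt I om)) = (\<Sum>w\<le>n. P w * h w)" for h :: "nat => real"
 proof -
  have "(LINT om|M. h (cnt I om)) = (LINT om|M. (\<Sum>w\<le>n. h w * indicator {om : space M. cnt I om = w} om))"
  proof (rule Bochner_Integration.integral_cong[OF refl])
   fix om assume "om : space M"
   then have "(\<Sum>w\<le>n. h w * indicator {om : space M. cnt I om = w} om) = (\<Sum>w\<le>n. if w = cnt I om then h w else 0)"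
    by (intro sum.cong) (auto simp: indicator_def)
   also have "... = h (cnt I om)" using cn[OF order_refl, of om] by simp
   finally show "h (cnt I om) = (\<Sum>w\<le>n. h w * indicator {om : space M. cnt I om = w} om)" by simp
  qed
  also have "... = (\<Sum>w\<le>n. \<integral>om. h w * indicator {om : space M. cnt I om = w} om \<partial>M)"
   using evw by (intro Bochner_Integration.integral_sum integrable_mult_right integrable_real_indicator) (auto simp: emeasure_eq_measure)
  also have "... = (\<Sum>w\<le>n. P w * h w)" using evw by (intro sum.cong) (auto simp: P_def)
  finally show ?thesis .
 qed
 define ph where "ph v = (\<Sum>w\<le>n. P w * v ^ w)" for v :: real
 define ph' where "ph' v = (\<Sum>w\<le>n. P w * (real w * v ^ (w - 1)))" for v :: real
 have dph: "(ph has_real_derivative ph' v) (at v)" for v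
  unfolding ph_def[abs_def] ph'_def
  by (intro DERIV_sum DERIV_cmult) (auto intro!: derivative_eq_intros)
 define b where "b = (\<Sum>a\<in>I. (\<Sum>b\<in>N a. prob (E a Int E b)) + prob (E a) * (\<Sum>b\<in>insert a (N a). prob (E b)))"
 have NI: "N a \<subseteq> I" "a \<notin> N a" "finite (N a)" if "a : I" for a using N[OF that] I by (auto intro: finite_subset)
 have part: "cnt I om = cnt (I - insert a (N a)) om + (cnt (N a) om + (if om : E a then 1 else 0))" if a: "a : I" for a om
 proof -
  have "cnt I om = cnt (I - insert a (N a)) om + cnt (insert a (N a)) om"
   unfolding cnt_def using NI[OF a] a I by (intro sum.subset_diff) auto
  also have "cnt (insert a (N a)) om = cnt (N a) om + (if om : E a then 1 else 0)"
   unfolding cnt_def using NI[OF a] by simp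
  finally show ?thesis .
 qed
 have step: "\<bar>(LINT om|M. indicator (E a) om * v ^ (cnt I om - 1)) - prob (E a) * ph v\<bar>
  <= (\<Sum>b\<in>N a. prob (E a Int E b)) + prob (E a) * (\<Sum>b\<in>insert a (N a). prob (E b))"
  if a: "a : I" and v: "0 <= v" "v <= 1" for a v
 proof -
  let ?V = "cnt (I - insert a (N a))" and ?U = "cnt (N a)"
  have vs: "I - insert a (N a) \<subseteq> I" by auto
  have U: "?U = cnt (N a)" ..
  have pw: "0 <= v ^ k" "v ^ k <= 1" for k :: nat using v by (auto simp: power_le_one)
  have iU: "integrable M (%om. indicator (E a) om * (\<Sum>b\<in>N a. indicator (E b) om) :: real)"
   unfolding sum_distrib_left
  proof (rule Bochner_Integration.integrable_sum)
   fix b assume "b : N a"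
   then have "E a Int E b : events" using ev a NI(1)[OF a] by auto
   then have "integrable M (indicator (E a Int E b) :: 'a => real)" by (intro integrable_real_indicator) (auto simp: emeasure_eq_measure)
   moreover have "(%om. indicator (E a) om * indicator (E b) om :: real) = indicator (E a Int E b)" by (auto simp: fun_eq_iff indicator_def)
   ultimately show "integrable M (%om. indicator (E a) om * indicator (E b) om :: real)" by simp
  qed
  have eU: "(LINT om|M. indicator (E a) om * (\<Sum>b\<in>N a. indicator (E b) om)) = (\<Sum>b\<in>N a. prob (E a Int E b))"
  proof -
   have i: "integrable M (indicator (E a Int E b) :: 'a => real)" "E a Int E b : events" if "b : N a" for b
   proof -
    show *: "E a Int E b : events" using ev a NI(1)[OF a] that by auto
    then show "integrable M (indicator (E a Int E b) :: 'a => real)" by (intro integrable_real_indicator) (auto simp: emeasure_eq_measure)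
   qed
   have "(LINT om|M. indicator (E a) om * (\<Sum>b\<in>N a. indicator (E b) om)) = (LINT om|M. (\<Sum>b\<in>N a. indicator (E a Int E b) om :: real))"
    by (simp add: sum_distrib_left indicator_inter_arith)
   also have "... = (\<Sum>b\<in>N a. \<integral>om. indicator (E a Int E b) om \<partial>M)" using i by (intro Bochner_Integration.integral_sum) auto
   also have "... = (\<Sum>b\<in>N a. prob (E a Int E b))" using i(2) by (intro sum.cong) auto
   finally show ?thesis .
  qed
  have iI: "integrable M (%om. \<Sum>b\<in>insert a (N a). indicator (E b) om :: real)"
   using ev a NI(1)[OF a] by (intro Bochner_Integration.integrable_sum integrable_real_indicator) (auto simp: emeasure_eq_measure)
  have eI: "(LINT om|M. (\<Sum>b\<in>insert a (N a). indicator (E b) om)) = (\<Sum>b\<in>insert a (N a). prob (E b))"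
  proof -
   have "(LINT om|M. (\<Sum>b\<in>insert a (N a). indicator (E b) om :: real)) = (\<Sum>b\<in>insert a (N a). \<integral>om. indicator (E b) om \<partial>M)"
    using ev a NI(1)[OF a] by (intro Bochner_Integration.integral_sum integrable_real_indicator) (auto simp: emeasure_eq_measure)
   also have "... = (\<Sum>b\<in>insert a (N a). prob (E b))" using ev a NI(1)[OF a] by (intro sum.cong) auto
   finally show ?thesis .
  qed
  have eq1: "indicator (E a) om * v ^ (cnt I om - 1) = indicator (E a) om * v ^ (?V om + ?U om)" for om
   using part[OF a, of om] by (cases "om : E a") auto
  have vs2: "I - {a} \<subseteq> I" by auto
  have "?V om + ?U om = cnt (I - {a}) om" for om
  proof -
   have "cnt (I - {a}) om = cnt ((I - {a}) - N a) om + cnt (N a) om"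
    unfolding cnt_def using N[OF a] I by (intro sum.subset_diff) auto
   moreover have "(I - {a}) - N a = I - insert a (N a)" by auto
   ultimately show ?thesis by simp
  qed
  then have i1: "integrable M (%om. indicator (E a) om * v ^ (?V om + ?U om))" using pind[OF vs2 v a] by simp
  have i2: "integrable M (%om. indicator (E a) om * v ^ ?V om)" by (rule pind[OF vs v a])
  have s1: "\<bar>(LINT om|M. indicator (E a) om * v ^ (?V om + ?U om)) - (LINT om|M. indicator (E a) om * v ^ ?V om)\<bar> <= (\<Sum>b\<in>N a. prob (E a Int E b))"
  proof -
   have "\<bar>\<integral>om. indicator (E a) om * v ^ (?V om + ?U om) - indicator (E a) om * v ^ ?V om \<partial>M\<bar>
    <= (LINT om|M. \<bar>indicator (E a) om * v ^ (?V om + ?U om) - indicator (E a) om * v ^ ?V om\<bar>)" by (rule integral_abs_bound)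
   also have "... <= (LINT om|M. indicator (E a) om * (\<Sum>b\<in>N a. indicator (E b) om))"
   proof (rule integral_mono)
    fix om
    have "v ^ ?V om * (1 - v ^ ?U om) <= 1 * real (?U om)"
     using pw one_minus_power_le[OF v(1)] by (intro mult_mono) auto
    moreover have "0 <= v ^ ?V om * (1 - v ^ ?U om)" using pw by simp
    moreover have "v ^ (?V om + ?U om) - v ^ ?V om = - (v ^ ?V om * (1 - v ^ ?U om))" by (simp add: power_add algebra_simps)
    ultimately have "\<bar>v ^ (?V om + ?U om) - v ^ ?V om\<bar> <= (\<Sum>b\<in>N a. indicator (E b) om)" unfolding cntr[symmetric] by linarith
    then show "\<bar>indicator (E a) om * v ^ (?V om + ?U om) - indicator (E a) om * v ^ ?V om\<bar> <= indicator (E a) om * (\<Sum>b\<in>N a. indicator (E b) om)"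
     by (cases "om : E a") auto
   qed (use i1 i2 iU in auto)
   finally show ?thesis using i1 i2 eU by simp
  qed
  have s2: "(LINT om|M. indicator (E a) om * v ^ ?V om) = prob (E a) * (LINT om|M. v ^ ?V om)"
   using indep[OF a v] by (simp only: cnt_def)
  have phE: "ph v = (LINT om|M. v ^ cnt I om)" unfolding ph_def by (rule ex[symmetric])
  have s3: "\<bar>(LINT om|M. v ^ ?V om) - ph v\<bar> <= (\<Sum>b\<in>insert a (N a). prob (E b))"
  proof -
   have "\<bar>\<integral>om. v ^ ?V om - v ^ cnt I om \<partial>M\<bar> <= (LINT om|M. \<bar>v ^ ?V om - v ^ cnt I om\<bar>)" by (rule integral_abs_bound)
   also have "... <= (LINT om|M. (\<Sum>b\<in>insert a (N a). indicator (E b) om))"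
   proof (rule integral_mono)
    fix om
    define k where "k = ?U om + (if om : E a then 1 else 0)"
    have ck: "cnt I om = ?V om + k" using part[OF a, of om] by (simp add: k_def)
    have "v ^ ?V om * (1 - v ^ k) <= 1 * real k"
     using pw one_minus_power_le[OF v(1)] by (intro mult_mono) auto
    moreover have "0 <= v ^ ?V om * (1 - v ^ k)" using pw by simp
    moreover have "v ^ ?V om - v ^ cnt I om = v ^ ?V om * (1 - v ^ k)" unfolding ck by (simp add: power_add algebra_simps)
    moreover have "real k = (\<Sum>b\<in>insert a (N a). indicator (E b) om)"
     using NI[OF a] cntr[of "N a" om] by (simp add: k_def indicator_def)
    ultimately show "\<bar>v ^ ?V om - v ^ cnt I om\<bar> <= (\<Sum>b\<in>insert a (N a). indicator (E b) om)" by linarith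
   qed (use powm[OF vs v] powm[OF order_refl v] iI in auto)
   finally show ?thesis using powm[OF vs v] powm[OF order_refl v] eI phE by simp
  qed
  have "\<bar>prob (E a) * (LINT om|M. v ^ ?V om) - prob (E a) * ph v\<bar> <= prob (E a) * (\<Sum>b\<in>insert a (N a). prob (E b))"
  proof -
   have "prob (E a) * (LINT om|M. v ^ ?V om) - prob (E a) * ph v = prob (E a) * ((LINT om|M. v ^ ?V om) - ph v)" by (simp only: right_diff_distrib)
   then show ?thesis using mult_left_mono[OF s3, of "prob (E a)"] by (simp only: abs_mult measure_nonneg abs_of_nonneg)
  qed
  with s1 s2 show ?thesis unfolding eq1 by linarith
 qed
 have ode: "\<bar>ph' v - \<Lambda> * ph v\<bar> <= b" if v: "0 <= v" "v <= 1" for v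
 proof -
  have "ph' v = (LINT om|M. real (cnt I om) * v ^ (cnt I om - 1))" unfolding ph'_def by (rule ex[symmetric])
  also have "... = (LINT om|M. (\<Sum>a\<in>I. indicator (E a) om * v ^ (cnt I om - 1)))" by (simp add: cntr sum_distrib_right)
  also have "... = (\<Sum>a\<in>I. \<integral>om. indicator (E a) om * v ^ (cnt I om - 1) \<partial>M)"
  proof (rule Bochner_Integration.integral_sum)
   fix a assume a: "a : I"
   show "integrable M (%om. indicator (E a) om * v ^ (cnt I om - 1))"
   proof (rule integrable_const_bound[where B=1])
    have "(%om. v ^ (cnt I om - 1)) : borel_measurable M"
     using measurable_compose[OF mc[OF order_refl], of "%k. v ^ (k - 1)" borel] by simp
    then show "(%om. indicator (E a) om * v ^ (cnt I om - 1)) : borel_measurable M"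
     using ev[OF a] by (intro borel_measurable_times borel_measurable_indicator) auto
   qed (use v in \<open>auto simp: power_le_one indicator_def\<close>)
  qed
  finally have "ph' v - \<Lambda> * ph v = (\<Sum>a\<in>I. (LINT om|M. indicator (E a) om * v ^ (cnt I om - 1)) - prob (E a) * ph v)"
   by (simp add: \<Lambda>_def sum_distrib_right sum_subtractf)
  also have "\<bar>\<dots>\<bar> <= b" unfolding b_def by (rule order_trans[OF sum_abs sum_mono]) (rule step[OF _ v])
  finally show ?thesis .
 qed
 have L0: "0 <= \<Lambda>" unfolding \<Lambda>_def by (simp add: sum_nonneg)
 define g where "g v = exp (- \<Lambda> * v) * ph v" for v
 have dg: "(g has_real_derivative exp (- \<Lambda> * v) * (ph' v - \<Lambda> * ph v)) (at v)" for v
 proof -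
  have "((%v. exp (- \<Lambda> * v)) has_real_derivative exp (- \<Lambda> * v) * (- \<Lambda>)) (at v)" by (auto intro!: derivative_eq_intros)
  from DERIV_mult[OF this dph] show ?thesis unfolding g_def[abs_def] by (simp add: algebra_simps)
 qed
 have "norm (g 1 - g 0) <= b * norm (1 - 0 :: real)"
 proof (rule field_differentiable_bound[where S="{0..1}" and f'="%v. exp (- \<Lambda> * v) * (ph' v - \<Lambda> * ph v)"])
  fix v :: real assume v: "v : {0..1}"
  show "(g has_field_derivative exp (- \<Lambda> * v) * (ph' v - \<Lambda> * ph v)) (at v within {0..1})" by (rule DERIV_subset[OF dg]) simp
  have "exp (- \<Lambda> * v) * \<bar>ph' v - \<Lambda> * ph v\<bar> <= 1 * b" using v L0 by (intro mult_mono ode) auto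
  then show "norm (exp (- \<Lambda> * v) * (ph' v - \<Lambda> * ph v)) <= b" by (simp add: abs_mult)
 qed auto
 then have gb: "\<bar>g 1 - g 0\<bar> <= b" by simp
 have "ph 1 = (LINT om|M. 1 ^ cnt I om)" unfolding ph_def by (rule ex[symmetric])
 then have ph1: "ph 1 = 1" by (simp add: prob_space)
 have "ph 0 = (\<Sum>w\<le>n. if w = 0 then P 0 else 0)" unfolding ph_def by (intro sum.cong) auto
 also have "... = P 0" by simp
 also have "... = prob {om : space M. \<forall>a\<in>I. om \<notin> E a}"
  unfolding P_def cnt_def using I by (intro arg_cong[where f=prob]) auto
 finally show ?thesis using gb ph1 unfolding g_def b_def[symmetric] by simp
qed

lemma conv_op_uminus:
 assumes [measurable_cong]: "sets kp = sets borel" and [measurable]: "f : borel_measurable borel"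
 shows "conv_op (distr kp borel uminus) f x = conv_op kp (%z. f (- z)) (- x)"
proof -
 have "conv_op (distr kp borel uminus) f x = (LINT y|kp. f (x + - y))" unfolding conv_op_def by (subst integral_distr) auto
 then show ?thesis by (simp add: conv_op_def)
qed

lemma real_distribution_uminus: "real_distribution kp ==> real_distribution (distr kp borel uminus)"
proof -
 assume "real_distribution kp"
 then interpret real_distribution kp .
 show ?thesis by (rule real_distribution_distr) simp
qed

lemma conv_op_pow_uminus:
 assumes "real_distribution kp" "bdd_borel f"
 shows "(conv_op (distr kp borel uminus) ^^ k) f x = (conv_op kp ^^ k) (%z. f (- z)) (- x)"
proof (induction k arbitrary: x)
 case (Suc k)
 interpret real_distribution kp by fact
 have rd: "real_distribution (distr kp borel uminus)" by (rule real_distribution_uminus) fact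
 have "bdd_borel ((conv_op (distr kp borel uminus) ^^ k) f)" by (rule real_distribution.conv_op_pow_bdd[OF rd assms(2)])
 then have m: "(conv_op (distr kp borel uminus) ^^ k) f : borel_measurable borel" by (rule bdd_borel_measurable)
 have "(conv_op (distr kp borel uminus) ^^ Suc k) f x = conv_op kp (%z. (conv_op (distr kp borel uminus) ^^ k) f (- z)) (- x)"
  using conv_op_uminus[OF events_eq_borel m] by simp
 then show ?case by (simp add: Suc.IH)
qed simp

lemma near_std_uminus:
 assumes "near_std M zt kp" shows "near_std M zt (distr kp borel uminus)"
proof -
 interpret real_distribution kp using assms by (simp add: near_std_def)
 have rd: "real_distribution (distr kp borel uminus)" by (rule real_distribution_uminus) (rule real_distribution_axioms)
 have 1: "(\<integral>y. y \<partial>distr kp borel uminus) = - (LINT y|kp. y)" by (subst integral_distr) auto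
 have 2: "(\<integral>y. y\<^sup>2 \<partial>distr kp borel uminus) = (LINT y|kp. y\<^sup>2)" by (subst integral_distr) auto
 have 3: "(\<integral>y. \<bar>y\<bar> ^ 3 \<partial>distr kp borel uminus) = (LINT y|kp. \<bar>y\<bar> ^ 3)" by (subst integral_distr) auto
 have 4: "AE y in distr kp borel uminus. \<bar>y\<bar> <= 1 / zt"
  using assms by (subst AE_distr_iff) (auto simp: near_std_def)
 show ?thesis using assms unfolding near_std_def 1 2 3 abs_minus_cancel using rd 4 by blast
qed

lemma Phibar_scale:
 assumes r: "0 < r" and s: "\<bar>s - 1\<bar> <= dl" "dl <= 1/2" and c: "2 * exp (3/2) * (1 + sqrt (2 * r)) * (sqrt r * dl) <= 1"
 shows "\<bar>Phibar (sqrt (r * s)) - Phibar (sqrt r)\<bar> <= 2 * exp (3/2) * (1 + sqrt (2 * r)) * (sqrt r * dl) * Phibar (sqrt r)"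
proof -
 define x where "x = exp (3/2) * (1 + sqrt (2 * r)) * (sqrt r * dl)"
 have s0: "1/2 <= s" "s <= 2" and dl0: "0 <= dl" using s by linarith+
 have x0: "0 <= x" using r dl0 by (simp add: x_def)
 have x1: "x <= 1/2" using c by (simp add: x_def)
 have gap: "Phibar v * (1 - x) <= Phibar w & Phibar w <= Phibar v" if vw: "0 <= v" "v <= w" "v <= sqrt (2 * r)" "w - v <= sqrt r * dl" for v w
 proof -
  have "exp (3/2) * (1 + v) * (w - v) <= x" unfolding x_def using vw by (intro mult_mono) auto
  then have "Phibar v * (1 - x) <= Phibar v * (1 - exp (3/2) * (1 + v) * (w - v))"
   using Phibar_bounds(1)[of v] by (intro mult_left_mono) auto
  then show ?thesis using Phibar_shift[of v "w - v"] vw by simp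
 qed
 have diff: "\<bar>sqrt (r * s) - sqrt r\<bar> <= sqrt r * dl"
 proof -
  have "\<bar>sqrt s - 1\<bar> <= \<bar>s - 1\<bar>"
  proof -
   have "s - 1 = (sqrt s - 1) * (sqrt s + 1)" using s0 by (simp add: algebra_simps)
   then have "\<bar>s - 1\<bar> = \<bar>sqrt s - 1\<bar> * (sqrt s + 1)" using s0 by (simp only: abs_mult) simp
   moreover have "\<bar>sqrt s - 1\<bar> * 1 <= \<bar>sqrt s - 1\<bar> * (sqrt s + 1)" using s0 by (intro mult_left_mono) auto
   ultimately show ?thesis by (simp only: mult_1_right)
  qed
  then have "sqrt r * \<bar>sqrt s - 1\<bar> <= sqrt r * dl" using s r by (intro mult_left_mono) auto
  moreover have "sqrt (r * s) - sqrt r = sqrt r * (sqrt s - 1)" by (simp add: real_sqrt_mult algebra_simps)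
  ultimately show ?thesis using r by (simp add: abs_mult)
 qed
 have P0: "0 <= Phibar (sqrt r)" by (rule Phibar_bounds)
 show ?thesis
 proof (cases "s <= 1")
  case True
  have "r * s <= r * 1" using True r by (intro mult_left_mono) auto
  then have le: "sqrt (r * s) <= sqrt r" by simp
  have g: "Phibar (sqrt (r * s)) * (1 - x) <= Phibar (sqrt r) & Phibar (sqrt r) <= Phibar (sqrt (r * s))"
   by (rule gap) (use le diff r s0 in \<open>auto intro: order_trans[OF le]\<close>)
  define a b where "a = Phibar (sqrt (r * s))" and "b = Phibar (sqrt r)"
  have g': "a * (1 - x) <= b" "b <= a" using g by (auto simp: a_def b_def)
  have "b * (2 * x) \<ge> a * x"
  proof -
   have "a * (1/2) <= a * (1 - x)" using x1 Phibar_bounds(1) by (intro mult_left_mono) (auto simp: a_def)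
   then have "a <= 2 * b" using g' by linarith
   then have "a * x <= 2 * b * x" using x0 by (intro mult_right_mono) auto
   then show ?thesis by (simp add: mult_ac)
  qed
  then have "\<bar>a - b\<bar> <= 2 * x * b" using g' by (simp add: algebra_simps)
  then show ?thesis by (simp add: a_def b_def x_def mult_ac)
 next
  case False
  have "r * 1 <= r * s" using False r by (intro mult_left_mono) auto
  then have le: "sqrt r <= sqrt (r * s)" by simp
  have g: "Phibar (sqrt r) * (1 - x) <= Phibar (sqrt (r * s)) & Phibar (sqrt (r * s)) <= Phibar (sqrt r)"
   by (rule gap) (use le diff r in auto)
  define a b where "a = Phibar (sqrt (r * s))" and "b = Phibar (sqrt r)"
  have g': "b * (1 - x) <= a" "a <= b" using g by (auto simp: a_def b_def)
  moreover have "0 <= b * x" using P0 x0 by (simp add: b_def)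
  ultimately have "\<bar>a - b\<bar> <= 2 * x * b" by (simp add: algebra_simps)
  then show ?thesis by (simp add: a_def b_def x_def mult_ac)
 qed
qed

lemma power_bracket:
 fixes x :: real assumes "0 <= x" "x <= 1" 
 shows "(1 + x) ^ d <= 1 + 2 ^ d * x" "1 - 2 ^ d * x <= (1 - x) ^ d"
proof -
 have d: "real k <= 2 ^ k" for k by (rule of_nat_less_two_power[THEN less_imp_le])
 show "(1 + x) ^ d <= 1 + 2 ^ d * x"
 proof (induction d)
  case (Suc d)
  show ?case
  proof -
   have "(1 + x) ^ d * x <= 2 ^ d * x" using assms by (intro mult_right_mono power_mono) auto
   moreover have "(1 + x) ^ Suc d = (1 + x) ^ d + (1 + x) ^ d * x" by (simp add: algebra_simps)
   ultimately show ?thesis using Suc by simp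
  qed
 qed (use assms in simp)
 have "1 + real d * (- x) <= (1 + - x) ^ d" using assms by (intro Bernoulli_inequality) auto
 moreover have "real d * x <= 2 ^ d * x" using d assms by (intro mult_right_mono) auto
 ultimately show "1 - 2 ^ d * x <= (1 - x) ^ d" by simp
qed

lemma (in prob_space) distr_sum_eq_conv_pow:
 assumes "finite I" "indep_vars (%_. borel) Y I" "!!i. i : I ==> distr M borel (Y i) = kp"
  and kp: "real_distribution kp" and rh: "real_distribution rh" "!!f. bdd_borel f ==> (conv_op kp ^^ card I) f = conv_op rh f"
 shows "distr M borel (%om. \<Sum>i\<in>I. Y i om) = rh"
proof -
 interpret rh: real_distribution rh by fact
 have rv[measurable]: "(%om. \<Sum>i\<in>I. Y i om) : borel_measurable M"
  using assms(2) by (intro borel_measurable_sum) (auto simp: indep_vars_def)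
 interpret D: prob_space "distr M borel (%om. \<Sum>i\<in>I. Y i om)" by (rule prob_space_distr) simp
 show ?thesis
 proof (rule measure_eqI)
  fix A assume "A : sets (distr M borel (%om. \<Sum>i\<in>I. Y i om))"
  then have A[measurable]: "A : sets borel" by simp
  have bA: "bdd_borel (indicator A)" by (rule bdd_borel_indicator[OF A])
  have "measure (distr M borel (%om. \<Sum>i\<in>I. Y i om)) A = (\<integral>y. indicator A y \<partial>distr M borel (%om. \<Sum>i\<in>I. Y i om))" by simp
  also have "... = (LINT om|M. indicator A (0 + (\<Sum>i\<in>I. Y i om)))" by (subst integral_distr) auto
  also have "... = (conv_op kp ^^ card I) (indicator A) 0" by (rule expectation_sum_conv_op[OF assms(1,2,3) kp bA])
  also have "... = measure rh A" unfolding rh(2)[OF bA] by (simp add: conv_op_def)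
  finally show "emeasure (distr M borel (%om. \<Sum>i\<in>I. Y i om)) A = emeasure rh A"
   by (simp add: D.emeasure_eq_measure rh.emeasure_eq_measure)
 qed simp
qed

theorem square_tail_moderate:
 fixes M U B K :: real
 assumes M: "0 <= M" and U: "1 <= U" and B: "0 <= B" and K: "0 <= K"
 obtains C where "1 <= C" "!!kp zt n rh r s. near_std M zt kp ==> 0 < zt ==> 1 <= n ==> 1 <= real n * zt\<^sup>2 ==>
  ln n <= B * (real n * zt\<^sup>2) ==> C * ((real n * zt\<^sup>2)\<^sup>2 / sqrt n) <= 1 ==>
  real_distribution rh ==> (!!f. bdd_borel f ==> (conv_op kp ^^ n) f = conv_op rh f) ==>
  \<bar>s - 1\<bar> <= K * zt ==> 0 < r ==> r <= U\<^sup>2 * (real n * zt\<^sup>2) ==>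
  \<bar>measure rh {x. r * s * real n <= x\<^sup>2} - 2 * Phibar (sqrt r)\<bar> <= C * ((real n * zt\<^sup>2)\<^sup>2 / sqrt n) * (2 * Phibar (sqrt r))"
proof -
 have U2: "0 <= 2 * U" using U by simp
 obtain C1 c1 where C1: "0 < C1" "1 <= c1" and cr: "!!kp zt h n. near_std M zt kp ==> 0 < zt ==> c1 * zt <= 1 ==> 1 <= n ==> real n * zt ^ 3 <= 1 ==>
  0 < h ==> h <= 2 * U * zt ==>
  \<bar>(conv_op kp ^^ n) (indicator {h * real n..}) 0 - Phibar (h * sqrt n)\<bar>
   <= C1 * (real n * zt ^ 3 + (1 + h * sqrt n) * ((1 + real n * zt\<^sup>2 + zt * (sqrt n * (1 + ln n))) / sqrt n)) * Phibar (h * sqrt n)"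
  using cramer_upper_tail[OF M U2] by blast
 define C2 where "C2 = C1 * (1 + (1 + 2 * U) * (3 + B))"
 define C3 where "C3 = 2 * exp (3/2) * (1 + 2 * U) * (U * K)"
 define C where "C = c1 + 2 * K + 2 * C2 + C3 + 1"
 have C2: "0 <= C2" using C1 U B by (simp add: C2_def)
 have C3: "0 <= C3" using U K by (simp add: C3_def)
 have Cb: "1 <= C" "c1 <= C" "2 * K <= C" "2 * C2 + C3 <= C" "C3 <= C" unfolding C_def using C1 C2 C3 K by linarith+
 show ?thesis
 proof (rule that[OF Cb(1)])
  fix kp zt and n :: nat and rh r s
  assume kp: "near_std M zt kp" and zt: "0 < zt" and n: "1 <= n" and L1: "1 <= real n * zt\<^sup>2" and lnn: "ln n <= B * (real n * zt\<^sup>2)"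
   and small: "C * ((real n * zt\<^sup>2)\<^sup>2 / sqrt n) <= 1" and rh: "real_distribution rh" "!!f. bdd_borel f ==> (conv_op kp ^^ n) f = conv_op rh f"
   and s: "\<bar>s - 1\<bar> <= K * zt" and r: "0 < r" "r <= U\<^sup>2 * (real n * zt\<^sup>2)"
  interpret rh: real_distribution rh by (rule rh(1))
  have rd: "real_distribution kp" using kp by (simp add: near_std_def)
  define q where "q = sqrt n"
  have q: "0 < q" and qq: "q\<^sup>2 = real n" using n by (auto simp: q_def)
  define l where "l = q * zt"
  have l0: "0 < l" using q zt by (simp add: l_def)
  have l2: "real n * zt\<^sup>2 = l\<^sup>2" unfolding l_def power_mult_distrib qq ..
  have l1: "1 <= l" using L1 l0 unfolding l2 by (simp add: one_le_power power2_ge_1_iff abs_le_iff)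
  define e where "e = (l\<^sup>2)\<^sup>2 / q"
  have e0: "0 < e" using l0 q by (simp add: e_def)
  have small': "C * e <= 1" using small by (simp only: e_def l2 q_def)
  have ztq: "zt = l / q" using q by (simp add: l_def)
  have lp: "l <= l ^ 4" "l\<^sup>2 <= l ^ 4" "l ^ 3 <= l ^ 4" using l1 power_increasing[of 1 4 l] power_increasing[of 2 4 l] power_increasing[of 3 4 l] by auto
  have e4: "e = l ^ 4 / q" by (simp add: e_def flip: power_mult)
  have zte: "zt <= e" unfolding ztq e4 using lp(1) q by (intro divide_right_mono) auto
  have ce: "x * e <= 1" if "x <= C" for x using mult_right_mono[OF that, of e] e0 small' by linarith
  have cz: "x * zt <= 1" if "x <= C" "0 <= x" for x using mult_left_mono[OF zte that(2)] ce[OF that(1)] by linarith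
  have nz3: "real n * zt ^ 3 = l ^ 3 / q" unfolding ztq qq[symmetric] using q by (simp add: power_divide power2_eq_square power3_eq_cube)
  have nz3e: "real n * zt ^ 3 <= e" unfolding nz3 e4 using lp q by (intro divide_right_mono) auto
  have nz31: "real n * zt ^ 3 <= 1" using nz3e ce[OF Cb(1)] by linarith
  have K2: "K * zt <= 1/2" using cz[OF Cb(3)] K by simp
  have s0: "1/2 <= s" "s <= 2" using s K2 by linarith+
  define u where "u = sqrt (r * s)"
  have u0: "0 < u" using r s0 by (simp add: u_def)
  have ul: "u <= 2 * U * l"
  proof -
   have "r * s <= (U\<^sup>2 * l\<^sup>2) * 2" using r(2) s0 r(1) unfolding l2 by (intro mult_mono) auto
   also have "... <= (2 * U * l)\<^sup>2" by (simp add: power_mult_distrib)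
   finally have "u <= sqrt ((2 * U * l)\<^sup>2)" unfolding u_def by (rule real_sqrt_le_mono)
   then show ?thesis using U l0 by simp
  qed
  define h where "h = u / q"
  have h0: "0 < h" using u0 q by (simp add: h_def)
  have hq: "h * sqrt n = u" using q by (simp add: h_def q_def)
  have hU: "h <= 2 * U * zt"
  proof -
   have "u / q <= (2 * U * l) / q" using ul q by (intro divide_right_mono) auto
   then show ?thesis by (simp add: h_def ztq)
  qed
  have hn: "h * real n = sqrt (r * s * real n)"
  proof -
   have "h * real n = u * q" unfolding h_def qq[symmetric] using q by (simp add: power2_eq_square)
   then show ?thesis by (simp add: u_def q_def real_sqrt_mult)
  qed
  have bnd: "C1 * (real n * zt ^ 3 + (1 + h * sqrt n) * ((1 + real n * zt\<^sup>2 + zt * (sqrt n * (1 + ln n))) / sqrt n)) <= C2 * e"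
  proof -
   have a1: "zt * (sqrt n * (1 + ln n)) <= l * (1 + B * l\<^sup>2)"
   proof -
    have "zt * (sqrt n * (1 + ln n)) = l * (1 + ln n)" by (simp add: l_def q_def)
    also have "... <= l * (1 + B * l\<^sup>2)" using lnn l0 unfolding l2 by (intro mult_left_mono) auto
    finally show ?thesis .
   qed
   have l3: "l * l\<^sup>2 = l ^ 3" by (simp add: power3_eq_cube power2_eq_square)
   have p: "1 <= l ^ 3" "l\<^sup>2 <= l ^ 3" "l <= l ^ 3" using l1 power_increasing[of 2 3 l] power_increasing[of 1 3 l] by (auto intro: one_le_power)
   have "1 + real n * zt\<^sup>2 + zt * (sqrt n * (1 + ln n)) <= 1 + l\<^sup>2 + (l + B * l ^ 3)"
    using a1 unfolding l2 by (simp add: algebra_simps l3[symmetric])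
   also have "... <= (3 + B) * l ^ 3" using p by (simp add: algebra_simps)
   finally have a2: "1 + real n * zt\<^sup>2 + zt * (sqrt n * (1 + ln n)) <= (3 + B) * l ^ 3" .
   have a3: "1 + h * sqrt n <= (1 + 2 * U) * l" using ul l1 unfolding hq by (simp add: algebra_simps)
   have "(1 + h * sqrt n) * ((1 + real n * zt\<^sup>2 + zt * (sqrt n * (1 + ln n))) / sqrt n)
    <= ((1 + 2 * U) * l) * (((3 + B) * l ^ 3) / q)"
    unfolding q_def[symmetric] using a2 a3 q U l0 B zt n by (intro mult_mono divide_right_mono) (auto simp: q_def)
   also have "... = ((1 + 2 * U) * (3 + B)) * e" unfolding e4 by (simp add: power3_eq_cube power4_eq_xxxx)
   finally have "real n * zt ^ 3 + (1 + h * sqrt n) * ((1 + real n * zt\<^sup>2 + zt * (sqrt n * (1 + ln n))) / sqrt n)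
    <= e + ((1 + 2 * U) * (3 + B)) * e" using nz3e by linarith
   also have "... = (1 + (1 + 2 * U) * (3 + B)) * e" by (simp add: algebra_simps)
   finally show ?thesis unfolding C2_def mult.assoc[of C1] using C1 by (intro mult_left_mono) auto
  qed
  have one: "\<bar>(conv_op kp' ^^ n) (indicator {h * real n..}) 0 - Phibar u\<bar> <= C2 * e * Phibar u" if "near_std M zt kp'" for kp'
  proof -
   have "c1 * zt <= 1" by (rule cz[OF Cb(2)]) (use C1 in simp)
   from cr[OF that zt this n nz31 h0 hU] mult_right_mono[OF bnd Phibar_bounds(1)[of u]]
   show ?thesis unfolding hq by linarith
  qed
  have bi: "bdd_borel (indicator {h * real n..})" "bdd_borel (indicator {..- (h * real n)})" by (auto intro!: bdd_borel_indicator)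
  have t1: "\<bar>measure rh {h * real n..} - Phibar u\<bar> <= C2 * e * Phibar u"
   using one[OF kp] conv_op_upper[OF rh(1), of "h * real n" 0] by (simp add: rh(2)[OF bi(1)])
  have t2: "\<bar>measure rh {..- (h * real n)} - Phibar u\<bar> <= C2 * e * Phibar u"
  proof -
   have "(%z. indicator {h * real n..} (- z)) = (indicator {..- (h * real n)} :: real => real)" by (auto simp: indicator_def fun_eq_iff)
   then have "(conv_op (distr kp borel uminus) ^^ n) (indicator {h * real n..}) 0 = conv_op rh (indicator {..- (h * real n)}) 0"
    using conv_op_pow_uminus[OF rd bi(1), of n 0] rh(2)[OF bi(2)] by simp
   also have "... = measure rh {..- (h * real n)}" by (simp add: conv_op_def)
   finally show ?thesis using one[OF near_std_uminus[OF kp]] by simp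
  qed
  have v0: "0 < r * s * real n" using r s0 n by simp
  have "measure rh {x. r * s * real n <= x\<^sup>2} = measure rh {h * real n..} + measure rh {..- (h * real n)}"
   unfolding two_sided_sets(1)[OF v0] hn using two_sided_sets(2)[OF v0] by (intro rh.finite_measure_Union) auto
  with t1 t2 have A: "\<bar>measure rh {x. r * s * real n <= x\<^sup>2} - 2 * Phibar u\<bar> <= 2 * (C2 * e * Phibar u)" by linarith
  have sr: "sqrt r <= U * l"
  proof -
   have "sqrt r <= sqrt ((U * l)\<^sup>2)" using r unfolding l2 by (intro real_sqrt_le_mono) (simp add: power_mult_distrib)
   then show ?thesis using U l0 by simp
  qed
  have sr2: "1 + sqrt (2 * r) <= (1 + 2 * U) * l"
  proof -
   have "sqrt (2 * r) <= sqrt ((2 * (U * l))\<^sup>2)" using r unfolding l2 by (intro real_sqrt_le_mono) (simp add: power_mult_distrib)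
   moreover have "sqrt ((2 * (U * l))\<^sup>2) = 2 * (U * l)" unfolding real_sqrt_abs using U l0 by simp
   ultimately have "sqrt (2 * r) <= 2 * (U * l)" by (simp only:)
   then show ?thesis using l1 by (simp add: algebra_simps)
  qed
  have x: "2 * exp (3/2) * (1 + sqrt (2 * r)) * (sqrt r * (K * zt)) <= C3 * e"
  proof -
   have "2 * exp (3/2) * (1 + sqrt (2 * r)) * (sqrt r * (K * zt)) <= 2 * exp (3/2) * ((1 + 2 * U) * l) * ((U * l) * (K * zt))"
    using sr sr2 r K zt U l0 by (intro mult_mono) auto
   also have "... = C3 * (l ^ 3 / q)" unfolding ztq C3_def by (simp add: power3_eq_cube)
   also have "... <= C3 * e" unfolding e4 using C3 lp q by (intro mult_left_mono divide_right_mono) auto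
   finally show ?thesis .
  qed
  have Pb: "\<bar>Phibar u - Phibar (sqrt r)\<bar> <= C3 * e * Phibar (sqrt r)"
  proof -
   have "2 * exp (3/2) * (1 + sqrt (2 * r)) * (sqrt r * (K * zt)) <= 1" using x ce[OF Cb(5)] by linarith
   from Phibar_scale[OF r(1) s K2 this] mult_right_mono[OF x Phibar_bounds(1)[of "sqrt r"]]
   show ?thesis unfolding u_def by linarith
  qed
  have "C3 * e <= 1" by (rule ce[OF Cb(5)])
  then have "C3 * e * Phibar (sqrt r) <= 1 * Phibar (sqrt r)" by (intro mult_right_mono Phibar_bounds)
  then have "Phibar u <= 2 * Phibar (sqrt r)" using Pb by linarith
  then have "C2 * e * Phibar u <= C2 * e * (2 * Phibar (sqrt r))" using C2 e0 by (intro mult_left_mono) auto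
  with A Pb have "\<bar>measure rh {x. r * s * real n <= x\<^sup>2} - 2 * Phibar (sqrt r)\<bar> <= (2 * C2 + C3) * e * (2 * Phibar (sqrt r))"
   by (simp only: distrib_right mult.assoc)
  also have "... <= C * e * (2 * Phibar (sqrt r))" using Cb(4) e0 Phibar_bounds(1) by (intro mult_right_mono) auto
  finally show "\<bar>measure rh {x. r * s * real n <= x\<^sup>2} - 2 * Phibar (sqrt r)\<bar> <= C * ((real n * zt\<^sup>2)\<^sup>2 / sqrt n) * (2 * Phibar (sqrt r))"
   by (simp only: e_def l2 q_def)
 qed
qed

definition good_net :: "nat => real => (nat => real) set => bool" where
 "good_net d ep F \<longleftrightarrow> finite F & (\<forall>tt\<in>F. (\<Sum>m=1..d. (tt m)\<^sup>2) <= 4) & (\<forall>tt\<in>F. \<forall>m\<in>{1..d}. \<bar>tt m\<bar> <= 2) \<and>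
  (\<forall>s. 1 <= (\<Sum>m=1..d. (s m)\<^sup>2) --> (\<exists>tt\<in>F. (1 - ep) / 2 <= (\<Sum>m=1..d. tt m * s m) - (\<Sum>m=1..d. (tt m)\<^sup>2) / 2))"

lemma good_net_exists:
 fixes d :: nat and ep :: real
 assumes e: "0 < ep" "ep <= 1"
 shows "\<exists>F. good_net d ep F"
proof -
 obtain N :: nat where N: "real d / ep + 1 < real N" using reals_Archimedean2[of "real d / ep + 1"] by (elim exE)
 have N1: "1 <= real N"
 proof -
  have "0 <= real d / ep" using e by simp
  then show ?thesis using N by linarith
 qed
 have dN: "real d * (1 / real N)\<^sup>2 <= ep"
 proof -
  have "real d / ep <= real N * 1" using N by linarith
  also have "... <= real N * real N" using N1 by (intro mult_left_mono) auto
  finally have "real d <= ep * (real N * real N)" using e by (simp add: pos_divide_le_eq mult.commute)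
  then have "real d / (real N * real N) <= ep" using N1 by (subst pos_divide_le_eq) (auto intro: mult_pos_pos)
  then show ?thesis by (simp add: power2_eq_square)
 qed
 define G where "G = (%k. real_of_int k / real N) ` {- int (2 * N) .. int (2 * N)}"
 define F where "F = {tt : PiE {1..d} (%_. G). (\<Sum>m=1..d. (tt m)\<^sup>2) <= 4}"
 have fG: "finite G" by (simp add: G_def)
 have fF: "finite F" unfolding F_def by (rule finite_subset[OF _ finite_PiE[of "{1..d}" "%_. G"]]) (use fG in auto)
 have sq: "\<bar>tt m\<bar> <= 2" if "tt : F" "m : {1..d}" for tt m
 proof -
  have "(tt m)\<^sup>2 <= (\<Sum>m=1..d. (tt m)\<^sup>2)" by (rule member_le_sum[OF that(2)]) auto
  also have "... <= 2\<^sup>2" using that by (simp add: F_def)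
  finally show ?thesis using abs_le_square_iff[of "tt m" 2] by simp
 qed
 show ?thesis
  unfolding good_net_def
 proof (intro exI[of _ F] conjI ballI allI impI)
  show "finite F" by (rule fF)
  show "(\<Sum>m=1..d. (tt m)\<^sup>2) <= 4" if "tt : F" for tt using that by (simp add: F_def)
  show "\<bar>tt m\<bar> <= 2" if "tt : F" "m : {1..d}" for tt m using that by (rule sq)
 next
  fix s :: "nat => real" assume s1: "1 <= (\<Sum>m=1..d. (s m)\<^sup>2)"
  define R where "R = sqrt (\<Sum>m=1..d. (s m)\<^sup>2)"
  have R1: "1 <= R" using s1 by (simp add: R_def)
  have R2: "R\<^sup>2 = (\<Sum>m=1..d. (s m)\<^sup>2)" using s1 by (simp add: R_def)
  define t where "t m = s m / R" for m
  have st: "s m = R * t m" for m using R1 by (simp add: t_def)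
  have t1: "(\<Sum>m=1..d. (t m)\<^sup>2) = 1"
  proof -
   have "(\<Sum>m=1..d. (t m)\<^sup>2) = (\<Sum>m=1..d. (s m)\<^sup>2) / R\<^sup>2" by (simp add: t_def power_divide sum_divide_distrib)
   also have "... = R\<^sup>2 / R\<^sup>2" unfolding R2 ..
   also have "... = 1" using R1 by simp
   finally show ?thesis .
  qed
  have tm: "\<bar>t m\<bar> <= 1" if "m : {1..d}" for m
  proof -
   have "(t m)\<^sup>2 <= (\<Sum>m=1..d. (t m)\<^sup>2)" by (rule member_le_sum[OF that]) auto
   then show ?thesis using t1 abs_square_le_1[of "t m"] by simp
  qed
  define tt where "tt = (\<lambda>m\<in>{1..d}. real_of_int \<lfloor>real N * t m\<rfloor> / real N)"
  have near: "\<bar>tt m - t m\<bar> <= 1 / real N" if "m : {1..d}" for m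
  proof -
   have "\<bar>real_of_int \<lfloor>real N * t m\<rfloor> - real N * t m\<bar> <= 1" by linarith
   then have "\<bar>real_of_int \<lfloor>real N * t m\<rfloor> - real N * t m\<bar> / real N <= 1 / real N" by (rule divide_right_mono) simp
   moreover have "tt m - t m = (real_of_int \<lfloor>real N * t m\<rfloor> - real N * t m) / real N" 
   proof -
    have "tt m = real_of_int \<lfloor>real N * t m\<rfloor> / real N" using that by (simp add: tt_def)
    moreover have "t m = real N * t m / real N" using N1 by simp
    ultimately show ?thesis unfolding diff_divide_distrib by linarith
   qed
   ultimately show ?thesis by (simp add: abs_divide)
  qed
  have D: "(\<Sum>m=1..d. (tt m - t m)\<^sup>2) <= ep"
  proof -
   have "(\<Sum>m=1..d. (tt m - t m)\<^sup>2) <= (\<Sum>m=1..d. (1 / real N)\<^sup>2)"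
   proof (rule sum_mono)
    fix m assume "m : {1..d}"
    from power_mono[OF near[OF this], of 2] show "(tt m - t m)\<^sup>2 <= (1 / real N)\<^sup>2" by simp
   qed
   then show ?thesis using dN by simp
  qed
  have T4: "(\<Sum>m=1..d. (tt m)\<^sup>2) <= 4"
  proof -
   have "(\<Sum>m=1..d. (tt m)\<^sup>2) <= (\<Sum>m=1..d. 2 * (t m)\<^sup>2 + 2 * (tt m - t m)\<^sup>2)"
   proof (rule sum_mono)
    fix m
    show "(tt m)\<^sup>2 <= 2 * (t m)\<^sup>2 + 2 * (tt m - t m)\<^sup>2"
     using zero_le_power2[of "tt m - 2 * t m"] by (simp add: power2_eq_square algebra_simps)
   qed
   also have "... = 2 * (\<Sum>m=1..d. (t m)\<^sup>2) + 2 * (\<Sum>m=1..d. (tt m - t m)\<^sup>2)" by (simp add: sum.distrib sum_distrib_left)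
   finally show ?thesis using D t1 e by linarith
  qed
  have "tt : PiE {1..d} (%_. G)"
  proof (rule PiE_I)
   fix m assume m: "m : {1..d}"
   have "real N * (-1) <= real N * t m" using tm[OF m] by (intro mult_left_mono) linarith+
   then have "- int N <= \<lfloor>real N * t m\<rfloor>" unfolding le_floor_iff by simp
   moreover have "real N * t m <= real N * 1" using tm[OF m] by (intro mult_left_mono) linarith+
   then have "\<lfloor>real N * t m\<rfloor> <= \<lfloor>real N * 1\<rfloor>" by (rule floor_mono)
   ultimately have "\<lfloor>real N * t m\<rfloor> : {- int (2 * N) .. int (2 * N)}" by simp
   then show "tt m : G" using m by (auto simp: tt_def G_def)
  qed (auto simp: tt_def)
  then have ttF: "tt : F" using T4 by (simp add: F_def)
  have eq: "(\<Sum>m=1..d. tt m * t m) - (\<Sum>m=1..d. (tt m)\<^sup>2) / 2 = ((\<Sum>m=1..d. (t m)\<^sup>2) - (\<Sum>m=1..d. (tt m - t m)\<^sup>2)) / 2"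
  proof -
   have "(\<Sum>m=1..d. (tt m - t m)\<^sup>2) = (\<Sum>m=1..d. (tt m)\<^sup>2 - 2 * (tt m * t m) + (t m)\<^sup>2)" by (rule sum.cong) (auto simp: power2_diff)
   also have "... = (\<Sum>m=1..d. (tt m)\<^sup>2) - 2 * (\<Sum>m=1..d. tt m * t m) + (\<Sum>m=1..d. (t m)\<^sup>2)"
    by (simp only: sum.distrib sum_subtractf sum_distrib_left)
   finally show ?thesis by simp
  qed
  have low: "(1 - ep) / 2 <= (\<Sum>m=1..d. tt m * t m) - (\<Sum>m=1..d. (tt m)\<^sup>2) / 2" unfolding eq t1 using D by simp
  have Q0: "0 <= (\<Sum>m=1..d. (tt m)\<^sup>2)" by (rule sum_nonneg) simp
  have "0 <= A" if "(1 - ep) / 2 <= A - Q / 2" "0 <= Q" for A Q :: real using that e by argo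
  from this[OF low Q0] have p: "0 <= (\<Sum>m=1..d. tt m * t m)" .
  have "(\<Sum>m=1..d. tt m * s m) = R * (\<Sum>m=1..d. tt m * t m)" by (simp add: st sum_distrib_left mult_ac)
  moreover have "1 * (\<Sum>m=1..d. tt m * t m) <= R * (\<Sum>m=1..d. tt m * t m)" by (rule mult_right_mono[OF R1 p])
  ultimately have "(1 - ep) / 2 <= (\<Sum>m=1..d. tt m * s m) - (\<Sum>m=1..d. (tt m)\<^sup>2) / 2" using low by linarith
  then show "\<exists>tt\<in>F. (1 - ep) / 2 <= (\<Sum>m=1..d. tt m * s m) - (\<Sum>m=1..d. (tt m)\<^sup>2) / 2" using ttF by blast
 qed
qed

lemma net_exponential:
 assumes F: "good_net d ep F" and r: "0 < r" and n: "0 < (n::real)" and S: "r\<^sup>2 * n <= (\<Sum>m=1..d. (S m)\<^sup>2)"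
 shows "1 <= (\<Sum>tt\<in>F. exp (r / sqrt n * (\<Sum>m=1..d. tt m * S m) - r\<^sup>2 * (\<Sum>m=1..d. (tt m)\<^sup>2) / 2 - (1 - ep) * r\<^sup>2 / 2))"
proof -
 define s where "s m = S m / (r * sqrt n)" for m
 have "(\<Sum>m=1..d. (s m)\<^sup>2) = (\<Sum>m=1..d. (S m)\<^sup>2) / (r\<^sup>2 * n)"
  unfolding s_def power_divide power_mult_distrib sum_divide_distrib using n by simp
 then have "1 <= (\<Sum>m=1..d. (s m)\<^sup>2)" using S r n by (simp add: le_divide_eq)
 then obtain tt where tt: "tt : F" and g: "(1 - ep) / 2 <= (\<Sum>m=1..d. tt m * s m) - (\<Sum>m=1..d. (tt m)\<^sup>2) / 2"
  using F unfolding good_net_def by blast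
 have e: "r\<^sup>2 * (\<Sum>m=1..d. tt m * s m) = r / sqrt n * (\<Sum>m=1..d. tt m * S m)"
  unfolding sum_distrib_left using r by (intro sum.cong) (auto simp: s_def power2_eq_square)
 have "r\<^sup>2 * ((1 - ep) / 2) <= r\<^sup>2 * ((\<Sum>m=1..d. tt m * s m) - (\<Sum>m=1..d. (tt m)\<^sup>2) / 2)" using g by (intro mult_left_mono) auto
 then have "0 <= r / sqrt n * (\<Sum>m=1..d. tt m * S m) - r\<^sup>2 * (\<Sum>m=1..d. (tt m)\<^sup>2) / 2 - (1 - ep) * r\<^sup>2 / 2"
  unfolding right_diff_distrib e by (simp add: mult_ac)
 then have "1 <= exp (r / sqrt n * (\<Sum>m=1..d. tt m * S m) - r\<^sup>2 * (\<Sum>m=1..d. (tt m)\<^sup>2) / 2 - (1 - ep) * r\<^sup>2 / 2)" by simp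
 also have "... <= (\<Sum>tt\<in>F. exp (r / sqrt n * (\<Sum>m=1..d. tt m * S m) - r\<^sup>2 * (\<Sum>m=1..d. (tt m)\<^sup>2) / 2 - (1 - ep) * r\<^sup>2 / 2))"
  by (rule member_le_sum[OF tt]) (use F in \<open>auto simp: good_net_def\<close>)
 finally show ?thesis .
qed

lemma (in prob_space) chernoff_single:
 assumes F: "good_net d ep F" and r: "0 < r" and n: "0 < (n::real)" and e: "0 <= ep" and D: "0 <= D"
  and [measurable]: "!!m. m : {1..d} ==> S m : borel_measurable M" "B : events"
  and i: "!!tt. tt : F ==> integrable M (%om. indicator B om * exp (r / sqrt n * (\<Sum>m=1..d. tt m * S m om)))"
  and b: "!!tt. tt : F ==> (LINT om|M. indicator B om * exp (r / sqrt n * (\<Sum>m=1..d. tt m * S m om))) <= D * exp ((1 + ep) * r\<^sup>2 * (\<Sum>m=1..d. (tt m)\<^sup>2) / 2)"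
 shows "prob (B Int {om : space M. r\<^sup>2 * n <= (\<Sum>m=1..d. (S m om)\<^sup>2)}) <= real (card F) * D * exp (- (1 - 5 * ep) * r\<^sup>2 / 2)"
proof -
 define c where "c tt = exp (- r\<^sup>2 * (\<Sum>m=1..d. (tt m)\<^sup>2) / 2 - (1 - ep) * r\<^sup>2 / 2)" for tt :: "nat => real"
 let ?E = "B Int {om : space M. r\<^sup>2 * n <= (\<Sum>m=1..d. (S m om)\<^sup>2)}"
 have mE: "?E : events" by measurable
 have "prob ?E = (LINT om|M. indicator ?E om)" using mE by simp
 also have "... <= (LINT om|M. (\<Sum>tt\<in>F. c tt * (indicator B om * exp (r / sqrt n * (\<Sum>m=1..d. tt m * S m om)))))"
 proof (rule integral_mono)
  show "integrable M (indicator ?E :: 'a => real)" using mE by (intro integrable_real_indicator) (auto simp: emeasure_eq_measure)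
  show "integrable M (%om. \<Sum>tt\<in>F. c tt * (indicator B om * exp (r / sqrt n * (\<Sum>m=1..d. tt m * S m om))))"
   by (intro Bochner_Integration.integrable_sum integrable_mult_right i)
  fix om
  show "indicator ?E om <= (\<Sum>tt\<in>F. c tt * (indicator B om * exp (r / sqrt n * (\<Sum>m=1..d. tt m * S m om))))"
  proof (cases "om : ?E")
   case True
   then have "1 <= (\<Sum>tt\<in>F. exp (r / sqrt n * (\<Sum>m=1..d. tt m * S m om) - r\<^sup>2 * (\<Sum>m=1..d. (tt m)\<^sup>2) / 2 - (1 - ep) * r\<^sup>2 / 2))"
    by (intro net_exponential[OF F r n]) auto
   also have "... = (\<Sum>tt\<in>F. c tt * (indicator B om * exp (r / sqrt n * (\<Sum>m=1..d. tt m * S m om))))"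
    using True by (intro sum.cong) (auto simp: c_def exp_add[symmetric] indicator_def)
   finally show ?thesis using True by simp
  next
   case False
   then show ?thesis by (auto intro!: sum_nonneg simp: c_def)
  qed
 qed
 also have "... = (\<Sum>tt\<in>F. c tt * (LINT om|M. indicator B om * exp (r / sqrt n * (\<Sum>m=1..d. tt m * S m om))))"
  using i by (subst Bochner_Integration.integral_sum) auto
 also have "... <= (\<Sum>tt\<in>F. D * exp (- (1 - 5 * ep) * r\<^sup>2 / 2))"
 proof (rule sum_mono)
  fix tt assume tt: "tt : F"
  define q where "q = (\<Sum>m=1..d. (tt m)\<^sup>2)"
  have q4: "q <= 4" using F tt by (simp add: good_net_def q_def)
  have "c tt * (LINT om|M. indicator B om * exp (r / sqrt n * (\<Sum>m=1..d. tt m * S m om))) <= c tt * (D * exp ((1 + ep) * r\<^sup>2 * q / 2))"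
   unfolding q_def by (intro mult_left_mono b tt) (simp add: c_def)
  also have "... = D * (exp (- r\<^sup>2 * q / 2 - (1 - ep) * r\<^sup>2 / 2) * exp ((1 + ep) * r\<^sup>2 * q / 2))" by (simp only: c_def q_def mult_ac)
  also have "... = D * exp (ep * r\<^sup>2 * q / 2 - (1 - ep) * r\<^sup>2 / 2)" unfolding exp_add[symmetric]
  proof -
   have "- r\<^sup>2 * q / 2 - (1 - ep) * r\<^sup>2 / 2 + (1 + ep) * r\<^sup>2 * q / 2 = ep * r\<^sup>2 * q / 2 - (1 - ep) * r\<^sup>2 / 2" by (simp add: field_simps)
   then show "D * exp (- r\<^sup>2 * q / 2 - (1 - ep) * r\<^sup>2 / 2 + (1 + ep) * r\<^sup>2 * q / 2) = D * exp (ep * r\<^sup>2 * q / 2 - (1 - ep) * r\<^sup>2 / 2)" by (simp only:)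
  qed
  also have "... <= D * exp (- (1 - 5 * ep) * r\<^sup>2 / 2)"
  proof (intro mult_left_mono D, subst exp_le_cancel_iff)
   have "ep * r\<^sup>2 * q <= ep * r\<^sup>2 * 4" using q4 e by (intro mult_left_mono) auto
   moreover have "(1 - ep) * r\<^sup>2 = r\<^sup>2 - ep * r\<^sup>2" "- (1 - 5 * ep) * r\<^sup>2 = 5 * (ep * r\<^sup>2) - r\<^sup>2" by (simp_all add: algebra_simps)
   moreover have "x / 2 - (R - P) / 2 <= (5 * P - R) / 2" if "x <= P * 4" for x P R :: real using that by argo
   ultimately show "ep * r\<^sup>2 * q / 2 - (1 - ep) * r\<^sup>2 / 2 <= - (1 - 5 * ep) * r\<^sup>2 / 2" by (simp only:)
  qed
  finally show "c tt * (LINT om|M. indicator B om * exp (r / sqrt n * (\<Sum>m=1..d. tt m * S m om))) <= D * exp (- (1 - 5 * ep) * r\<^sup>2 / 2)" .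
 qed
 also have "... = real (card F) * D * exp (- (1 - 5 * ep) * r\<^sup>2 / 2)" by simp
 finally show ?thesis .
qed

definition trunc :: "real => real => real" where "trunc b x = (if \<bar>x\<bar> < b then x else 0)"

lemma trunc_measurable [measurable]: "trunc b : borel_measurable borel"
 unfolding trunc_def[abs_def] by measurable

lemma abs_trunc_le: "\<bar>trunc b x\<bar> <= \<bar>x\<bar>" "0 < b ==> \<bar>trunc b x\<bar> <= b"
 by (auto simp: trunc_def)

locale iid_array = prob_space M for M :: "'a measure" +
 fixes d :: nat and X X' :: "'a => real" and Xa :: "nat => nat => nat => 'a => real"
 assumes d1: "1 <= d"
  and indep: "indep_vars (%_. borel) (%t. case t of None => X | Some (m, k, i) => Xa m k i)
    (insert None (Some ` ({1..d} \<times> {1..} \<times> {1..})))"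
  and ident: "!!m k i. m : {1..d} ==> k \<ge> 1 ==> i \<ge> 1 ==> distr M borel (Xa m k i) = distr M borel X"
  and intX: "integrable M X" and meanX: "(LINT om|M. X om) = 0"
  and int2: "integrable M (%om. (X om)^2)" and var: "(LINT om|M. (X om)^2) = 1"
  and int4: "integrable M (%om. (X om)^4)"
  and copy_indep: "indep_var borel X borel X'"
  and copy_distr: "distr M borel X' = distr M borel X"
begin

lemma rvX [measurable]: "X : borel_measurable M" "X' : borel_measurable M"
 using copy_indep by (auto dest: indep_var_rv1 indep_var_rv2)

lemma rv_Xa: "m : {1..d} ==> 1 <= k ==> 1 <= i ==> Xa m k i : borel_measurable M"
proof -
 assume "m : {1..d}" "1 <= k" "1 <= i"
 then have "Some (m, k, i) : insert None (Some ` ({1..d} \<times> {1..} \<times> {1..}))" by auto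
 then show ?thesis using indep unfolding indep_vars_def by fastforce
qed

lemma ident_integral:
 fixes f :: "real => real"
 assumes "m : {1..d}" "1 <= k" "1 <= i" and [measurable]: "f : borel_measurable borel"
 shows "(LINT om|M. f (Xa m k i om)) = (LINT om|M. f (X om))"
  "integrable M (%om. f (X om)) ==> integrable M (%om. f (Xa m k i om))"
proof -
 note r[measurable] = rv_Xa[OF assms(1-3)]
 show "(LINT om|M. f (Xa m k i om)) = (LINT om|M. f (X om))"
  using integral_distr[OF r assms(4)] integral_distr[OF rvX(1) assms(4)] ident[OF assms(1-3)] by simp
 show "integrable M (%om. f (X om)) ==> integrable M (%om. f (Xa m k i om))"
  using integrable_distr_eq[OF r assms(4)] integrable_distr_eq[OF rvX(1) assms(4)] ident[OF assms(1-3)] by simp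
qed

lemma ident_prob:
 assumes "m : {1..d}" "1 <= k" "1 <= i" and A: "A : sets borel"
 shows "prob {om : space M. Xa m k i om : A} = prob {om : space M. X om : A}"
proof -
 have "measure (distr M borel (Xa m k i)) A = prob (Xa m k i -` A Int space M)" by (rule measure_distr[OF rv_Xa[OF assms(1-3)] A])
 moreover have "measure (distr M borel X) A = prob (X -` A Int space M)" by (rule measure_distr[OF rvX(1) A])
 ultimately show ?thesis using ident[OF assms(1-3)] by (simp add: vimage_def Int_def conj_commute)
qed

lemma indep_triples:
 fixes F :: "nat => nat => real => real => real => real"
 assumes ijl: "1 <= i" "1 <= j" "1 <= l" and F: "!!m k. (%(x, y, z). F m k x y z) : borel_measurable (borel \<Otimes>\<^sub>M borel \<Otimes>\<^sub>M borel)"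
 shows "indep_vars (%_. borel) (%(m, k) om. F m k (Xa m k i om) (Xa m k j om) (Xa m k l om)) ({1..d} \<times> {1..n})"
proof -
 define Z where "Z = (%t. case t of None => X | Some (m, k, i) => Xa m k i)"
 define K where "K = (%(m, k). Some ` ({m} \<times> {k} \<times> {i, j, l}) :: (nat \<times> nat \<times> nat) option set)"
 have R: "indep_vars (%p. PiM (K p) (%_. borel)) (%p om. restrict (%t. Z t om) (K p)) ({1..d} \<times> {1..n})"
  unfolding Z_def by (rule indep_vars_restrict[OF indep]) (use ijl in \<open>auto simp: K_def disjoint_family_on_def\<close>)
 define G where "G = (%(m, k) g. F m k (g (Some (m, k, i))) (g (Some (m, k, j))) (g (Some (m, k, l))))"
 have G: "G p : borel_measurable (PiM (K p) (%_. borel))" for p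
 proof -
  obtain m k where p: "p = (m, k)" by (cases p)
  have c: "(%g. g t) : measurable (PiM (K p) (%_. borel)) borel" if "t : K p" for t
   by (rule measurable_component_singleton[OF that])
  have [measurable]: "(%g. g (Some (m, k, i))) : measurable (PiM (K p) (%_. borel)) borel"
   "(%g. g (Some (m, k, j))) : measurable (PiM (K p) (%_. borel)) borel"
   "(%g. g (Some (m, k, l))) : measurable (PiM (K p) (%_. borel)) borel"
   by (auto intro!: c simp: K_def p)
  have "(%g. (g (Some (m, k, i)), g (Some (m, k, j)), g (Some (m, k, l)))) : measurable (PiM (K p) (%_. borel)) (borel \<Otimes>\<^sub>M borel \<Otimes>\<^sub>M borel)"
   by measurable
  from measurable_compose[OF this F[of m k]] show ?thesis by (simp add: G_def p)
 qed
 have "indep_vars (%_. borel) (%p om. G p (restrict (%t. Z t om) (K p))) ({1..d} \<times> {1..n})"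
  by (rule indep_vars_compose2[OF R]) (rule G)
 moreover have "(%om. G p (restrict (%t. Z t om) (K p))) = (case p of (m, k) => %om. F m k (Xa m k i om) (Xa m k j om) (Xa m k l om))" for p
  by (cases p) (auto simp: G_def K_def Z_def fun_eq_iff)
 ultimately show ?thesis by (subst indep_vars_cong[OF refl _ refl]) (auto simp: fun_eq_iff)
qed

lemma expect_prod3:
 fixes f g h :: "real => real"
 assumes mk: "m : {1..d}" "1 <= k" and ijl: "1 <= i" "1 <= j" "1 <= l" "i ~= j" "i ~= l" "j ~= l"
  and [measurable]: "f : borel_measurable borel" "g : borel_measurable borel" "h : borel_measurable borel"
  and int: "integrable M (%om. f (X om))" "integrable M (%om. g (X om))" "integrable M (%om. h (X om))"
 shows "(LINT om|M. f (Xa m k i om) * g (Xa m k j om) * h (Xa m k l om)) = (LINT om|M. f (X om)) * (LINT om|M. g (X om)) * (LINT om|M. h (X om))"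
  "integrable M (%om. f (Xa m k i om) * g (Xa m k j om) * h (Xa m k l om))"
proof -
 define Z where "Z = (%t. case t of None => X | Some (m, k, i) => Xa m k i)"
 let ?a = "Some (m, k, i)" and ?b = "Some (m, k, j)" and ?c = "Some (m, k, l)"
 let ?A = "{?a, ?b, ?c}"
 define ph where "ph t = (if t = ?a then f else if t = ?b then g else h)" for t
 have I0: "indep_vars (%_. borel) Z ?A"
  unfolding Z_def by (rule indep_vars_subset[OF indep]) (use mk ijl in auto)
 have I: "indep_vars (%_. borel) (%t om. ph t (Z t om)) ?A"
  by (rule indep_vars_compose2[OF I0]) (auto simp: ph_def)
 have i: "integrable M (%om. ph t (Z t om))" if "t : ?A" for t
  using that ijl by (auto simp: ph_def Z_def intro!: ident_integral(2) mk int)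
 have e: "(LINT om|M. f (Xa m k i om)) = (LINT om|M. f (X om))" "(LINT om|M. g (Xa m k j om)) = (LINT om|M. g (X om))" "(LINT om|M. h (Xa m k l om)) = (LINT om|M. h (X om))"
  by (auto intro!: ident_integral(1) mk ijl)
 show "(LINT om|M. f (Xa m k i om) * g (Xa m k j om) * h (Xa m k l om)) = (LINT om|M. f (X om)) * (LINT om|M. g (X om)) * (LINT om|M. h (X om))"
  using indep_vars_lebesgue_integral[OF _ I i] ijl by (simp add: ph_def Z_def e mult.assoc)
 show "integrable M (%om. f (Xa m k i om) * g (Xa m k j om) * h (Xa m k l om))"
  using indep_vars_integrable[OF _ I i] ijl by (simp add: ph_def Z_def mult.assoc)
qed

lemma pair_law:
 assumes mk: "m : {1..d}" "1 <= k" and ij: "1 <= i" "1 <= j" "i ~= j"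
 shows "distr M (borel \<Otimes>\<^sub>M borel) (%om. (Xa m k i om, Xa m k j om)) = distr M (borel \<Otimes>\<^sub>M borel) (%om. (X om, X' om))"
proof -
 define Z where "Z = (%t. case t of None => X | Some (m, k, i) => Xa m k i)"
 let ?a = "Some (m, k, i)" and ?b = "Some (m, k, j)"
 have "indep_var (PiM {?a} (%_. borel)) (%om. restrict (%t. Z t om) {?a}) (PiM {?b} (%_. borel)) (%om. restrict (%t. Z t om) {?b})"
  unfolding Z_def by (rule indep_var_restrict[OF indep]) (use mk ij in auto)
 from indep_var_compose[OF this, of "%g. g ?a" borel "%g. g ?b" borel]
 have "indep_var borel (Xa m k i) borel (Xa m k j)" by (simp add: comp_def Z_def)
 then have "distr M borel (Xa m k i) \<Otimes>\<^sub>M distr M borel (Xa m k j) = distr M (borel \<Otimes>\<^sub>M borel) (%om. (Xa m k i om, Xa m k j om))"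
  unfolding indep_var_distribution_eq by simp
 moreover have "distr M borel X \<Otimes>\<^sub>M distr M borel X' = distr M (borel \<Otimes>\<^sub>M borel) (%om. (X om, X' om))"
  using copy_indep unfolding indep_var_distribution_eq by simp
 ultimately show ?thesis using ident[OF mk ij(1)] ident[OF mk ij(2)] copy_distr by simp
qed

lemma pair_integral:
 fixes f :: "real => real => real"
 assumes mk: "m : {1..d}" "1 <= k" and ij: "1 <= i" "1 <= j" "i ~= j"
  and f: "(%(x, y). f x y) : borel_measurable (borel \<Otimes>\<^sub>M borel)"
 shows "(LINT om|M. f (Xa m k i om) (Xa m k j om)) = (LINT om|M. f (X om) (X' om))"
proof -
 have [measurable]: "Xa m k i : borel_measurable M" "Xa m k j : borel_measurable M" using rv_Xa mk ij by auto
 have "(LINT om|M. f (Xa m k i om) (Xa m k j om)) = (\<integral>z. (%(x, y). f x y) z \<partial>distr M (borel \<Otimes>\<^sub>M borel) (%om. (Xa m k i om, Xa m k j om)))"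
  using f by (subst integral_distr) auto
 also have "... = (LINT om|M. f (X om) (X' om))" unfolding pair_law[OF mk ij] using f by (subst integral_distr) auto
 finally show ?thesis .
qed

lemma pair_prob:
 assumes mk: "m : {1..d}" "1 <= k" and ij: "1 <= i" "1 <= j" "i ~= j"
 shows "prob {om : space M. a <= \<bar>Xa m k i om * Xa m k j om\<bar>} = prob {om : space M. a <= \<bar>X om * X' om\<bar>}"
proof -
 have [measurable]: "Xa m k i : borel_measurable M" "Xa m k j : borel_measurable M" using rv_Xa mk ij by auto
 define A where "A = {z :: real \<times> real. a <= \<bar>fst z * snd z\<bar>}"
 have "A = {z : space (borel \<Otimes>\<^sub>M borel). a <= \<bar>fst z * snd z\<bar>}" by (auto simp: A_def space_pair_measure)
 also have "... : sets (borel \<Otimes>\<^sub>M borel)" by measurable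
 finally have A: "A : sets (borel \<Otimes>\<^sub>M borel)" .
 have "measure (distr M (borel \<Otimes>\<^sub>M borel) (%om. (Xa m k i om, Xa m k j om))) A = prob ((%om. (Xa m k i om, Xa m k j om)) -` A Int space M)"
  by (rule measure_distr[OF _ A]) measurable
 moreover have "measure (distr M (borel \<Otimes>\<^sub>M borel) (%om. (X om, X' om))) A = prob ((%om. (X om, X' om)) -` A Int space M)"
  by (rule measure_distr[OF _ A]) measurable
 ultimately show ?thesis unfolding pair_law[OF mk ij] by (simp add: A_def vimage_def Int_def conj_commute)
qed

definition m4 :: real where "m4 = (LINT om|M. (X om) ^ 4)"

lemma m4_nonneg: "0 <= m4" unfolding m4_def by (rule Bochner_Integration.integral_nonneg) simp

lemma trunc_bounded_integrable:
 assumes "0 < b" and [measurable]: "f : borel_measurable borel" and "!!x. \<bar>x\<bar> <= b ==> \<bar>f x :: real\<bar> <= C"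
 shows "integrable M (%om. f (trunc b (X om)))"
proof (rule integrable_const_bound[where B=C])
 show "AE om in M. norm (f (trunc b (X om))) <= C" using assms(3) abs_trunc_le(2)[OF assms(1)] by simp
qed measurable

lemma trunc_integrable:
 assumes "0 < b"
 shows "integrable M (%om. trunc b (X om))" "integrable M (%om. (trunc b (X om))\<^sup>2)" "integrable M (%om. \<bar>trunc b (X om)\<bar> ^ 3)"
  "integrable M (%om. (trunc b (X om)) ^ 4)"
proof -
 have p: "\<bar>x ^ j\<bar> <= b ^ j" "\<bar>\<bar>x\<bar> ^ j\<bar> <= b ^ j" if "\<bar>x\<bar> <= b" for x :: real and j using power_mono[OF that, of j] by (simp_all add: power_abs)
 have m[measurable]: "(%x::real. x ^ j) : borel_measurable borel" "(%x::real. \<bar>x\<bar> ^ j) : borel_measurable borel" for j by measurable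
 show "integrable M (%om. trunc b (X om))" by (rule trunc_bounded_integrable[OF assms, where f="%x. x" and C=b]) auto
 show "integrable M (%om. (trunc b (X om))\<^sup>2)" by (rule trunc_bounded_integrable[OF assms, where f="%x. x\<^sup>2" and C="b\<^sup>2", OF m(1) p(1)])
 show "integrable M (%om. \<bar>trunc b (X om)\<bar> ^ 3)" by (rule trunc_bounded_integrable[OF assms, where f="%x. \<bar>x\<bar> ^ 3" and C="b ^ 3", OF m(2) p(2)])
 show "integrable M (%om. (trunc b (X om)) ^ 4)" by (rule trunc_bounded_integrable[OF assms, where f="%x. x ^ 4" and C="b ^ 4", OF m(1) p(1)])
qed

lemma trunc_moments:
 assumes b: "0 < b"
 shows "\<bar>\<integral>om. trunc b (X om) \<partial>M\<bar> <= m4 / b ^ 3" "1 - m4 / b\<^sup>2 <= (LINT om|M. (trunc b (X om))\<^sup>2)" "(LINT om|M. (trunc b (X om))\<^sup>2) <= 1"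
  "(LINT om|M. \<bar>trunc b (X om)\<bar> ^ 3) <= 1 + m4" "(LINT om|M. (trunc b (X om)) ^ 4) <= m4"
proof -
 note ti = trunc_integrable[OF b]
 have big: "\<bar>x\<bar> <= x ^ 4 / b ^ 3" "x\<^sup>2 <= x ^ 4 / b\<^sup>2" if "b <= \<bar>x\<bar>" for x :: real
 proof -
  have "\<bar>x\<bar> * b ^ 3 <= \<bar>x\<bar> * \<bar>x\<bar> ^ 3" using that b by (intro mult_left_mono power_mono) auto
  also have "\<bar>x\<bar> * \<bar>x\<bar> ^ 3 = x ^ 4" by (simp add: power4_eq_xxxx power3_eq_cube abs_mult[symmetric])
  finally show "\<bar>x\<bar> <= x ^ 4 / b ^ 3" using b by (simp add: le_divide_eq)
  have "x\<^sup>2 * b\<^sup>2 <= x\<^sup>2 * \<bar>x\<bar>\<^sup>2" using that b by (intro mult_left_mono power_mono) auto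
  also have "x\<^sup>2 * \<bar>x\<bar>\<^sup>2 = x ^ 4" by (simp add: power4_eq_xxxx power2_eq_square)
  finally show "x\<^sup>2 <= x ^ 4 / b\<^sup>2" using b by (simp add: le_divide_eq)
 qed
 have "\<bar>\<integral>om. trunc b (X om) - X om \<partial>M\<bar> <= (LINT om|M. (X om) ^ 4 / b ^ 3)"
 proof (rule abs_integral_le)
  fix om show "\<bar>trunc b (X om) - X om\<bar> <= (X om) ^ 4 / b ^ 3" using big(1)[of "X om"] b by (auto simp: trunc_def)
 qed (use ti intX int4 in auto)
 then show "\<bar>\<integral>om. trunc b (X om) \<partial>M\<bar> <= m4 / b ^ 3" using ti intX meanX by (simp add: m4_def)
 have "(LINT om|M. (X om)\<^sup>2 - (X om) ^ 4 / b\<^sup>2) <= (LINT om|M. (trunc b (X om))\<^sup>2)"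
 proof (rule integral_mono)
  fix om show "(X om)\<^sup>2 - (X om) ^ 4 / b\<^sup>2 <= (trunc b (X om))\<^sup>2" using big(2)[of "X om"] b by (auto simp: trunc_def)
 qed (use ti int2 int4 in auto)
 then show "1 - m4 / b\<^sup>2 <= (LINT om|M. (trunc b (X om))\<^sup>2)" using int2 int4 var by (simp add: m4_def)
 have "(LINT om|M. (trunc b (X om))\<^sup>2) <= (LINT om|M. (X om)\<^sup>2)"
  by (rule integral_mono) (use ti int2 in \<open>auto simp: trunc_def\<close>)
 then show "(LINT om|M. (trunc b (X om))\<^sup>2) <= 1" using var by simp
 have "(LINT om|M. \<bar>trunc b (X om)\<bar> ^ 3) <= (LINT om|M. 1 + (X om) ^ 4)"
 proof (rule integral_mono)
  fix om
  have "t ^ 3 <= 1 + t ^ 4" if "0 <= t" for t :: real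
  proof (cases "t <= 1")
   case True
   then have "t ^ 3 <= 1" using that by (simp add: power_le_one)
   moreover have "0 <= t ^ 4" by simp
   ultimately show ?thesis by linarith
  next
   case False
   then have "t ^ 3 <= t ^ 4" by (intro power_increasing) auto
   then show ?thesis by linarith
  qed
  from this[of "\<bar>X om\<bar>"] have "\<bar>X om\<bar> ^ 3 <= 1 + (X om) ^ 4" by simp
  then show "\<bar>trunc b (X om)\<bar> ^ 3 <= 1 + (X om) ^ 4" using power_mono[OF abs_trunc_le(1)[of b "X om"] abs_ge_zero, of 3] by linarith
 qed (use ti int4 in auto)
 then show "(LINT om|M. \<bar>trunc b (X om)\<bar> ^ 3) <= 1 + m4" using int4 by (simp add: m4_def prob_space)
 have "(LINT om|M. (trunc b (X om)) ^ 4) <= (LINT om|M. (X om) ^ 4)"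
  by (rule integral_mono) (use ti int4 in \<open>auto simp: trunc_def\<close>)
 then show "(LINT om|M. (trunc b (X om)) ^ 4) <= m4" by (simp add: m4_def)
qed

definition K0 :: real where "K0 = 1 + 2 * m4 + m4\<^sup>2 + (1 + m4)\<^sup>2"

lemma copy_prod:
 fixes f g :: "real => real"
 assumes [measurable]: "f : borel_measurable borel" "g : borel_measurable borel" and i: "integrable M (%om. f (X om))" "integrable M (%om. g (X om))"
 shows "(LINT om|M. f (X om) * g (X' om)) = (LINT om|M. f (X om)) * (LINT om|M. g (X om))"
  "integrable M (%om. f (X om) * g (X' om))"
proof -
 have e: "(LINT om|M. g (X' om)) = (LINT om|M. g (X om))"
  using integral_distr[OF rvX(2) assms(2)] integral_distr[OF rvX(1) assms(2)] copy_distr by simp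
 have i': "integrable M (%om. g (X' om))"
  using integrable_distr_eq[OF rvX(2) assms(2)] integrable_distr_eq[OF rvX(1) assms(2)] copy_distr i(2) by simp
 have ind: "indep_var borel (%om. f (X om)) borel (%om. g (X' om))"
  using indep_var_compose[OF copy_indep assms(1,2)] by (simp add: comp_def)
 show "(LINT om|M. f (X om) * g (X' om)) = (LINT om|M. f (X om)) * (LINT om|M. g (X om))"
  using indep_var_lebesgue_integral[OF ind i(1) i'] e by simp
 show "integrable M (%om. f (X om) * g (X' om))" by (rule indep_var_integrable[OF ind i(1) i'])
qed

definition kap :: "real => real measure" where "kap b = distr M borel (%om. trunc b (X om) * trunc b (X' om))"

lemma near_std_kap:
 assumes b: "1 <= b" shows "near_std K0 (1 / b\<^sup>2) (kap b)"
proof -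
 have b0: "0 < b" using b by simp
 note ti = trunc_integrable[OF b0] and tm = trunc_moments[OF b0]
 define e v a where "e = (LINT om|M. trunc b (X om))" and "v = (LINT om|M. (trunc b (X om))\<^sup>2)" and "a = (LINT om|M. \<bar>trunc b (X om)\<bar> ^ 3)"
 define z where "z = 1 / b\<^sup>2"
 have z: "0 < z" "z <= 1" using b by (auto simp: z_def one_le_power)
 have K0: "m4\<^sup>2 <= K0" "2 * m4 <= K0" "(1 + m4)\<^sup>2 <= K0" using m4_nonneg unfolding K0_def by (auto intro!: add_nonneg_nonneg)
 have rd: "real_distribution (kap b)" unfolding kap_def by (rule real_distribution_distr) measurable
 have 1: "(\<integral>y. y \<partial>kap b) = e * e"
  unfolding kap_def e_def using copy_prod(1)[of "trunc b" "trunc b"] ti by (subst integral_distr) auto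
 have 2: "(\<integral>y. y\<^sup>2 \<partial>kap b) = v * v"
  unfolding kap_def v_def using copy_prod(1)[of "%x. (trunc b x)\<^sup>2" "%x. (trunc b x)\<^sup>2"] ti by (subst integral_distr) (auto simp: power_mult_distrib)
 have 3: "(\<integral>y. \<bar>y\<bar> ^ 3 \<partial>kap b) = a * a"
  unfolding kap_def a_def using copy_prod(1)[of "%x. \<bar>trunc b x\<bar> ^ 3" "%x. \<bar>trunc b x\<bar> ^ 3"] ti by (subst integral_distr) (auto simp: power_mult_distrib abs_mult)
 have ae: "AE y in kap b. \<bar>y\<bar> <= 1 / z"
 proof -
  have "\<bar>trunc b (X om) * trunc b (X' om)\<bar> <= 1 / z" for om
   using mult_mono[OF abs_trunc_le(2)[OF b0, of "X om"] abs_trunc_le(2)[OF b0, of "X' om"]] b0 by (simp add: abs_mult z_def power2_eq_square)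
  then show ?thesis unfolding kap_def by (subst AE_distr_iff) auto
 qed
 have "\<bar>e * e\<bar> <= K0 * z\<^sup>2"
 proof -
  have "\<bar>e\<bar> * \<bar>e\<bar> <= (m4 / b ^ 3) * (m4 / b ^ 3)" using tm(1) by (intro mult_mono) (auto simp: e_def)
  also have "... = m4\<^sup>2 * (z\<^sup>2 * z)" by (simp add: z_def power2_eq_square power3_eq_cube)
  also have "... <= m4\<^sup>2 * (z\<^sup>2 * 1)" using z by (intro mult_left_mono) auto
  also have "... <= K0 * z\<^sup>2" using K0 by (simp add: mult_right_mono)
  finally show ?thesis by (simp add: abs_mult)
 qed
 moreover have "\<bar>v * v - 1\<bar> <= K0 * z"
 proof -
  have v: "1 - m4 * z <= v" "v <= 1" "0 <= v" using tm(2,3) by (auto simp: v_def z_def)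
  have "v * v - 1 = - ((1 - v) * (1 + v))" by (simp add: algebra_simps)
  then have "\<bar>v * v - 1\<bar> = (1 - v) * (1 + v)" using v by simp
  also have "... <= (m4 * z) * 2" using v m4_nonneg z by (intro mult_mono) auto
  also have "... = (2 * m4) * z" by simp
  also have "... <= K0 * z" using K0 z by (intro mult_right_mono) auto
  finally show ?thesis .
 qed
 moreover have "a * a <= K0"
 proof -
  have "0 <= a" unfolding a_def by (rule Bochner_Integration.integral_nonneg) simp
  then have "a * a <= (1 + m4) * (1 + m4)" using tm(4) m4_nonneg by (intro mult_mono) (auto simp: a_def)
  then show ?thesis using K0(3) by (simp add: power2_eq_square)
 qed
 ultimately show ?thesis using rd ae unfolding near_std_def 1 2 3 z_def[symmetric] by blast
qed

lemma mgf_triple: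
 fixes U :: real
 assumes U: "0 <= U"
 obtains C where "0 <= C" "!!b h1 h2 m k i j l. 1 <= b ==> \<bar>h1\<bar> <= U / b\<^sup>2 ==> \<bar>h2\<bar> <= U / b\<^sup>2 ==> m : {1..d} ==> 1 <= k ==>
  1 <= i ==> 1 <= j ==> 1 <= l ==> i ~= j ==> i ~= l ==> j ~= l ==>
  (LINT om|M. exp (h1 * (trunc b (Xa m k i om) * trunc b (Xa m k j om)) + h2 * (trunc b (Xa m k i om) * trunc b (Xa m k l om))))
   <= exp ((h1\<^sup>2 + h2\<^sup>2) / 2 + C * (1 / b\<^sup>2) ^ 3)"
proof -
 define E where "E = exp (2 * U)"
 define C where "C = 2 * U * m4\<^sup>2 + U\<^sup>2 * m4\<^sup>2 + E * 8 * U ^ 3 * (1 + m4)\<^sup>2"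
 have C0: "0 <= C" using U by (simp add: C_def E_def)
 show ?thesis
 proof (rule that[OF C0])
  fix b h1 h2 :: real and m k i j l :: nat
  assume b: "1 <= b" and h: "\<bar>h1\<bar> <= U / b\<^sup>2" "\<bar>h2\<bar> <= U / b\<^sup>2" and mk: "m : {1..d}" "1 <= k"
   and ijl: "1 <= i" "1 <= j" "1 <= l" "i ~= j" "i ~= l" "j ~= l"
  have b0: "0 < b" using b by simp
  note ti = trunc_integrable[OF b0] and tm = trunc_moments[OF b0]
  define z where "z = 1 / b\<^sup>2"
  have z: "0 < z" "z <= 1" using b by (auto simp: z_def one_le_power)
  have hz: "\<bar>h1\<bar> <= U * z" "\<bar>h2\<bar> <= U * z" using h by (auto simp: z_def)
  define x y w where "x om = trunc b (Xa m k i om)" and "y om = trunc b (Xa m k j om)" and "w om = trunc b (Xa m k l om)" for om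
  have [measurable]: "Xa m k i : borel_measurable M" "Xa m k j : borel_measurable M" "Xa m k l : borel_measurable M" using rv_Xa mk ijl by auto
  have [measurable]: "x : borel_measurable M" "y : borel_measurable M" "w : borel_measurable M" unfolding x_def[abs_def] y_def[abs_def] w_def[abs_def] by measurable
  define e v a where "e = (LINT om|M. trunc b (X om))" and "v = (LINT om|M. (trunc b (X om))\<^sup>2)" and "a = (LINT om|M. \<bar>trunc b (X om)\<bar> ^ 3)"
  have one: "integrable M (%om. (1::real))" "(LINT om|M. (1::real)) = 1" by (simp_all add: prob_space)
  have M: "trunc b : borel_measurable borel" "(%x. (trunc b x)\<^sup>2) : borel_measurable borel" "(%x. \<bar>trunc b x\<bar> ^ 3) : borel_measurable borel" "(%_::real. 1::real) : borel_measurable borel"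
   by measurable
  note E3 = expect_prod3[OF mk ijl]
  have P1: "(LINT om|M. x om * y om) = e * e" "integrable M (%om. x om * y om)"
   using E3(1)[OF M(1) M(1) M(4) ti(1) ti(1) one(1)] E3(2)[OF M(1) M(1) M(4) ti(1) ti(1) one(1)] unfolding x_def y_def e_def by (simp_all only: mult_1_right mult_1_left one(2))
  have P2: "(LINT om|M. x om * w om) = e * e" "integrable M (%om. x om * w om)"
   using E3(1)[OF M(1) M(4) M(1) ti(1) one(1) ti(1)] E3(2)[OF M(1) M(4) M(1) ti(1) one(1) ti(1)] unfolding x_def w_def e_def by (simp_all only: mult_1_right mult_1_left one(2))
  have Q1: "(LINT om|M. (x om)\<^sup>2 * (y om)\<^sup>2) = v * v" "integrable M (%om. (x om)\<^sup>2 * (y om)\<^sup>2)"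
   using E3(1)[OF M(2) M(2) M(4) ti(2) ti(2) one(1)] E3(2)[OF M(2) M(2) M(4) ti(2) ti(2) one(1)] unfolding x_def y_def v_def by (simp_all only: mult_1_right mult_1_left one(2))
  have Q2: "(LINT om|M. (x om)\<^sup>2 * (w om)\<^sup>2) = v * v" "integrable M (%om. (x om)\<^sup>2 * (w om)\<^sup>2)"
   using E3(1)[OF M(2) M(4) M(2) ti(2) one(1) ti(2)] E3(2)[OF M(2) M(4) M(2) ti(2) one(1) ti(2)] unfolding x_def w_def v_def by (simp_all only: mult_1_right mult_1_left one(2))
  have Q3: "(LINT om|M. (x om)\<^sup>2 * y om * w om) = v * e * e" "integrable M (%om. (x om)\<^sup>2 * y om * w om)"
   using E3(1)[OF M(2) M(1) M(1) ti(2) ti(1) ti(1)] E3(2)[OF M(2) M(1) M(1) ti(2) ti(1) ti(1)] unfolding x_def y_def w_def v_def e_def by (simp_all only: mult_1_right mult_1_left one(2))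
  have R1: "(LINT om|M. \<bar>x om\<bar> ^ 3 * \<bar>y om\<bar> ^ 3) = a * a" "integrable M (%om. \<bar>x om\<bar> ^ 3 * \<bar>y om\<bar> ^ 3)"
   using E3(1)[OF M(3) M(3) M(4) ti(3) ti(3) one(1)] E3(2)[OF M(3) M(3) M(4) ti(3) ti(3) one(1)] unfolding x_def y_def a_def by (simp_all only: mult_1_right mult_1_left one(2))
  have R2: "(LINT om|M. \<bar>x om\<bar> ^ 3 * \<bar>w om\<bar> ^ 3) = a * a" "integrable M (%om. \<bar>x om\<bar> ^ 3 * \<bar>w om\<bar> ^ 3)"
   using E3(1)[OF M(3) M(4) M(3) ti(3) one(1) ti(3)] E3(2)[OF M(3) M(4) M(3) ti(3) one(1) ti(3)] unfolding x_def w_def a_def by (simp_all only: mult_1_right mult_1_left one(2))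
  define Z where "Z om = h1 * (x om * y om) + h2 * (x om * w om)" for om
  define G where "G om = 1 + (h1 * (x om * y om) + h2 * (x om * w om)) + (h1\<^sup>2 / 2 * ((x om)\<^sup>2 * (y om)\<^sup>2) + h2\<^sup>2 / 2 * ((x om)\<^sup>2 * (w om)\<^sup>2) + (h1 * h2) * ((x om)\<^sup>2 * y om * w om))
   + (4 * E * \<bar>h1\<bar> ^ 3 * (\<bar>x om\<bar> ^ 3 * \<bar>y om\<bar> ^ 3) + 4 * E * \<bar>h2\<bar> ^ 3 * (\<bar>x om\<bar> ^ 3 * \<bar>w om\<bar> ^ 3))" for om
  have iG: "integrable M G" unfolding G_def[abs_def]
   by (intro Bochner_Integration.integrable_add integrable_mult_right one(1) P1 P2 Q1 Q2 Q3 R1 R2)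
  have EG: "(LINT om|M. G om) = 1 + (h1 * (e * e) + h2 * (e * e)) + (h1\<^sup>2 / 2 * (v * v) + h2\<^sup>2 / 2 * (v * v) + (h1 * h2) * (v * e * e))
   + (4 * E * \<bar>h1\<bar> ^ 3 * (a * a) + 4 * E * \<bar>h2\<bar> ^ 3 * (a * a))"
   unfolding G_def using one P1 P2 Q1 Q2 Q3 R1 R2
   by (simp only: Bochner_Integration.integral_add Bochner_Integration.integrable_add integrable_mult_right integral_mult_right_zero)
  have xb: "\<bar>x om\<bar> <= b" "\<bar>y om\<bar> <= b" "\<bar>w om\<bar> <= b" for om unfolding x_def y_def w_def using abs_trunc_le(2)[OF b0] by auto
  have pt: "exp (Z om) <= G om" "\<bar>Z om\<bar> <= 2 * U" for om
  proof -
   have h1: "\<bar>h1 * (x om * y om)\<bar> <= U"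
   proof -
    have "\<bar>h1\<bar> * (\<bar>x om\<bar> * \<bar>y om\<bar>) <= (U * z) * (b * b)"
     by (rule mult_mono[OF hz(1) mult_mono[OF xb(1) xb(2)]]) (use b0 U z in auto)
    also have "... = U" using b0 by (simp add: z_def power2_eq_square)
    finally show ?thesis by (simp add: abs_mult)
   qed
   have h2: "\<bar>h2 * (x om * w om)\<bar> <= U"
   proof -
    have "\<bar>h2\<bar> * (\<bar>x om\<bar> * \<bar>w om\<bar>) <= (U * z) * (b * b)"
     by (rule mult_mono[OF hz(2) mult_mono[OF xb(1) xb(3)]]) (use b0 U z in auto)
    also have "... = U" using b0 by (simp add: z_def power2_eq_square)
    finally show ?thesis by (simp add: abs_mult)
   qed
   show Zb: "\<bar>Z om\<bar> <= 2 * U" unfolding Z_def using h1 h2 by linarith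
   have cube: "\<bar>p + q\<bar> ^ 3 <= 4 * (\<bar>p\<bar> ^ 3 + \<bar>q\<bar> ^ 3)" for p q :: real
   proof -
    define s t where "s = \<bar>p\<bar>" and "t = \<bar>q\<bar>"
    have st: "0 <= s" "0 <= t" by (auto simp: s_def t_def)
    have "\<bar>p + q\<bar> ^ 3 <= (s + t) ^ 3" unfolding s_def t_def by (intro power_mono) auto
    moreover have "4 * (s ^ 3 + t ^ 3) - (s + t) ^ 3 = 3 * ((s + t) * (s - t)\<^sup>2)" by (simp add: power3_eq_cube power2_eq_square algebra_simps)
    moreover have "0 <= (s + t) * (s - t)\<^sup>2" using st by simp
    ultimately show ?thesis unfolding s_def t_def by linarith
   qed
   have "exp (Z om) <= 1 + Z om + (Z om)\<^sup>2 / 2 + E * \<bar>Z om\<bar> ^ 3" using exp_taylor_bounds(4)[OF Zb] unfolding E_def by linarith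
   also have "... <= 1 + Z om + (Z om)\<^sup>2 / 2 + E * (4 * (\<bar>h1 * (x om * y om)\<bar> ^ 3 + \<bar>h2 * (x om * w om)\<bar> ^ 3))"
   proof -
    have "E * \<bar>Z om\<bar> ^ 3 <= E * (4 * (\<bar>h1 * (x om * y om)\<bar> ^ 3 + \<bar>h2 * (x om * w om)\<bar> ^ 3))"
     unfolding Z_def E_def by (rule mult_left_mono[OF cube]) simp
    then show ?thesis by (rule add_left_mono)
   qed
   also have "1 + Z om + (Z om)\<^sup>2 / 2 + E * (4 * (\<bar>h1 * (x om * y om)\<bar> ^ 3 + \<bar>h2 * (x om * w om)\<bar> ^ 3)) = G om"
   proof -
    have s1: "(Z om)\<^sup>2 / 2 = h1\<^sup>2 / 2 * ((x om)\<^sup>2 * (y om)\<^sup>2) + h2\<^sup>2 / 2 * ((x om)\<^sup>2 * (w om)\<^sup>2) + (h1 * h2) * ((x om)\<^sup>2 * y om * w om)"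
     unfolding Z_def by (simp add: power2_eq_square field_simps)
    have s2: "\<bar>h1 * (x om * y om)\<bar> ^ 3 = \<bar>h1\<bar> ^ 3 * (\<bar>x om\<bar> ^ 3 * \<bar>y om\<bar> ^ 3)" "\<bar>h2 * (x om * w om)\<bar> ^ 3 = \<bar>h2\<bar> ^ 3 * (\<bar>x om\<bar> ^ 3 * \<bar>w om\<bar> ^ 3)"
     by (simp_all only: abs_mult power_mult_distrib)
    have s3: "E * (4 * (A * B + A' * B')) = 4 * E * A * B + 4 * E * A' * B'" for A B A' B' :: real by (simp add: algebra_simps)
    show ?thesis unfolding s1 s2 s3 unfolding Z_def G_def by (rule refl)
   qed
   finally show "exp (Z om) <= G om" .
  qed
  have "(LINT om|M. exp (Z om)) <= (LINT om|M. G om)"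
  proof (rule integral_mono[OF _ iG pt(1)])
   show "integrable M (%om. exp (Z om))"
   proof (rule integrable_const_bound[where B=E])
    show "AE om in M. norm (exp (Z om)) <= E"
    proof (rule AE_I2)
     fix om
     have "Z om <= 2 * U" using pt(2)[of om] by (rule order_trans[OF abs_ge_self])
     then show "norm (exp (Z om)) <= E" by (simp add: E_def)
    qed
   qed (unfold Z_def, measurable)
  qed
  also have "... <= 1 + (h1\<^sup>2 + h2\<^sup>2) / 2 + C * z ^ 3"
  proof -
   have z3: "\<bar>e * e\<bar> <= m4\<^sup>2 * z ^ 3"
   proof -
    have "\<bar>e\<bar> * \<bar>e\<bar> <= (m4 / b ^ 3) * (m4 / b ^ 3)" using tm(1) by (intro mult_mono) (auto simp: e_def)
    also have "... = m4\<^sup>2 * z ^ 3" by (simp add: z_def power2_eq_square power3_eq_cube)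
    finally show ?thesis by (simp add: abs_mult)
   qed
   have v: "0 <= v" "v <= 1" using tm(3) by (auto simp: v_def)
   have vv: "v * v <= 1" using mult_mono[OF v(2) v(2)] v by simp
   have a: "0 <= a" "a <= 1 + m4" using tm(4) by (auto simp: a_def)
   have aa: "a * a <= (1 + m4)\<^sup>2" unfolding power2_eq_square using a by (intro mult_mono) auto
   have U1: "U * z <= U" using z U by (simp add: mult_left_le)
   have b1: "\<bar>h * (e * e)\<bar> <= U * (m4\<^sup>2 * z ^ 3)" if "\<bar>h\<bar> <= U * z" for h
    unfolding abs_mult[of h] using that U1 z3 U by (intro mult_mono) auto
   have b2: "h\<^sup>2 / 2 * (v * v) <= h\<^sup>2 / 2" for h using mult_left_mono[OF vv, of "h\<^sup>2 / 2"] by simp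
   have b3: "(h1 * h2) * (v * e * e) <= U\<^sup>2 * (m4\<^sup>2 * z ^ 3)"
   proof -
    have "\<bar>h1 * h2\<bar> <= U * U" unfolding abs_mult using hz U1 U by (intro mult_mono) auto
    moreover have "\<bar>v * e * e\<bar> <= 1 * (m4\<^sup>2 * z ^ 3)" unfolding mult.assoc abs_mult[of v] using v z3 by (intro mult_mono) auto
    ultimately have "\<bar>h1 * h2\<bar> * \<bar>v * e * e\<bar> <= (U * U) * (1 * (m4\<^sup>2 * z ^ 3))" by (rule mult_mono) (use U in auto)
    then have "\<bar>(h1 * h2) * (v * e * e)\<bar> <= (U * U) * (1 * (m4\<^sup>2 * z ^ 3))" by (simp only: abs_mult)
    then have "(h1 * h2) * (v * e * e) <= (U * U) * (1 * (m4\<^sup>2 * z ^ 3))" by (rule order_trans[OF abs_ge_self])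
    then show ?thesis by (simp only: power2_eq_square mult_1_left)
   qed
   have b4: "4 * E * \<bar>h\<bar> ^ 3 * (a * a) <= 4 * E * (U ^ 3 * z ^ 3) * (1 + m4)\<^sup>2" if "\<bar>h\<bar> <= U * z" for h
   proof -
    have "\<bar>h\<bar> ^ 3 <= U ^ 3 * z ^ 3" using power_mono[OF that, of 3] by (simp add: power_mult_distrib)
    then show ?thesis using aa a U z by (intro mult_mono) (auto simp: E_def)
   qed
   have "(LINT om|M. G om) <= 1 + (U * (m4\<^sup>2 * z ^ 3) + U * (m4\<^sup>2 * z ^ 3)) + (h1\<^sup>2 / 2 + h2\<^sup>2 / 2 + U\<^sup>2 * (m4\<^sup>2 * z ^ 3))
    + (4 * E * (U ^ 3 * z ^ 3) * (1 + m4)\<^sup>2 + 4 * E * (U ^ 3 * z ^ 3) * (1 + m4)\<^sup>2)"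
    unfolding EG using b1[OF hz(1)] b1[OF hz(2)] b2[of h1] b2[of h2] b3 b4[OF hz(1)] b4[OF hz(2)] by linarith
   also have "... = 1 + (h1\<^sup>2 + h2\<^sup>2) / 2 + C * z ^ 3" unfolding C_def by (simp add: algebra_simps add_divide_distrib)
   finally show ?thesis .
  qed
  also have "... <= exp ((h1\<^sup>2 + h2\<^sup>2) / 2 + C * z ^ 3)" unfolding add.assoc[of 1] by (rule exp_ge_add_one_self)
  finally show "(LINT om|M. exp (h1 * (trunc b (Xa m k i om) * trunc b (Xa m k j om)) + h2 * (trunc b (Xa m k i om) * trunc b (Xa m k l om))))
   <= exp ((h1\<^sup>2 + h2\<^sup>2) / 2 + C * (1 / b\<^sup>2) ^ 3)" by (simp only: Z_def x_def y_def w_def z_def)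
 qed
qed


lemma expectation_triple_prod:
 fixes G :: "nat => nat => real => real => real => real"
 assumes ijl: "1 <= i" "1 <= j" "1 <= l"
  and G: "!!m k. (%(x, y, z). G m k x y z) : borel_measurable (borel \<Otimes>\<^sub>M borel \<Otimes>\<^sub>M borel)"
  and b: "!!m k x y z. \<bar>G m k x y z\<bar> <= C"
 shows "(LINT om|M. (\<Prod>p\<in>{1..d} \<times> {1..n}. G (fst p) (snd p) (Xa (fst p) (snd p) i om) (Xa (fst p) (snd p) j om) (Xa (fst p) (snd p) l om)))
  = (\<Prod>p\<in>{1..d} \<times> {1..n}. \<integral>om. G (fst p) (snd p) (Xa (fst p) (snd p) i om) (Xa (fst p) (snd p) j om) (Xa (fst p) (snd p) l om) \<partial>M)"
  "integrable M (%om. (\<Prod>p\<in>{1..d} \<times> {1..n}. G (fst p) (snd p) (Xa (fst p) (snd p) i om) (Xa (fst p) (snd p) j om) (Xa (fst p) (snd p) l om)))"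
proof -
 have I: "indep_vars (%_. borel) (%p om. G (fst p) (snd p) (Xa (fst p) (snd p) i om) (Xa (fst p) (snd p) j om) (Xa (fst p) (snd p) l om)) ({1..d} \<times> {1..n})"
  using indep_triples[OF ijl G, where n=n] by (simp add: case_prod_beta')
 have i: "integrable M (%om. G (fst p) (snd p) (Xa (fst p) (snd p) i om) (Xa (fst p) (snd p) j om) (Xa (fst p) (snd p) l om))" if "p : {1..d} \<times> {1..n}" for p
 proof (rule integrable_const_bound[where B=C])
  show "(%om. G (fst p) (snd p) (Xa (fst p) (snd p) i om) (Xa (fst p) (snd p) j om) (Xa (fst p) (snd p) l om)) : borel_measurable M"
   using I that unfolding indep_vars_def by blast
 qed (use b in simp)
 have f: "finite ({1..d} \<times> {1..n})" by simp
 show "(LINT om|M. (\<Prod>p\<in>{1..d} \<times> {1..n}. G (fst p) (snd p) (Xa (fst p) (snd p) i om) (Xa (fst p) (snd p) j om) (Xa (fst p) (snd p) l om)))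
  = (\<Prod>p\<in>{1..d} \<times> {1..n}. \<integral>om. G (fst p) (snd p) (Xa (fst p) (snd p) i om) (Xa (fst p) (snd p) j om) (Xa (fst p) (snd p) l om) \<partial>M)"
  by (rule indep_vars_lebesgue_integral[OF f I i])
 show "integrable M (%om. (\<Prod>p\<in>{1..d} \<times> {1..n}. G (fst p) (snd p) (Xa (fst p) (snd p) i om) (Xa (fst p) (snd p) j om) (Xa (fst p) (snd p) l om)))"
  by (rule indep_vars_integrable[OF f I i])
qed


lemma exp_sum_bound:
 fixes f :: "real => real => real" and w :: "nat \<times> nat => real => real" and tt1 tt2 cc :: "nat => real"
 assumes ijl: "1 <= i" "1 <= j" "1 <= l"
  and f: "(%(x, y). f x y) : borel_measurable (borel \<Otimes>\<^sub>M borel)" "!!x y. \<bar>f x y\<bar> <= K"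
  and w: "!!p. w p : borel_measurable borel" "!!p x. 0 <= w p x" "!!p x. w p x <= 1"
  and th: "!!m. \<bar>tt1 m\<bar> <= H" "!!m. \<bar>tt2 m\<bar> <= H"
  and mg: "!!m k. m : {1..d} ==> k : {1..n} ==>
   (LINT om|M. w (m, k) (Xa m k i om) * exp (tt1 m * f (Xa m k i om) (Xa m k j om) + tt2 m * f (Xa m k i om) (Xa m k l om))) <= A (m, k) * exp (cc m)"
 defines "W \<equiv> %om. (\<Prod>p\<in>{1..d} \<times> {1..n}. w p (Xa (fst p) (snd p) i om)) *
   exp (\<Sum>m=1..d. tt1 m * (\<Sum>k=1..n. f (Xa m k i om) (Xa m k j om)) + tt2 m * (\<Sum>k=1..n. f (Xa m k i om) (Xa m k l om)))"
 shows "(LINT om|M. W om) <= (\<Prod>p\<in>{1..d} \<times> {1..n}. A p) * exp (real n * (\<Sum>m=1..d. cc m))" "integrable M W"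
proof -
 define G where "G m k x y z = w (m, k) x * exp (tt1 m * f x y + tt2 m * f x z)" for m k :: nat and x y z
 have K0: "0 <= K" using f(2)[of 0 0] by linarith
 have Gm: "(%(x, y, z). G m k x y z) : borel_measurable (borel \<Otimes>\<^sub>M borel \<Otimes>\<^sub>M borel)" for m k
 proof -
  have [measurable]: "w (m, k) : borel_measurable borel" by (rule w(1))
  have 1: "(%q :: real \<times> real \<times> real. (fst q, fst (snd q))) : measurable (borel \<Otimes>\<^sub>M borel \<Otimes>\<^sub>M borel) (borel \<Otimes>\<^sub>M borel)" by measurable
  have 2: "(%q :: real \<times> real \<times> real. (fst q, snd (snd q))) : measurable (borel \<Otimes>\<^sub>M borel \<Otimes>\<^sub>M borel) (borel \<Otimes>\<^sub>M borel)" by measurable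
  have [measurable]: "(%q :: real \<times> real \<times> real. f (fst q) (fst (snd q))) : borel_measurable (borel \<Otimes>\<^sub>M borel \<Otimes>\<^sub>M borel)"
   using measurable_compose[OF 1 f(1)] by simp
  have [measurable]: "(%q :: real \<times> real \<times> real. f (fst q) (snd (snd q))) : borel_measurable (borel \<Otimes>\<^sub>M borel \<Otimes>\<^sub>M borel)"
   using measurable_compose[OF 2 f(1)] by simp
  have "(%q. w (m, k) (fst q) * exp (tt1 m * f (fst q) (fst (snd q)) + tt2 m * f (fst q) (snd (snd q)))) : borel_measurable (borel \<Otimes>\<^sub>M borel \<Otimes>\<^sub>M borel)" by measurable
  then show ?thesis by (simp add: G_def case_prod_beta')
 qed
 have Gb: "\<bar>G m k x y z\<bar> <= exp (H * K + H * K)" for m k x y z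
 proof -
  have a: "\<bar>tt1 m * f x y\<bar> <= H * K" "\<bar>tt2 m * f x z\<bar> <= H * K"
   unfolding abs_mult by (rule mult_mono[OF th(1) f(2)], use th(1)[of 0] in linarith, simp, rule mult_mono[OF th(2) f(2)], use th(1)[of 0] in linarith, simp)
  have "w (m, k) x * exp (tt1 m * f x y + tt2 m * f x z) <= 1 * exp (H * K + H * K)"
  proof (rule mult_mono[OF w(3)])
   have "tt1 m * f x y + tt2 m * f x z <= H * K + H * K" using a by linarith
   then show "exp (tt1 m * f x y + tt2 m * f x z) <= exp (H * K + H * K)" by simp
  qed auto
  moreover have "0 <= w (m, k) x * exp (tt1 m * f x y + tt2 m * f x z)" using w(2) by simp
  ultimately show ?thesis unfolding G_def by simp
 qed
 have Weq: "W om = (\<Prod>p\<in>{1..d} \<times> {1..n}. G (fst p) (snd p) (Xa (fst p) (snd p) i om) (Xa (fst p) (snd p) j om) (Xa (fst p) (snd p) l om))" for om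
 proof -
  have "(\<Sum>m=1..d. tt1 m * (\<Sum>k=1..n. f (Xa m k i om) (Xa m k j om)) + tt2 m * (\<Sum>k=1..n. f (Xa m k i om) (Xa m k l om)))
   = (\<Sum>m=1..d. \<Sum>k=1..n. tt1 m * f (Xa m k i om) (Xa m k j om) + tt2 m * f (Xa m k i om) (Xa m k l om))"
   by (simp only: sum_distrib_left sum.distrib)
  also have "... = (\<Sum>p\<in>{1..d} \<times> {1..n}. tt1 (fst p) * f (Xa (fst p) (snd p) i om) (Xa (fst p) (snd p) j om) + tt2 (fst p) * f (Xa (fst p) (snd p) i om) (Xa (fst p) (snd p) l om))"
   by (simp add: sum.cartesian_product case_prod_beta')
  finally show ?thesis unfolding W_def G_def by (simp only: exp_sum finite_cartesian_product finite_atLeastAtMost prod.distrib prod.collapse)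
 qed
 note EP = expectation_triple_prod[OF ijl Gm Gb, where n=n]
 show "integrable M W" unfolding Weq[abs_def] using EP(2) by simp
 have "(LINT om|M. W om) = (\<Prod>p\<in>{1..d} \<times> {1..n}. \<integral>om. G (fst p) (snd p) (Xa (fst p) (snd p) i om) (Xa (fst p) (snd p) j om) (Xa (fst p) (snd p) l om) \<partial>M)"
  unfolding Weq by (rule EP(1))
 also have "... <= (\<Prod>p\<in>{1..d} \<times> {1..n}. A p * exp (cc (fst p)))"
 proof (rule prod_mono)
  fix p assume p: "p : {1..d} \<times> {1..n}"
  have "0 <= (LINT om|M. G (fst p) (snd p) (Xa (fst p) (snd p) i om) (Xa (fst p) (snd p) j om) (Xa (fst p) (snd p) l om))"
   by (rule Bochner_Integration.integral_nonneg) (simp add: G_def w(2))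
  moreover have "(LINT om|M. G (fst p) (snd p) (Xa (fst p) (snd p) i om) (Xa (fst p) (snd p) j om) (Xa (fst p) (snd p) l om)) <= A p * exp (cc (fst p))"
   using mg[of "fst p" "snd p"] p unfolding G_def by auto
  ultimately show "0 <= (LINT om|M. G (fst p) (snd p) (Xa (fst p) (snd p) i om) (Xa (fst p) (snd p) j om) (Xa (fst p) (snd p) l om)) \<and>
   (LINT om|M. G (fst p) (snd p) (Xa (fst p) (snd p) i om) (Xa (fst p) (snd p) j om) (Xa (fst p) (snd p) l om)) <= A p * exp (cc (fst p))" by blast
 qed
 also have "... = (\<Prod>p\<in>{1..d} \<times> {1..n}. A p) * exp (\<Sum>p\<in>{1..d} \<times> {1..n}. cc (fst p))"
  by (simp add: prod.distrib exp_sum)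
 also have "(\<Sum>p\<in>{1..d} \<times> {1..n}. cc (fst p)) = real n * (\<Sum>m=1..d. cc m)"
 proof -
  have "(\<Sum>p\<in>{1..d} \<times> {1..n}. cc (fst p)) = (\<Sum>m=1..d. \<Sum>k=1..n. cc m)" unfolding sum.cartesian_product by (rule sum.cong) auto
  then show ?thesis by (simp add: sum_distrib_left)
 qed
 finally show "(LINT om|M. W om) <= (\<Prod>p\<in>{1..d} \<times> {1..n}. A p) * exp (real n * (\<Sum>m=1..d. cc m))" .
qed

lemma chernoff_column:
 fixes f :: "real => real => real" and w :: "nat \<times> nat => real => real"
 assumes F: "good_net d ep F" and r: "0 < r" and n: "1 <= n" and e: "0 <= ep"
  and ij: "1 <= i" "1 <= j"
  and f: "(%(x, y). f x y) : borel_measurable (borel \<Otimes>\<^sub>M borel)" "!!x y. \<bar>f x y\<bar> <= K"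
  and w: "!!p. w p : borel_measurable borel" "!!p x. 0 <= w p x" "!!p x. w p x <= 1"
  and A: "!!p. 0 <= A p"
  and mg: "!!h m k. \<bar>h\<bar> <= 2 * r / sqrt n ==> m : {1..d} ==> k : {1..n} ==>
   (LINT om|M. w (m, k) (Xa m k i om) * exp (h * f (Xa m k i om) (Xa m k j om))) <= A (m, k) * exp ((1 + ep) * h\<^sup>2 / 2 + c)"
  and B: "B : events" "!!om. om : space M ==> indicator B om = (\<Prod>p\<in>{1..d} \<times> {1..n}. w p (Xa (fst p) (snd p) i om))"
 shows "prob (B Int {om : space M. r\<^sup>2 * n <= (\<Sum>m=1..d. (\<Sum>k=1..n. f (Xa m k i om) (Xa m k j om))\<^sup>2)})
  <= real (card F) * ((\<Prod>p\<in>{1..d} \<times> {1..n}. A p) * exp (real n * (real d * c))) * exp (- (1 - 5 * ep) * r\<^sup>2 / 2)"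
proof (rule chernoff_single[OF F r _ e])
 let ?PA = "\<Prod>p\<in>{1..d} \<times> {1..n}. A p"
 let ?S = "%m om. \<Sum>k=1..n. f (Xa m k i om) (Xa m k j om)"
 show "0 < real n" using n by simp
 show "0 <= ?PA * exp (real n * (real d * c))" using A by (simp add: prod_nonneg)
 show "B : events" by (rule B(1))
 show "?S m : borel_measurable M" if m: "m : {1..d}" for m
 proof (rule borel_measurable_sum)
  fix k assume "k : {1..n}"
  then have [measurable]: "Xa m k i : borel_measurable M" "Xa m k j : borel_measurable M" using m ij rv_Xa by auto
  have "(%om. (Xa m k i om, Xa m k j om)) : measurable M (borel \<Otimes>\<^sub>M borel)" by measurable
  from measurable_compose[OF this f(1)] show "(%om. f (Xa m k i om) (Xa m k j om)) : borel_measurable M" by simp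
 qed
 fix tt assume tt: "tt : F"
 define t where "t m = (if m : {1..d} then r / sqrt n * tt m else 0)" for m
 have tb: "\<bar>t m\<bar> <= 2 * r / sqrt n" for m
 proof (cases "m : {1..d}")
  case True
  then have "\<bar>tt m\<bar> <= 2" using F tt by (auto simp: good_net_def)
  then have "r / sqrt n * \<bar>tt m\<bar> <= r / sqrt n * 2" using r by (intro mult_left_mono) auto
  then show ?thesis using True r by (simp add: t_def abs_mult mult.commute)
 next
  case False then have "t m = 0" unfolding t_def by (rule if_not_P)
  then show ?thesis using r by simp
 qed
 have z: "\<bar>0::real\<bar> <= 2 * r / sqrt n" using r by simp
 define V where "V om = (\<Prod>p\<in>{1..d} \<times> {1..n}. w p (Xa (fst p) (snd p) i om)) *
   exp (\<Sum>m=1..d. t m * (\<Sum>k=1..n. f (Xa m k i om) (Xa m k j om)) + (%_. 0) m * (\<Sum>k=1..n. f (Xa m k i om) (Xa m k j om)))" for om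
 have ES: "(LINT om|M. V om) <= ?PA * exp (real n * (\<Sum>m=1..d. (1 + ep) * (t m)\<^sup>2 / 2 + c))" "integrable M V"
  unfolding V_def
  by (rule exp_sum_bound[OF ij(1) ij(2) ij(2) f w tb z]; use mg[OF tb] in simp)+
 have eqV: "indicator B om * exp (r / sqrt n * (\<Sum>m=1..d. tt m * ?S m om)) = V om" if "om : space M" for om
 proof -
  have "(\<Sum>m=1..d. t m * ?S m om + (%_. 0) m * ?S m om) = (\<Sum>m=1..d. r / sqrt n * (tt m * ?S m om))"
   by (rule sum.cong) (auto simp: t_def)
  also have "... = r / sqrt n * (\<Sum>m=1..d. tt m * ?S m om)" by (simp only: sum_distrib_left)
  finally show ?thesis unfolding V_def B(2)[OF that] by simp
 qed
 have i1: "integrable M (%om. indicator B om * exp (r / sqrt n * (\<Sum>m=1..d. tt m * ?S m om))) = integrable M V"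
  by (rule Bochner_Integration.integrable_cong[OF refl]) (rule eqV)
 then show "integrable M (%om. indicator B om * exp (r / sqrt n * (\<Sum>m=1..d. tt m * ?S m om)))" using ES(2) by simp
 have "(LINT om|M. indicator B om * exp (r / sqrt n * (\<Sum>m=1..d. tt m * ?S m om))) = (LINT om|M. V om)"
  by (rule Bochner_Integration.integral_cong[OF refl]) (rule eqV)
 also note ES(1)
 also have "real n * (\<Sum>m=1..d. (1 + ep) * (t m)\<^sup>2 / 2 + c) = (1 + ep) * r\<^sup>2 * (\<Sum>m=1..d. (tt m)\<^sup>2) / 2 + real n * (real d * c)"
 proof -
  have "(\<Sum>m=1..d. (1 + ep) * (t m)\<^sup>2 / 2 + c) = (\<Sum>m=1..d. ((1 + ep) * r\<^sup>2 / 2 / real n) * (tt m)\<^sup>2 + c)"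
   by (rule sum.cong) (auto simp: t_def power_mult_distrib power_divide)
  also have "... = ((1 + ep) * r\<^sup>2 / 2 / real n) * (\<Sum>m=1..d. (tt m)\<^sup>2) + real d * c"
   by (simp add: sum.distrib sum_distrib_left)
  finally show ?thesis using n by (simp add: distrib_left)
 qed
 also have "?PA * exp ((1 + ep) * r\<^sup>2 * (\<Sum>m=1..d. (tt m)\<^sup>2) / 2 + real n * (real d * c)) = ?PA * exp (real n * (real d * c)) * exp ((1 + ep) * r\<^sup>2 * (\<Sum>m=1..d. (tt m)\<^sup>2) / 2)"
  unfolding exp_add by simp
 finally show "(LINT om|M. indicator B om * exp (r / sqrt n * (\<Sum>m=1..d. tt m * ?S m om)))
  <= ?PA * exp (real n * (real d * c)) * exp ((1 + ep) * r\<^sup>2 * (\<Sum>m=1..d. (tt m)\<^sup>2) / 2)" .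
qed

lemma chernoff_two_columns:
 fixes f :: "real => real => real"
 assumes F: "good_net (2 * d) ep F" and r: "0 < r" and n: "1 <= n" and e: "0 <= ep"
  and ij: "1 <= i" "1 <= j" "1 <= l"
  and f: "(%(x, y). f x y) : borel_measurable (borel \<Otimes>\<^sub>M borel)" "!!x y. \<bar>f x y\<bar> <= K"
  and mg: "!!h1 h2 m k. \<bar>h1\<bar> <= 4 * r / sqrt n ==> \<bar>h2\<bar> <= 4 * r / sqrt n ==> m : {1..d} ==> k : {1..n} ==>
   (LINT om|M. exp (h1 * f (Xa m k i om) (Xa m k j om) + h2 * f (Xa m k i om) (Xa m k l om))) <= exp ((h1\<^sup>2 + h2\<^sup>2) / 2 + c)"
 shows "prob ({om : space M. r\<^sup>2 * n <= (\<Sum>m=1..d. (\<Sum>k=1..n. f (Xa m k i om) (Xa m k j om))\<^sup>2)} Int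
  {om : space M. r\<^sup>2 * n <= (\<Sum>m=1..d. (\<Sum>k=1..n. f (Xa m k i om) (Xa m k l om))\<^sup>2)})
  <= real (card F) * exp (real n * (real d * c)) * exp (- (1 - 5 * ep) * r\<^sup>2)"
proof -
 define S where "S m om = (if m <= d then (\<Sum>k=1..n. f (Xa m k i om) (Xa m k j om)) else (\<Sum>k=1..n. f (Xa (m - d) k i om) (Xa (m - d) k l om)))" for m om
 define R where "R = sqrt 2 * r"
 have R: "0 < R" "R\<^sup>2 = 2 * r\<^sup>2" using r by (auto simp: R_def power_mult_distrib)
 have split: "(\<Sum>m=1..2 * d. g m) = (\<Sum>m=1..d. g m) + (\<Sum>m=1..d. g (m + d))" for g :: "nat => real"
 proof -
  have "(\<Sum>m=1..2 * d. g m) = (\<Sum>m=1..d. g m) + (\<Sum>m=d + 1..d + d. g m)"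
   using sum.ub_add_nat[of 1 d g d] by (simp add: mult_2)
  also have "(\<Sum>m=d + 1..d + d. g m) = (\<Sum>m=1..d. g (m + d))" using sum.shift_bounds_cl_nat_ivl[of g 1 d d] by (simp add: add.commute)
  finally show ?thesis .
 qed
 have Sm: "S m : borel_measurable M" if m: "m : {1..2 * d}" for m
 proof -
  have g: "(%om. \<Sum>k=1..n. f (Xa m k i om) (Xa m k j om)) : borel_measurable M" if m: "m : {1..d}" and j: "1 <= j" for m j
  proof (rule borel_measurable_sum)
   fix k assume "k : {1..n}"
   then have [measurable]: "Xa m k i : borel_measurable M" "Xa m k j : borel_measurable M" using m j ij rv_Xa by auto
   have "(%om. (Xa m k i om, Xa m k j om)) : measurable M (borel \<Otimes>\<^sub>M borel)" by measurable
   from measurable_compose[OF this f(1)] show "(%om. f (Xa m k i om) (Xa m k j om)) : borel_measurable M" by simp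
  qed
  show ?thesis
  proof (cases "m <= d")
   case True
   then have "S m = (%om. \<Sum>k=1..n. f (Xa m k i om) (Xa m k j om))" by (auto simp: S_def)
   then show ?thesis using g[OF _ ij(2), of m] True m by simp
  next
   case False
   then have "S m = (%om. \<Sum>k=1..n. f (Xa (m - d) k i om) (Xa (m - d) k l om))" by (auto simp: S_def)
   moreover have "m - d : {1..d}" using False m by auto
   ultimately show ?thesis using g[OF _ ij(3), of "m - d"] by simp
  qed
 qed
 have key: "(LINT om|M. indicator (space M) om * exp (R / sqrt n * (\<Sum>m=1..2 * d. tt m * S m om))) <= exp (real n * (real d * c)) * exp ((1 + ep) * R\<^sup>2 * (\<Sum>m=1..2 * d. (tt m)\<^sup>2) / 2)
   & integrable M (%om. indicator (space M) om * exp (R / sqrt n * (\<Sum>m=1..2 * d. tt m * S m om)))" if tt: "tt : F" for tt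
 proof -
  define t1 where "t1 m = (if m : {1..d} then R / sqrt n * tt m else 0)" for m
  define t2 where "t2 m = (if m : {1..d} then R / sqrt n * tt (m + d) else 0)" for m
  have s2: "sqrt 2 <= 2" using real_sqrt_le_mono[of 2 4] by simp
  have h: "R / sqrt n * \<bar>tt m\<bar> <= 4 * r / sqrt n" if "m : {1..2 * d}" for m
  proof -
   have "\<bar>tt m\<bar> <= 2" using F tt that by (auto simp: good_net_def)
   then have "R * \<bar>tt m\<bar> <= (2 * r) * 2" unfolding R_def using s2 r by (intro mult_mono) auto
   then have "R * \<bar>tt m\<bar> / sqrt n <= 4 * r / sqrt n" by (intro divide_right_mono) auto
   then show ?thesis by simp
  qed
  have b1: "\<bar>t1 m\<bar> <= 4 * r / sqrt n" for m
  proof (cases "m : {1..d}")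
   case True then show ?thesis using h[of m] R(1) by (simp add: t1_def abs_mult)
  next
   case False then have "t1 m = 0" unfolding t1_def by (rule if_not_P)
   then show ?thesis using r by simp
  qed
  have b2: "\<bar>t2 m\<bar> <= 4 * r / sqrt n" for m
  proof (cases "m : {1..d}")
   case True then show ?thesis using h[of "m + d"] R(1) by (simp add: t2_def abs_mult)
  next
   case False then have "t2 m = 0" unfolding t2_def by (rule if_not_P)
   then show ?thesis using r by simp
  qed
  define V where "V om = (\<Prod>p\<in>{1..d} \<times> {1..n}. (%_ _. 1) p (Xa (fst p) (snd p) i om)) *
   exp (\<Sum>m=1..d. t1 m * (\<Sum>k=1..n. f (Xa m k i om) (Xa m k j om)) + t2 m * (\<Sum>k=1..n. f (Xa m k i om) (Xa m k l om)))" for om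
  have ES: "(LINT om|M. V om) <= (\<Prod>p\<in>{1..d} \<times> {1..n}. (%_. 1) p) * exp (real n * (\<Sum>m=1..d. ((t1 m)\<^sup>2 + (t2 m)\<^sup>2) / 2 + c))" "integrable M V"
   unfolding V_def
   by (rule exp_sum_bound[OF ij f _ _ _ b1 b2, where w="%_ _. 1" and A="%_. 1"]; use mg[OF b1 b2] in simp)+
  have eqV: "R / sqrt n * (\<Sum>m=1..2 * d. tt m * S m om) = (\<Sum>m=1..d. t1 m * (\<Sum>k=1..n. f (Xa m k i om) (Xa m k j om)) + t2 m * (\<Sum>k=1..n. f (Xa m k i om) (Xa m k l om)))" for om
  proof -
   define P Q where "P m = (\<Sum>k=1..n. f (Xa m k i om) (Xa m k j om))" and "Q m = (\<Sum>k=1..n. f (Xa m k i om) (Xa m k l om))" for m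
   have "(\<Sum>m=1..d. t1 m * P m + t2 m * Q m) = (\<Sum>m=1..d. R / sqrt n * (tt m * P m) + R / sqrt n * (tt (m + d) * Q m))"
    by (rule sum.cong) (simp_all add: t1_def t2_def)
   also have "... = R / sqrt n * ((\<Sum>m=1..d. tt m * P m) + (\<Sum>m=1..d. tt (m + d) * Q m))"
    by (simp only: sum.distrib distrib_left sum_distrib_left)
   also have "(\<Sum>m=1..d. tt m * P m) = (\<Sum>m=1..d. tt m * S m om)" by (rule sum.cong) (auto simp: S_def P_def)
   also have "(\<Sum>m=1..d. tt (m + d) * Q m) = (\<Sum>m=1..d. tt (m + d) * S (m + d) om)" by (rule sum.cong) (auto simp: S_def Q_def)
   finally show ?thesis unfolding split P_def Q_def by (rule sym)
  qed
  have VV: "V om = exp (R / sqrt n * (\<Sum>m=1..2 * d. tt m * S m om))" for om unfolding V_def eqV by simp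
  have sq: "real n * (\<Sum>m=1..d. ((t1 m)\<^sup>2 + (t2 m)\<^sup>2) / 2 + c) = R\<^sup>2 * (\<Sum>m=1..2 * d. (tt m)\<^sup>2) / 2 + real n * (real d * c)"
  proof -
   have "(\<Sum>m=1..d. ((t1 m)\<^sup>2 + (t2 m)\<^sup>2) / 2 + c) = (\<Sum>m=1..d. (R\<^sup>2 / 2 / real n) * ((tt m)\<^sup>2 + (tt (m + d))\<^sup>2) + c)"
    by (rule sum.cong) (auto simp: t1_def t2_def power_mult_distrib power_divide add_divide_distrib distrib_left)
   also have "... = (R\<^sup>2 / 2 / real n) * (\<Sum>m=1..2 * d. (tt m)\<^sup>2) + real d * c"
    unfolding split sum.distrib sum_distrib_left[symmetric] by simp
   finally show ?thesis using n by (simp add: distrib_left)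
  qed
  have Q0: "0 <= (\<Sum>m=1..2 * d. (tt m)\<^sup>2)" by (rule sum_nonneg) simp
  have "(LINT om|M. indicator (space M) om * exp (R / sqrt n * (\<Sum>m=1..2 * d. tt m * S m om))) = (LINT om|M. V om)"
   by (rule Bochner_Integration.integral_cong) (auto simp: VV)
  also have "... <= exp (R\<^sup>2 * (\<Sum>m=1..2 * d. (tt m)\<^sup>2) / 2 + real n * (real d * c))" using ES(1) unfolding sq by simp
  also have "... = exp (real n * (real d * c)) * exp (R\<^sup>2 * (\<Sum>m=1..2 * d. (tt m)\<^sup>2) / 2)" unfolding exp_add by simp
  also have "... <= exp (real n * (real d * c)) * exp ((1 + ep) * R\<^sup>2 * (\<Sum>m=1..2 * d. (tt m)\<^sup>2) / 2)"
  proof (rule mult_left_mono)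
   have "0 <= ep * (R\<^sup>2 * (\<Sum>m=1..2 * d. (tt m)\<^sup>2))" using e Q0 by simp
   then have "R\<^sup>2 * (\<Sum>m=1..2 * d. (tt m)\<^sup>2) / 2 <= (1 + ep) * R\<^sup>2 * (\<Sum>m=1..2 * d. (tt m)\<^sup>2) / 2" by (simp add: distrib_right mult.assoc)
   then show "exp (R\<^sup>2 * (\<Sum>m=1..2 * d. (tt m)\<^sup>2) / 2) <= exp ((1 + ep) * R\<^sup>2 * (\<Sum>m=1..2 * d. (tt m)\<^sup>2) / 2)" by simp
  qed simp
  finally have 1: "(LINT om|M. indicator (space M) om * exp (R / sqrt n * (\<Sum>m=1..2 * d. tt m * S m om))) <= exp (real n * (real d * c)) * exp ((1 + ep) * R\<^sup>2 * (\<Sum>m=1..2 * d. (tt m)\<^sup>2) / 2)" .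
  have "integrable M (%om. indicator (space M) om * exp (R / sqrt n * (\<Sum>m=1..2 * d. tt m * S m om))) = integrable M V"
   by (rule Bochner_Integration.integrable_cong) (auto simp: VV)
  then show ?thesis using 1 ES(2) by blast
 qed
 have n0: "0 < real n" using n by simp
 have "prob (space M Int {om : space M. R\<^sup>2 * n <= (\<Sum>m=1..2 * d. (S m om)\<^sup>2)}) <= real (card F) * exp (real n * (real d * c)) * exp (- (1 - 5 * ep) * R\<^sup>2 / 2)"
  by (rule chernoff_single[OF F R(1) n0 e]) (use Sm key in auto)
 moreover have "prob ({om : space M. r\<^sup>2 * n <= (\<Sum>m=1..d. (\<Sum>k=1..n. f (Xa m k i om) (Xa m k j om))\<^sup>2)} Int
  {om : space M. r\<^sup>2 * n <= (\<Sum>m=1..d. (\<Sum>k=1..n. f (Xa m k i om) (Xa m k l om))\<^sup>2)}) <= prob (space M Int {om : space M. R\<^sup>2 * n <= (\<Sum>m=1..2 * d. (S m om)\<^sup>2)})"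
 proof (rule finite_measure_mono)
  have "(\<Sum>m=1..2 * d. (S m om)\<^sup>2) = (\<Sum>m=1..d. (\<Sum>k=1..n. f (Xa m k i om) (Xa m k j om))\<^sup>2) + (\<Sum>m=1..d. (\<Sum>k=1..n. f (Xa m k i om) (Xa m k l om))\<^sup>2)" for om
   unfolding split by (intro arg_cong2[where f="(+)"] sum.cong) (auto simp: S_def)
  then show "{om : space M. r\<^sup>2 * n <= (\<Sum>m=1..d. (\<Sum>k=1..n. f (Xa m k i om) (Xa m k j om))\<^sup>2)} Int
  {om : space M. r\<^sup>2 * n <= (\<Sum>m=1..d. (\<Sum>k=1..n. f (Xa m k i om) (Xa m k l om))\<^sup>2)} \<subseteq> space M Int {om : space M. R\<^sup>2 * n <= (\<Sum>m=1..2 * d. (S m om)\<^sup>2)}"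
   unfolding R(2) by auto
  have [measurable]: "!!m. m : {1..2 * d} ==> S m : borel_measurable M" by (rule Sm)
  show "space M Int {om : space M. R\<^sup>2 * n <= (\<Sum>m=1..2 * d. (S m om)\<^sup>2)} : events" by measurable
 qed
 moreover have "- (1 - 5 * ep) * R\<^sup>2 / 2 = - (1 - 5 * ep) * r\<^sup>2" unfolding R(2) by simp
 ultimately show ?thesis by (simp only: order_trans)
qed

lemma column_norm_concentration:
 obtains K where "0 <= K" "!!b n i. 1 <= b ==> 1 <= i ==>
  prob {om : space M. K * (real n / b\<^sup>2) <= \<bar>(\<Sum>m=1..d. \<Sum>k=1..n. (trunc b (Xa m k i om))\<^sup>2) - real d * real n\<bar>} <= 2 * exp (- 3 * (real n / (b\<^sup>2)\<^sup>2))"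
proof -
 define c where "c = m4 + exp 1 * (m4 + 1)"
 define K where "K = real d * c + 3"
 have K0: "0 <= K" using m4_nonneg by (simp add: K_def c_def)
 show ?thesis
 proof (rule that[OF K0])
  fix b :: real and n i :: nat assume b: "1 <= b" and i: "1 <= i"
  have b0: "0 < b" using b by simp
  note ti = trunc_integrable[OF b0] and tm = trunc_moments[OF b0]
  define z where "z = 1 / b\<^sup>2"
  have z: "0 < z" "z <= 1" using b by (auto simp: z_def one_le_power)
  define Q where "Q x = (trunc b x)\<^sup>2 - 1" for x
  have Qm[measurable]: "Q : borel_measurable borel" unfolding Q_def[abs_def] by measurable
  have zQ: "\<bar>z * Q x\<bar> <= 1" for x
  proof -
   have "(trunc b x)\<^sup>2 <= b\<^sup>2" using power_mono[OF abs_trunc_le(2)[OF b0, of x] abs_ge_zero, of 2] by simp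
   then have "z * (trunc b x)\<^sup>2 <= z * b\<^sup>2" using z by (intro mult_left_mono) auto
   also have "z * b\<^sup>2 = 1" using b0 by (simp add: z_def)
   finally have 1: "z * (trunc b x)\<^sup>2 <= 1" .
   have 2: "0 <= z * (trunc b x)\<^sup>2" using z by simp
   have "z * Q x = z * (trunc b x)\<^sup>2 - z" by (simp add: Q_def right_diff_distrib)
   then show ?thesis using 1 2 z by linarith
  qed
  have mg: "(LINT om|M. exp (s * (z * Q (X om)))) <= exp (c * z\<^sup>2)" if s: "s = 1 \<or> s = -1" for s :: real
  proof -
   have sq: "\<bar>s * (z * Q x)\<bar> <= 1" for x using zQ[of x] s by auto
   have iQ: "integrable M (%om. Q (X om))" unfolding Q_def using ti(2) by simp
   have EQ: "(LINT om|M. Q (X om)) = (LINT om|M. (trunc b (X om))\<^sup>2) - 1" unfolding Q_def using ti(2) by (simp add: prob_space)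
   have i4: "integrable M (%om. (trunc b (X om)) ^ 4 + 1)" using ti(4) by simp
   define G where "G om = 1 + s * z * Q (X om) + exp 1 * z\<^sup>2 * ((trunc b (X om)) ^ 4 + 1)" for om
   have iG: "integrable M G" unfolding G_def[abs_def] by (intro Bochner_Integration.integrable_add integrable_mult_right iQ i4 integrable_const)
   have EG: "(LINT om|M. G om) = 1 + s * z * ((LINT om|M. (trunc b (X om))\<^sup>2) - 1) + exp 1 * z\<^sup>2 * ((LINT om|M. (trunc b (X om)) ^ 4) + 1)"
   proof -
    have "(LINT om|M. G om) = (LINT om|M. 1 + s * z * Q (X om)) + (LINT om|M. exp 1 * z\<^sup>2 * ((trunc b (X om)) ^ 4 + 1))"
     unfolding G_def by (intro Bochner_Integration.integral_add Bochner_Integration.integrable_add integrable_mult_right iQ i4 integrable_const)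
    also have "(LINT om|M. 1 + s * z * Q (X om)) = 1 + s * z * (LINT om|M. Q (X om))" using iQ by (simp add: prob_space)
    also have "(LINT om|M. exp 1 * z\<^sup>2 * ((trunc b (X om)) ^ 4 + 1)) = exp 1 * z\<^sup>2 * ((LINT om|M. (trunc b (X om)) ^ 4) + 1)" using ti(4) by (simp add: prob_space)
    finally show ?thesis unfolding EQ .
   qed
   have "(LINT om|M. exp (s * (z * Q (X om)))) <= (LINT om|M. G om)"
   proof (rule integral_mono[OF _ iG])
    show "integrable M (%om. exp (s * (z * Q (X om))))"
    proof (rule integrable_const_bound[where B="exp 1"])
     show "AE om in M. norm (exp (s * (z * Q (X om)))) <= exp 1"
     proof (rule AE_I2)
      fix om have "s * (z * Q (X om)) <= 1" using sq[of "X om"] by (rule order_trans[OF abs_ge_self])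
      then show "norm (exp (s * (z * Q (X om)))) <= exp 1" by simp
     qed
    qed measurable
    fix om
    define t where "t = s * (z * Q (X om))"
    have "t\<^sup>2 = z\<^sup>2 * (Q (X om))\<^sup>2" using s by (auto simp: t_def power_mult_distrib)
    moreover have "(Q (X om))\<^sup>2 <= (trunc b (X om)) ^ 4 + 1"
    proof -
     have "(u - 1)\<^sup>2 <= u\<^sup>2 + 1" if "0 <= u" for u :: real using that by (simp add: power2_eq_square algebra_simps)
     from this[of "(trunc b (X om))\<^sup>2"] show ?thesis unfolding Q_def by (simp flip: power_mult)
    qed
    ultimately have "t\<^sup>2 <= z\<^sup>2 * ((trunc b (X om)) ^ 4 + 1)" by (simp add: mult_left_mono)
    then have "exp 1 * t\<^sup>2 <= exp 1 * (z\<^sup>2 * ((trunc b (X om)) ^ 4 + 1))" by (intro mult_left_mono) auto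
    moreover have "\<bar>exp t - 1 - t\<bar> <= exp 1 * t\<^sup>2" by (rule exp_taylor_bounds(3)) (use sq in \<open>simp add: t_def\<close>)
    ultimately have "exp t <= 1 + t + exp 1 * (z\<^sup>2 * ((trunc b (X om)) ^ 4 + 1))" by linarith
    then show "exp (s * (z * Q (X om))) <= G om" unfolding t_def G_def by (simp only: mult.assoc)
   qed
   also have "... <= 1 + c * z\<^sup>2"
   proof -
    define v where "v = (LINT om|M. (trunc b (X om))\<^sup>2)"
    have v: "1 - m4 * z <= v" "v <= 1" using tm(2,3) by (auto simp: v_def z_def)
    have "s * z * (v - 1) <= z * (m4 * z)"
    proof -
     have "\<bar>s * z * (v - 1)\<bar> = z * (1 - v)" using s z v by (auto simp: abs_mult)
     also have "... <= z * (m4 * z)" using v z by (intro mult_left_mono) auto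
     finally show ?thesis by (rule order_trans[OF abs_ge_self])
    qed
    moreover have "exp 1 * z\<^sup>2 * ((LINT om|M. (trunc b (X om)) ^ 4) + 1) <= exp 1 * z\<^sup>2 * (m4 + 1)" using tm(5) by (intro mult_left_mono) auto
    moreover have "1 + c * z\<^sup>2 = 1 + z * (m4 * z) + exp 1 * z\<^sup>2 * (m4 + 1)" by (simp add: c_def power2_eq_square algebra_simps)
    ultimately show ?thesis unfolding EG v_def[symmetric] by linarith
   qed
   also have "... <= exp (c * z\<^sup>2)" by (rule exp_ge_add_one_self)
   finally show ?thesis .
  qed
  define T where "T om = (\<Sum>m=1..d. \<Sum>k=1..n. Q (Xa m k i om))" for om
  have Tm[measurable]: "T : borel_measurable M" unfolding T_def[abs_def]
  proof (intro borel_measurable_sum)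
   fix m k assume "m : {1..d}" "k : {1..n}"
   then have [measurable]: "Xa m k i : borel_measurable M" using rv_Xa i by auto
   show "(%om. Q (Xa m k i om)) : borel_measurable M" by measurable
  qed
  have one: "prob {om : space M. K * (real n * z) <= s * T om} <= exp (- 3 * (real n * z\<^sup>2))" if s: "s = 1 \<or> s = -1" for s :: real
  proof -
   define f where "f x y = z * Q x" for x y :: real
   have fm: "(%(x, y). f x y) : borel_measurable (borel \<Otimes>\<^sub>M borel)" unfolding f_def by measurable
   have fb: "\<bar>f x y\<bar> <= 1" for x y unfolding f_def by (rule zQ)
   have mg': "(LINT om|M. (%_ _. 1) (m, k) (Xa m k i om) * exp ((%_. s) m * f (Xa m k i om) (Xa m k i om) + (%_. 0) m * f (Xa m k i om) (Xa m k i om))) <= (%_. 1) (m, k) * exp ((%_. c * z\<^sup>2) m)"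
    if "m : {1..d}" "k : {1..n}" for m k
    using mg[OF s] ident_integral(1)[of m k i "%x. exp (s * (z * Q x))"] that i by (simp add: f_def)
   define V where "V om = (\<Prod>p\<in>{1..d} \<times> {1..n}. (%_ _. 1) p (Xa (fst p) (snd p) i om)) *
    exp (\<Sum>m=1..d. (%_. s) m * (\<Sum>k=1..n. f (Xa m k i om) (Xa m k i om)) + (%_. 0) m * (\<Sum>k=1..n. f (Xa m k i om) (Xa m k i om)))" for om
   have s1: "\<bar>(%_::nat. s) m\<bar> <= 1" "\<bar>(%_::nat. 0::real) m\<bar> <= 1" for m using s by auto
   have ES: "(LINT om|M. V om) <= (\<Prod>p\<in>{1..d} \<times> {1..n}. (%_. 1) p) * exp (real n * (\<Sum>m=1..d. (%_. c * z\<^sup>2) m))" "integrable M V"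
    unfolding V_def by (rule exp_sum_bound[OF i i i fm fb _ _ _ s1 mg']; simp)+
   have VT: "V om = exp (z * (s * T om))" for om
    unfolding V_def T_def f_def by (simp add: sum_distrib_left mult_ac)
   have "prob {om : space M. K * (real n * z) <= s * T om} = (LINT om|M. indicator {om : space M. K * (real n * z) <= s * T om} om)" by simp
   also have "... <= (LINT om|M. exp (- (z * (K * (real n * z)))) * V om)"
   proof (rule integral_mono)
    show "integrable M (indicator {om : space M. K * (real n * z) <= s * T om} :: 'a => real)"
     by (intro integrable_real_indicator) (auto simp: emeasure_eq_measure)
    show "integrable M (%om. exp (- (z * (K * (real n * z)))) * V om)" using ES(2) by simp
    fix om
    have "1 <= exp (- (z * (K * (real n * z)))) * V om" if "K * (real n * z) <= s * T om"
     unfolding VT exp_add[symmetric] using mult_left_mono[OF that, of z] z by simp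
    moreover have "0 <= exp (- (z * (K * (real n * z)))) * V om" by (simp add: VT)
    ultimately show "indicator {om : space M. K * (real n * z) <= s * T om} om <= exp (- (z * (K * (real n * z)))) * V om"
     by (auto simp: indicator_def)
   qed
   also have "... = exp (- (z * (K * (real n * z)))) * (LINT om|M. V om)" by simp
   also have "... <= exp (- (z * (K * (real n * z)))) * exp (real n * (real d * (c * z\<^sup>2)))" using ES(1) by (intro mult_left_mono) auto
   also have "... = exp (- 3 * (real n * z\<^sup>2))" unfolding exp_add[symmetric]
    by (rule arg_cong[where f=exp]) (simp add: K_def power2_eq_square algebra_simps)
   finally show ?thesis .
  qed
  have A: "(\<Sum>m=1..d. \<Sum>k=1..n. (trunc b (Xa m k i om))\<^sup>2) - real d * real n = T om" for om
   unfolding T_def Q_def by (simp add: sum_subtractf)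
  have "prob {om : space M. K * (real n * z) <= \<bar>T om\<bar>} <= prob ({om : space M. K * (real n * z) <= 1 * T om} \<union> {om : space M. K * (real n * z) <= -1 * T om})"
   by (rule finite_measure_mono) auto
  also have "... <= prob {om : space M. K * (real n * z) <= 1 * T om} + prob {om : space M. K * (real n * z) <= -1 * T om}"
   by (rule measure_Un_le) measurable
  also have "... <= exp (- 3 * (real n * z\<^sup>2)) + exp (- 3 * (real n * z\<^sup>2))" by (intro add_mono one) auto
  finally have "prob {om : space M. K * (real n * z) <= \<bar>T om\<bar>} <= 2 * exp (- 3 * (real n * z\<^sup>2))" by simp
  then show "prob {om : space M. K * (real n / b\<^sup>2) <= \<bar>(\<Sum>m=1..d. \<Sum>k=1..n. (trunc b (Xa m k i om))\<^sup>2) - real d * real n\<bar>} <= 2 * exp (- 3 * (real n / (b\<^sup>2)\<^sup>2))"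
   unfolding A by (simp add: z_def power_divide)
 qed
qed

end

lemma exp_le_quadratic:
 fixes t ep :: real
 assumes "\<bar>t\<bar> <= ep" "ep <= 1"
 shows "exp t <= 1 + t + (1 + ep) * t\<^sup>2 / 2"
proof -
 obtain a where a: "\<bar>a\<bar> <= \<bar>t\<bar>" "exp t = (\<Sum>m<3. t ^ m / fact m) + exp a / fact 3 * t ^ 3" using Maclaurin_exp_le by blast
 have e: "exp t = 1 + t + t\<^sup>2 / 2 + exp a / 6 * t ^ 3" using a(2) by (simp add: eval_nat_numeral)
 have "a <= 1" using a(1) assms by linarith
 then have "exp a <= exp 1" by simp
 also have "exp (1::real) <= 3" by (rule exp_le)
 finally have ea: "exp a / 6 <= 1 / 2" by simp
 have "t * t\<^sup>2 <= \<bar>t\<bar> * t\<^sup>2" by (intro mult_right_mono) auto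
 then have "exp a / 6 * t ^ 3 <= exp a / 6 * (\<bar>t\<bar> * t\<^sup>2)"
  by (intro mult_left_mono) (simp_all add: power3_eq_cube power2_eq_square)
 also have "... <= 1 / 2 * (ep * t\<^sup>2)" by (intro mult_mono ea mult_right_mono assms(1)) auto
 finally show ?thesis unfolding e by (simp add: algebra_simps)
qed

lemma quadratic_lower:
 fixes t ep :: real
 assumes "0 <= ep" shows "0 <= 1 + t + (1 + ep) * t\<^sup>2 / 2"
proof -
 have "0 <= (1 + t)\<^sup>2 / 2 + 1 / 2 + ep * t\<^sup>2 / 2" using assms by simp
 also have "... = 1 + t + (1 + ep) * t\<^sup>2 / 2" by (simp add: power2_eq_square field_simps)
 finally show ?thesis .
qed

context iid_array
begin

definition Sq :: "(real => real => real) => nat => nat => nat => 'a => real" where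
 "Sq f n i j om = (\<Sum>m=1..d. (\<Sum>k=1..n. f (Xa m k i om) (Xa m k j om))\<^sup>2)"

definition big :: "real => nat => nat => 'a set" where
 "big b n i = {om : space M. \<exists>m\<in>{1..d}. \<exists>k\<in>{1..n}. b <= \<bar>Xa m k i om\<bar>}"

definition tprod :: "real => real => real => real" where "tprod b x y = trunc b x * trunc b y"

lemma tprod_measurable: "(%(x, y). tprod b x y) : borel_measurable (borel \<Otimes>\<^sub>M borel)"
 unfolding tprod_def by measurable

lemma trunc_prod_measurable: "(%(x, y). trunc a (x * y)) : borel_measurable (borel \<Otimes>\<^sub>M borel)"
 by measurable

lemma tprod_bound: "0 < b ==> \<bar>tprod b x y\<bar> <= b * b"
 unfolding tprod_def abs_mult by (intro mult_mono abs_trunc_le) auto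

lemma Sq_measurable:
 assumes f: "(%(x, y). f x y) : borel_measurable (borel \<Otimes>\<^sub>M borel)" and ij: "1 <= i" "1 <= j"
 shows "Sq f n i j : borel_measurable M"
 unfolding Sq_def[abs_def]
proof (intro borel_measurable_sum borel_measurable_power)
 fix m k assume "m : {1..d}" "k : {1..n}"
 then have [measurable]: "Xa m k i : borel_measurable M" "Xa m k j : borel_measurable M" using ij rv_Xa by auto
 have "(%om. (Xa m k i om, Xa m k j om)) : measurable M (borel \<Otimes>\<^sub>M borel)" by measurable
 from measurable_compose[OF this f] show "(%om. f (Xa m k i om) (Xa m k j om)) : borel_measurable M" by simp
qed

lemma Sq_commute: "(!!x y. f x y = f y x) ==> Sq f n i j = Sq f n j i"
 unfolding Sq_def[abs_def] by (intro ext sum.cong refl arg_cong[where f="%x. x\<^sup>2"]) auto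

lemma big_event: assumes i: "1 <= i" shows "big b n i : events"
proof -
 have "{om : space M. b <= \<bar>Xa m k i om\<bar>} : events" if "m : {1..d}" "k : {1..n}" for m k
 proof -
  have [measurable]: "Xa m k i : borel_measurable M" using that i rv_Xa by auto
  show ?thesis by measurable
 qed
 then have "(\<Union>m\<in>{1..d}. \<Union>k\<in>{1..n}. {om : space M. b <= \<bar>Xa m k i om\<bar>}) : events" by (intro sets.finite_UN) auto
 moreover have "big b n i = (\<Union>m\<in>{1..d}. \<Union>k\<in>{1..n}. {om : space M. b <= \<bar>Xa m k i om\<bar>})" unfolding big_def by blast
 ultimately show ?thesis by simp
qed

lemma mgf_trunc_prod:
 assumes a: "0 < a" and e: "0 < ep" "ep <= 1" and h: "\<bar>h\<bar> <= H" and H: "0 < H"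
 shows "(LINT om|M. exp (h * trunc a (X om * X' om)))
  <= exp ((1 + ep) * h\<^sup>2 / 2 + (H * (m4\<^sup>2 / a ^ 3) + exp (H * a) * prob {om : space M. ep / H <= \<bar>X om * X' om\<bar>}))"
proof -
 define Y where "Y om = X om * X' om" for om
 have Ym[measurable]: "Y : borel_measurable M" unfolding Y_def[abs_def] by measurable
 have iY: "integrable M Y" "(LINT om|M. Y om) = 0"
  using copy_prod[of "%x. x" "%x. x"] intX meanX unfolding Y_def[abs_def] by auto
 have iY2: "integrable M (%om. (Y om)\<^sup>2)" "(LINT om|M. (Y om)\<^sup>2) = 1"
  using copy_prod[of "%x. x\<^sup>2" "%x. x\<^sup>2"] int2 var unfolding Y_def[abs_def] power_mult_distrib by auto
 have iY4: "integrable M (%om. (Y om) ^ 4)" "(LINT om|M. (Y om) ^ 4) = m4\<^sup>2"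
  using copy_prod[of "%x. x ^ 4" "%x. x ^ 4"] int4 unfolding Y_def[abs_def] power_mult_distrib m4_def by (auto simp: power2_eq_square)
 define T where "T om = trunc a (Y om)" for om
 have Tm[measurable]: "T : borel_measurable M" unfolding T_def[abs_def] by measurable
 have Tb: "\<bar>T om\<bar> <= a" "\<bar>T om\<bar> <= \<bar>Y om\<bar>" for om unfolding T_def using abs_trunc_le a by auto
 have iT: "integrable M T" by (rule integrable_const_bound[where B=a]) (use Tb in auto)
 have T2: "(T om)\<^sup>2 <= (Y om)\<^sup>2" for om using Tb(2) by (rule abs_le_square_iff[THEN iffD1])
 have iT2: "integrable M (%om. (T om)\<^sup>2)" by (rule Bochner_Integration.integrable_bound[OF iY2(1)]) (use T2 in auto)
 have ET2: "(LINT om|M. (T om)\<^sup>2) <= 1" using integral_mono[OF iT2 iY2(1) T2] iY2(2) by simp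
 have pt: "\<bar>T om - Y om\<bar> <= (Y om) ^ 4 / a ^ 3" for om
 proof (cases "\<bar>Y om\<bar> < a")
  case True then show ?thesis using a by (simp add: T_def trunc_def)
 next
  case False
  then have "\<bar>Y om\<bar> * a ^ 3 <= \<bar>Y om\<bar> * \<bar>Y om\<bar> ^ 3" using a by (intro mult_left_mono power_mono) auto
  also have "... = \<bar>Y om\<bar> ^ 4" by (simp add: eval_nat_numeral)
  also have "... = (Y om) ^ 4" by simp
  finally show ?thesis using False a by (simp add: T_def trunc_def field_simps)
 qed
 have ET: "\<bar>\<integral>om. T om \<partial>M\<bar> <= m4\<^sup>2 / a ^ 3"
 proof -
  have "(LINT om|M. T om) = (LINT om|M. T om - Y om)" using iT iY by simp
  also have "\<bar>\<dots>\<bar> <= (LINT om|M. \<bar>T om - Y om\<bar>)" by (rule integral_abs_bound)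
  also have "... <= (LINT om|M. (Y om) ^ 4 / a ^ 3)" by (rule integral_mono) (use iT iY iY4 pt in auto)
  finally show ?thesis using iY4 by simp
 qed
 let ?A = "{om : space M. ep / H <= \<bar>Y om\<bar>}"
 define G where "G om = (1 + h * T om + (1 + ep) * h\<^sup>2 / 2 * (T om)\<^sup>2) + exp (H * a) * indicator ?A om" for om
 have ind: "integrable M (indicator ?A :: 'a => real)" by (intro integrable_real_indicator) (auto simp: emeasure_eq_measure)
 have i1: "integrable M (%om. h * T om)" "integrable M (%om. (1 + ep) * h\<^sup>2 / 2 * (T om)\<^sup>2)" "integrable M (%om. exp (H * a) * indicator ?A om)"
  using iT iT2 ind by auto
 have iG: "integrable M G" unfolding G_def[abs_def] by (intro Bochner_Integration.integrable_add i1 integrable_const)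
 have hT: "\<bar>h * T om\<bar> <= H * a" for om unfolding abs_mult by (intro mult_mono h Tb) (use H in auto)
 have "(LINT om|M. exp (h * T om)) <= (LINT om|M. G om)"
 proof (rule integral_mono[OF _ iG])
  have le: "h * T om <= H * a" for om using hT[of om] by (rule order_trans[OF abs_ge_self])
  show "integrable M (%om. exp (h * T om))" by (rule integrable_const_bound[where B="exp (H * a)"]) (use le in auto)
  fix om assume w: "om : space M"
  show "exp (h * T om) <= G om"
  proof (cases "om : ?A")
   case True
   have "0 <= 1 + h * T om + (1 + ep) * (h * T om)\<^sup>2 / 2" using e by (intro quadratic_lower) auto
   moreover have "exp (h * T om) <= exp (H * a)" using le by simp
   ultimately have "exp (h * T om) <= 1 + h * T om + (1 + ep) * (h * T om)\<^sup>2 / 2 + exp (H * a)" by linarith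
   then show ?thesis using True unfolding G_def by (simp add: power_mult_distrib mult.assoc)
  next
   case False
   then have "\<bar>Y om\<bar> < ep / H" using w by auto
   then have "\<bar>T om\<bar> <= ep / H" using Tb(2)[of om] by linarith
   then have "\<bar>h\<bar> * \<bar>T om\<bar> <= H * (ep / H)" using h H by (intro mult_mono) auto
   then have "\<bar>h * T om\<bar> <= ep" using H by (simp add: abs_mult)
   from exp_le_quadratic[OF this e(2)] have "exp (h * T om) <= 1 + h * T om + (1 + ep) * (h * T om)\<^sup>2 / 2" .
   then show ?thesis using False unfolding G_def by (simp add: power_mult_distrib mult.assoc)
  qed
 qed
 also have "(LINT om|M. G om) = 1 + h * (LINT om|M. T om) + (1 + ep) * h\<^sup>2 / 2 * (LINT om|M. (T om)\<^sup>2) + exp (H * a) * prob ?A"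
 proof -
  have "(LINT om|M. G om) = (LINT om|M. 1 + h * T om + (1 + ep) * h\<^sup>2 / 2 * (T om)\<^sup>2) + (LINT om|M. exp (H * a) * indicator ?A om)"
   unfolding G_def by (intro Bochner_Integration.integral_add Bochner_Integration.integrable_add i1 integrable_const)
  also have "(LINT om|M. 1 + h * T om + (1 + ep) * h\<^sup>2 / 2 * (T om)\<^sup>2) = (LINT om|M. 1 + h * T om) + (LINT om|M. (1 + ep) * h\<^sup>2 / 2 * (T om)\<^sup>2)"
   by (intro Bochner_Integration.integral_add Bochner_Integration.integrable_add i1 integrable_const)
  also have "(LINT om|M. 1 + h * T om) = 1 + h * (LINT om|M. T om)" using iT by (simp add: prob_space)
  finally show ?thesis by simp
 qed
 also have "... <= 1 + H * (m4\<^sup>2 / a ^ 3) + (1 + ep) * h\<^sup>2 / 2 * 1 + exp (H * a) * prob ?A"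
 proof -
  have "h * (LINT om|M. T om) <= \<bar>h\<bar> * \<bar>\<integral>om. T om \<partial>M\<bar>" unfolding abs_mult[symmetric] by (rule abs_ge_self)
  also have "... <= H * (m4\<^sup>2 / a ^ 3)" using H by (intro mult_mono h ET) auto
  finally have 1: "h * (LINT om|M. T om) <= H * (m4\<^sup>2 / a ^ 3)" .
  have 2: "(1 + ep) * h\<^sup>2 / 2 * (LINT om|M. (T om)\<^sup>2) <= (1 + ep) * h\<^sup>2 / 2 * 1" using e by (intro mult_left_mono ET2) auto
  show ?thesis by (intro add_mono order_refl 1 2)
 qed
 also have "... = 1 + ((1 + ep) * h\<^sup>2 / 2 + (H * (m4\<^sup>2 / a ^ 3) + exp (H * a) * prob ?A))" by simp
 also have "... <= exp ((1 + ep) * h\<^sup>2 / 2 + (H * (m4\<^sup>2 / a ^ 3) + exp (H * a) * prob ?A))" by (rule exp_ge_add_one_self)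
 finally show ?thesis unfolding T_def Y_def .
qed

lemma chernoff_big_entry:
 assumes F: "good_net d ep F" and r: "0 < r" and n: "1 <= n" and e: "0 <= ep"
  and ij: "1 <= i" "1 <= j"
  and f: "(%(x, y). f x y) : borel_measurable (borel \<Otimes>\<^sub>M borel)" "!!x y. \<bar>f x y\<bar> <= K"
  and g: "0 <= g" and c: "0 <= c"
  and mg: "!!h m k. \<bar>h\<bar> <= 2 * r / sqrt n ==> m : {1..d} ==> k : {1..n} ==>
   (LINT om|M. exp (h * f (Xa m k i om) (Xa m k j om))) <= exp ((1 + ep) * h\<^sup>2 / 2 + c)"
  and hf: "!!h x y. \<bar>h\<bar> <= 2 * r / sqrt n ==> b <= \<bar>x\<bar> ==> h * f x y <= g"
 shows "prob (big b n i Int {om : space M. r\<^sup>2 * n <= Sq f n i j om})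
  <= real d * real n * (real (card F) * (exp g * prob {om : space M. b <= \<bar>X om\<bar>} * exp (real n * (real d * c))) * exp (- (1 - 5 * ep) * r\<^sup>2 / 2))"
proof -
 let ?E = "{om : space M. r\<^sup>2 * n <= Sq f n i j om}"
 let ?P = "{1..d} \<times> {1..n}"
 let ?pi = "prob {om : space M. b <= \<bar>X om\<bar>}"
 let ?R = "real (card F) * (exp g * ?pi * exp (real n * (real d * c))) * exp (- (1 - 5 * ep) * r\<^sup>2 / 2)"
 define B where "B q = {om : space M. b <= \<bar>Xa (fst q) (snd q) i om\<bar>}" for q
 have Sm: "Sq f n i j : borel_measurable M" by (rule Sq_measurable[OF f(1) ij])
 have Bm: "B q : events" if "q : ?P" for q
 proof -
  have [measurable]: "Xa (fst q) (snd q) i : borel_measurable M" using that ij rv_Xa by auto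
  show ?thesis unfolding B_def by measurable
 qed
 have Em: "?E : events" using Sm by measurable
 have one: "prob (B q Int ?E) <= ?R" if q: "q : ?P" for q
 proof -
  define w where "w p x = (if p = q then indicator {x. b <= \<bar>x\<bar>} x else 1 :: real)" for p :: "nat \<times> nat" and x :: real
  define A where "A p = (if p = q then exp g * ?pi else 1 :: real)" for p :: "nat \<times> nat"
  have wm: "w p : borel_measurable borel" for p
   unfolding w_def[abs_def] by (cases "p = q") (simp_all, measurable)
  have w01: "0 <= w p x" "w p x <= 1" for p x unfolding w_def by (auto simp: indicator_def)
  have A0: "0 <= A p" for p unfolding A_def by simp
  have mg': "(LINT om|M. w (m, k) (Xa m k i om) * exp (h * f (Xa m k i om) (Xa m k j om))) <= A (m, k) * exp ((1 + ep) * h\<^sup>2 / 2 + c)"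
   if h: "\<bar>h\<bar> <= 2 * r / sqrt n" and m: "m : {1..d}" and k: "k : {1..n}" for h m k
  proof (cases "(m, k) = q")
   case False then show ?thesis using mg[OF h m k] by (simp add: w_def A_def)
  next
   case True
   have [measurable]: "Xa m k i : borel_measurable M" "Xa m k j : borel_measurable M" using m k ij rv_Xa by auto
   have fm: "(%om. f (Xa m k i om) (Xa m k j om)) : borel_measurable M"
   proof -
    have "(%om. (Xa m k i om, Xa m k j om)) : measurable M (borel \<Otimes>\<^sub>M borel)" by measurable
    from measurable_compose[OF this f(1)] show ?thesis by simp
   qed
   define I where "I = {om : space M. b <= \<bar>Xa m k i om\<bar>}"
   have Im: "I : events" unfolding I_def by measurable
   have wI: "w (m, k) (Xa m k i om) = indicator I om" if "om : space M" for om using True that by (auto simp: w_def I_def indicator_def)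
   have pt: "indicator I om * exp (h * f (Xa m k i om) (Xa m k j om)) <= exp g * indicator I om" for om
   proof (cases "om : I")
    case True
    then have "h * f (Xa m k i om) (Xa m k j om) <= g" by (intro hf[OF h]) (auto simp: I_def)
    then show ?thesis using True by simp
   qed simp
   have iI: "integrable M (%om. exp g * indicator I om)" using Im by (simp add: emeasure_eq_measure)
   have "(LINT om|M. w (m, k) (Xa m k i om) * exp (h * f (Xa m k i om) (Xa m k j om))) = (LINT om|M. indicator I om * exp (h * f (Xa m k i om) (Xa m k j om)))"
    by (rule Bochner_Integration.integral_cong[OF refl]) (simp add: wI)
   also have "... <= (LINT om|M. exp g * indicator I om)"
   proof (rule integral_mono[OF _ iI pt])
    show "integrable M (%om. indicator I om * exp (h * f (Xa m k i om) (Xa m k j om)))"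
    proof (rule Bochner_Integration.integrable_bound[OF iI])
     show "(%om. indicator I om * exp (h * f (Xa m k i om) (Xa m k j om))) : borel_measurable M" using fm Im by measurable
     show "AE om in M. norm (indicator I om * exp (h * f (Xa m k i om) (Xa m k j om))) <= norm (exp g * indicator I om)"
      by (rule AE_I2) (use pt in \<open>simp add: abs_mult\<close>)
    qed
   qed
   also have "... = exp g * prob I" using Im by simp
   also have "prob I = ?pi"
    using ident_prob[of m k i "{x. b <= \<bar>x\<bar>}"] m k ij by (simp add: I_def)
   also have "exp g * ?pi <= exp g * ?pi * exp ((1 + ep) * h\<^sup>2 / 2 + c)"
   proof -
    have "1 <= exp ((1 + ep) * h\<^sup>2 / 2 + c)" using e c by simp
    from mult_left_mono[OF this, of "exp g * ?pi"] show ?thesis by simp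
   qed
   finally show ?thesis using True by (simp add: A_def)
  qed
  have iB: "indicator (B q) om = (\<Prod>p\<in>?P. w p (Xa (fst p) (snd p) i om))" if "om : space M" for om
  proof -
   have "(\<Prod>p\<in>?P. w p (Xa (fst p) (snd p) i om)) = (\<Prod>p\<in>?P. if p = q then indicator (B q) om else 1)"
    by (rule prod.cong) (use that in \<open>auto simp: w_def B_def indicator_def\<close>)
   also have "... = indicator (B q) om" using q by (simp add: prod.delta)
   finally show ?thesis by simp
  qed
  have PA: "(\<Prod>p\<in>?P. A p) = exp g * ?pi" unfolding A_def using q by (simp add: prod.delta)
  from chernoff_column[OF F r n e ij f wm w01 A0 mg' Bm[OF q] iB] show ?thesis unfolding PA Sq_def by simp
 qed
 have "prob (big b n i Int ?E) = prob (\<Union>q\<in>?P. B q Int ?E)"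
 proof (rule arg_cong[where f=prob])
  show "big b n i Int ?E = (\<Union>q\<in>?P. B q Int ?E)" unfolding big_def B_def by (simp only: UN_simps set_eq_iff) auto
 qed
 also have "... <= (\<Sum>q\<in>?P. prob (B q Int ?E))"
  by (rule measure_UNION_le) (use Bm Em in auto)
 also have "... <= (\<Sum>q\<in>?P. ?R)" by (rule sum_mono) (rule one)
 finally show ?thesis by simp
qed

text \<open>Here \<open>1 / b\<^sup>2\<close> plays the role of \<open>sqrt (log p / n)\<close>, so the condition on \<open>r\<close> is the
 moderate deviation range \<open>r = O(sqrt (log p))\<close>.\<close>

lemma trunc_pair_tails:
 fixes U ep :: real
 assumes U: "0 <= U" and e: "0 < ep" "ep <= 1"
 obtains C where "1 <= C"
  "!!b n r i j. 1 <= b ==> 1 <= n ==> real n * (1 / b\<^sup>2) ^ 3 <= 1 ==> 0 < r ==> r / sqrt n <= U / b\<^sup>2 ==> 1 <= i ==> 1 <= j ==> i ~= j ==>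
   prob {om : space M. r\<^sup>2 * n <= Sq (tprod b) n i j om} <= C * exp (- (1 - 5 * ep) * r\<^sup>2 / 2)"
  "!!b n r i j l. 1 <= b ==> 1 <= n ==> real n * (1 / b\<^sup>2) ^ 3 <= 1 ==> 0 < r ==> r / sqrt n <= U / b\<^sup>2 ==> 1 <= i ==> 1 <= j ==> 1 <= l ==> i ~= j ==> i ~= l ==> j ~= l ==>
   prob ({om : space M. r\<^sup>2 * n <= Sq (tprod b) n i j om} Int {om : space M. r\<^sup>2 * n <= Sq (tprod b) n i l om}) <= C * exp (- (1 - 5 * ep) * r\<^sup>2)"
  "!!b n r i j. 1 <= b ==> 1 <= n ==> real n * (1 / b\<^sup>2) ^ 3 <= 1 ==> 0 < r ==> r / sqrt n <= U / b\<^sup>2 ==> 1 <= i ==> 1 <= j ==> i ~= j ==>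
   prob (big b n i Int {om : space M. r\<^sup>2 * n <= Sq (tprod b) n i j om}) <= C * (real n * prob {om : space M. b <= \<bar>X om\<bar>}) * exp (- (1 - 5 * ep) * r\<^sup>2 / 2)"
proof -
 obtain F where F: "good_net d ep F" using good_net_exists[OF e] by blast
 obtain F2 where F2: "good_net (2 * d) ep F2" using good_net_exists[OF e] by blast
 have U4: "0 <= 4 * U" using U by simp
 obtain C0 where C0: "0 <= C0" and mg: "!!b h1 h2 m k i j l. 1 <= b ==> \<bar>h1\<bar> <= (4 * U) / b\<^sup>2 ==> \<bar>h2\<bar> <= (4 * U) / b\<^sup>2 ==> m : {1..d} ==> 1 <= k ==>
  1 <= i ==> 1 <= j ==> 1 <= l ==> i ~= j ==> i ~= l ==> j ~= l ==>
  (LINT om|M. exp (h1 * (trunc b (Xa m k i om) * trunc b (Xa m k j om)) + h2 * (trunc b (Xa m k i om) * trunc b (Xa m k l om))))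
   <= exp ((h1\<^sup>2 + h2\<^sup>2) / 2 + C0 * (1 / b\<^sup>2) ^ 3)"
 proof (rule mgf_triple[OF U4], goal_cases)
  case (1 C) show thesis by (rule that[OF 1(2) 1(3)])
 qed
 define K1 where "K1 = (1 + real (card F)) * exp (real d * C0)"
 define K2 where "K2 = (1 + real (card F2)) * exp (real d * C0)"
 define C where "C = K1 + K2 + real d * K1"
 have K: "1 <= K1" "0 <= K2"
 proof -
  have "1 * 1 <= (1 + real (card F)) * exp (real d * C0)" using C0 by (intro mult_mono) auto
  then show "1 <= K1" by (simp add: K1_def)
 qed (simp add: K2_def)
 have C: "1 <= C" "K1 <= C" "K2 <= C" "real d * K1 <= C" 
 proof -
  have "0 <= real d * K1" using K by simp
  then show "1 <= C" "K1 <= C" "K2 <= C" "real d * K1 <= C" using K unfolding C_def by linarith+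
 qed
 have small: "exp (real n * (real d * (C0 * (1 / b\<^sup>2) ^ 3))) <= exp (real d * C0)" if "real n * (1 / b\<^sup>2) ^ 3 <= 1" for n and b :: real
 proof -
  have "real d * C0 * (real n * (1 / b\<^sup>2) ^ 3) <= real d * C0 * 1" using C0 that by (intro mult_left_mono) auto
  then show ?thesis by (simp add: mult_ac)
 qed
 have rng: "\<bar>h\<bar> <= (4 * U) / b\<^sup>2" if "\<bar>h\<bar> <= 4 * r / sqrt n" "r / sqrt n <= U / b\<^sup>2" for h r b and n :: nat
 proof -
  have "4 * (r / sqrt n) <= 4 * (U / b\<^sup>2)" using that(2) by simp
  then show ?thesis using that(1) by simp
 qed
 have rng2: "\<bar>h\<bar> <= (4 * U) / b\<^sup>2" if "\<bar>h\<bar> <= 2 * r / sqrt n" "r / sqrt n <= U / b\<^sup>2" "0 < r" for h r b and n :: nat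
 proof (rule rng[OF _ that(2)])
  have "0 <= r / sqrt n" using that(3) by simp
  then have "2 * r / sqrt n <= 4 * r / sqrt n" by (simp add: divide_right_mono)
  then show "\<bar>h\<bar> <= 4 * r / sqrt n" using that(1) by linarith
 qed
 have mg1: "(LINT om|M. exp (h * tprod b (Xa m k i om) (Xa m k j om))) <= exp ((1 + ep) * h\<^sup>2 / 2 + C0 * (1 / b\<^sup>2) ^ 3)"
  if b: "1 <= b" and h: "\<bar>h\<bar> <= (4 * U) / b\<^sup>2" and m: "m : {1..d}" "1 <= k" and ij: "1 <= i" "1 <= j" "i ~= j" for b h m k i j
 proof -
  have z: "\<bar>0\<bar> <= (4 * U) / b\<^sup>2" using U by simp
  have "(LINT om|M. exp (h * tprod b (Xa m k i om) (Xa m k j om))) <= exp ((h\<^sup>2 + 0\<^sup>2) / 2 + C0 * (1 / b\<^sup>2) ^ 3)"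
   using mg[OF b h z m ij(1,2), of "i + j"] ij by (simp add: tprod_def)
  also have "... <= exp ((1 + ep) * h\<^sup>2 / 2 + C0 * (1 / b\<^sup>2) ^ 3)" using e by (simp add: distrib_right)
  finally show ?thesis .
 qed
 show ?thesis
 proof (rule that[OF C(1)])
  fix b r :: real and n i j :: nat
  assume b: "1 <= b" and n: "1 <= n" and nz: "real n * (1 / b\<^sup>2) ^ 3 <= 1" and r: "0 < r" "r / sqrt n <= U / b\<^sup>2" and ij: "1 <= i" "1 <= j" "i ~= j"
  have b0: "0 < b" using b by simp
  have m1: "(LINT om|M. (%_ _. 1) (m, k) (Xa m k i om) * exp (h * tprod b (Xa m k i om) (Xa m k j om))) <= (%_. 1) (m, k) * exp ((1 + ep) * h\<^sup>2 / 2 + C0 * (1 / b\<^sup>2) ^ 3)"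
   if "\<bar>h\<bar> <= 2 * r / sqrt n" "m : {1..d}" "k : {1..n}" for h m k
   using mg1[OF b rng2[OF that(1) r(2,1)] that(2) _ ij, of k] that(3) by simp
  have "prob (space M Int {om : space M. r\<^sup>2 * n <= (\<Sum>m=1..d. (\<Sum>k=1..n. tprod b (Xa m k i om) (Xa m k j om))\<^sup>2)})
   <= real (card F) * ((\<Prod>p\<in>{1..d} \<times> {1..n}. (%_. 1) p) * exp (real n * (real d * (C0 * (1 / b\<^sup>2) ^ 3)))) * exp (- (1 - 5 * ep) * r\<^sup>2 / 2)"
   by (rule chernoff_column[OF F r(1) n less_imp_le[OF e(1)] ij(1,2) tprod_measurable tprod_bound[OF b0] _ _ _ _ m1]) auto
  also have "... <= K1 * exp (- (1 - 5 * ep) * r\<^sup>2 / 2)" unfolding K1_def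
   by (intro mult_right_mono mult_mono) (use small[OF nz] in auto)
  also have "... <= C * exp (- (1 - 5 * ep) * r\<^sup>2 / 2)" by (intro mult_right_mono C) auto
  also have "space M Int {om : space M. r\<^sup>2 * n <= (\<Sum>m=1..d. (\<Sum>k=1..n. tprod b (Xa m k i om) (Xa m k j om))\<^sup>2)} = {om : space M. r\<^sup>2 * n <= Sq (tprod b) n i j om}"
   unfolding Sq_def by auto
  finally show "prob {om : space M. r\<^sup>2 * n <= Sq (tprod b) n i j om} <= C * exp (- (1 - 5 * ep) * r\<^sup>2 / 2)" .
 next
  fix b r :: real and n i j l :: nat
  assume b: "1 <= b" and n: "1 <= n" and nz: "real n * (1 / b\<^sup>2) ^ 3 <= 1" and r: "0 < r" "r / sqrt n <= U / b\<^sup>2"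
   and ijl: "1 <= i" "1 <= j" "1 <= l" and ne: "i ~= j" "i ~= l" "j ~= l"
  have b0: "0 < b" using b by simp
  have m1: "(LINT om|M. exp (h1 * tprod b (Xa m k i om) (Xa m k j om) + h2 * tprod b (Xa m k i om) (Xa m k l om))) <= exp ((h1\<^sup>2 + h2\<^sup>2) / 2 + C0 * (1 / b\<^sup>2) ^ 3)"
   if "\<bar>h1\<bar> <= 4 * r / sqrt n" "\<bar>h2\<bar> <= 4 * r / sqrt n" "m : {1..d}" "k : {1..n}" for h1 h2 m k
   using mg[OF b rng[OF that(1) r(2)] rng[OF that(2) r(2)] that(3) _ ijl ne, of k] that(4) by (simp add: tprod_def)
  have "prob ({om : space M. r\<^sup>2 * n <= Sq (tprod b) n i j om} Int {om : space M. r\<^sup>2 * n <= Sq (tprod b) n i l om})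
   <= real (card F2) * exp (real n * (real d * (C0 * (1 / b\<^sup>2) ^ 3))) * exp (- (1 - 5 * ep) * r\<^sup>2)"
   unfolding Sq_def by (rule chernoff_two_columns[OF F2 r(1) n less_imp_le[OF e(1)] ijl tprod_measurable tprod_bound[OF b0] m1])
  also have "... <= K2 * exp (- (1 - 5 * ep) * r\<^sup>2)" unfolding K2_def
   by (intro mult_right_mono mult_mono) (use small[OF nz] in auto)
  also have "... <= C * exp (- (1 - 5 * ep) * r\<^sup>2)" by (intro mult_right_mono C) auto
  finally show "prob ({om : space M. r\<^sup>2 * n <= Sq (tprod b) n i j om} Int {om : space M. r\<^sup>2 * n <= Sq (tprod b) n i l om}) <= C * exp (- (1 - 5 * ep) * r\<^sup>2)" .
 next
  fix b r :: real and n i j :: nat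
  assume b: "1 <= b" and n: "1 <= n" and nz: "real n * (1 / b\<^sup>2) ^ 3 <= 1" and r: "0 < r" "r / sqrt n <= U / b\<^sup>2" and ij: "1 <= i" "1 <= j" "i ~= j"
  have b0: "0 < b" using b by simp
  have m1: "(LINT om|M. exp (h * tprod b (Xa m k i om) (Xa m k j om))) <= exp ((1 + ep) * h\<^sup>2 / 2 + C0 * (1 / b\<^sup>2) ^ 3)"
   if "\<bar>h\<bar> <= 2 * r / sqrt n" "m : {1..d}" "k : {1..n}" for h m k
   using mg1[OF b rng2[OF that(1) r(2,1)] that(2) _ ij, of k] that(3) by simp
  have hf: "h * tprod b x y <= 0" if "\<bar>h\<bar> <= 2 * r / sqrt n" "b <= \<bar>x\<bar>" for h x y using that(2) by (simp add: tprod_def trunc_def)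
  have c0: "0 <= C0 * (1 / b\<^sup>2) ^ 3" using C0 by simp
  let ?pi = "prob {om : space M. b <= \<bar>X om\<bar>}" and ?e = "exp (- (1 - 5 * ep) * r\<^sup>2 / 2)"
  have "prob (big b n i Int {om : space M. r\<^sup>2 * n <= Sq (tprod b) n i j om})
   <= real d * real n * (real (card F) * (exp 0 * ?pi * exp (real n * (real d * (C0 * (1 / b\<^sup>2) ^ 3)))) * ?e)"
   by (rule chernoff_big_entry[OF F r(1) n less_imp_le[OF e(1)] ij(1,2) tprod_measurable tprod_bound[OF b0] order_refl c0 m1 hf])
  also have "... = (real d * (real (card F) * exp (real n * (real d * (C0 * (1 / b\<^sup>2) ^ 3))))) * (real n * ?pi * ?e)" by (simp add: mult_ac)
  also have "... <= (real d * K1) * (real n * ?pi * ?e)" unfolding K1_def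
   by (intro mult_right_mono mult_left_mono mult_mono) (use small[OF nz] in auto)
  also have "... <= C * (real n * ?pi * ?e)" by (intro mult_right_mono C) auto
  finally show "prob (big b n i Int {om : space M. r\<^sup>2 * n <= Sq (tprod b) n i j om}) <= C * (real n * ?pi) * ?e" by (simp add: mult_ac)
 qed
qed


definition Zv :: "(nat \<times> nat \<times> nat) option => 'a => real" where
 "Zv = (%t. case t of None => X | Some (m, k, i) => Xa m k i)"

lemma Zv_simps [simp]: "Zv (Some (m, k, i)) = Xa m k i"
 by (simp add: Zv_def)

lemma indep_Zv: "indep_vars (%_. borel) Zv (insert None (Some ` ({1..d} \<times> {1..} \<times> {1..})))"
 unfolding Zv_def by (rule indep)

lemma coordinate_pair_measurable:
 fixes f :: "real => real => real" and A :: "(nat \<times> nat \<times> nat) option set"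
 assumes f: "(%(x, y). f x y) : borel_measurable (borel \<Otimes>\<^sub>M borel)" and t: "t1 : A" "t2 : A"
 shows "(%g. f (g t1) (g t2)) : borel_measurable (PiM A (%_. borel))"
proof -
 have [measurable]: "(%g. g t1) : measurable (PiM A (%_. borel :: real measure)) borel" "(%g. g t2) : measurable (PiM A (%_. borel :: real measure)) borel"
  by (rule measurable_component_singleton[OF t(1)], rule measurable_component_singleton[OF t(2)])
 have "(%g. (g t1, g t2)) : measurable (PiM A (%_. borel :: real measure)) (borel \<Otimes>\<^sub>M borel)" by measurable
 from measurable_compose[OF this f] show ?thesis by simp
qed

lemma indep_row_terms:
 fixes f :: "real => real => real"
 assumes f: "(%(x, y). f x y) : borel_measurable (borel \<Otimes>\<^sub>M borel)" and m: "m : {1..d}" and ij: "1 <= i" "1 <= j"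
 shows "indep_vars (%_. borel) (%k om. f (Xa m k i om) (Xa m k j om)) {1..n}"
proof -
 define K where "K k = Some ` ({m} \<times> {k} \<times> {i, j})" for k :: nat
 have R: "indep_vars (%k. PiM (K k) (%_. borel)) (%k om. restrict (%t. Zv t om) (K k)) {1..n}"
  by (rule indep_vars_restrict[OF indep_Zv]) (use ij m in \<open>auto simp: K_def disjoint_family_on_def\<close>)
 have "indep_vars (%_. borel) (%k om. (%g. f (g (Some (m, k, i))) (g (Some (m, k, j)))) (restrict (%t. Zv t om) (K k))) {1..n}"
  by (rule indep_vars_compose2[OF R]) (rule coordinate_pair_measurable[OF f], auto simp: K_def)
 then show ?thesis by (simp add: K_def)
qed

lemma indep_row_sums:
 fixes f :: "real => real => real"
 assumes f: "(%(x, y). f x y) : borel_measurable (borel \<Otimes>\<^sub>M borel)" and ij: "1 <= i" "1 <= j"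
  and h: "h : borel_measurable borel"
 shows "indep_vars (%_. borel) (%m om. h (\<Sum>k=1..n. f (Xa m k i om) (Xa m k j om)) :: real) {1..d}"
proof -
 define K where "K m = Some ` ({m} \<times> {1..n} \<times> {i, j})" for m :: nat
 have R: "indep_vars (%m. PiM (K m) (%_. borel)) (%m om. restrict (%t. Zv t om) (K m)) {1..d}"
  by (rule indep_vars_restrict[OF indep_Zv]) (use ij in \<open>auto simp: K_def disjoint_family_on_def\<close>)
 have "indep_vars (%_. borel) (%m om. (%g. h (\<Sum>k=1..n. f (g (Some (m, k, i))) (g (Some (m, k, j))))) (restrict (%t. Zv t om) (K m))) {1..d}"
 proof (rule indep_vars_compose2[OF R])
  fix m assume "m : {1..d}"
  have "(%g. \<Sum>k=1..n. f (g (Some (m, k, i))) (g (Some (m, k, j)))) : borel_measurable (PiM (K m) (%_. borel))"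
   by (rule borel_measurable_sum, rule coordinate_pair_measurable[OF f]) (auto simp: K_def)
  from measurable_compose[OF this h] show "(%g. h (\<Sum>k=1..n. f (g (Some (m, k, i))) (g (Some (m, k, j))))) : borel_measurable (PiM (K m) (%_. borel))" .
 qed
 moreover have "h (\<Sum>k=1..n. f (restrict (%t. Zv t om) (K m) (Some (m, k, i))) (restrict (%t. Zv t om) (K m) (Some (m, k, j)))) = h (\<Sum>k=1..n. f (Xa m k i om) (Xa m k j om))" for m om
  by (intro arg_cong[where f=h] sum.cong refl) (auto simp: K_def)
 ultimately show ?thesis by simp
qed

lemma chi_square_pair_tail:
 fixes U B K :: real
 assumes U: "1 <= U" and B: "0 <= B" and K: "0 <= K"
 obtains C where "1 <= C"
  "!!b n s t i j. 1 <= b ==> 1 <= n ==> 1 <= real n * (1 / b\<^sup>2)\<^sup>2 ==> ln n <= B * (real n * (1 / b\<^sup>2)\<^sup>2) ==>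
   C * ((real n * (1 / b\<^sup>2)\<^sup>2)\<^sup>2 / sqrt n) <= 1 ==> \<bar>s - 1\<bar> <= K * (1 / b\<^sup>2) ==> 0 < t ==> t <= U\<^sup>2 * (real n * (1 / b\<^sup>2)\<^sup>2) ==>
   1 <= i ==> 1 <= j ==> i ~= j ==>
   \<bar>prob {om : space M. t * s * n <= Sq (tprod b) n i j om} - chi_square_tail d t\<bar> <= C * ((real n * (1 / b\<^sup>2)\<^sup>2)\<^sup>2 / sqrt n) * chi_square_tail d t"
proof -
 have K00: "0 <= K0" unfolding K0_def using m4_nonneg by (auto intro!: add_nonneg_nonneg)
 obtain C0 where C0: "1 <= C0" and mod: "!!kp zt n rh r s. near_std K0 zt kp ==> 0 < zt ==> 1 <= n ==> 1 <= real n * zt\<^sup>2 ==>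
  ln n <= B * (real n * zt\<^sup>2) ==> C0 * ((real n * zt\<^sup>2)\<^sup>2 / sqrt n) <= 1 ==>
  real_distribution rh ==> (!!f. bdd_borel f ==> (conv_op kp ^^ n) f = conv_op rh f) ==>
  \<bar>s - 1\<bar> <= K * zt ==> 0 < r ==> r <= U\<^sup>2 * (real n * zt\<^sup>2) ==>
  \<bar>measure rh {x. r * s * real n <= x\<^sup>2} - 2 * Phibar (sqrt r)\<bar> <= C0 * ((real n * zt\<^sup>2)\<^sup>2 / sqrt n) * (2 * Phibar (sqrt r))"
 proof (rule square_tail_moderate[OF K00 U B K], goal_cases)
  case (1 C) show thesis by (rule that[OF 1(2) 1(3)])
 qed
 define C where "C = 2 * (2 ^ d * C0) + 2 * K"
 have p2: "1 <= (2::real) ^ d" by simp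
 have C0d: "C0 <= 2 ^ d * C0" using mult_right_mono[OF p2, of C0] C0 by simp
 have C: "1 <= C" "2 * C0 <= C" "2 * K <= C" "2 ^ d * C0 <= C" using C0 C0d K unfolding C_def by linarith+
 show ?thesis
 proof (rule that[OF C(1)])
  fix b s t :: real and n i j :: nat
  define z where "z = 1 / b\<^sup>2"
  assume b: "1 <= b" and n: "1 <= n" and w: "1 <= real n * (1 / b\<^sup>2)\<^sup>2" and ln: "ln n <= B * (real n * (1 / b\<^sup>2)\<^sup>2)"
   and Cw: "C * ((real n * (1 / b\<^sup>2)\<^sup>2)\<^sup>2 / sqrt n) <= 1" and s: "\<bar>s - 1\<bar> <= K * (1 / b\<^sup>2)" and t: "0 < t" "t <= U\<^sup>2 * (real n * (1 / b\<^sup>2)\<^sup>2)"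
   and ij: "1 <= i" "1 <= j" "i ~= j"
  note w = w[folded z_def] and ln = ln[folded z_def] and Cw = Cw[folded z_def] and s = s[folded z_def] and t = t[folded z_def]
  have z0: "0 < z" using b by (simp add: z_def)
  have n0: "0 < real n" using n by simp
  define v where "v = (real n * z\<^sup>2)\<^sup>2 / sqrt n"
  have v0: "0 <= v" by (simp add: v_def)
  have Cv: "C * v <= 1" using Cw unfolding v_def .
  have c0v: "C0 * v <= 1 / 2"
  proof -
   have "2 * C0 * v <= C * v" using C v0 by (intro mult_right_mono) auto
   then show ?thesis using Cv by linarith
  qed
  have zv: "z <= v"
  proof -
   have "(z * sqrt n)\<^sup>2 = real n * z\<^sup>2" by (simp add: power_mult_distrib)
   also have "... <= (real n * z\<^sup>2)\<^sup>2 * (real n * z\<^sup>2)\<^sup>2"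
   proof -
    have "1 <= (real n * z\<^sup>2) ^ 3" using w by (rule one_le_power)
    from mult_left_mono[OF this, of "real n * z\<^sup>2"] w show ?thesis by (simp add: power2_eq_square power3_eq_cube mult.assoc)
   qed
   also have "... = ((real n * z\<^sup>2)\<^sup>2)\<^sup>2" by (simp only: power2_eq_square)
   finally have "z * sqrt n <= (real n * z\<^sup>2)\<^sup>2" by (rule power2_le_imp_le) simp
   then show ?thesis unfolding v_def using n0 by (simp add: pos_le_divide_eq)
  qed
  have Kz: "K * z <= 1 / 2"
  proof -
   have "2 * K * z <= C * v" using C K v0 zv z0 by (intro mult_mono) auto
   then show ?thesis using Cv by linarith
  qed
  have s0: "0 < s" using s Kz by linarith
  have sn: "0 < s * real n" using s0 n0 by simp
  have ns: "near_std K0 z (kap b)" unfolding z_def by (rule near_std_kap[OF b])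
  then have rk: "real_distribution (kap b)" by (simp add: near_std_def)
  obtain rh where rh: "real_distribution rh" "!!f. bdd_borel f ==> (conv_op (kap b) ^^ n) f = conv_op rh f"
   using conv_op_pow_measure[OF rk, of n] by metis
  interpret rh: real_distribution rh by (rule rh(1))
  define g where "g x = x\<^sup>2 / (s * real n)" for x :: real
  have gm[measurable]: "g : borel_measurable borel" unfolding g_def[abs_def] by measurable
  define nu where "nu = distr rh borel g"
  have nu: "real_distribution nu" unfolding nu_def by (rule rh.real_distribution_distr) simp
  have nu0: "AE y in nu. 0 <= y" unfolding nu_def by (subst AE_distr_iff) (use sn in \<open>auto simp: g_def\<close>)
  have tailv: "measure nu {r..} = measure rh {x. r * s * real n <= x\<^sup>2}" for r
  proof -
   have "measure nu {r..} = measure rh (g -` {r..} Int space rh)" unfolding nu_def by (rule measure_distr) auto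
   also have "g -` {r..} Int space rh = {x. r * s * real n <= x\<^sup>2}" using sn by (auto simp: g_def pos_le_divide_eq mult.assoc)
   finally show ?thesis .
  qed
  define et where "et = C0 * v"
  have et: "0 <= et" "et <= 1 / 2" using c0v C0 v0 by (auto simp: et_def)
  have br: "\<bar>measure nu {r..} - measure gau_sq {r..}\<bar> <= et * measure gau_sq {r..}" if r: "0 < r" "r <= t" for r
  proof -
   have rt: "r <= U\<^sup>2 * (real n * z\<^sup>2)" using r t by linarith
   have c1: "C0 * ((real n * z\<^sup>2)\<^sup>2 / sqrt n) <= 1" using c0v unfolding v_def by linarith
   show ?thesis unfolding tailv gau_sq_tail[OF r(1)] et_def v_def
    by (rule mod[OF ns z0 n w ln c1 rh s r(1) rt])
  qed
  let ?q = "chi_square_tail d t" and ?P = "(conv_op nu ^^ d) (indicator {t..}) 0"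
  have up: "?P <= (1 + 2 ^ d * et) * ?q"
  proof -
   have "?P <= (1 + et) ^ d * (conv_op gau_sq ^^ d) (indicator {t..}) 0"
   proof (rule conv_op_pow_tail_compare[OF nu nu0 real_distribution_gau_sq gau_sq_nonneg])
    fix r assume r: "0 < r" "r <= t"
    show "measure nu {r..} <= (1 + et) * measure gau_sq {r..}" using br[OF r] by (simp add: distrib_right abs_le_iff)
   qed (use et in auto)
   also have "... = (1 + et) ^ d * ?q" by (simp add: chi_square_tail_conv_op)
   also have "... <= (1 + 2 ^ d * et) * ?q" using et by (intro mult_right_mono power_bracket) (auto simp: chi_square_tail_def)
   finally show ?thesis .
  qed
  have lo: "(1 - 2 ^ d * et) * ?q <= ?P"
  proof -
   have "?q <= (1 / (1 - et)) ^ d * ?P" unfolding chi_square_tail_conv_op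
   proof (rule conv_op_pow_tail_compare[OF real_distribution_gau_sq gau_sq_nonneg nu nu0])
    fix r assume r: "0 < r" "r <= t"
    have "(1 - et) * measure gau_sq {r..} <= measure nu {r..}" using br[OF r] by (simp add: left_diff_distrib abs_le_iff)
    then show "measure gau_sq {r..} <= 1 / (1 - et) * measure nu {r..}" using et by (simp add: pos_le_divide_eq mult.commute)
   qed (use et in auto)
   then have "(1 - et) ^ d * ?q <= (1 - et) ^ d * ((1 / (1 - et)) ^ d * ?P)" using et by (intro mult_left_mono) auto
   also have "... = ?P" using et by (simp add: power_divide)
   finally have "(1 - et) ^ d * ?q <= ?P" .
   moreover have "(1 - 2 ^ d * et) * ?q <= (1 - et) ^ d * ?q" using et by (intro mult_right_mono power_bracket) (auto simp: chi_square_tail_def)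
   ultimately show ?thesis by linarith
  qed
  define S where "S m om = (\<Sum>k=1..n. tprod b (Xa m k i om) (Xa m k j om))" for m om
  have law: "distr M borel (%om. g (S m om)) = nu" if m: "m : {1..d}" for m
  proof -
   have lk: "distr M borel (%om. tprod b (Xa m k i om) (Xa m k j om)) = kap b" if k: "k : {1..n}" for k
   proof -
    have [measurable]: "Xa m k i : borel_measurable M" "Xa m k j : borel_measurable M" using rv_Xa m k ij by auto
    have k1: "1 <= k" using k by simp
    have "distr M borel (%om. tprod b (Xa m k i om) (Xa m k j om)) = distr (distr M (borel \<Otimes>\<^sub>M borel) (%om. (Xa m k i om, Xa m k j om))) borel (%(x, y). tprod b x y)"
     by (subst distr_distr[OF tprod_measurable]) (auto simp: comp_def)
    also have "... = kap b" unfolding pair_law[OF m k1 ij]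
     by (subst distr_distr[OF tprod_measurable]) (auto simp: comp_def kap_def tprod_def)
    finally show ?thesis .
   qed
   have "distr M borel (%om. \<Sum>k\<in>{1..n}. tprod b (Xa m k i om) (Xa m k j om)) = rh"
   proof (rule distr_sum_eq_conv_pow[OF _ indep_row_terms[OF tprod_measurable m ij(1,2)] lk rk rh(1)])
    fix f :: "real => real" assume "bdd_borel f"
    then show "(conv_op (kap b) ^^ card {1..n}) f = conv_op rh f" using rh(2) by simp
   qed auto
   then have dS: "distr M borel (S m) = rh" unfolding S_def[abs_def] .
   have Sm: "S m : borel_measurable M" unfolding S_def[abs_def]
    using indep_row_terms[OF tprod_measurable m ij(1,2), of b n] by (intro borel_measurable_sum) (auto simp: indep_vars_def)
   have "distr (distr M borel (S m)) borel g = distr M borel (g \<circ> S m)" by (rule distr_distr[OF gm Sm])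
   then show ?thesis unfolding dS nu_def by (simp add: comp_def)
  qed
  have ind: "indep_vars (%_. borel) (%m om. g (S m om)) {1..d}"
   unfolding S_def by (rule indep_row_sums[OF tprod_measurable ij(1,2) gm])
  have Pe: "prob {om : space M. t * s * n <= Sq (tprod b) n i j om} = ?P"
  proof -
   have eq: "indicator {t..} (0 + (\<Sum>m\<in>{1..d}. g (S m om))) = (indicator {om : space M. t * s * n <= Sq (tprod b) n i j om} om :: real)" if "om : space M" for om
   proof -
    have "(\<Sum>m\<in>{1..d}. g (S m om)) = Sq (tprod b) n i j om / (s * real n)" unfolding g_def S_def Sq_def by (simp add: sum_divide_distrib)
    then show ?thesis using sn that by (auto simp: indicator_def pos_le_divide_eq mult.assoc)
   qed
   have ev: "{om : space M. t * s * n <= Sq (tprod b) n i j om} : events" using Sq_measurable[OF tprod_measurable ij(1,2), of b n] by measurable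
   have "(LINT om|M. indicator {t..} (0 + (\<Sum>m\<in>{1..d}. g (S m om)))) = (conv_op nu ^^ card {1..d}) (indicator {t..}) 0"
    by (rule expectation_sum_conv_op[OF _ ind law nu]) (auto intro: bdd_borel_indicator)
   then have "?P = (LINT om|M. indicator {t..} (0 + (\<Sum>m\<in>{1..d}. g (S m om))))" by simp
   also have "... = (LINT om|M. indicator {om : space M. t * s * n <= Sq (tprod b) n i j om} om)"
    by (rule Bochner_Integration.integral_cong[OF refl]) (rule eq)
   also have "... = prob {om : space M. t * s * n <= Sq (tprod b) n i j om}" using ev by simp
   finally show ?thesis by simp
  qed
  have q0: "0 <= ?q" by (simp add: chi_square_tail_def)
  have "2 ^ d * et * ?q <= C * v * ?q" unfolding et_def mult.assoc[symmetric] using q0 v0 C by (intro mult_right_mono) auto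
  moreover have "?P <= ?q + 2 ^ d * et * ?q" using up by (simp only: distrib_right mult_1_left)
  moreover have "?q - 2 ^ d * et * ?q <= ?P" using lo by (simp only: left_diff_distrib mult_1_left)
  ultimately have "\<bar>?P - ?q\<bar> <= C * v * ?q" by linarith
  then show "\<bar>prob {om : space M. t * s * n <= Sq (tprod b) n i j om} - ?q\<bar> <= C * ((real n * (1 / b\<^sup>2)\<^sup>2)\<^sup>2 / sqrt n) * ?q"
   unfolding Pe v_def z_def .
 qed
qed

lemma chen_stein_pairs:
 fixes f :: "real => real => real" and T bt1 bt2 :: real and p n :: nat
 assumes f: "(%(x, y). f x y) : borel_measurable (borel \<Otimes>\<^sub>M borel)" and sym: "!!x y. f x y = f y x"
 defines "E \<equiv> %(i, j). {om : space M. T <= Sq f n i j om}" and "I \<equiv> {(i, j). 1 <= i & i < j & j <= p}"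
 assumes b1: "!!i j. 1 <= i ==> 1 <= j ==> i ~= j ==> prob (E (i, j)) <= bt1"
  and b2: "!!i j l. 1 <= i ==> 1 <= j ==> 1 <= l ==> i ~= j ==> i ~= l ==> j ~= l ==> prob (E (i, j) Int E (i, l)) <= bt2"
  and bt: "0 <= bt1" "0 <= bt2"
 shows "\<bar>prob {om : space M. \<forall>a\<in>I. om \<notin> E a} - exp (- (\<Sum>a\<in>I. prob (E a)))\<bar> <= real p ^ 3 * (4 * bt2 + 5 * bt1\<^sup>2)"
proof -
 have finI: "finite I" by (rule finite_subset[of _ "{..p} \<times> {..p}"]) (auto simp: I_def)
 have cardI: "card I <= p * p"
 proof -
  have "card I <= card ({1..p} \<times> {1..p})" by (rule card_mono) (auto simp: I_def)
  then show ?thesis by simp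
 qed
 have Esym: "E (i, j) = E (j, i)" for i j unfolding E_def using Sq_commute[of f n i j] sym by simp
 define N where "N a = {b : I - {a}. fst b : {fst a, snd a} \<or> snd b : {fst a, snd a}}" for a :: "nat \<times> nat"
 have cardN: "card (N a) <= 4 * p" if "a : I" for a
 proof -
  have "card (N a) <= card (({fst a, snd a} \<times> {1..p}) \<union> ({1..p} \<times> {fst a, snd a}))"
   by (rule card_mono) (auto simp: N_def I_def)
  also have "... <= card ({fst a, snd a} \<times> {1..p}) + card ({1..p} \<times> {fst a, snd a})" by (rule card_Un_le)
  also have "... = 2 * (card {fst a, snd a} * p)" by (simp add: card_cartesian_product)
  also have "card {fst a, snd a} <= 2" by (rule card_insert_le_m1) auto
  finally show ?thesis by simp
 qed
 have p1: "1 <= p" if "a : I" for a using that by (auto simp: I_def)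
 have evE: "E a : events" if "a : I" for a
 proof -
  obtain i j where a: "a = (i, j)" by (cases a)
  have "Sq f n i j : borel_measurable M" using that by (intro Sq_measurable f) (auto simp: a I_def)
  then show ?thesis unfolding a E_def by simp
 qed
 define Sz where "Sz = (%(i :: nat, j :: nat) g. (\<Sum>m=1..d. (\<Sum>k=1..n. f (g (Some (m, k, i))) (g (Some (m, k, j))))\<^sup>2))" 
 have SzM: "Sz b : borel_measurable (PiM (Some ` ({1..d} \<times> {1..n} \<times> Q)) (%_. borel))" if "fst b : Q" "snd b : Q" for b Q
 proof -
  obtain i j where b: "b = (i, j)" by (cases b)
  show ?thesis unfolding Sz_def b prod.case
   by (intro borel_measurable_sum borel_measurable_power, rule coordinate_pair_measurable[OF f]) (use that in \<open>auto simp: b\<close>)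
 qed
 have SzE: "om : E b \<longleftrightarrow> T <= Sz b (restrict (%t. Zv t om) (Some ` ({1..d} \<times> {1..n} \<times> Q)))" if "om : space M" "fst b : Q" "snd b : Q" for om b Q
 proof -
  obtain i j where b: "b = (i, j)" by (cases b)
  have "Sz b (restrict (%t. Zv t om) (Some ` ({1..d} \<times> {1..n} \<times> Q))) = Sq f n i j om"
   unfolding Sz_def b prod.case Sq_def
   by (intro sum.cong refl arg_cong[where f="%x. x\<^sup>2"]) (use that in \<open>auto simp: b image_iff\<close>)
  then show ?thesis using that(1) unfolding E_def b by simp
 qed
 have prodform: "(LINT om|M. indicator (E a) om * v ^ (\<Sum>b\<in>I - insert a (N a). if om : E b then 1 else 0))
   = prob (E a) * (LINT om|M. v ^ (\<Sum>b\<in>I - insert a (N a). if om : E b then 1 else 0))"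
  if a: "a : I" and v: "0 <= v" "v <= 1" for a and v :: real
 proof -
  define Qa where "Qa = {fst a, snd a}"
  define Qb where "Qb = {1..p} - Qa"
  define A where "A = Some ` ({1..d} \<times> {1..n} \<times> Qa)"
  define Bs where "Bs = Some ` ({1..d} \<times> {1..n} \<times> Qb)"
  define J where "J = I - insert a (N a)"
  have J: "fst b : Qb & snd b : Qb" if "b : J" for b using that by (auto simp: J_def N_def Qb_def Qa_def I_def)
  have finJ: "finite J" using finI by (simp add: J_def)
  have iv: "indep_var (PiM A (%_. borel)) (%om. restrict (%t. Zv t om) A) (PiM Bs (%_. borel)) (%om. restrict (%t. Zv t om) Bs)"
  proof (rule indep_var_restrict[OF indep_Zv])
   show "A Int Bs = {}" by (auto simp: A_def Bs_def Qb_def)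
   show "A \<subseteq> insert None (Some ` ({1..d} \<times> {1..} \<times> {1..}))" using a by (auto simp: A_def Qa_def I_def)
   show "Bs \<subseteq> insert None (Some ` ({1..d} \<times> {1..} \<times> {1..}))" by (auto simp: Bs_def Qb_def)
  qed
  define ph where "ph g = (if T <= Sz a g then 1 else 0 :: real)" for g
  define \<psi> where "\<psi> g = (\<Prod>b\<in>J. if T <= Sz b g then v else 1)" for g
  have phm: "ph : borel_measurable (PiM A (%_. borel))"
  proof -
   have [measurable]: "Sz a : borel_measurable (PiM A (%_. borel))" unfolding A_def by (rule SzM) (auto simp: Qa_def)
   show ?thesis unfolding ph_def[abs_def] by measurable
  qed
  have \<psi>m: "\<psi> : borel_measurable (PiM Bs (%_. borel))" unfolding \<psi>_def[abs_def]
  proof (rule borel_measurable_prod)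
   fix b assume "b : J"
   then have [measurable]: "Sz b : borel_measurable (PiM Bs (%_. borel))" unfolding Bs_def using J by (intro SzM) auto
   show "(%g. if T <= Sz b g then v else 1) : borel_measurable (PiM Bs (%_. borel))" by measurable
  qed
  define ra rb where "ra om = restrict (%t. Zv t om) A" and "rb om = restrict (%t. Zv t om) Bs" for om
  have iv2: "indep_var borel (%om. ph (ra om)) borel (%om. \<psi> (rb om))"
   using indep_var_compose[OF iv phm \<psi>m] by (simp add: comp_def ra_def rb_def)
  have m2: "(%om. ph (ra om)) : borel_measurable M" "(%om. \<psi> (rb om)) : borel_measurable M"
   using indep_var_rv1[OF iv2] indep_var_rv2[OF iv2] by auto
  have bnd: "\<bar>\<psi> g\<bar> <= 1" for g
  proof -
   have "\<bar>\<psi> g\<bar> = (\<Prod>b\<in>J. \<bar>if T <= Sz b g then v else 1\<bar>)" unfolding \<psi>_def by (rule abs_prod)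
   also have "... <= (\<Prod>b\<in>J. 1)" by (rule prod_mono) (use v in auto)
   finally show ?thesis by simp
  qed
  have i2: "integrable M (%om. ph (ra om))" "integrable M (%om. \<psi> (rb om))"
   by (rule integrable_const_bound[where B=1]; use m2 bnd in \<open>auto simp: ph_def\<close>)+
  have pr: "(LINT om|M. ph (ra om) * \<psi> (rb om)) = (LINT om|M. ph (ra om)) * (LINT om|M. \<psi> (rb om))"
   by (rule indep_var_lebesgue_integral[OF iv2 i2])
  have eph: "ph (ra om) = indicator (E a) om" if "om : space M" for om
   using SzE[OF that, of a Qa] by (auto simp: ph_def ra_def A_def Qa_def indicator_def)
  have e\<psi>: "\<psi> (rb om) = v ^ (\<Sum>b\<in>J. if om : E b then 1 else 0)" if "om : space M" for om
  proof -
   have "\<psi> (rb om) = (\<Prod>b\<in>J. v ^ (if om : E b then 1 else 0))" unfolding \<psi>_def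
   proof (rule prod.cong[OF refl])
    fix b assume "b : J"
    then show "(if T <= Sz b (rb om) then v else 1) = v ^ (if om : E b then 1 else 0)"
     using SzE[OF that, of b Qb] J[of b] by (auto simp: rb_def Bs_def)
   qed
   then show ?thesis by (simp add: power_sum)
  qed
  have "(LINT om|M. indicator (E a) om * v ^ (\<Sum>b\<in>J. if om : E b then 1 else 0)) = (LINT om|M. ph (ra om) * \<psi> (rb om))"
   by (rule Bochner_Integration.integral_cong[OF refl]) (simp add: eph e\<psi>)
  also note pr
  also have "(LINT om|M. ph (ra om)) = (LINT om|M. indicator (E a) om)"
   by (rule Bochner_Integration.integral_cong[OF refl]) (simp add: eph)
  also have "(LINT om|M. indicator (E a) om) = prob (E a)" using evE[OF a] by simp
  also have "(LINT om|M. \<psi> (rb om)) = (LINT om|M. v ^ (\<Sum>b\<in>J. if om : E b then 1 else 0))"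
   by (rule Bochner_Integration.integral_cong[OF refl]) (simp add: e\<psi>)
  finally show ?thesis unfolding J_def .
 qed
 have one: "prob (E a) <= bt1" if "a : I" for a using that b1[of "fst a" "snd a"] by (auto simp: I_def)
 have two: "prob (E a Int E b) <= bt2" if a: "a : I" and b: "b : N a" for a b
 proof -
  obtain i j where a': "a = (i, j)" by (cases a)
  obtain i' j' where b': "b = (i', j')" by (cases b)
  have ij: "1 <= i" "i < j" "1 <= i'" "i' < j'" using a b by (auto simp: a' b' I_def N_def)
  have "(i' = i & j' ~= j) \<or> (i' = j) \<or> (j' = i) \<or> (j' = j & i' ~= i)" using b by (auto simp: a' b' N_def)
  then show ?thesis
  proof (elim disjE conjE)
   assume h: "i' = i" "j' ~= j" show ?thesis unfolding a' b' h(1) using ij h by (intro b2) auto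
  next
   assume h: "i' = j" show ?thesis unfolding a' b' h Esym[of i j] using ij h by (intro b2) auto
  next
   assume h: "j' = i" show ?thesis unfolding a' b' h Esym[of i' i] using ij h by (intro b2) auto
  next
   assume h: "j' = j" "i' ~= i" show ?thesis unfolding a' b' h(1) Esym[of i j] Esym[of i' j] using ij h by (intro b2) auto
  qed
 qed
 have "\<bar>prob {om : space M. \<forall>a\<in>I. om \<notin> E a} - exp (- (\<Sum>a\<in>I. prob (E a)))\<bar>
  <= (\<Sum>a\<in>I. (\<Sum>b\<in>N a. prob (E a Int E b)) + prob (E a) * (\<Sum>b\<in>insert a (N a). prob (E b)))"
  by (rule poisson_zero_approx[OF finI evE _ prodform]) (auto simp: N_def)
 also have "... <= (\<Sum>a\<in>I. real p * (4 * bt2 + 5 * bt1\<^sup>2))"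
 proof (rule sum_mono)
  fix a assume a: "a : I"
  have finN: "finite (N a)" using finI by (simp add: N_def)
  have "(\<Sum>b\<in>N a. prob (E a Int E b)) <= real (card (N a)) * bt2" by (rule sum_bounded_above) (rule two[OF a])
  also have "... <= real (4 * p) * bt2" using cardN[OF a] bt by (intro mult_right_mono) (auto simp del: of_nat_mult)
  finally have 1: "(\<Sum>b\<in>N a. prob (E a Int E b)) <= real p * (4 * bt2)" by (simp add: mult_ac)
  have "(\<Sum>b\<in>insert a (N a). prob (E b)) <= real (card (insert a (N a))) * bt1"
   by (rule sum_bounded_above) (use one a in \<open>auto simp: N_def\<close>)
  also have "... <= real (5 * p) * bt1"
  proof (intro mult_right_mono bt)
   have "card (insert a (N a)) <= Suc (card (N a))" by (rule card_insert_le_m1[of "Suc (card (N a))", simplified]) simp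
   then show "real (card (insert a (N a))) <= real (5 * p)" using cardN[OF a] p1[OF a] by (simp del: of_nat_mult)
  qed
  finally have 2: "(\<Sum>b\<in>insert a (N a). prob (E b)) <= real (5 * p) * bt1" .
  have "prob (E a) * (\<Sum>b\<in>insert a (N a). prob (E b)) <= bt1 * (real (5 * p) * bt1)"
   using bt by (intro mult_mono one[OF a] 2 sum_nonneg) auto
  then have 3: "prob (E a) * (\<Sum>b\<in>insert a (N a). prob (E b)) <= real p * (5 * bt1\<^sup>2)" by (simp add: power2_eq_square mult_ac)
  show "(\<Sum>b\<in>N a. prob (E a Int E b)) + prob (E a) * (\<Sum>b\<in>insert a (N a). prob (E b)) <= real p * (4 * bt2 + 5 * bt1\<^sup>2)"
   using add_mono[OF 1 3] by (simp only: distrib_left)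
 qed
 also have "... = real (card I) * (real p * (4 * bt2 + 5 * bt1\<^sup>2))" by simp
 also have "... <= real (p * p) * (real p * (4 * bt2 + 5 * bt1\<^sup>2))"
  using cardI bt by (intro mult_right_mono) (auto simp del: of_nat_mult)
 also have "... = real p ^ 3 * (4 * bt2 + 5 * bt1\<^sup>2)" by (simp add: power3_eq_cube mult.assoc)
 finally show ?thesis .
qed

end

lemma exp_minus_close:
 fixes kp mu et :: real
 assumes l: "0 <= kp" and c: "\<bar>mu - kp\<bar> <= et * kp" and e: "0 <= et" "et <= 1 / 2"
 shows "\<bar>exp (- mu) - exp (- kp)\<bar> <= et"
proof -
 have lip: "\<bar>exp (- y) - exp (- x)\<bar> <= exp (- z) * \<bar>y - x\<bar>" if "z <= x" "x <= y" for x y z :: real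
 proof -
  have "1 - w <= exp (- w)" for w :: real using exp_ge_add_one_self[of "- w"] by simp
  then have "exp (- x) * (1 - (y - x)) <= exp (- x) * exp (- (y - x))" by (rule mult_left_mono) simp
  also have "... = exp (- y)" by (simp flip: exp_add)
  finally have "exp (- x) - exp (- y) <= exp (- x) * (y - x)" by (simp add: algebra_simps)
  also have "... <= exp (- z) * (y - x)" using that by (intro mult_right_mono) auto
  finally have "exp (- x) - exp (- y) <= exp (- z) * (y - x)" .
  moreover have "exp (- y) <= exp (- x)" using that by simp
  ultimately show ?thesis using that by simp
 qed
 have "et * kp <= 1 / 2 * kp" using e l by (intro mult_right_mono) auto
 then have half: "kp / 2 <= mu" using c by linarith
 have "\<bar>exp (- mu) - exp (- kp)\<bar> <= exp (- (kp / 2)) * \<bar>mu - kp\<bar>"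
 proof (cases "kp <= mu")
  case True then show ?thesis using lip[of "kp / 2" kp mu] l by simp
 next
  case False then show ?thesis using lip[of "kp / 2" mu kp] half by (simp add: abs_minus_commute)
 qed
 also have "... <= exp (- (kp / 2)) * (et * kp)" using c by (intro mult_left_mono) auto
 also have "... = et * (kp * exp (- (kp / 2)))" by simp
 also have "kp * exp (- (kp / 2)) <= 1"
 proof -
  have "0 <= (kp - 2)\<^sup>2 / 8 + 1 / 2" by simp
  also have "... = 1 + kp / 2 + (kp / 2)\<^sup>2 / 2 - kp" by (simp add: power2_eq_square field_simps)
  finally have "kp <= 1 + kp / 2 + (kp / 2)\<^sup>2 / 2" by simp
  also have "... <= exp (kp / 2)" by (rule exp_lower_Taylor_quadratic) (use l in simp)
  finally show ?thesis by (simp add: exp_minus field_simps)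
 qed
 finally show ?thesis using e by (simp add: mult_left_mono)
qed

lemma card_ordered_pairs: "real (card {(i, j). 1 <= i & i < j & j <= (p::nat)}) = ((real p)\<^sup>2 - real p) / 2"
proof (induction p)
 case 0
 have e: "{(i, j). 1 <= i & i < j & j <= (0::nat)} = {}" by auto
 show ?case unfolding e by simp
next
 case (Suc p)
 let ?I = "%p. {(i, j). 1 <= i & i < j & j <= (p::nat)}"
 have fin: "finite (?I p)" by (rule finite_subset[of _ "{..p} \<times> {..p}"]) auto
 have eq: "?I (Suc p) = ?I p \<union> (%i. (i, Suc p)) ` {1..p}" by (auto simp: le_Suc_eq)
 have "card (?I (Suc p)) = card (?I p) + card ((%i. (i, Suc p)) ` {1..p})"
  unfolding eq by (rule card_Un_disjoint) (use fin in auto)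
 also have "card ((%i. (i, Suc p)) ` {1..p}) = p" by (subst card_image) (auto simp: inj_on_def)
 finally have "card (?I (Suc p)) = card (?I p) + p" .
 then have "real (card (?I (Suc p))) = real (card (?I p)) + real p" by simp
 then show ?case using Suc.IH by (simp add: power2_eq_square field_simps)
qed

lemma ratio_exceeds:
 fixes Ai Aj S t y :: real
 assumes n: "0 < (n::real)" and d: "1 <= (d::real)" and y: "0 <= y" "y < 1" and t: "0 < t"
  and A: "\<bar>Ai - d * n\<bar> < y * n" "\<bar>Aj - d * n\<bar> < y * n" and S: "t * (1 + 3 * y) * n <= S"
 shows "t < d\<^sup>2 * n * S / (Ai * Aj)"
proof -
 have yn: "y * n <= d * (y * n)" using mult_right_mono[OF d, of "y * n"] y n by simp
 have dn: "0 < d * n" using d n by simp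
 have pos: "0 < A" "A < d * n * (1 + y)" if "\<bar>A - d * n\<bar> < y * n" for A
 proof -
  have "d * n * y < d * n * 1" using y dn by (intro mult_strict_left_mono) auto
  then show "0 < A" using that yn by (simp add: mult_ac abs_less_iff)
  show "A < d * n * (1 + y)" using that yn by (simp add: abs_less_iff distrib_left mult_ac)
 qed
 have "Ai * Aj < (d * n * (1 + y)) * (d * n * (1 + y))" using pos[OF A(1)] pos[OF A(2)] by (intro mult_strict_mono) auto
 also have "... = (d\<^sup>2 * n) * (n * (1 + y)\<^sup>2)" by (simp add: power2_eq_square mult_ac)
 also have "... <= (d\<^sup>2 * n) * (n * (1 + 3 * y))"
 proof -
  have "y * y <= 1 * y" using y by (intro mult_right_mono) auto
  then have "(1 + y)\<^sup>2 <= 1 + 3 * y" by (simp add: power2_eq_square algebra_simps)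
  then show ?thesis using n by (intro mult_left_mono) auto
 qed
 finally have "t * (Ai * Aj) < t * ((d\<^sup>2 * n) * (n * (1 + 3 * y)))" using t by (rule mult_strict_left_mono)
 also have "... = (d\<^sup>2 * n) * (t * (1 + 3 * y) * n)" by (simp add: mult_ac)
 also have "... <= (d\<^sup>2 * n) * S" using S n by (intro mult_left_mono) auto
 finally show ?thesis using pos[OF A(1)] pos[OF A(2)] by (simp add: pos_less_divide_eq)
qed

lemma ratio_exceeds_imp:
 fixes Ai Aj S t y :: real
 assumes n: "0 < (n::real)" and d: "1 <= (d::real)" and y: "0 <= y" "y < 1" and t: "0 < t"
  and A: "d * n - y * n < Ai" "d * n - y * n < Aj" and S: "t < d\<^sup>2 * n * S / (Ai * Aj)"
 shows "t * (1 - 3 * y) * n <= S"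
proof -
 have yn: "y * n <= d * (y * n)" using mult_right_mono[OF d, of "y * n"] y n by simp
 have dn: "0 < d * n" using d n by simp
 have lo: "d * n * (1 - y) <= A" if "d * n - y * n < A" for A using that yn by (simp add: right_diff_distrib mult_ac)
 have p0: "0 < d * n * (1 - y)" using dn y by simp
 have "(d * n * (1 - y)) * (d * n * (1 - y)) <= Ai * Aj" using lo[OF A(1)] lo[OF A(2)] p0 by (intro mult_mono) auto
 then have "t * ((d * n * (1 - y)) * (d * n * (1 - y))) <= t * (Ai * Aj)" using t by (intro mult_left_mono) auto
 also have "... < d\<^sup>2 * n * S"
 proof -
  have "0 < Ai * Aj" using lo[OF A(1)] lo[OF A(2)] p0 by (intro mult_pos_pos) auto
  then show ?thesis using S by (simp add: pos_less_divide_eq)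
 qed
 finally have "(d\<^sup>2 * n) * (t * (1 - y)\<^sup>2 * n) < (d\<^sup>2 * n) * S" by (simp add: power2_eq_square mult_ac)
 moreover have "0 < d\<^sup>2 * n" using d n by simp
 ultimately have "t * (1 - y)\<^sup>2 * n < S" using mult_less_cancel_left_pos by blast
 moreover have "t * (1 - 3 * y) * n <= t * (1 - y)\<^sup>2 * n"
 proof -
  have "0 <= y * y" by simp
  then have "1 - 3 * y <= (1 - y)\<^sup>2" using y by (simp add: power2_eq_square algebra_simps)
  then show ?thesis using t n by (intro mult_right_mono mult_left_mono) auto
 qed
 ultimately show ?thesis by linarith
qed

context iid_array
begin

definition no_exceed :: "nat => nat => real => 'a set" where
 "no_exceed p n t = {om : space M. \<forall>a\<in>{(i, j). 1 <= i & i < j & j <= p}.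
  (real d)\<^sup>2 * real n * S_sq d Xa n (fst a) (snd a) om / (A_ni d Xa n (fst a) om * A_ni d Xa n (snd a) om) <= t}"

definition no_large :: "nat => nat => real => real => 'a set" where
 "no_large p n b T = {om : space M. \<forall>a\<in>{(i, j). 1 <= i & i < j & j <= p}.
  om \<notin> (%(i, j). {om : space M. T <= Sq (tprod b) n i j om}) a}"

definition bad_norm :: "real => real => nat => nat => 'a set" where
 "bad_norm K b n i = {om : space M. K * (real n / b\<^sup>2) <= \<bar>(\<Sum>m=1..d. \<Sum>k=1..n. (trunc b (Xa m k i om))\<^sup>2) - real d * real n\<bar>}"

lemma S_sq_eq: "S_sq d Xa n i j = Sq (*) n i j"
 unfolding S_sq_def[abs_def] Sq_def[abs_def] ..

lemma A_ni_measurable: "1 <= i ==> A_ni d Xa n i : borel_measurable M"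
 unfolding A_ni_def[abs_def] by (intro borel_measurable_sum borel_measurable_power rv_Xa) auto

lemma S_sq_measurable: "1 <= i ==> 1 <= j ==> S_sq d Xa n i j : borel_measurable M"
 unfolding S_sq_eq by (rule Sq_measurable) auto

lemma no_exceed_event: "no_exceed p n t : events"
proof -
 let ?I = "{(i, j). 1 <= i & i < j & j <= p}"
 have fin: "finite ?I" by (rule finite_subset[of _ "{..p} \<times> {..p}"]) auto
 show ?thesis unfolding no_exceed_def
 proof (rule sets.sets_Collect_finite_All[OF _ fin])
  fix a assume "a : ?I"
  then have [measurable]: "S_sq d Xa n (fst a) (snd a) : borel_measurable M" "A_ni d Xa n (fst a) : borel_measurable M" "A_ni d Xa n (snd a) : borel_measurable M"
   by (auto intro: S_sq_measurable A_ni_measurable)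
  show "{om : space M. (real d)\<^sup>2 * real n * S_sq d Xa n (fst a) (snd a) om / (A_ni d Xa n (fst a) om * A_ni d Xa n (snd a) om) <= t} : events" by measurable
 qed
qed

lemma Sq_event:
 assumes "(%(x, y). f x y) : borel_measurable (borel \<Otimes>\<^sub>M borel)" "1 <= i" "1 <= j"
 shows "{om : space M. T <= Sq f n i j om} : events"
 using Sq_measurable[OF assms] by measurable

lemma no_large_event: "no_large p n b T : events"
proof -
 let ?I = "{(i, j). 1 <= i & i < j & j <= p}"
 have fin: "finite ?I" by (rule finite_subset[of _ "{..p} \<times> {..p}"]) auto
 show ?thesis unfolding no_large_def
 proof (rule sets.sets_Collect_finite_All[OF _ fin])
  fix a assume "a : ?I"
  then obtain i j where a: "a = (i, j)" "1 <= i" "1 <= j" by auto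
  have "{om : space M. T <= Sq (tprod b) n i j om} : events" by (rule Sq_event[OF tprod_measurable a(2,3)])
  then show "{om : space M. om \<notin> (%(i, j). {om : space M. T <= Sq (tprod b) n i j om}) a} : events"
   unfolding a(1) prod.case by (auto intro: sets.sets_Collect_neg)
 qed
qed

lemma bad_norm_event: assumes "1 <= i" shows "bad_norm K b n i : events"
proof -
 have [measurable]: "(%om. \<Sum>m=1..d. \<Sum>k=1..n. (trunc b (Xa m k i om))\<^sup>2) : borel_measurable M"
 proof (intro borel_measurable_sum borel_measurable_power)
  fix m k assume "m : {1..d}" "k : {1..n}"
  then have "Xa m k i : borel_measurable M" using rv_Xa assms by auto
  then show "(%om. trunc b (Xa m k i om)) : borel_measurable M" by measurable
 qed
 show ?thesis unfolding bad_norm_def by measurable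
qed

lemma norm_lower:
 assumes "om : space M" "om \<notin> bad_norm K b n i"
 shows "real d * real n - K * (1 / b\<^sup>2) * real n < A_ni d Xa n i om"
proof -
 have "(\<Sum>m=1..d. \<Sum>k=1..n. (trunc b (Xa m k i om))\<^sup>2) <= A_ni d Xa n i om" unfolding A_ni_def
  by (intro sum_mono) (auto simp: trunc_def)
 moreover have "\<bar>(\<Sum>m=1..d. \<Sum>k=1..n. (trunc b (Xa m k i om))\<^sup>2) - real d * real n\<bar> < K * (1 / b\<^sup>2) * real n"
  using assms by (auto simp: bad_norm_def)
 ultimately show ?thesis by linarith
qed

lemma norm_close:
 assumes "om : space M" "om \<notin> bad_norm K b n i" "om \<notin> big b n i"
 shows "\<bar>A_ni d Xa n i om - real d * real n\<bar> < K * (1 / b\<^sup>2) * real n"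
proof -
 have "(\<Sum>m=1..d. \<Sum>k=1..n. (trunc b (Xa m k i om))\<^sup>2) = A_ni d Xa n i om" unfolding A_ni_def
  by (intro sum.cong refl) (use assms(1,3) in \<open>force simp: trunc_def big_def\<close>)
 then show ?thesis using assms(1,2) by (auto simp: bad_norm_def)
qed

lemma Sq_tprod_eq:
 assumes "om : space M" "om \<notin> big b n i" "om \<notin> big b n j"
 shows "Sq (tprod b) n i j om = S_sq d Xa n i j om"
proof -
 have small: "\<bar>Xa m k l om\<bar> < b" if "m : {1..d}" "k : {1..n}" "om \<notin> big b n l" for m k l
  using that assms(1) unfolding big_def by (simp add: not_le)
 have "tprod b (Xa m k i om) (Xa m k j om) = Xa m k i om * Xa m k j om" if "m : {1..d}" "k : {1..n}" for m k
  using small[OF that assms(2)] small[OF that assms(3)] by (simp add: tprod_def trunc_def)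
 then show ?thesis unfolding Sq_def S_sq_def
  by (intro sum.cong refl arg_cong[where f="%x. x\<^sup>2"]) blast
qed

lemma prob_pair_product_large:
 assumes ij: "1 <= i" "1 <= j" "i ~= j"
 shows "{om : space M. \<exists>m\<in>{1..d}. \<exists>k\<in>{1..n}. a <= \<bar>Xa m k i om * Xa m k j om\<bar>} : events"
  "prob {om : space M. \<exists>m\<in>{1..d}. \<exists>k\<in>{1..n}. a <= \<bar>Xa m k i om * Xa m k j om\<bar>} <= real d * real n * prob {om : space M. a <= \<bar>X om * X' om\<bar>}"
proof -
 let ?P = "{1..d} \<times> {1..n}"
 define B where "B q = {om : space M. a <= \<bar>Xa (fst q) (snd q) i om * Xa (fst q) (snd q) j om\<bar>}" for q
 have Bm: "B q : events" if "q : ?P" for q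
 proof -
  have [measurable]: "Xa (fst q) (snd q) i : borel_measurable M" "Xa (fst q) (snd q) j : borel_measurable M" using that ij rv_Xa by auto
  show ?thesis unfolding B_def by measurable
 qed
 have eq: "{om : space M. \<exists>m\<in>{1..d}. \<exists>k\<in>{1..n}. a <= \<bar>Xa m k i om * Xa m k j om\<bar>} = (\<Union>q\<in>?P. B q)" unfolding B_def by force
 show "{om : space M. \<exists>m\<in>{1..d}. \<exists>k\<in>{1..n}. a <= \<bar>Xa m k i om * Xa m k j om\<bar>} : events"
  unfolding eq by (rule sets.finite_UN) (use Bm in auto)
 have "prob (\<Union>q\<in>?P. B q) <= (\<Sum>q\<in>?P. prob (B q))" by (rule measure_UNION_le) (use Bm in auto)
 also have "... = (\<Sum>q\<in>?P. prob {om : space M. a <= \<bar>X om * X' om\<bar>})"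
  by (rule sum.cong[OF refl]) (use pair_prob[OF _ _ ij] in \<open>auto simp: B_def\<close>)
 finally show "prob {om : space M. \<exists>m\<in>{1..d}. \<exists>k\<in>{1..n}. a <= \<bar>Xa m k i om * Xa m k j om\<bar>} <= real d * real n * prob {om : space M. a <= \<bar>X om * X' om\<bar>}"
  unfolding eq by simp
qed

lemma pair_union_bound:
 assumes A: "A \<subseteq> B \<union> ((\<Union>i\<in>{1..p}. G i) \<union> (\<Union>a\<in>{(i, j). 1 <= i & i < j & j <= p}. H (fst a) (snd a)))"
  and ev: "B : events" "!!i. 1 <= i ==> G i : events" "!!i j. 1 <= i ==> 1 <= j ==> i ~= j ==> H i j : events"
  and G: "!!i. 1 <= i ==> prob (G i) <= gmv" and H: "!!i j. 1 <= i ==> 1 <= j ==> i ~= j ==> prob (H i j) <= h"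
  and h: "0 <= h"
 shows "prob A <= prob B + real p * gmv + (real p)\<^sup>2 * h"
proof -
 let ?I = "{(i, j). 1 <= i & i < j & j <= p}"
 have fin: "finite ?I" by (rule finite_subset[of _ "{..p} \<times> {..p}"]) auto
 have Hev: "H (fst a) (snd a) : events" "prob (H (fst a) (snd a)) <= h" if "a : ?I" for a using that ev(3) H by auto
 have m1: "(\<Union>i\<in>{1..p}. G i) : events" by (rule sets.finite_UN) (use ev(2) in auto)
 have m2: "(\<Union>a\<in>?I. H (fst a) (snd a)) : events" by (rule sets.finite_UN[OF fin]) (rule Hev)
 have "prob A <= prob (B \<union> ((\<Union>i\<in>{1..p}. G i) \<union> (\<Union>a\<in>?I. H (fst a) (snd a))))"
  by (rule finite_measure_mono[OF A]) (intro sets.Un ev(1) m1 m2)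
 also have "... <= prob B + prob ((\<Union>i\<in>{1..p}. G i) \<union> (\<Union>a\<in>?I. H (fst a) (snd a)))" by (intro measure_Un_le sets.Un ev(1) m1 m2)
 also have "prob ((\<Union>i\<in>{1..p}. G i) \<union> (\<Union>a\<in>?I. H (fst a) (snd a))) <= prob (\<Union>i\<in>{1..p}. G i) + prob (\<Union>a\<in>?I. H (fst a) (snd a))"
  by (intro measure_Un_le m1 m2)
 also have "prob (\<Union>i\<in>{1..p}. G i) <= (\<Sum>i\<in>{1..p}. prob (G i))" by (rule measure_UNION_le) (use ev(2) in auto)
 also have "(\<Sum>i\<in>{1..p}. prob (G i)) <= (\<Sum>i\<in>{1..p}. gmv)" by (rule sum_mono) (use G in auto)
 also have "prob (\<Union>a\<in>?I. H (fst a) (snd a)) <= (\<Sum>a\<in>?I. prob (H (fst a) (snd a)))" by (rule measure_UNION_le[OF fin]) (rule Hev)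
 also have "(\<Sum>a\<in>?I. prob (H (fst a) (snd a))) <= (\<Sum>a\<in>?I. h)" by (rule sum_mono) (rule Hev)
 also have "(\<Sum>a\<in>?I. h) <= (real p)\<^sup>2 * h"
 proof -
  have half: "(A - B) / 2 <= A" if "0 <= A" "0 <= B" for A B :: real using that by (simp add: field_simps)
  have "real (card ?I) <= (real p)\<^sup>2" unfolding card_ordered_pairs by (rule half) simp_all
  then show ?thesis using h by (simp add: mult_right_mono)
 qed
 finally show ?thesis by simp
qed

lemma truncation_sandwich:
 fixes n p :: nat and b K t a gmv u v :: real
 defines "y \<equiv> K * (1 / b\<^sup>2)"
 assumes n: "1 <= n" and y: "0 <= y" "y < 1" and t: "0 < t"
  and g: "!!i. 1 <= i ==> prob (bad_norm K b n i) <= gmv"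
  and u: "!!i j. 1 <= i ==> 1 <= j ==> i ~= j ==> prob (big b n i Int {om : space M. t * (1 + 3 * y) * n <= Sq (tprod b) n i j om}) <= u" "0 <= u"
  and v: "!!i j. 1 <= i ==> 1 <= j ==> i ~= j ==> prob (big b n i Int {om : space M. t * (1 - 3 * y) * n <= Sq (%x y. trunc a (x * y)) n i j om}) <= v" "0 <= v"
 shows "prob (no_exceed p n t) <= prob (no_large p n b (t * (1 + 3 * y) * n)) + real p * gmv + (real p)\<^sup>2 * (u + u)"
  "prob (no_large p n b (t * (1 - 3 * y) * n)) <= prob (no_exceed p n t) + real p * gmv + (real p)\<^sup>2 * (real d * real n * prob {om : space M. a <= \<bar>X om * X' om\<bar>} + (v + v))"
proof -
 let ?I = "{(i, j). 1 <= i & i < j & j <= p}"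
 have n0: "0 < real n" and dd: "1 <= real d" using n d1 by auto
 define Ea where "Ea i j = {om : space M. t * (1 + 3 * y) * n <= Sq (tprod b) n i j om}" for i j
 define Eb where "Eb i j = {om : space M. t * (1 - 3 * y) * n <= Sq (%x y. trunc a (x * y)) n i j om}" for i j
 define Bp where "Bp i j = {om : space M. \<exists>m\<in>{1..d}. \<exists>k\<in>{1..n}. a <= \<bar>Xa m k i om * Xa m k j om\<bar>}" for i j
 have sa: "Ea i j = Ea j i" for i j unfolding Ea_def using Sq_commute[of "tprod b" n i j] by (simp add: tprod_def mult.commute)
 have sb: "Eb i j = Eb j i" for i j unfolding Eb_def using Sq_commute[of "%x y. trunc a (x * y)" n i j] by (simp add: mult.commute)
 have Eaev: "Ea i j : events" if "1 <= i" "1 <= j" for i j unfolding Ea_def by (rule Sq_event[OF tprod_measurable that])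
 have Ebev: "Eb i j : events" if "1 <= i" "1 <= j" for i j unfolding Eb_def by (rule Sq_event[OF trunc_prod_measurable that])
 show "prob (no_exceed p n t) <= prob (no_large p n b (t * (1 + 3 * y) * n)) + real p * gmv + (real p)\<^sup>2 * (u + u)"
 proof (rule pair_union_bound[where G="bad_norm K b n" and H="%i j. (big b n i Int Ea i j) \<union> (big b n j Int Ea j i)"])
  show "no_exceed p n t \<subseteq> no_large p n b (t * (1 + 3 * y) * n) \<union> ((\<Union>i\<in>{1..p}. bad_norm K b n i) \<union> (\<Union>a\<in>?I. (big b n (fst a) Int Ea (fst a) (snd a)) \<union> (big b n (snd a) Int Ea (snd a) (fst a))))"
  proof (rule subsetI, rule ccontr)
   fix om assume w: "om : no_exceed p n t" and
    c: "om \<notin> no_large p n b (t * (1 + 3 * y) * n) \<union> ((\<Union>i\<in>{1..p}. bad_norm K b n i) \<union> (\<Union>a\<in>?I. (big b n (fst a) Int Ea (fst a) (snd a)) \<union> (big b n (snd a) Int Ea (snd a) (fst a))))"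
   have sp: "om : space M" using w by (simp add: no_exceed_def)
   from c sp obtain i j where ij: "(i, j) : ?I" and E: "om : Ea i j" by (force simp: no_large_def Ea_def)
   have ijp: "i : {1..p}" "j : {1..p}" using ij by auto
   have nb: "om \<notin> bad_norm K b n i" "om \<notin> bad_norm K b n j" using c ijp by blast+
   have "om \<notin> (big b n (fst (i, j)) Int Ea (fst (i, j)) (snd (i, j))) \<union> (big b n (snd (i, j)) Int Ea (snd (i, j)) (fst (i, j)))" using c ij by blast
   then have ng: "om \<notin> big b n i" "om \<notin> big b n j" using E sa[of i j] by auto
   have "t * (1 + 3 * y) * n <= S_sq d Xa n i j om" using E Sq_tprod_eq[OF sp ng] by (simp add: Ea_def)
   then have "t < (real d)\<^sup>2 * real n * S_sq d Xa n i j om / (A_ni d Xa n i om * A_ni d Xa n j om)"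
    by (rule ratio_exceeds[OF n0 dd y t norm_close[OF sp nb(1) ng(1), folded y_def] norm_close[OF sp nb(2) ng(2), folded y_def]])
   moreover have "(real d)\<^sup>2 * real n * S_sq d Xa n (fst (i, j)) (snd (i, j)) om / (A_ni d Xa n (fst (i, j)) om * A_ni d Xa n (snd (i, j)) om) <= t"
    using w ij unfolding no_exceed_def by blast
   ultimately show False by simp
  qed
  fix i j :: nat assume ij: "1 <= i" "1 <= j" "i ~= j"
  show "prob ((big b n i Int Ea i j) \<union> (big b n j Int Ea j i)) <= u + u"
  proof -
   have "prob ((big b n i Int Ea i j) \<union> (big b n j Int Ea j i)) <= prob (big b n i Int Ea i j) + prob (big b n j Int Ea j i)"
    by (intro measure_Un_le sets.Int big_event Eaev ij)
   also have "... <= u + u" unfolding Ea_def using ij by (intro add_mono u(1)) auto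
   finally show ?thesis .
  qed
  show "(big b n i Int Ea i j) \<union> (big b n j Int Ea j i) : events" by (intro sets.Un sets.Int big_event Eaev ij)
 qed (use g u no_large_event bad_norm_event in auto)
 show "prob (no_large p n b (t * (1 - 3 * y) * n)) <= prob (no_exceed p n t) + real p * gmv + (real p)\<^sup>2 * (real d * real n * prob {om : space M. a <= \<bar>X om * X' om\<bar>} + (v + v))"
 proof (rule pair_union_bound[where G="bad_norm K b n" and H="%i j. Bp i j \<union> ((big b n i Int Eb i j) \<union> (big b n j Int Eb j i))"])
  show "no_large p n b (t * (1 - 3 * y) * n) \<subseteq> no_exceed p n t \<union> ((\<Union>i\<in>{1..p}. bad_norm K b n i) \<union> (\<Union>a\<in>?I. Bp (fst a) (snd a) \<union> ((big b n (fst a) Int Eb (fst a) (snd a)) \<union> (big b n (snd a) Int Eb (snd a) (fst a)))))"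
  proof (rule subsetI, rule ccontr)
   fix om assume w: "om : no_large p n b (t * (1 - 3 * y) * n)" and
    c: "om \<notin> no_exceed p n t \<union> ((\<Union>i\<in>{1..p}. bad_norm K b n i) \<union> (\<Union>a\<in>?I. Bp (fst a) (snd a) \<union> ((big b n (fst a) Int Eb (fst a) (snd a)) \<union> (big b n (snd a) Int Eb (snd a) (fst a)))))"
   have sp: "om : space M" using w by (simp add: no_large_def)
   from c sp obtain i j where ij: "(i, j) : ?I" and E: "t < (real d)\<^sup>2 * real n * S_sq d Xa n i j om / (A_ni d Xa n i om * A_ni d Xa n j om)"
    by (force simp: no_exceed_def not_le)
   have ijp: "i : {1..p}" "j : {1..p}" using ij by auto
   have nb: "om \<notin> bad_norm K b n i" "om \<notin> bad_norm K b n j" using c ijp by blast+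
   have S: "t * (1 - 3 * y) * n <= S_sq d Xa n i j om"
    by (rule ratio_exceeds_imp[OF n0 dd y t norm_lower[OF sp nb(1), folded y_def] norm_lower[OF sp nb(2), folded y_def] E])
   have nl: "om \<notin> (%(i, j). {om : space M. t * (1 - 3 * y) * n <= Sq (tprod b) n i j om}) (i, j)" using w ij unfolding no_large_def by blast
   have bg: "om : big b n i \<or> om : big b n j" using nl Sq_tprod_eq[OF sp, of b n i j] S sp by auto
   have "om \<notin> Bp (fst (i, j)) (snd (i, j)) \<union> ((big b n (fst (i, j)) Int Eb (fst (i, j)) (snd (i, j))) \<union> (big b n (snd (i, j)) Int Eb (snd (i, j)) (fst (i, j))))" using c ij by blast
   then have nB: "om \<notin> Bp i j" and nE: "om \<notin> Eb i j" using bg sb[of i j] by auto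
   have "Sq (%x y. trunc a (x * y)) n i j om = S_sq d Xa n i j om" unfolding Sq_def S_sq_def
    by (intro sum.cong refl arg_cong[where f="%x. x\<^sup>2"]) (use nB sp in \<open>force simp: trunc_def Bp_def\<close>)
   then have "om : Eb i j" using S sp by (simp add: Eb_def)
   then show False using nE by simp
  qed
  fix i j :: nat assume ij: "1 <= i" "1 <= j" "i ~= j"
  have Bpev: "Bp i j : events" unfolding Bp_def by (rule prob_pair_product_large[OF ij])
  have m2: "(big b n i Int Eb i j) \<union> (big b n j Int Eb j i) : events" by (intro sets.Un sets.Int big_event Ebev ij)
  show "Bp i j \<union> ((big b n i Int Eb i j) \<union> (big b n j Int Eb j i)) : events" by (intro sets.Un Bpev m2)
  have "prob (Bp i j \<union> ((big b n i Int Eb i j) \<union> (big b n j Int Eb j i))) <= prob (Bp i j) + prob ((big b n i Int Eb i j) \<union> (big b n j Int Eb j i))"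
   by (intro measure_Un_le Bpev m2)
  also have "prob ((big b n i Int Eb i j) \<union> (big b n j Int Eb j i)) <= prob (big b n i Int Eb i j) + prob (big b n j Int Eb j i)"
   by (intro measure_Un_le sets.Int big_event Ebev ij)
  also have "... <= v + v" unfolding Eb_def using ij by (intro add_mono v(1)) auto
  also have "prob (Bp i j) <= real d * real n * prob {om : space M. a <= \<bar>X om * X' om\<bar>}" unfolding Bp_def by (rule prob_pair_product_large[OF ij])
  finally show "prob (Bp i j \<union> ((big b n i Int Eb i j) \<union> (big b n j Int Eb j i))) <= real d * real n * prob {om : space M. a <= \<bar>X om * X' om\<bar>} + (v + v)" by simp
 qed (use g v no_exceed_event bad_norm_event in auto)
qed


lemma window_bound:
 fixes ep B :: real
 assumes e: "0 < ep" "ep <= 1 / 10 ^ 4" and B: "0 <= B"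
 obtains C where "1 <= C"
  "!!n p b a t L. 1 <= n ==> 1 <= b ==> real p = exp L ==> 1 <= L ==> real n * (1 / b\<^sup>2)\<^sup>2 = L ==> ln n <= B * L ==>
   C * (L\<^sup>2 / sqrt n) <= 1 ==> 0 < a ==> real n * (8 / b\<^sup>2 * (m4\<^sup>2 / a ^ 3)) <= B ==>
   real n * (exp (8 / b\<^sup>2 * a) * prob {om : space M. ep / (8 / b\<^sup>2) <= \<bar>X om * X' om\<bar>}) <= B ==> 8 / b\<^sup>2 * a <= 8 * ep * L ==>
   (4 - 4 * ep) * L <= t ==> t <= 8 * L ==>
   \<bar>prob (no_exceed p n t) - exp (- (((real p)\<^sup>2 - real p) / 2 * chi_square_tail d t))\<bar>
   <= C * (exp (- L + 28 * ep * L) + L\<^sup>2 / sqrt n + (real p)\<^sup>2 * (real n * prob {om : space M. a <= \<bar>X om * X' om\<bar>})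
     + real n * prob {om : space M. b <= \<bar>X om\<bar>} * exp (22 * ep * L))
   & chi_square_tail d t <= C * exp (- (1 - 5 * ep) * t / 2)"
proof -
 have e1: "ep <= 1" "ep <= 1 / 100" using e by auto
 obtain K where K: "0 <= K" and conc: "!!b n i. 1 <= b ==> 1 <= i ==>
  prob {om : space M. K * (real n / b\<^sup>2) <= \<bar>(\<Sum>m=1..d. \<Sum>k=1..n. (trunc b (Xa m k i om))\<^sup>2) - real d * real n\<bar>} <= 2 * exp (- 3 * (real n / (b\<^sup>2)\<^sup>2))"
 proof (rule column_norm_concentration, goal_cases)
  case (1 C) show thesis by (rule that[OF 1(2) 1(3)])
 qed
 have U3: "0 <= (3::real)" "1 <= (3::real)" by auto
 obtain C1 where C1: "1 <= C1" and
  t1: "!!b n r i j. 1 <= b ==> 1 <= n ==> real n * (1 / b\<^sup>2) ^ 3 <= 1 ==> 0 < r ==> r / sqrt n <= 3 / b\<^sup>2 ==> 1 <= i ==> 1 <= j ==> i ~= j ==>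
   prob {om : space M. r\<^sup>2 * n <= Sq (tprod b) n i j om} <= C1 * exp (- (1 - 5 * ep) * r\<^sup>2 / 2)" and
  t2: "!!b n r i j l. 1 <= b ==> 1 <= n ==> real n * (1 / b\<^sup>2) ^ 3 <= 1 ==> 0 < r ==> r / sqrt n <= 3 / b\<^sup>2 ==> 1 <= i ==> 1 <= j ==> 1 <= l ==> i ~= j ==> i ~= l ==> j ~= l ==>
   prob ({om : space M. r\<^sup>2 * n <= Sq (tprod b) n i j om} Int {om : space M. r\<^sup>2 * n <= Sq (tprod b) n i l om}) <= C1 * exp (- (1 - 5 * ep) * r\<^sup>2)" and
  t3: "!!b n r i j. 1 <= b ==> 1 <= n ==> real n * (1 / b\<^sup>2) ^ 3 <= 1 ==> 0 < r ==> r / sqrt n <= 3 / b\<^sup>2 ==> 1 <= i ==> 1 <= j ==> i ~= j ==>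
   prob (big b n i Int {om : space M. r\<^sup>2 * n <= Sq (tprod b) n i j om}) <= C1 * (real n * prob {om : space M. b <= \<bar>X om\<bar>}) * exp (- (1 - 5 * ep) * r\<^sup>2 / 2)"
 proof (rule trunc_pair_tails[OF U3(1) e(1) e1(1)], goal_cases)
  case (1 C) show thesis by (rule that[OF 1(2) 1(3) 1(4) 1(5)])
 qed
 have K3: "0 <= 3 * K" using K by simp
 obtain C2 where C2: "1 <= C2" and
  chi: "!!b n s t i j. 1 <= b ==> 1 <= n ==> 1 <= real n * (1 / b\<^sup>2)\<^sup>2 ==> ln n <= B * (real n * (1 / b\<^sup>2)\<^sup>2) ==>
   C2 * ((real n * (1 / b\<^sup>2)\<^sup>2)\<^sup>2 / sqrt n) <= 1 ==> \<bar>s - 1\<bar> <= (3 * K) * (1 / b\<^sup>2) ==> 0 < t ==> t <= 3\<^sup>2 * (real n * (1 / b\<^sup>2)\<^sup>2) ==>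
   1 <= i ==> 1 <= j ==> i ~= j ==>
   \<bar>prob {om : space M. t * s * n <= Sq (tprod b) n i j om} - chi_square_tail d t\<bar> <= C2 * ((real n * (1 / b\<^sup>2)\<^sup>2)\<^sup>2 / sqrt n) * chi_square_tail d t"
 proof (rule chi_square_pair_tail[OF U3(2) B K3], goal_cases)
  case (1 C) show thesis by (rule that[OF 1(2) 1(3)])
 qed
 obtain F where F: "good_net d ep F" using good_net_exists[OF e(1) e1(1)] by blast
 define K9 where "K9 = real d * (real (card F) * exp (real d * (2 * B)))"
 have K9: "0 <= K9" by (simp add: K9_def)
 define Q where "Q = 4 * C1 + 5 * C1\<^sup>2"
 have Q: "0 <= Q" using C1 by (simp add: Q_def)
 define C where "C = 1 + 2 * C2 + 3 * K / ep + 2 + Q + 2 * C1 + real d + 2 * K9"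
 have Ke: "0 <= 3 * K / ep" using K e by simp
 have C: "1 <= C" "2 * C2 <= C" "3 * K / ep <= C" "2 + Q <= C" "C2 <= C" "2 * C1 <= C" "real d <= C" "2 * K9 <= C"
  using C1 C2 K9 Q Ke unfolding C_def by linarith+
 show ?thesis
 proof (rule that[OF C(1)])
  fix n p :: nat and b a t L :: real
  assume n: "1 <= n" and b: "1 <= b" and pL: "real p = exp L" and L: "1 <= L" and nb: "real n * (1 / b\<^sup>2)\<^sup>2 = L" and lnn: "ln n <= B * L"
   and CL: "C * (L\<^sup>2 / sqrt n) <= 1" and a: "0 < a" and a1: "real n * (8 / b\<^sup>2 * (m4\<^sup>2 / a ^ 3)) <= B"
   and a2: "real n * (exp (8 / b\<^sup>2 * a) * prob {om : space M. ep / (8 / b\<^sup>2) <= \<bar>X om * X' om\<bar>}) <= B" and a3: "8 / b\<^sup>2 * a <= 8 * ep * L"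
   and t: "(4 - 4 * ep) * L <= t" "t <= 8 * L"
  define z where "z = 1 / b\<^sup>2"
  have z0: "0 < z" using b by (simp add: z_def)
  have n0: "0 < real n" using n by simp
  have nz: "real n * z\<^sup>2 = L" using nb by (simp add: z_def)
  have L0: "0 < L" using L by simp
  define et where "et = L\<^sup>2 / sqrt n"
  have et0: "0 <= et" by (simp add: et_def)
  have Cet: "C * et <= 1" using CL by (simp add: et_def)
  have sL: "sqrt n * z = sqrt L" unfolding nz[symmetric] using z0 by (simp add: real_sqrt_mult)
  have sLL: "sqrt L <= L" using L by (simp add: real_le_lsqrt self_le_power)
  have zet: "z <= et" "L * z <= et"
  proof -
   have "L * (sqrt n * z) <= L * L" unfolding sL using sLL L0 by (intro mult_left_mono) auto
   then show "L * z <= et" unfolding et_def using n0 by (simp add: pos_le_divide_eq power2_eq_square mult_ac)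
   moreover have "1 * z <= L * z" using L z0 by (intro mult_right_mono) auto
   ultimately show "z <= et" by linarith
  qed
  have nz3: "real n * (1 / b\<^sup>2) ^ 3 <= 1"
  proof -
   have "real n * (1 / b\<^sup>2) ^ 3 = L * z" unfolding nz[symmetric] z_def by (simp add: power2_eq_square power3_eq_cube)
   also have "... <= et" by (rule zet)
   also have "... <= C * et" using mult_right_mono[OF C(1) et0] by simp
   finally show ?thesis using Cet by linarith
  qed
  define y where "y = K * (1 / b\<^sup>2)"
  have y0: "0 <= y" using K by (simp add: y_def)
  have y3: "3 * y <= ep"
  proof -
   have "3 * K / ep * z <= C * et" using C zet Ke z0 et0 by (intro mult_mono) auto
   then have "3 * K / ep * z <= 1" using Cet by linarith
   then have "3 * K * z <= ep" using e by (simp add: field_simps)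
   then show ?thesis by (simp add: y_def z_def)
  qed
  have t0: "0 < t"
  proof -
   have "0 < (4 - 4 * ep) * L" using L0 e1 by simp
   then show ?thesis using t by linarith
  qed
  let ?e0 = "exp (- L + 28 * ep * L)" and ?q = "chi_square_tail d t" and ?pi = "prob {om : space M. b <= \<bar>X om\<bar>}"
  let ?lam = "((real p)\<^sup>2 - real p) / 2 * ?q"
  let ?tau = "prob {om : space M. a <= \<bar>X om * X' om\<bar>}"
  let ?e22 = "exp (22 * ep * L)"
  have rr: "\<exists>r. 0 < r & r\<^sup>2 = t * s & r / sqrt n <= 3 / b\<^sup>2 & exp (- (1 - 5 * ep) * r\<^sup>2 / 2) <= exp (- 2 * L + 14 * ep * L) & exp (- (1 - 5 * ep) * r\<^sup>2) <= exp (- 4 * L + 28 * ep * L)"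
   if s: "\<bar>s - 1\<bar> <= 3 * y" for s
  proof -
   have s1: "1 - ep <= s" "s <= 1 + ep" using s y3 by linarith+
   have s0: "0 < s" using s1 e1 by linarith
   have ts0: "0 < t * s" using t0 s0 by simp
   have "t * s <= (8 * L) * (1 + ep)" using t s1 s0 L0 t0 by (intro mult_mono) auto
   also have "... <= 9 * L"
   proof -
    have "8 * (1 + ep) <= 9" using e1 by simp
    from mult_right_mono[OF this, of L] L0 show ?thesis by (simp add: mult_ac)
   qed
   finally have up: "t * s <= 9 * L" .
   have "sqrt (t * s) <= sqrt (9 * L)" using up by (rule real_sqrt_le_mono)
   also have "... = 3 * (sqrt n * z)" unfolding sL by (simp add: real_sqrt_mult)
   finally have r3: "sqrt (t * s) / sqrt n <= 3 / b\<^sup>2" using n0 by (simp add: pos_divide_le_eq z_def mult_ac)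
   have "(4 - 28 * ep) * L <= (1 - 5 * ep) * (t * s)"
   proof -
    have m: "1 - (u + v) <= (1 - u) * (1 - v)" if "0 <= u" "0 <= v" for u v :: real using mult_nonneg_nonneg[OF that] by (simp add: algebra_simps)
    have "1 - (5 * ep + 2 * ep) <= (1 - 5 * ep) * (1 - 2 * ep)" by (rule m) (use e in auto)
    also have "... <= (1 - 5 * ep) * ((1 - ep) * (1 - ep))" using m[of ep ep] e e1 by (intro mult_left_mono) auto
    finally have "(4 * L) * (1 - 7 * ep) <= (4 * L) * ((1 - 5 * ep) * ((1 - ep) * (1 - ep)))" using L0 by (intro mult_left_mono) auto
    also have "... = (1 - 5 * ep) * (((4 - 4 * ep) * L) * (1 - ep))" by (simp add: algebra_simps)
    also have "... <= (1 - 5 * ep) * (t * s)" using t s1 e1 L0 t0 by (intro mult_left_mono mult_mono) auto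
    finally show ?thesis by (simp add: algebra_simps)
   qed
   then have k: "- ((1 - 5 * ep) * (t * s)) <= - 4 * L + 28 * ep * L" by (simp add: left_diff_distrib)
   have sq: "(sqrt (t * s))\<^sup>2 = t * s" using ts0 by simp
   have "- (1 - 5 * ep) * (t * s) / 2 <= - 2 * L + 14 * ep * L" "- (1 - 5 * ep) * (t * s) <= - 4 * L + 28 * ep * L"
    using k by (simp_all only: minus_mult_left[symmetric])
   then show ?thesis using ts0 r3 sq by (intro exI[of _ "sqrt (t * s)"]) simp
  qed
  have p3: "(real p) ^ 3 * exp (- 4 * L + 28 * ep * L) = ?e0" "(real p) ^ 3 * (exp (- 2 * L + 14 * ep * L))\<^sup>2 = ?e0"
   "(real p)\<^sup>2 * exp (- 2 * L + 14 * ep * L) = exp (14 * ep * L)"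
   unfolding pL by (simp_all add: exp_of_nat_mult[symmetric] exp_add[symmetric] power2_eq_square power3_eq_cube algebra_simps)
  have q0: "0 <= ?q" by (simp add: chi_square_tail_def)
  have one: "\<bar>prob {om : space M. t * s * n <= Sq (tprod b) n i j om} - ?q\<bar> <= C2 * et * ?q" if s: "\<bar>s - 1\<bar> <= 3 * y" and ij: "1 <= i" "1 <= j" "i ~= j" for s i j
  proof -
   have w1: "1 <= real n * (1 / b\<^sup>2)\<^sup>2" using L nb by simp
   have w2: "ln n <= B * (real n * (1 / b\<^sup>2)\<^sup>2)" using lnn nb by simp
   have "C2 * et <= C * et" using C(5) et0 by (rule mult_right_mono)
   then have w3: "C2 * ((real n * (1 / b\<^sup>2)\<^sup>2)\<^sup>2 / sqrt n) <= 1" using Cet unfolding nb et_def by linarith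
   have w4: "\<bar>s - 1\<bar> <= (3 * K) * (1 / b\<^sup>2)" using s by (simp add: y_def)
   have w5: "t <= 3\<^sup>2 * (real n * (1 / b\<^sup>2)\<^sup>2)" unfolding nb using t L0 by simp
   from chi[OF b n w1 w2 w3 w4 t0 w5 ij] show ?thesis unfolding nb et_def by simp
  qed
  have h1: "0 <= C2 * et" using C2 et0 by simp
  have h2: "C2 * et <= 1 / 2"
  proof -
   have "2 * C2 * et <= C * et" using C(2) et0 by (rule mult_right_mono)
   then show ?thesis using Cet by linarith
  qed
  have main: "\<bar>prob (no_large p n b (t * s * n)) - exp (- ?lam)\<bar> <= C2 * et + Q * ?e0" if s: "\<bar>s - 1\<bar> <= 3 * y" for s
  proof -
   obtain r where r: "0 < r" "r\<^sup>2 = t * s" "r / sqrt n <= 3 / b\<^sup>2" "exp (- (1 - 5 * ep) * r\<^sup>2 / 2) <= exp (- 2 * L + 14 * ep * L)" "exp (- (1 - 5 * ep) * r\<^sup>2) <= exp (- 4 * L + 28 * ep * L)"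
    using rr[OF s] by blast
   let ?E = "%(i, j). {om : space M. t * s * n <= Sq (tprod b) n i j om}" and ?I = "{(i, j). 1 <= i & i < j & j <= p}"
   define bt1 where "bt1 = C1 * exp (- 2 * L + 14 * ep * L)"
   define bt2 where "bt2 = C1 * exp (- 4 * L + 28 * ep * L)"
   have b1: "prob (?E (i, j)) <= bt1" if "1 <= i" "1 <= j" "i ~= j" for i j
   proof -
    have "prob (?E (i, j)) <= C1 * exp (- (1 - 5 * ep) * r\<^sup>2 / 2)" using t1[OF b n nz3 r(1,3) that] by (simp add: r(2))
    also have "... <= bt1" unfolding bt1_def using C1 r(4) by (intro mult_left_mono) auto
    finally show ?thesis .
   qed
   have b2: "prob (?E (i, j) Int ?E (i, l)) <= bt2" if "1 <= i" "1 <= j" "1 <= l" "i ~= j" "i ~= l" "j ~= l" for i j l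
   proof -
    have "prob (?E (i, j) Int ?E (i, l)) <= C1 * exp (- (1 - 5 * ep) * r\<^sup>2)" using t2[OF b n nz3 r(1,3) that] by (simp add: r(2))
    also have "... <= bt2" unfolding bt2_def using C1 r(5) by (intro mult_left_mono) auto
    finally show ?thesis .
   qed
   have ts: "tprod b x y = tprod b y x" for x y by (simp add: tprod_def mult.commute)
   have bt: "0 <= bt1" "0 <= bt2" using C1 by (auto simp: bt1_def bt2_def)
   define lh where "lh = (\<Sum>a\<in>?I. prob (?E a))"
   have cs: "\<bar>prob (no_large p n b (t * s * n)) - exp (- lh)\<bar> <= real p ^ 3 * (4 * bt2 + 5 * bt1\<^sup>2)"
    unfolding no_large_def lh_def by (rule chen_stein_pairs[OF tprod_measurable ts b1 b2 bt])
   have "real p ^ 3 * (4 * bt2 + 5 * bt1\<^sup>2) = 4 * C1 * (real p ^ 3 * exp (- 4 * L + 28 * ep * L)) + 5 * C1\<^sup>2 * (real p ^ 3 * (exp (- 2 * L + 14 * ep * L))\<^sup>2)"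
    unfolding bt1_def bt2_def power_mult_distrib by (simp only: distrib_left mult_ac)
   also have "... = Q * ?e0" unfolding p3 Q_def by (simp only: distrib_right)
   finally have cs': "\<bar>prob (no_large p n b (t * s * n)) - exp (- lh)\<bar> <= Q * ?e0" using cs by simp
   have each: "\<bar>prob (?E a) - ?q\<bar> <= C2 * et * ?q" if aI: "a : ?I" for a
   proof -
    obtain i j where ij: "a = (i, j)" "1 <= i" "1 <= j" "i ~= j" using aI by auto
    show ?thesis using one[OF s ij(2-4)] unfolding ij(1) by simp
   qed
   have lam: "?lam = (\<Sum>a\<in>?I. ?q)" using card_ordered_pairs[of p] by simp
   have "\<bar>lh - ?lam\<bar> <= (\<Sum>a\<in>?I. C2 * et * ?q)"
   proof -
    have "\<bar>lh - ?lam\<bar> = \<bar>\<Sum>a\<in>?I. prob (?E a) - ?q\<bar>" unfolding lam lh_def by (simp only: sum_subtractf)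
    also have "... <= (\<Sum>a\<in>?I. \<bar>prob (?E a) - ?q\<bar>)" by (rule sum_abs)
    also have "... <= (\<Sum>a\<in>?I. C2 * et * ?q)" by (rule sum_mono) (rule each)
    finally show ?thesis .
   qed
   also have "... = C2 * et * ?lam" unfolding lam by (simp only: sum_distrib_left)
   finally have cl: "\<bar>lh - ?lam\<bar> <= C2 * et * ?lam" .
   have l0: "0 <= ?lam" unfolding lam by (rule sum_nonneg) (rule q0)
   have "\<bar>exp (- lh) - exp (- ?lam)\<bar> <= C2 * et" by (rule exp_minus_close[OF l0 cl h1 h2])
   then show ?thesis using cs' by linarith
  qed
  have s1: "\<bar>(1 + 3 * y) - 1\<bar> <= 3 * y" "\<bar>(1 - 3 * y) - 1\<bar> <= 3 * y" using y0 by auto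
  define gmv where "gmv = 2 * exp (- 3 * L)"
  have g: "prob (bad_norm K b n i) <= gmv" if "1 <= i" for i
  proof -
   have "real n / (b\<^sup>2)\<^sup>2 = L" using nb by (simp add: power_divide)
   then show ?thesis using conc[OF b that, of n] unfolding bad_norm_def gmv_def by simp
  qed
  define u where "u = C1 * (real n * ?pi) * exp (- 2 * L + 14 * ep * L)"
  have u0: "0 <= u" using C1 by (simp add: u_def)
  have u: "prob (big b n i Int {om : space M. t * (1 + 3 * y) * n <= Sq (tprod b) n i j om}) <= u" if ij: "1 <= i" "1 <= j" "i ~= j" for i j
  proof -
   obtain r where r: "0 < r" "r\<^sup>2 = t * (1 + 3 * y)" "r / sqrt n <= 3 / b\<^sup>2" "exp (- (1 - 5 * ep) * r\<^sup>2 / 2) <= exp (- 2 * L + 14 * ep * L)"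
    using rr[OF s1(1)] by blast
   have "prob (big b n i Int {om : space M. t * (1 + 3 * y) * n <= Sq (tprod b) n i j om}) <= C1 * (real n * ?pi) * exp (- (1 - 5 * ep) * r\<^sup>2 / 2)"
    using t3[OF b n nz3 r(1,3) ij] by (simp add: r(2))
   also have "... <= u" unfolding u_def using C1 r(4) by (intro mult_left_mono) auto
   finally show ?thesis .
  qed
  define H where "H = 8 / b\<^sup>2"
  have H0: "0 < H" using b by (simp add: H_def)
  define c where "c = H * (m4\<^sup>2 / a ^ 3) + exp (H * a) * prob {om : space M. ep / H <= \<bar>X om * X' om\<bar>}"
  have c0: "0 <= c" using H0 a by (simp add: c_def)
  have nc: "real n * c <= 2 * B" using a1 a2 unfolding c_def H_def distrib_left by linarith
  define v where "v = real d * real n * (real (card F) * (exp (8 * ep * L) * ?pi * exp (real d * (2 * B))) * exp (- 2 * L + 14 * ep * L))"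
  have v0: "0 <= v" by (simp add: v_def)
  have v: "prob (big b n i Int {om : space M. t * (1 - 3 * y) * n <= Sq (%x y. trunc a (x * y)) n i j om}) <= v" if ij: "1 <= i" "1 <= j" "i ~= j" for i j
  proof -
   obtain r where r: "0 < r" "r\<^sup>2 = t * (1 - 3 * y)" "r / sqrt n <= 3 / b\<^sup>2" "exp (- (1 - 5 * ep) * r\<^sup>2 / 2) <= exp (- 2 * L + 14 * ep * L)"
    using rr[OF s1(2)] by blast
   have rH: "2 * r / sqrt n <= H"
   proof -
    have "2 * (r / sqrt n) <= 2 * (3 / b\<^sup>2)" using r(3) by simp
    also have "... <= 8 / b\<^sup>2" using b by (simp add: divide_right_mono)
    finally show ?thesis by (simp add: H_def)
   qed
   have mg: "(LINT om|M. exp (h * trunc a (Xa m k i om * Xa m k j om))) <= exp ((1 + ep) * h\<^sup>2 / 2 + c)"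
    if h: "\<bar>h\<bar> <= 2 * r / sqrt n" and m: "m : {1..d}" "k : {1..n}" for h m k
   proof -
    have k1: "1 <= k" using m by simp
    have hm: "(%(x, y). exp (h * trunc a (x * y))) : borel_measurable (borel \<Otimes>\<^sub>M borel)" by measurable
    have hH: "\<bar>h\<bar> <= H" using h rH by linarith
    have "(LINT om|M. exp (h * trunc a (Xa m k i om * Xa m k j om))) = (LINT om|M. exp (h * trunc a (X om * X' om)))"
     by (rule pair_integral[OF m(1) k1 ij hm])
    also have "... <= exp ((1 + ep) * h\<^sup>2 / 2 + c)" unfolding c_def by (rule mgf_trunc_prod[OF a e(1) e1(1) hH H0])
    finally show ?thesis .
   qed
   have hf: "h * trunc a (x * y) <= 8 * ep * L" if h: "\<bar>h\<bar> <= 2 * r / sqrt n" and "b <= \<bar>x\<bar>" for h x y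
   proof -
    have "h * trunc a (x * y) <= \<bar>h\<bar> * \<bar>trunc a (x * y)\<bar>" unfolding abs_mult[symmetric] by (rule abs_ge_self)
    also have "... <= H * a" using h rH abs_trunc_le(2)[OF a] H0 by (intro mult_mono) auto
    finally show ?thesis using a3 unfolding H_def by linarith
   qed
   have g0: "0 <= 8 * ep * L" using e L0 by simp
   have fb: "\<bar>trunc a (x * y)\<bar> <= a" for x y by (rule abs_trunc_le(2)[OF a])
   have "prob (big b n i Int {om : space M. r\<^sup>2 * n <= Sq (%x y. trunc a (x * y)) n i j om})
    <= real d * real n * (real (card F) * (exp (8 * ep * L) * ?pi * exp (real n * (real d * c))) * exp (- (1 - 5 * ep) * r\<^sup>2 / 2))"
    by (rule chernoff_big_entry[OF F r(1) n less_imp_le[OF e(1)] ij(1,2) trunc_prod_measurable fb g0 c0 mg hf])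
   also have "... <= v" unfolding v_def
   proof (intro mult_left_mono mult_mono)
    have "real d * (real n * c) <= real d * (2 * B)" using nc by (intro mult_left_mono) auto
    then show "exp (real n * (real d * c)) <= exp (real d * (2 * B))" by (simp add: mult_ac)
    show "exp (- (1 - 5 * ep) * r\<^sup>2 / 2) <= exp (- 2 * L + 14 * ep * L)" by (rule r(4))
   qed auto
   finally show ?thesis unfolding r(2) .
  qed
  have y1: "y < 1" using y3 y0 e1 by linarith
  note sw = truncation_sandwich[where b=b and K=K and t=t and a=a and gmv=gmv and u=u and v=v and n=n and p=p, folded y_def, OF n y0 y1 t0 g u u0 v v0]
  have pg: "real p * gmv <= 2 * ?e0"
  proof -
   have "real p * gmv = 2 * exp (- 2 * L)" unfolding pL gmv_def by (simp flip: exp_add)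
   also have "... <= 2 * ?e0"
   proof -
    have "0 <= 28 * ep * L" using e L0 by simp
    then have "- 2 * L <= - L + 28 * ep * L" using L0 by linarith
    then show ?thesis by simp
   qed
   finally show ?thesis .
  qed
  have e14: "exp (14 * ep * L) <= ?e22" using e L0 by simp
  define W where "W = real n * ?pi * ?e22"
  have W0: "0 <= W" by (simp add: W_def)
  have pu: "(real p)\<^sup>2 * (u + u) <= 2 * C1 * W"
  proof -
   have "(real p)\<^sup>2 * (u + u) = 2 * C1 * (real n * ?pi) * ((real p)\<^sup>2 * exp (- 2 * L + 14 * ep * L))" by (simp add: u_def mult_ac)
   also have "... <= 2 * C1 * (real n * ?pi) * ?e22" unfolding p3 using C1 e14 by (intro mult_left_mono) auto
   finally show ?thesis by (simp add: W_def mult_ac)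
  qed
  have pv: "(real p)\<^sup>2 * (v + v) = 2 * K9 * W"
  proof -
   have "(real p)\<^sup>2 * (v + v) = 2 * K9 * (real n * ?pi * (exp (8 * ep * L) * ((real p)\<^sup>2 * exp (- 2 * L + 14 * ep * L))))" by (simp add: v_def K9_def mult_ac)
   also have "exp (8 * ep * L) * ((real p)\<^sup>2 * exp (- 2 * L + 14 * ep * L)) = ?e22" unfolding p3 by (simp flip: exp_add)
   finally show ?thesis by (simp add: W_def)
  qed
  define R where "R = (real p)\<^sup>2 * (real n * ?tau)"
  have R0: "0 <= R" by (simp add: R_def)
  have pt: "(real p)\<^sup>2 * (real d * real n * ?tau + (v + v)) = real d * R + 2 * K9 * W"
   unfolding distrib_left[of _ _ "v + v"] pv by (simp add: R_def mult_ac)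
  have c1: "(2 + Q) * ?e0 <= C * ?e0" using C by (intro mult_right_mono) auto
  have c2: "C2 * et <= C * et" using C et0 by (intro mult_right_mono) auto
  have c3: "real d * R <= C * R" "0 <= C * R" using C R0 by (auto intro: mult_right_mono)
  have c4: "2 * K9 * W <= C * W" "2 * C1 * W <= C * W" using C W0 by (auto intro: mult_right_mono)
  have d0: "(2 + Q) * ?e0 = 2 * ?e0 + Q * ?e0" by (simp only: distrib_right)
  have tot: "C * (?e0 + et + R + W) = C * ?e0 + C * et + C * R + C * W" by (simp only: distrib_left)
  have lo1: "prob (no_exceed p n t) - exp (- ?lam) <= C * (?e0 + et + R + W)"
   using sw(1) main[OF s1(1)] pg pu c1 c2 c3 c4 unfolding tot d0 by linarith
  have lo2: "exp (- ?lam) - prob (no_exceed p n t) <= C * (?e0 + et + R + W)"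
   using sw(2) main[OF s1(2)] pg c1 c2 c3 c4 unfolding tot d0 pt by linarith
  have "?q <= C * exp (- (1 - 5 * ep) * t / 2)"
  proof -
   have s0: "\<bar>1 - 1\<bar> <= 3 * y" using y0 by simp
   obtain r where r: "0 < r" "r\<^sup>2 = t * 1" "r / sqrt n <= 3 / b\<^sup>2" using rr[OF s0] by blast
   have "prob {om : space M. t * 1 * n <= Sq (tprod b) n 1 2 om} <= C1 * exp (- (1 - 5 * ep) * t / 2)"
    using t1[OF b n nz3 r(1,3), of 1 2] by (simp add: r(2))
   moreover have "\<bar>prob {om : space M. t * 1 * n <= Sq (tprod b) n 1 2 om} - ?q\<bar> <= C2 * et * ?q" by (rule one[OF s0]) auto
   moreover have "C2 * et * ?q <= 1 / 2 * ?q" using h2 q0 by (rule mult_right_mono)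
   ultimately have "?q <= 2 * (C1 * exp (- (1 - 5 * ep) * t / 2))" by linarith
   also have "... = (2 * C1) * exp (- (1 - 5 * ep) * t / 2)" by simp
   also have "... <= C * exp (- (1 - 5 * ep) * t / 2)" using C by (intro mult_right_mono) auto
   finally show ?thesis .
  qed
  moreover have "\<bar>prob (no_exceed p n t) - exp (- ?lam)\<bar> <= C * (?e0 + L\<^sup>2 / sqrt n + (real p)\<^sup>2 * (real n * ?tau) + real n * ?pi * ?e22)"
   using lo1 lo2 unfolding R_def[symmetric] W_def[symmetric] et_def[symmetric] by linarith
  ultimately show "\<bar>prob (no_exceed p n t) - exp (- ?lam)\<bar> <= C * (?e0 + L\<^sup>2 / sqrt n + (real p)\<^sup>2 * (real n * ?tau) + real n * ?pi * ?e22)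
   & ?q <= C * exp (- (1 - 5 * ep) * t / 2)" by blast
 qed
qed

end

lemma exp_minus_ge_one_minus: "1 - x <= exp (- x)" for x :: real
 using exp_ge_add_one_self[of "- x"] by simp

context iid_array
begin

lemma L_sq_event:
 assumes p: "2 <= p" and n: "1 <= n"
 shows "{om : space M. (real d)^2 * real n * L_sq d Xa p n om - c <= y} = no_exceed p n (c + y)"
proof -
 let ?I = "{(i, j). 1 <= i & i < j & j <= p}"
 define D where "D = (real d)\<^sup>2 * real n"
 have D: "0 < D" using d1 n by (simp add: D_def)
 define T where "T om a = S_sq d Xa n (fst a) (snd a) om / (A_ni d Xa n (fst a) om * A_ni d Xa n (snd a) om)" for om a
 have fin: "finite ?I" by (rule finite_subset[of _ "{..p} \<times> {..p}"]) auto
 have "(1, 2) : ?I" using p by simp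
 then have ne: "?I ~= {}" by blast
 have "D * L_sq d Xa p n om - c <= y \<longleftrightarrow> (\<forall>a\<in>?I. D * S_sq d Xa n (fst a) (snd a) om / (A_ni d Xa n (fst a) om * A_ni d Xa n (snd a) om) <= c + y)" for om
 proof -
  have "L_sq d Xa p n om = Max (T om ` ?I)" unfolding L_sq_def T_def by (rule arg_cong[where f=Max]) force
  then have "L_sq d Xa p n om <= (c + y) / D \<longleftrightarrow> (\<forall>a\<in>?I. T om a <= (c + y) / D)" using fin ne by (simp add: Max_le_iff)
  moreover have "D * L_sq d Xa p n om - c <= y \<longleftrightarrow> L_sq d Xa p n om <= (c + y) / D" using D by (simp add: pos_le_divide_eq mult.commute) linarith
  moreover have "T om a <= (c + y) / D \<longleftrightarrow> D * S_sq d Xa n (fst a) (snd a) om / (A_ni d Xa n (fst a) om * A_ni d Xa n (snd a) om) <= c + y" for a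
   using D by (simp add: T_def pos_le_divide_eq mult.commute)
  ultimately show ?thesis by simp
 qed
 then show ?thesis unfolding no_exceed_def D_def by simp
qed

lemma no_exceed_mono: "s <= t ==> prob (no_exceed p n s) <= prob (no_exceed p n t)"
 by (rule finite_measure_mono[OF _ no_exceed_event]) (fastforce simp: no_exceed_def)

lemma uniform_bound:
 fixes ep B :: real
 assumes e: "0 < ep" "ep <= 1 / 10 ^ 4" and B: "0 <= B"
 obtains C where "1 <= C"
  "!!n p b a t L. 1 <= n ==> 1 <= b ==> real p = exp L ==> 1 <= L ==> real n * (1 / b\<^sup>2)\<^sup>2 = L ==> ln n <= B * L ==>
   C * (L\<^sup>2 / sqrt n) <= 1 ==> 0 < a ==> real n * (8 / b\<^sup>2 * (m4\<^sup>2 / a ^ 3)) <= B ==>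
   real n * (exp (8 / b\<^sup>2 * a) * prob {om : space M. ep / (8 / b\<^sup>2) <= \<bar>X om * X' om\<bar>}) <= B ==> 8 / b\<^sup>2 * a <= 8 * ep * L ==>
   L <= exp (2 * ep * L) * (exp (- 3 / 2) / (2 * sqrt (2 * pi))) / (1 + 2 * sqrt L) ==>
   \<bar>prob (no_exceed p n t) - exp (- (((real p)\<^sup>2 - real p) / 2 * chi_square_tail d t))\<bar>
   <= C * (exp (- L + 28 * ep * L) + L\<^sup>2 / sqrt n + (real p)\<^sup>2 * (real n * prob {om : space M. a <= \<bar>X om * X' om\<bar>})
     + real n * prob {om : space M. b <= \<bar>X om\<bar>} * exp (22 * ep * L))"
proof -
 have e1: "ep <= 1 / 100" using e by auto
 obtain C where C: "1 <= C" and win: "!!n p b a t L. 1 <= n ==> 1 <= b ==> real p = exp L ==> 1 <= L ==> real n * (1 / b\<^sup>2)\<^sup>2 = L ==> ln n <= B * L ==>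
   C * (L\<^sup>2 / sqrt n) <= 1 ==> 0 < a ==> real n * (8 / b\<^sup>2 * (m4\<^sup>2 / a ^ 3)) <= B ==>
   real n * (exp (8 / b\<^sup>2 * a) * prob {om : space M. ep / (8 / b\<^sup>2) <= \<bar>X om * X' om\<bar>}) <= B ==> 8 / b\<^sup>2 * a <= 8 * ep * L ==>
   (4 - 4 * ep) * L <= t ==> t <= 8 * L ==>
   \<bar>prob (no_exceed p n t) - exp (- (((real p)\<^sup>2 - real p) / 2 * chi_square_tail d t))\<bar>
   <= C * (exp (- L + 28 * ep * L) + L\<^sup>2 / sqrt n + (real p)\<^sup>2 * (real n * prob {om : space M. a <= \<bar>X om * X' om\<bar>})
     + real n * prob {om : space M. b <= \<bar>X om\<bar>} * exp (22 * ep * L))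
   & chi_square_tail d t <= C * exp (- (1 - 5 * ep) * t / 2)"
 proof (rule window_bound[OF e B], goal_cases)
  case (1 C) show thesis by (rule that[OF 1(2) 1(3)])
 qed
 have C2: "1 <= 2 * C" using C by simp
 show ?thesis
 proof (rule that[OF C2])
  fix n p :: nat and b a t L :: real
  assume n: "1 <= n" and b: "1 <= b" and pL: "real p = exp L" and L: "1 <= L" and nb: "real n * (1 / b\<^sup>2)\<^sup>2 = L" and lnn: "ln n <= B * L"
   and CL: "2 * C * (L\<^sup>2 / sqrt n) <= 1" and a: "0 < a" and a1: "real n * (8 / b\<^sup>2 * (m4\<^sup>2 / a ^ 3)) <= B"
   and a2: "real n * (exp (8 / b\<^sup>2 * a) * prob {om : space M. ep / (8 / b\<^sup>2) <= \<bar>X om * X' om\<bar>}) <= B" and a3: "8 / b\<^sup>2 * a <= 8 * ep * L"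
   and Lg: "L <= exp (2 * ep * L) * (exp (- 3 / 2) / (2 * sqrt (2 * pi))) / (1 + 2 * sqrt L)"
  let ?e0 = "exp (- L + 28 * ep * L)"
  define rest where "rest = L\<^sup>2 / sqrt n + (real p)\<^sup>2 * (real n * prob {om : space M. a <= \<bar>X om * X' om\<bar>})
     + real n * prob {om : space M. b <= \<bar>X om\<bar>} * exp (22 * ep * L)"
  have rest0: "0 <= rest" unfolding rest_def by (intro add_nonneg_nonneg) auto
  define err where "err = C * (?e0 + rest)"
  have err0: "0 <= err" using C rest0 by (simp add: err_def)
  define lam where "lam t = ((real p)\<^sup>2 - real p) / 2 * chi_square_tail d t" for t
  have L0: "0 < L" using L by simp
  have CL': "C * (L\<^sup>2 / sqrt n) <= 1"
  proof -
   have "0 <= C * (L\<^sup>2 / sqrt n)" using C by simp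
   then show ?thesis using CL by linarith
  qed
  have p2: "2 <= real p" using exp_ge_add_one_self[of L] L unfolding pL by linarith
  have pp: "(real p)\<^sup>2 / 4 <= ((real p)\<^sup>2 - real p) / 2" "0 <= ((real p)\<^sup>2 - real p) / 2" "((real p)\<^sup>2 - real p) / 2 <= (real p)\<^sup>2"
  proof -
   have "2 * real p <= real p * real p" using p2 by (intro mult_right_mono) auto
   then have q: "2 * real p <= (real p)\<^sup>2" by (simp only: power2_eq_square)
   have gen: "A / 4 <= (A - P) / 2 & 0 <= (A - P) / 2 & (A - P) / 2 <= A" if "2 * P <= A" "0 <= P" for A P :: real
    using that by (simp add: field_simps)
   show "(real p)\<^sup>2 / 4 <= ((real p)\<^sup>2 - real p) / 2" "0 <= ((real p)\<^sup>2 - real p) / 2" "((real p)\<^sup>2 - real p) / 2 <= (real p)\<^sup>2"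
    using gen[OF q of_nat_0_le_iff] by blast+
  qed
  have lam0: "0 <= lam t" for t unfolding lam_def using pp by (intro mult_nonneg_nonneg) (auto simp: chi_square_tail_def)
  have lam_anti: "lam t <= lam s" if "s <= t" for s t unfolding lam_def using pp chi_square_tail_antimono[OF that] by (intro mult_left_mono) auto
  have w: "\<bar>prob (no_exceed p n t) - exp (- lam t)\<bar> <= err" "chi_square_tail d t <= C * exp (- (1 - 5 * ep) * t / 2)"
   if "(4 - 4 * ep) * L <= t" "t <= 8 * L" for t
   using win[OF n b pL L nb lnn CL' a a1 a2 a3 that] unfolding lam_def err_def rest_def by (simp_all add: add.assoc)
  let ?t0 = "(4 - 4 * ep) * L" and ?t1 = "8 * L"
  have t01: "?t0 <= ?t1" "0 < ?t0" "?t0 <= 4 * L" using L0 e e1 by (auto intro: mult_right_mono)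
  have lo: "exp (- lam ?t0) <= ?e0"
  proof -
   define u where "u = sqrt ?t0"
   have u0: "0 <= u" unfolding u_def by (rule real_sqrt_ge_zero[OF less_imp_le[OF t01(2)]])
   have usq: "u\<^sup>2 = ?t0" unfolding u_def by (rule real_sqrt_pow2[OF less_imp_le[OF t01(2)]])
   have "u <= sqrt (4 * L)" unfolding u_def by (rule real_sqrt_le_mono[OF t01(3)])
   also have "sqrt (4 * L) = 2 * sqrt L" by (simp add: real_sqrt_mult)
   finally have u2: "u <= 2 * sqrt L" .
   have sL: "0 <= sqrt L" using L0 by simp
   have V: "0 < 1 + u" "0 < 1 + 2 * sqrt L" using u0 sL by linarith+
   have dens: "std_normal_density u = exp (- ?t0 / 2) / sqrt (2 * pi)" unfolding std_normal_density_def usq by simp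
   have gen: "A * E * (F / (2 * S)) / W = A / 4 * (2 * (E / S * F / W))" if "S ~= 0" "W ~= 0" for A E F S W :: real
    using that by (simp add: field_simps)
   have "L <= exp (2 * ep * L) * (exp (- 3 / 2) / (2 * sqrt (2 * pi))) / (1 + 2 * sqrt L)" by (rule Lg)
   also have "... <= exp (2 * ep * L) * (exp (- 3 / 2) / (2 * sqrt (2 * pi))) / (1 + u)"
   proof (rule divide_left_mono)
    show "1 + u <= 1 + 2 * sqrt L" using u2 by simp
    show "0 < (1 + 2 * sqrt L) * (1 + u)" using V by (intro mult_pos_pos)
   qed simp
   also have "exp (2 * ep * L) = (real p)\<^sup>2 * exp (- ?t0 / 2)"
   proof -
    have "(exp L)\<^sup>2 * exp (- ?t0 / 2) = exp (L + L + - ?t0 / 2)" by (simp only: power2_eq_square exp_add)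
    also have "L + L + - ?t0 / 2 = 2 * ep * L" by (simp add: field_simps)
    finally show ?thesis unfolding pL by simp
   qed
   also have "(real p)\<^sup>2 * exp (- ?t0 / 2) * (exp (- 3 / 2) / (2 * sqrt (2 * pi))) / (1 + u) = (real p)\<^sup>2 / 4 * (2 * (std_normal_density u * exp (- 3 / 2) / (1 + u)))"
    unfolding dens by (rule gen) (use V in auto)
   also have "... <= (real p)\<^sup>2 / 4 * (2 * Phibar u)" using Phibar_lower[OF u0] by (intro mult_left_mono) auto
   also have "... <= ((real p)\<^sup>2 - real p) / 2 * chi_square_tail d ?t0"
   proof (rule mult_mono)
    show "2 * Phibar u <= chi_square_tail d ?t0" unfolding u_def by (rule chi_square_tail_lower[OF d1 t01(2)])
    show "0 <= 2 * Phibar u" using Phibar_pos[OF u0] by simp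
   qed (rule pp(1), rule pp(2))
   finally have "L <= lam ?t0" unfolding lam_def .
   moreover have "0 <= 28 * ep * L" using e L0 by simp
   ultimately have "- lam ?t0 <= - L + 28 * ep * L" by linarith
   then show ?thesis by simp
  qed
  have hi: "lam ?t1 <= C * ?e0"
  proof -
   have "lam ?t1 <= (real p)\<^sup>2 * (C * exp (- (1 - 5 * ep) * (8 * L) / 2))" unfolding lam_def
    by (rule mult_mono[OF pp(3) w(2)[OF t01(1) order_refl]]) (simp_all add: chi_square_tail_def)
   also have "... = C * ((real p)\<^sup>2 * exp (- (1 - 5 * ep) * (8 * L) / 2))" by (rule mult.left_commute)
   also have "(real p)\<^sup>2 * exp (- (1 - 5 * ep) * (8 * L) / 2) = exp (L + L + - (1 - 5 * ep) * (8 * L) / 2)" unfolding pL by (simp only: power2_eq_square exp_add)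
   also have "L + L + - (1 - 5 * ep) * (8 * L) / 2 = - 2 * L + 20 * ep * L" by (simp add: field_simps)
   also have "C * exp (- 2 * L + 20 * ep * L) <= C * ?e0"
   proof -
    have "0 <= 8 * ep * L" using e L0 by simp
    then have "- 2 * L + 20 * ep * L <= - L + 28 * ep * L" using L0 by linarith
    then show ?thesis using C by (intro mult_left_mono) auto
   qed
   finally show ?thesis .
  qed
  have Ce: "?e0 <= C * ?e0" using mult_right_mono[OF C, of ?e0] by simp
  have Cr: "C * ?e0 <= err" unfolding err_def distrib_left using C rest0 by simp
  have "\<bar>prob (no_exceed p n t) - exp (- lam t)\<bar> <= 2 * err"
  proof -
   consider "t < ?t0" | "?t0 <= t" "t <= ?t1" | "?t1 < t" by linarith
   then show ?thesis
   proof cases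
    case 1
    have "prob (no_exceed p n t) <= prob (no_exceed p n ?t0)" using 1 by (intro no_exceed_mono) auto
    moreover have "\<bar>prob (no_exceed p n ?t0) - exp (- lam ?t0)\<bar> <= err" by (rule w(1)[OF order_refl t01(1)])
    moreover have "exp (- lam t) <= exp (- lam ?t0)" using lam_anti[of t ?t0] 1 by simp
    moreover have "0 <= exp (- lam t)" "0 <= prob (no_exceed p n t)" by auto
    ultimately show ?thesis using lo Ce Cr by linarith
   next
    case 2 then show ?thesis using w(1)[of t] err0 by linarith
   next
    case 3
    have "prob (no_exceed p n ?t1) <= prob (no_exceed p n t)" using 3 by (intro no_exceed_mono) auto
    moreover have "\<bar>prob (no_exceed p n ?t1) - exp (- lam ?t1)\<bar> <= err" by (rule w(1)[OF t01(1) order_refl])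
    moreover have "exp (- lam ?t1) <= exp (- lam t)" using lam_anti[of ?t1 t] 3 by simp
    moreover have "exp (- lam t) <= 1" "prob (no_exceed p n t) <= 1" using lam0[of t] by auto
    moreover have "1 - lam ?t1 <= exp (- lam ?t1)" by (rule exp_minus_ge_one_minus)
    ultimately show ?thesis using hi Cr by linarith
   qed
  qed
  then show "\<bar>prob (no_exceed p n t) - exp (- (((real p)\<^sup>2 - real p) / 2 * chi_square_tail d t))\<bar>
   <= 2 * C * (exp (- L + 28 * ep * L) + L\<^sup>2 / sqrt n + (real p)\<^sup>2 * (real n * prob {om : space M. a <= \<bar>X om * X' om\<bar>})
     + real n * prob {om : space M. b <= \<bar>X om\<bar>} * exp (22 * ep * L))"
   unfolding lam_def err_def rest_def by (simp add: add.assoc)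
 qed
qed

end

theorem theorem3p2:
  fixes M :: "'a measure"
    and d :: nat
    and X X' :: "'a \<Rightarrow> real"
    and Xa :: "nat \<Rightarrow> nat \<Rightarrow> nat \<Rightarrow> 'a \<Rightarrow> real"
    and \<alpha> c1 c2 :: real
    and p :: "nat \<Rightarrow> nat"
  assumes P: "prob_space M"
    and d: "d \<ge> 1"
    and indep: "prob_space.indep_vars M (\<lambda>_. borel)
        (\<lambda>t. case t of None \<Rightarrow> X | Some (m, k, i) \<Rightarrow> Xa m k i)
        (insert None (Some ` ({1..d} \<times> {1..} \<times> {1..})))"
    and ident: "\<And>m k i. m \<in> {1..d} \<Longrightarrow> k \<ge> 1 \<Longrightarrow> i \<ge> 1 \<Longrightarrow>
        distr M borel (Xa m k i) = distr M borel X"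
    and intX: "integrable M X" and meanX: "(\<integral>\<omega>. X \<omega> \<partial>M) = 0"
    and int2: "integrable M (\<lambda>\<omega>. (X \<omega>)^2)" and var: "(\<integral>\<omega>. (X \<omega>)^2 \<partial>M) = 1"
    and int4: "integrable M (\<lambda>\<omega>. (X \<omega>)^4)"
    and copy_indep: "prob_space.indep_var M borel X borel X'"
    and copy_distr: "distr M borel X' = distr M borel X"
    and pos: "\<alpha> > 0" "c1 > 0" "c2 > 0"
    and tail: "\<exists>B. \<forall>x::real. x > 0 \<longrightarrow>
        x powr (1 + 2 * \<alpha>) *
          measure M {\<omega> \<in> space M. \<bar>X \<omega> * X' \<omega>\<bar> \<ge> sqrt (x * logc x)} \<le> B"
    and p_bounds: "\<And>n. n \<ge> 1 \<Longrightarrow>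
        c1 * real n powr \<alpha> \<le> real (p n) \<and> real (p n) \<le> c2 * real n powr \<alpha>"
  shows "\<forall>\<epsilon>::real. 0 < \<epsilon> \<and> \<epsilon> \<le> 1 / 10^4 \<longrightarrow>
    (\<exists>C::real. \<forall>n::nat. n \<ge> 1 \<longrightarrow> (\<forall>y::real.
       \<bar>measure M {\<omega> \<in> space M.
            (real d)^2 * real n * L_sq d Xa (p n) n \<omega> - alpha_p d (p n) \<le> y}
        - exp (- ((real (p n))^2 - real (p n)) / 2 * chi_square_tail d (alpha_p d (p n) + y))\<bar>
       \<le> C * real (p n) powr (-1 + 20 * sqrt \<epsilon>)
          + C * (logc (real n)) powr (5/2) / sqrt (real n)
          + C * real n powr (1 + 2 * \<alpha>) *
              measure M {\<omega> \<in> space M. \<bar>X \<omega> * X' \<omega>\<bar> \<ge>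
                 real d powr (-1/2) * \<epsilon> * sqrt (real n * logc (real (p n)))}
          + C * real n * real (p n) powr (20 * sqrt \<epsilon>) *
              measure M {\<omega> \<in> space M. \<bar>X \<omega>\<bar> \<ge>
                 real n powr (1/4) / (logc (real (p n))) powr (1/4)}))"
proof (intro allI impI)
 fix \<epsilon> :: real assume "0 < \<epsilon> \<and> \<epsilon> <= 1 / 10 ^ 4"
 then have e: "0 < \<epsilon>" "\<epsilon> <= 1 / 10 ^ 4" by auto
 have e1: "\<epsilon> <= 1 / 100" using e by simp
 interpret iid_array M d X X' Xa
  by (intro iid_array.intro iid_array_axioms.intro P) (fact d indep ident intX meanX int2 var int4 copy_indep copy_distr)+
 obtain B0 where B0: "\<And>x::real. 0 < x ==> x powr (1 + 2 * \<alpha>) * prob {\<omega> \<in> space M. \<bar>X \<omega> * X' \<omega>\<bar> \<ge> sqrt (x * logc x)} <= B0"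
  using tail by blast
 have B00: "0 <= B0"
 proof -
  have "0 <= (1::real) powr (1 + 2 * \<alpha>) * prob {\<omega> \<in> space M. \<bar>X \<omega> * X' \<omega>\<bar> \<ge> sqrt (1 * logc 1)}" by simp
  also have "... <= B0" by (rule B0) simp
  finally show ?thesis .
 qed
 define c where "c = real d powr (-1/2) * \<epsilon>"
 have dr: "1 <= real d" using d by simp
 have c0: "0 < c" using dr e by (simp add: c_def)
 have ce: "c <= \<epsilon>"
 proof -
  have "real d powr (-1/2) <= real d powr 0" using dr by (intro powr_mono) auto
  then have "real d powr (-1/2) * \<epsilon> <= 1 * \<epsilon>" using dr e by (intro mult_right_mono) auto
  then show ?thesis by (simp add: c_def)
 qed
 define B where "B = 2 / \<alpha> + 8 * m4\<^sup>2 / c ^ 3 + B0"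
 have Bc: "0 <= B" "2 / \<alpha> <= B" "8 * m4\<^sup>2 / c ^ 3 <= B" "B0 <= B"
 proof -
  have "0 <= 2 / \<alpha>" "0 <= 8 * m4\<^sup>2 / c ^ 3" using pos c0 by auto
  then show "0 <= B" "2 / \<alpha> <= B" "8 * m4\<^sup>2 / c ^ 3 <= B" "B0 <= B" using B00 unfolding B_def by linarith+
 qed
 obtain C where C: "1 <= C" and unif: "\<And>n p b a t L. 1 <= n ==> 1 <= b ==> real p = exp L ==> 1 <= L ==> real n * (1 / b\<^sup>2)\<^sup>2 = L ==> ln n <= B * L ==>
   C * (L\<^sup>2 / sqrt n) <= 1 ==> 0 < a ==> real n * (8 / b\<^sup>2 * (m4\<^sup>2 / a ^ 3)) <= B ==>
   real n * (exp (8 / b\<^sup>2 * a) * prob {\<omega> \<in> space M. \<epsilon> / (8 / b\<^sup>2) <= \<bar>X \<omega> * X' \<omega>\<bar>}) <= B ==> 8 / b\<^sup>2 * a <= 8 * \<epsilon> * L ==>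
   L <= exp (2 * \<epsilon> * L) * (exp (- 3 / 2) / (2 * sqrt (2 * pi))) / (1 + 2 * sqrt L) ==>
   \<bar>prob (no_exceed p n t) - exp (- (((real p)\<^sup>2 - real p) / 2 * chi_square_tail d t))\<bar>
   <= C * (exp (- L + 28 * \<epsilon> * L) + L\<^sup>2 / sqrt n + (real p)\<^sup>2 * (real n * prob {\<omega> \<in> space M. a <= \<bar>X \<omega> * X' \<omega>\<bar>})
     + real n * prob {\<omega> \<in> space M. b <= \<bar>X \<omega>\<bar>} * exp (22 * \<epsilon> * L))"
 proof (rule uniform_bound[OF e Bc(1)], goal_cases)
  case (1 C) show thesis by (rule that[OF 1(2) 1(3)])
 qed
 define \<theta> where "\<theta> = (1 + \<alpha>) / (1 + 2 * \<alpha>)"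
 have \<theta>: "0 < \<theta>" "\<theta> < 1" "\<theta> * (1 + 2 * \<alpha>) = 1 + \<alpha>" using pos by (auto simp: \<theta>_def field_simps)
 define \<kappa> where "\<kappa> = exp (- 3 / 2) / (2 * sqrt (2 * pi))"
 have \<kappa>: "0 < \<kappa>" by (simp add: \<kappa>_def)
 have "eventually (\<lambda>L::real. L <= exp (2 * \<epsilon> * L) * \<kappa> / (1 + 2 * sqrt L)) at_top" using e(1) \<kappa> by real_asymp
 then obtain L1 where L1: "\<And>L. L1 <= L ==> L <= exp (2 * \<epsilon> * L) * \<kappa> / (1 + 2 * sqrt L)" unfolding eventually_at_top_linorder by blast
 have "eventually (\<lambda>n::nat. 3 <= c1 * real n powr \<alpha>) sequentially" using pos by real_asymp
 moreover have "eventually (\<lambda>n::nat. - ln c1 <= \<alpha> / 2 * ln (real n)) sequentially" using pos by real_asymp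
 moreover have "eventually (\<lambda>n::nat. ln c2 <= \<alpha> * ln (real n)) sequentially" using pos by real_asymp
 moreover have "eventually (\<lambda>n::nat. 2 * \<alpha> * ln (real n) <= real n) sequentially" using pos by real_asymp
 moreover have "eventually (\<lambda>n::nat. C * ((2 * \<alpha> * ln (real n))\<^sup>2 / sqrt (real n)) <= 1) sequentially" using pos C by real_asymp
 moreover have "eventually (\<lambda>n::nat. 64 * (2 * \<alpha> * ln (real n)) * (real n powr \<theta> * ln (real n)) <= \<epsilon>\<^sup>2 * real n) sequentially" using pos e(1) \<theta>(1,2) by real_asymp
 moreover have "eventually (\<lambda>n::nat. L1 <= \<alpha> / 2 * ln (real n)) sequentially" using pos by real_asymp
 moreover have "eventually (\<lambda>n::nat. 3 <= real n) sequentially" by real_asymp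
 ultimately have "eventually (\<lambda>n::nat. 3 <= c1 * real n powr \<alpha> \<and> - ln c1 <= \<alpha> / 2 * ln (real n) \<and> ln c2 <= \<alpha> * ln (real n) \<and> 2 * \<alpha> * ln (real n) <= real n \<and>
   C * ((2 * \<alpha> * ln (real n))\<^sup>2 / sqrt (real n)) <= 1 \<and> 64 * (2 * \<alpha> * ln (real n)) * (real n powr \<theta> * ln (real n)) <= \<epsilon>\<^sup>2 * real n \<and>
   L1 <= \<alpha> / 2 * ln (real n) \<and> 3 <= real n) sequentially"
  by (intro eventually_conj)
 then obtain N0 where N0: "\<And>n. N0 <= n ==> 3 <= c1 * real n powr \<alpha> \<and> - ln c1 <= \<alpha> / 2 * ln (real n) \<and> ln c2 <= \<alpha> * ln (real n) \<and> 2 * \<alpha> * ln (real n) <= real n \<and>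
   C * ((2 * \<alpha> * ln (real n))\<^sup>2 / sqrt (real n)) <= 1 \<and> 64 * (2 * \<alpha> * ln (real n)) * (real n powr \<theta> * ln (real n)) <= \<epsilon>\<^sup>2 * real n \<and>
   L1 <= \<alpha> / 2 * ln (real n) \<and> 3 <= real n"
  unfolding eventually_sequentially by blast
 define D where "D = C * (1 + 4 * \<alpha>\<^sup>2 + c2\<^sup>2) + sqrt (real N0)"
 have D: "C <= D" "C * (4 * \<alpha>\<^sup>2) <= D" "C * c2\<^sup>2 <= D" "sqrt (real N0) <= D" "0 <= D"
 proof -
  have "0 <= C" "0 <= C * (4 * \<alpha>\<^sup>2)" "0 <= C * c2\<^sup>2" "0 <= sqrt (real N0)" using C by auto
  then show "C <= D" "C * (4 * \<alpha>\<^sup>2) <= D" "C * c2\<^sup>2 <= D" "sqrt (real N0) <= D" "0 <= D" unfolding D_def distrib_left by linarith+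
 qed
 have logc1: "1 <= logc x" for x unfolding logc_def by (subst ln_ge_iff) (auto simp: less_max_iff_disj)
 show "\<exists>C::real. \<forall>n::nat. n \<ge> 1 \<longrightarrow> (\<forall>y::real.
   \<bar>measure M {\<omega> \<in> space M.
      (real d)^2 * real n * L_sq d Xa (p n) n \<omega> - alpha_p d (p n) <= y}
    - exp (- ((real (p n))^2 - real (p n)) / 2 * chi_square_tail d (alpha_p d (p n) + y))\<bar>
   <= C * real (p n) powr (-1 + 20 * sqrt \<epsilon>)
     + C * (logc (real n)) powr (5/2) / sqrt (real n)
     + C * real n powr (1 + 2 * \<alpha>) *
       measure M {\<omega> \<in> space M. \<bar>X \<omega> * X' \<omega>\<bar> \<ge>
        real d powr (-1/2) * \<epsilon> * sqrt (real n * logc (real (p n)))}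
     + C * real n * real (p n) powr (20 * sqrt \<epsilon>) *
       measure M {\<omega> \<in> space M. \<bar>X \<omega>\<bar> \<ge>
        real n powr (1/4) / (logc (real (p n))) powr (1/4)})"
 proof (rule exI[of _ D], intro allI impI)
  fix n :: nat and y :: real assume n: "1 <= n"
  define q where "q = p n"
  define L where "L = logc (real q)"
  define t where "t = alpha_p d q + y"
  let ?lhs = "\<bar>prob {\<omega> \<in> space M. (real d)^2 * real n * L_sq d Xa q n \<omega> - alpha_p d q <= y} - exp (- ((real q)^2 - real q) / 2 * chi_square_tail d t)\<bar>"
  define a where "a = c * sqrt (real n * L)"
  define b where "b = real n powr (1/4) / L powr (1/4)"
  define \<tau> where "\<tau> = prob {\<omega> \<in> space M. a <= \<bar>X \<omega> * X' \<omega>\<bar>}"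
  define \<pi> where "\<pi> = prob {\<omega> \<in> space M. b <= \<bar>X \<omega>\<bar>}"
  have \<tau>0: "0 <= \<tau>" and \<pi>0: "0 <= \<pi>" by (auto simp: \<tau>_def \<pi>_def)
  have ex: "- ((real q)^2 - real q) / 2 * chi_square_tail d t = - (((real q)\<^sup>2 - real q) / 2 * chi_square_tail d t)"
   by (simp only: minus_divide_left[symmetric] mult_minus_left)
  have n0: "0 < real n" using n by simp
  have "?lhs <= D * real q powr (-1 + 20 * sqrt \<epsilon>) + D * (logc (real n)) powr (5/2) / sqrt (real n) + D * real n powr (1 + 2 * \<alpha>) * \<tau> + D * real n * real q powr (20 * sqrt \<epsilon>) * \<pi>"
  proof (cases "n < N0")
   case True
   have "real q <= (real q)\<^sup>2" by (cases q) (auto simp: power2_eq_square)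
   then have "0 <= ((real q)\<^sup>2 - real q) / 2 * chi_square_tail d t" by (intro mult_nonneg_nonneg) (auto simp: chi_square_tail_def)
   then have "exp (- (((real q)\<^sup>2 - real q) / 2 * chi_square_tail d t)) <= 1" by simp
   moreover have "0 <= exp (- (((real q)\<^sup>2 - real q) / 2 * chi_square_tail d t))" by simp
   moreover have "prob {\<omega> \<in> space M. (real d)^2 * real n * L_sq d Xa q n \<omega> - alpha_p d q <= y} <= 1"
    "0 <= prob {\<omega> \<in> space M. (real d)^2 * real n * L_sq d Xa q n \<omega> - alpha_p d q <= y}" by auto
   ultimately have "?lhs <= 1" unfolding ex by linarith
   also have "1 <= D * (logc (real n)) powr (5/2) / sqrt (real n)"
   proof -
    have "sqrt (real n) <= sqrt (real N0)" using True by simp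
    also have "... <= D * 1" using D by simp
    also have "... <= D * (logc (real n)) powr (5/2)" using D logc1[of "real n"] by (intro mult_left_mono ge_one_powr_ge_zero) auto
    finally show ?thesis using n0 by (simp add: pos_le_divide_eq)
   qed
   also have "... <= D * real q powr (-1 + 20 * sqrt \<epsilon>) + D * (logc (real n)) powr (5/2) / sqrt (real n) + D * real n powr (1 + 2 * \<alpha>) * \<tau> + D * real n * real q powr (20 * sqrt \<epsilon>) * \<pi>"
   proof -
    have "0 <= D * real q powr (-1 + 20 * sqrt \<epsilon>)" "0 <= D * real n powr (1 + 2 * \<alpha>) * \<tau>" "0 <= D * real n * real q powr (20 * sqrt \<epsilon>) * \<pi>"
     using D(5) \<tau>0 \<pi>0 by auto
    then show ?thesis by linarith
   qed
   finally show ?thesis .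
  next
   case False
   define l where "l = ln (real n)"
   have E: "3 <= c1 * real n powr \<alpha>" "- ln c1 <= \<alpha> / 2 * l" "ln c2 <= \<alpha> * l" "2 * \<alpha> * l <= real n"
    "C * ((2 * \<alpha> * l)\<^sup>2 / sqrt (real n)) <= 1" "64 * (2 * \<alpha> * l) * (real n powr \<theta> * l) <= \<epsilon>\<^sup>2 * real n"
    "L1 <= \<alpha> / 2 * l" "3 <= real n" using N0[of n] False unfolding l_def by auto
   have pb: "c1 * real n powr \<alpha> <= real q" "real q <= c2 * real n powr \<alpha>" using p_bounds[OF n] by (auto simp: q_def)
   have q3: "3 <= real q" using E(1) pb(1) by linarith
   have ex3: "exp (1::real) <= 3" by (rule exp_le)
   have Lq: "L = ln (real q)" using q3 ex3 by (simp add: L_def logc_def max_absorb1)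
   have qL: "real q = exp L" using q3 by (simp add: Lq)
   have L: "1 <= L" unfolding L_def by (rule logc1)
   have ll: "logc (real n) = l" using E(8) ex3 by (simp add: l_def logc_def max_absorb1)
   have l1: "1 <= l" using logc1[of "real n"] unfolding ll .
   have La: "\<alpha> / 2 * l <= L"
   proof -
    have "ln (c1 * real n powr \<alpha>) <= L" unfolding Lq using pb(1) E(1) q3 by (subst ln_le_cancel_iff) auto
    then show ?thesis using E(2) pos n0 by (simp add: ln_mult ln_powr l_def[symmetric])
   qed
   have Lb: "L <= 2 * \<alpha> * l"
   proof -
    have "L <= ln (c2 * real n powr \<alpha>)" unfolding Lq using pb(2) q3 pos n0 by (subst ln_le_cancel_iff) auto
    also have "... = ln c2 + \<alpha> * l" using pos n0 by (simp add: ln_mult ln_powr l_def)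
    finally show ?thesis using E(3) by linarith
   qed
   define s r where "s = sqrt (real n)" and "r = sqrt L"
   have sr: "0 < s" "0 < r" "s * s = real n" "r * r = L" "1 <= r" "1 <= s" using n0 n L by (auto simp: s_def r_def)
   have quart: "(x powr (1/4))\<^sup>2 = sqrt x" if "0 < x" for x :: real
    using that by (simp add: power2_eq_square powr_half_sqrt flip: powr_add)
   have b2: "b\<^sup>2 = s / r" unfolding b_def power_divide using quart[of "real n"] quart[of L] n0 L by (simp add: s_def r_def)
   have ib: "1 / b\<^sup>2 = r / s" "8 / b\<^sup>2 = 8 * (r / s)" unfolding b2 using sr by auto
   have b1: "1 <= b"
   proof -
    have "L powr (1/4) <= real n powr (1/4)" using L Lb E(4) by (intro powr_mono2) auto
    then show ?thesis unfolding b_def using L by (simp add: pos_le_divide_eq)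
   qed
   have u1: "real n * (1 / b\<^sup>2)\<^sup>2 = L"
   proof -
    have "(r / s)\<^sup>2 = L / real n" unfolding power2_eq_square times_divide_times_eq sr(3,4) ..
    then show ?thesis unfolding ib(1) using n0 by simp
   qed
   have u2: "ln (real n) <= B * L"
   proof -
    have "l = 2 / \<alpha> * (\<alpha> / 2 * l)" using pos by simp
    also have "... <= 2 / \<alpha> * L" using La pos by (intro mult_left_mono) auto
    also have "... <= B * L" using Bc L by (intro mult_right_mono) auto
    finally show ?thesis by (simp add: l_def)
   qed
   have L2: "L\<^sup>2 <= (2 * \<alpha> * l)\<^sup>2" using Lb L by (intro power_mono) auto
   have u3: "C * (L\<^sup>2 / sqrt n) <= 1"
   proof -
    have "C * (L\<^sup>2 / sqrt n) <= C * ((2 * \<alpha> * l)\<^sup>2 / sqrt n)" using L2 C by (intro mult_left_mono divide_right_mono) auto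
    then show ?thesis using E(5) by linarith
   qed
   have asr: "a = c * (s * r)" by (simp add: a_def s_def r_def real_sqrt_mult)
   have a0: "0 < a" using c0 sr by (simp add: asr)
   have u4: "real n * (8 / b\<^sup>2 * (m4\<^sup>2 / a ^ 3)) <= B"
   proof -
    have "real n * (8 / b\<^sup>2 * (m4\<^sup>2 / a ^ 3)) = (8 * m4\<^sup>2 / c ^ 3) / ((s * s) * (r * r))"
     unfolding ib asr sr(3)[symmetric] using sr(1,2) c0 by (simp add: field_simps power3_eq_cube)
    also have "... <= (8 * m4\<^sup>2 / c ^ 3) / 1"
    proof (rule divide_left_mono)
     have "1 * 1 <= (s * s) * (r * r)" unfolding sr using L n by (intro mult_mono) auto
     then show "1 <= (s * s) * (r * r)" by simp
     show "0 < ((s * s) * (r * r)) * 1" using sr(1,2) by simp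
     show "0 <= 8 * m4\<^sup>2 / c ^ 3" using c0 by simp
    qed
    also have "... <= B" using Bc by simp
    finally show ?thesis .
   qed
   have ha: "8 / b\<^sup>2 * a = 8 * c * L" unfolding ib asr sr(4)[symmetric] using sr(1) by simp
   have u6: "8 / b\<^sup>2 * a <= 8 * \<epsilon> * L" unfolding ha using ce L by simp
   have u5: "real n * (exp (8 / b\<^sup>2 * a) * prob {\<omega> \<in> space M. \<epsilon> / (8 / b\<^sup>2) <= \<bar>X \<omega> * X' \<omega>\<bar>}) <= B"
   proof -
    define x where "x = real n powr \<theta>"
    have x0: "0 < x" using n0 by (simp add: x_def)
    have xn: "x <= real n" using powr_mono[of \<theta> 1 "real n"] \<theta> E(8) by (simp add: x_def)
    have lx: "logc x <= l" unfolding logc_def l_def using xn ex3 E(8) by (subst ln_le_cancel_iff) (auto simp: less_max_iff_disj)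
    have sq: "sqrt (x * logc x) <= \<epsilon> / (8 / b\<^sup>2)"
    proof (rule real_le_lsqrt)
     show "0 <= \<epsilon> / (8 / b\<^sup>2)" using e by simp
     have v: "(\<epsilon> / (8 / b\<^sup>2))\<^sup>2 = \<epsilon>\<^sup>2 * real n / (64 * L)" unfolding ib sr(3)[symmetric] sr(4)[symmetric] using sr(1,2) by (simp add: field_simps power2_eq_square)
     have "(64 * L) * (x * logc x) <= (64 * (2 * \<alpha> * l)) * (x * l)" using Lb lx x0 L l1 pos logc1[of x] by (intro mult_mono) auto
     also have "... <= \<epsilon>\<^sup>2 * real n" using E(6) unfolding x_def .
     finally show "x * logc x <= (\<epsilon> / (8 / b\<^sup>2))\<^sup>2" unfolding v using L by (simp add: pos_le_divide_eq mult.commute)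
    qed
    let ?P = "prob {\<omega> \<in> space M. \<epsilon> / (8 / b\<^sup>2) <= \<bar>X \<omega> * X' \<omega>\<bar>}"
    have "?P <= prob {\<omega> \<in> space M. \<bar>X \<omega> * X' \<omega>\<bar> \<ge> sqrt (x * logc x)}"
     by (rule finite_measure_mono) (use sq in auto)
    then have "x powr (1 + 2 * \<alpha>) * ?P <= x powr (1 + 2 * \<alpha>) * prob {\<omega> \<in> space M. \<bar>X \<omega> * X' \<omega>\<bar> \<ge> sqrt (x * logc x)}" by (rule mult_left_mono) simp
    also have "... <= B0" by (rule B0[OF x0])
    finally have PB: "real n powr (1 + \<alpha>) * ?P <= B0" unfolding x_def powr_powr \<theta>(3) .
    have "8 * c * L <= \<alpha> * l"
    proof -
     have "8 * c * L <= 8 * (1 / 100) * (2 * \<alpha> * l)" using ce e1 c0 L Lb by (intro mult_mono) auto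
     also have "... <= \<alpha> * l" using pos l1 by simp
     finally show ?thesis .
    qed
    then have "exp (8 / b\<^sup>2 * a) <= real n powr \<alpha>" unfolding ha using n0 by (simp add: powr_def l_def)
    then have "real n * (exp (8 / b\<^sup>2 * a) * ?P) <= real n * (real n powr \<alpha> * ?P)" by (intro mult_left_mono mult_right_mono) auto
    also have "... = real n powr (1 + \<alpha>) * ?P" using n0 by (simp add: powr_add)
    finally show ?thesis using PB Bc by linarith
   qed
   have u7: "L <= exp (2 * \<epsilon> * L) * (exp (- 3 / 2) / (2 * sqrt (2 * pi))) / (1 + 2 * sqrt L)"
    using L1[of L] La E(7) unfolding \<kappa>_def by simp
   have q2: "2 <= q" using q3 by simp
   have ev: "prob {\<omega> \<in> space M. (real d)^2 * real n * L_sq d Xa q n \<omega> - alpha_p d q <= y} = prob (no_exceed q n t)"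
    unfolding L_sq_event[OF q2 n] t_def ..
   have main: "?lhs <= C * (exp (- L + 28 * \<epsilon> * L) + L\<^sup>2 / sqrt n + (real q)\<^sup>2 * (real n * \<tau>) + real n * \<pi> * exp (22 * \<epsilon> * L))"
    unfolding ev ex \<tau>_def \<pi>_def by (rule unif[OF n b1 qL L u1 u2 u3 a0 u4 u5 u6 u7])
   have se: "28 * \<epsilon> <= 20 * sqrt \<epsilon>"
   proof -
    have "\<epsilon> <= (1 / 100)\<^sup>2" using e(2) by (simp add: power2_eq_square)
    then have "sqrt \<epsilon> <= 1 / 100" by (intro real_le_lsqrt) auto
    then have "sqrt \<epsilon> * sqrt \<epsilon> <= 1 / 100 * sqrt \<epsilon>" using e by (intro mult_right_mono) auto
    moreover have "sqrt \<epsilon> * sqrt \<epsilon> = \<epsilon>" "0 <= sqrt \<epsilon>" using e by auto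
    ultimately show ?thesis by linarith
   qed
   have qpow: "real q powr x = exp (x * L)" for x using q3 by (simp add: powr_def Lq)
   have f1: "exp (- L + 28 * \<epsilon> * L) <= real q powr (-1 + 20 * sqrt \<epsilon>)"
   proof -
    have "28 * \<epsilon> * L <= 20 * sqrt \<epsilon> * L" using se L by (intro mult_right_mono) auto
    moreover have "(- 1 + 20 * sqrt \<epsilon>) * L = - 1 * L + 20 * sqrt \<epsilon> * L" by (rule distrib_right)
    ultimately have "- L + 28 * \<epsilon> * L <= (- 1 + 20 * sqrt \<epsilon>) * L" by linarith
    then show ?thesis unfolding qpow by (simp only: exp_le_cancel_iff)
   qed
   have f4: "exp (22 * \<epsilon> * L) <= real q powr (20 * sqrt \<epsilon>)"
   proof -
    have "22 * \<epsilon> <= 20 * sqrt \<epsilon>" using se e by linarith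
    then have "22 * \<epsilon> * L <= 20 * sqrt \<epsilon> * L" using L by (intro mult_right_mono) auto
    then show ?thesis unfolding qpow by (simp only: exp_le_cancel_iff)
   qed
   have f2: "L\<^sup>2 / sqrt n <= (4 * \<alpha>\<^sup>2) * (logc (real n) powr (5/2) / sqrt n)"
   proof -
    have "l\<^sup>2 = l powr 2" using l1 by simp
    also have "... <= l powr (5/2)" using l1 by (intro powr_mono) auto
    finally have "(4 * \<alpha>\<^sup>2) * l\<^sup>2 <= (4 * \<alpha>\<^sup>2) * l powr (5/2)" by (intro mult_left_mono) auto
    moreover have "(2 * \<alpha> * l)\<^sup>2 = (4 * \<alpha>\<^sup>2) * l\<^sup>2" by (simp add: power_mult_distrib)
    ultimately have "L\<^sup>2 <= (4 * \<alpha>\<^sup>2) * l powr (5/2)" using L2 by linarith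
    then have "L\<^sup>2 / sqrt n <= (4 * \<alpha>\<^sup>2) * l powr (5/2) / sqrt n" by (intro divide_right_mono) auto
    then show ?thesis unfolding ll by simp
   qed
   have f3: "(real q)\<^sup>2 * (real n * \<tau>) <= c2\<^sup>2 * (real n powr (1 + 2 * \<alpha>) * \<tau>)"
   proof -
    have "(real q)\<^sup>2 <= (c2 * real n powr \<alpha>)\<^sup>2" using pb by (intro power_mono) auto
    then have "(real q)\<^sup>2 * (real n * \<tau>) <= (c2 * real n powr \<alpha>)\<^sup>2 * (real n * \<tau>)" using \<tau>0 by (intro mult_right_mono) auto
    also have "(c2 * real n powr \<alpha>)\<^sup>2 * (real n * \<tau>) = c2\<^sup>2 * ((real n * (real n powr \<alpha> * real n powr \<alpha>)) * \<tau>)" by (simp only: power2_eq_square mult_ac)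
    also have "real n * (real n powr \<alpha> * real n powr \<alpha>) = real n powr (1 + 2 * \<alpha>)"
    proof -
     have "1 + 2 * \<alpha> = 1 + (\<alpha> + \<alpha>)" by simp
     then have "real n powr (1 + 2 * \<alpha>) = real n powr 1 * (real n powr \<alpha> * real n powr \<alpha>)" by (simp only: powr_add)
     then show ?thesis using n0 by simp
    qed
    finally show ?thesis .
   qed
   have g1: "C * exp (- L + 28 * \<epsilon> * L) <= D * real q powr (-1 + 20 * sqrt \<epsilon>)" using D(1) C f1 by (intro mult_mono) auto
   have g2: "C * (L\<^sup>2 / sqrt n) <= D * (logc (real n)) powr (5/2) / sqrt (real n)"
   proof -
    have "C * (L\<^sup>2 / sqrt n) <= C * ((4 * \<alpha>\<^sup>2) * (logc (real n) powr (5/2) / sqrt n))" using f2 C by (intro mult_left_mono) auto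
    also have "... = (C * (4 * \<alpha>\<^sup>2)) * (logc (real n) powr (5/2) / sqrt n)" by (simp only: mult.assoc)
    also have "... <= D * (logc (real n) powr (5/2) / sqrt n)" using D(2) by (intro mult_right_mono) auto
    finally show ?thesis by simp
   qed
   have g3: "C * ((real q)\<^sup>2 * (real n * \<tau>)) <= D * real n powr (1 + 2 * \<alpha>) * \<tau>"
   proof -
    have "C * ((real q)\<^sup>2 * (real n * \<tau>)) <= C * (c2\<^sup>2 * (real n powr (1 + 2 * \<alpha>) * \<tau>))" using f3 C by (intro mult_left_mono) auto
    also have "... = (C * c2\<^sup>2) * (real n powr (1 + 2 * \<alpha>) * \<tau>)" by (simp only: mult.assoc)
    also have "... <= D * (real n powr (1 + 2 * \<alpha>) * \<tau>)" using D(3) \<tau>0 by (intro mult_right_mono) auto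
    finally show ?thesis by (simp only: mult.assoc)
   qed
   have g4: "C * (real n * \<pi> * exp (22 * \<epsilon> * L)) <= D * real n * real q powr (20 * sqrt \<epsilon>) * \<pi>"
   proof -
    have "C * (real n * \<pi> * exp (22 * \<epsilon> * L)) <= D * (real n * \<pi> * real q powr (20 * sqrt \<epsilon>))" using D(1) D(5) C f4 \<pi>0 by (intro mult_mono) auto
    then show ?thesis by (simp add: mult_ac)
   qed
   show ?thesis using main g1 g2 g3 g4 unfolding distrib_left by linarith
  qed
  then show "\<bar>measure M {\<omega> \<in> space M.
      (real d)^2 * real n * L_sq d Xa (p n) n \<omega> - alpha_p d (p n) <= y}
    - exp (- ((real (p n))^2 - real (p n)) / 2 * chi_square_tail d (alpha_p d (p n) + y))\<bar>
   <= D * real (p n) powr (-1 + 20 * sqrt \<epsilon>)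
     + D * (logc (real n)) powr (5/2) / sqrt (real n)
     + D * real n powr (1 + 2 * \<alpha>) *
       measure M {\<omega> \<in> space M. \<bar>X \<omega> * X' \<omega>\<bar> \<ge>
        real d powr (-1/2) * \<epsilon> * sqrt (real n * logc (real (p n)))}
     + D * real n * real (p n) powr (20 * sqrt \<epsilon>) *
       measure M {\<omega> \<in> space M. \<bar>X \<omega>\<bar> \<ge>
        real n powr (1/4) / (logc (real (p n))) powr (1/4)}"
   unfolding \<tau>_def \<pi>_def a_def b_def L_def t_def q_def c_def .
 qed
qed

end
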